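(* Let $\mathbb{K}$ be a field of characteristic zero, let $\mathcal{P}=\mathcal{P}(E,R)$ be an arbitrary binary quadratic operad ($E$ finite-dimensional, homogeneous of degree zero or even), with Koszul dual $\mathcal{P}^{!}=\mathcal{F}(E^\vee)/(R^\perp)$, and let $A$ be a $\mathcal{P}^{!}$-algebra with a Rota-Baxter operator $\beta$ (of weight zero), i.e. a linear map $\beta:A\to A$ with $$\beta(x)*\beta(y)=\beta\big(\beta(x)*y+x*\beta(y)\big)\qquad\text{for all }x,y\in A\text{ and all multiplications }*\in E^\vee.$$ Then $A$ with the dual-derived products $\beta(x)*y$ and $x*\beta(y)$ ($*\in E^\vee$) is a $(pre\mathcal{L}ie\bullet\mathcal{P}^{!})$-algebra, where $\bullet$ is the Manin black product. Explicitly, there is an operad morphism $pre\mathcal{L}ie\bullet\mathcal{P}^{!}\to\mathcal{E}nd(A)$ which on the generating space, identified as in the context with the span of symbols $\beta x_1*x_2$, $x_1*\beta x_2$ ($*\in E^\vee$), sends the symbol $\beta x_1*x_2$ to the operation $(x_1,x_2)\mapsto\beta(x_1)*x_2$ and the symbol $x_1*\beta x_2$ to the operation $(x_1,x_2)\mapsto x_1*\beta(x_2)$.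
   Context: Operads are symmetric operads $\{\mathcal{P}(n)\}_{n\ge1}$ over $\mathbb{K}$; a $\mathcal{P}$-algebra structure on $V$ is an operad morphism $\mathcal{P}\to\mathcal{E}nd(V)$. If $A$ is graded, $\beta$ has degree $0$. Binary quadratic operad: $E$ is an $S_2$-module placed in arity 2, $\mathcal{F}(E)$ the free operad, $R\subset\mathcal{F}(E)(3)$ an $S_3$-stable subspace, $\mathcal{P}(E,R):=\mathcal{F}(E)/(R)$ with $(R)$ the operadic ideal generated by $R$. Koszul dual: $E^\vee$ is the dual space of $E$ with the $S_2$-action such that the pairing satisfies $\langle e,f\rangle=\mathrm{sgn}(\sigma)\langle e\sigma,f\sigma\rangle$. One has $\mathcal{F}(E)(3)\cong\bigoplus_{(i,j,k)}E\otimes E\otimes(i,j,k)$, where $(i,j,k)$ runs over $(1,2,3),(3,1,2),(2,3,1)$ and $e\otimes e'\otimes(i,j,k)$ corresponds to $e(e'(x_i,x_j),x_k)$; similarly for $E^\vee$. The pairing of $\mathcal{F}(E)(3)$ and $\mathcal{F}(E^\vee)(3)$ is $\langle e\otimes e'\otimes(i,j,k),f\otimes f'\otimes(a,b,c)\rangle=\langle e,f\rangle\langle e',f'\rangle\delta_{ia}\delta_{jb}\delta_{kc}$. $R^\perp$ is the orthogonal space of $R$ and $\mathcal{P}^!:=\mathcal{F}(E^\vee)/(R^\perp)$; $\mathcal{P}^{!!}\cong\mathcal{P}$. Manin white product: for $\mathcal{P}_i=\mathcal{P}(E_i,R_i)$, let $\Phi:\mathcal{F}(E_1\otimes E_2)\to\mathcal{F}(E_1)\otimes\mathcal{F}(E_2)$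 be the operad morphism extending the identity of $E_1\otimes E_2$. Then $\mathcal{P}_1\circ\mathcal{P}_2$ is the quotient of $\mathcal{F}(E_1\otimes E_2)$ by the ideal generated by $\Phi^{-1}\big(R_1\otimes\mathcal{F}(E_2)(3)+\mathcal{F}(E_1)(3)\otimes R_2\big)\subset \mathcal F(E_1\otimes E_2)(3)$. Manin black product: $\mathcal{P}_1^!\bullet\mathcal{P}_2^!:=(\mathcal{P}_1\circ\mathcal{P}_2)^!$. $\mathcal{P}erm$ is the operad of (left) permutation algebras: associative algebras with $(x*y)*z=(y*x)*z$ (Koszul signs in the graded case); $\mathcal{P}erm(2)$ has basis $e^2_2=x_1*x_2$, $e^2_1=x_2*x_1$. $pre\mathcal{L}ie=\mathcal{P}erm^!$ is the operad of preLie algebras, so $pre\mathcal{L}ie\bullet\mathcal{P}^!=(\mathcal{P}erm\circ\mathcal{P})^!$. Identification of generators: the generating space of $pre\mathcal{L}ie\bullet\mathcal{P}^!$ is $(\mathcal{P}erm(2)\otimes E)^\vee$. It is identified with two copies of $E^\vee$, the span of formal symbols $\beta x_1*x_2$ and $x_1*\beta x_2$ for $*\in E^\vee$ (linear in $*$), with $S_2$-action $(\beta x_1*x_2)(12)=\beta x_2*x_1=x_1*^{(12)}\beta x_2$ ($*^{(12)}$ the transposition of $*$), via the pairing $\langle\beta x_1*x_2,\ e^2_2\otimes\mu\rangle=\langle *,\mu\rangle$, $\langle x_1*\beta x_2,\ e^2_1\otimes\mu\rangle=\langle *,\mu\rangle$ for $\mu\in E$, the other pairings being $0$. *)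

theory Defs
  imports
    "HOL-Algebra.AbelCoset"
    "HOL-Algebra.Module"
    "HOL-Algebra.Algebraic_Closure_Type"
    "HOL-Combinatorics.Permutations"
    "HOL-Library.Poly_Mapping"
    "HOL-Library.FuncSet"
begin

section \<open>Vector spaces with carriers\<close>

text \<open>The ground field is a type \<^typ>\<open>'k\<close> of class \<^class>\<open>field\<close>; vector spaces are HOL-Algebra modules
  over it, seen as a ring record. The fields \<^const>\<open>monoid.mult\<close> and \<^const>\<open>monoid.one\<close> of the module
  records are never used.\<close>

abbreviation KK :: "'k::field ring"
  where "KK \<equiv> ring_of_type_algebra"

definition lin_span :: "('k::field, 'x, 'm) module_scheme \<Rightarrow> 'x set \<Rightarrow> 'x set"
  where "lin_span M S = (\<lambda>N. submodule N KK M) hull S"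

definition linear_between ::
    "('k::field, 'x, 'm) module_scheme \<Rightarrow> ('k, 'y, 'n) module_scheme \<Rightarrow> ('x \<Rightarrow> 'y) \<Rightarrow> bool"
  where "linear_between M N h \<longleftrightarrow>
    h \<in> carrier M \<rightarrow> carrier N \<and>
    (\<forall>x\<in>carrier M. \<forall>y\<in>carrier M. h (x \<oplus>\<^bsub>M\<^esub> y) = h x \<oplus>\<^bsub>N\<^esub> h y) \<and>
    (\<forall>c. \<forall>x\<in>carrier M. h (c \<odot>\<^bsub>M\<^esub> x) = c \<odot>\<^bsub>N\<^esub> h x)"

definition finite_dim :: "('k::field, 'x, 'm) module_scheme \<Rightarrow> bool"
  where "finite_dim M \<longleftrightarrow> (\<exists>B. finite B \<and> B \<subseteq> carrier M \<and> lin_span M B = carrier M)"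

definition quot_module ::
    "('k::field, 'x, 'm) module_scheme \<Rightarrow> 'x set \<Rightarrow> ('k, 'x set) module"
  where "quot_module M N = \<lparr>
    carrier = a_rcosets\<^bsub>M\<^esub> N,
    monoid.mult = undefined, one = undefined,
    zero = N,
    add = set_add M,
    module.smult = (\<lambda>c C. \<Union>x\<in>C. N +>\<^bsub>M\<^esub> (c \<odot>\<^bsub>M\<^esub> x))\<rparr>"

definition free_module :: "'s set \<Rightarrow> ('k::field, 's \<Rightarrow>\<^sub>0 'k) module"
  where "free_module S = \<lparr>
    carrier = {p. Poly_Mapping.keys p \<subseteq> S},
    monoid.mult = undefined, one = undefined,
    zero = 0,
    add = (+),
    module.smult = (\<lambda>c. Poly_Mapping.map ((*) c))\<rparr>"

text \<open>The linear extension of a map of sets, and the bilinear extension of a map of two variables.\<close>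

definition lin_ext :: "('s \<Rightarrow> 't) \<Rightarrow> ('s \<Rightarrow>\<^sub>0 'k::field) \<Rightarrow> ('t \<Rightarrow>\<^sub>0 'k)"
  where "lin_ext g p = (\<Sum>s\<in>Poly_Mapping.keys p. Poly_Mapping.single (g s) (Poly_Mapping.lookup p s))"

definition bilin_ext ::
    "('s \<Rightarrow> 't \<Rightarrow> 'u) \<Rightarrow> ('s \<Rightarrow>\<^sub>0 'k::field) \<Rightarrow> ('t \<Rightarrow>\<^sub>0 'k) \<Rightarrow> ('u \<Rightarrow>\<^sub>0 'k)"
  where "bilin_ext g p q = (\<Sum>s\<in>Poly_Mapping.keys p. \<Sum>t\<in>Poly_Mapping.keys q.
    Poly_Mapping.single (g s t) (Poly_Mapping.lookup p s * Poly_Mapping.lookup q t))"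

text \<open>The tensor product, as the quotient of the free vector space on all pairs.\<close>

definition tensor_rels ::
    "('k::field, 'x, 'm) module_scheme \<Rightarrow> ('k, 'y, 'n) module_scheme \<Rightarrow> ('x \<times> 'y \<Rightarrow>\<^sub>0 'k) set"
  where "tensor_rels V W = lin_span (free_module (carrier V \<times> carrier W))
   ({Poly_Mapping.single (v \<oplus>\<^bsub>V\<^esub> v', w) 1 - Poly_Mapping.single (v, w) 1 - Poly_Mapping.single (v', w) 1
       | v v' w. v \<in> carrier V \<and> v' \<in> carrier V \<and> w \<in> carrier W} \<union>
    {Poly_Mapping.single (v, w \<oplus>\<^bsub>W\<^esub> w') 1 - Poly_Mapping.single (v, w) 1 - Poly_Mapping.single (v, w') 1
       | v w w'. v \<in> carrier V \<and> w \<in> carrier W \<and> w' \<in> carrier W} \<union>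
    {Poly_Mapping.single (c \<odot>\<^bsub>V\<^esub> v, w) 1 - Poly_Mapping.single (v, w) c
       | c v w. v \<in> carrier V \<and> w \<in> carrier W} \<union>
    {Poly_Mapping.single (v, c \<odot>\<^bsub>W\<^esub> w) 1 - Poly_Mapping.single (v, w) c
       | c v w. v \<in> carrier V \<and> w \<in> carrier W})"

definition tensor ::
    "('k::field, 'x, 'm) module_scheme \<Rightarrow> ('k, 'y, 'n) module_scheme \<Rightarrow> ('k, ('x \<times> 'y \<Rightarrow>\<^sub>0 'k) set) module"
  where "tensor V W = quot_module (free_module (carrier V \<times> carrier W)) (tensor_rels V W)"

definition pure_tensor ::
    "('k::field, 'x, 'm) module_scheme \<Rightarrow> ('k, 'y, 'n) module_scheme \<Rightarrow> 'x \<Rightarrow> 'y \<Rightarrow> ('x \<times> 'y \<Rightarrow>\<^sub>0 'k) set"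
  where "pure_tensor V W v w =
    tensor_rels V W +>\<^bsub>free_module (carrier V \<times> carrier W)\<^esub> Poly_Mapping.single (v, w) 1"


section \<open>Homogeneous \<open>S\<^sub>2\<close>-modules\<close>

text \<open>A vector space with the action \<open>swap\<close> of the transposition \<open>(12)\<close>, homogeneous of degree \<open>hdeg\<close>.\<close>

record ('k, 'e) s2module = "('k, 'e) module" +
  swap :: "'e \<Rightarrow> 'e"
  hdeg :: int

definition s2_module :: "('k::field, 'e) s2module \<Rightarrow> bool"
  where "s2_module E \<longleftrightarrow> module KK E \<and> linear_between E E (swap E) \<and>
    (\<forall>e\<in>carrier E. swap E (swap E e) = e)"

text \<open>The dual space with the action twisted by the sign: \<open>\<langle>e, f\<rangle> = sgn(\<sigma>) \<langle>e\<sigma>, f\<sigma>\<rangle>\<close>.\<close>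

definition dual :: "('k::field, 'e) s2module \<Rightarrow> ('k, 'e \<Rightarrow> 'k) s2module"
  where "dual E = \<lparr>
    carrier = {f \<in> extensional (carrier E).
      (\<forall>x\<in>carrier E. \<forall>y\<in>carrier E. f (x \<oplus>\<^bsub>E\<^esub> y) = f x + f y) \<and>
      (\<forall>c. \<forall>x\<in>carrier E. f (c \<odot>\<^bsub>E\<^esub> x) = c * f x)},
    monoid.mult = undefined, one = undefined,
    zero = (\<lambda>x\<in>carrier E. 0),
    add = (\<lambda>f g. \<lambda>x\<in>carrier E. f x + g x),
    module.smult = (\<lambda>c f. \<lambda>x\<in>carrier E. c * f x),
    swap = (\<lambda>f. \<lambda>x\<in>carrier E. - f (swap E x)),
    hdeg = - hdeg E\<rparr>"

text \<open>There are no Koszul signs here: tensor products are only formed for even degrees.\<close>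

definition s2_tensor ::
    "('k::field, 'e) s2module \<Rightarrow> ('k, 'f) s2module \<Rightarrow> ('k, ('e \<times> 'f \<Rightarrow>\<^sub>0 'k) set) s2module"
  where "s2_tensor E F = module.extend (tensor E F) (s2module.fields
    (\<lambda>A. \<Union>p\<in>A. tensor_rels E F +>\<^bsub>free_module (carrier E \<times> carrier F)\<^esub>
       lin_ext (map_prod (swap E) (swap F)) p)
    (hdeg E + hdeg F))"


section \<open>Operads\<close>

text \<open>Symmetric operads in terms of the partial compositions: \<open>pcomp P n m i x y\<close> is \<open>x \<circ>\<^sub>i y\<close> for
  \<open>x \<in> P(n)\<close>, \<open>y \<in> P(m)\<close>, \<open>1 \<le> i \<le> n\<close>, and \<open>pact P n x \<sigma>\<close> is the right action \<open>x\<sigma>\<close> of a permutation of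
  \<open>{1..n}\<close>. Only arities \<open>n \<ge> 1\<close> are meaningful.\<close>

record ('k, 'x) operad =
  comps :: "nat \<Rightarrow> ('k, 'x) module"
  pact :: "nat \<Rightarrow> 'x \<Rightarrow> (nat \<Rightarrow> nat) \<Rightarrow> 'x"
  ident :: 'x
  pcomp :: "nat \<Rightarrow> nat \<Rightarrow> nat \<Rightarrow> 'x \<Rightarrow> 'x \<Rightarrow> 'x"

definition operad_hom ::
    "('k::field, 'x) operad \<Rightarrow> ('k, 'y) operad \<Rightarrow> (nat \<Rightarrow> 'x \<Rightarrow> 'y) \<Rightarrow> bool"
  where "operad_hom P Q \<phi> \<longleftrightarrow>
    (\<forall>n\<ge>1. linear_between (comps P n) (comps Q n) (\<phi> n)) \<and>
    (\<forall>n\<ge>1. \<forall>x\<in>carrier (comps P n). \<forall>\<sigma>. \<sigma> permutes {1..n} \<longrightarrow>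
       \<phi> n (pact P n x \<sigma>) = pact Q n (\<phi> n x) \<sigma>) \<and>
    \<phi> 1 (ident P) = ident Q \<and>
    (\<forall>n\<ge>1. \<forall>m\<ge>1. \<forall>i\<in>{1..n}. \<forall>x\<in>carrier (comps P n). \<forall>y\<in>carrier (comps P m).
       \<phi> (n + m - 1) (pcomp P n m i x y) = pcomp Q n m i (\<phi> n x) (\<phi> m y))"

definition operad_ideal :: "('k::field, 'x) operad \<Rightarrow> (nat \<Rightarrow> 'x set) \<Rightarrow> bool"
  where "operad_ideal P I \<longleftrightarrow>
    (\<forall>n. submodule (I n) KK (comps P n)) \<and>
    (\<forall>n\<ge>1. \<forall>x\<in>I n. \<forall>\<sigma>. \<sigma> permutes {1..n} \<longrightarrow> pact P n x \<sigma> \<in> I n) \<and>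
    (\<forall>n\<ge>1. \<forall>m\<ge>1. \<forall>i\<in>{1..n}. \<forall>x\<in>carrier (comps P n). \<forall>y\<in>carrier (comps P m).
       x \<in> I n \<or> y \<in> I m \<longrightarrow> pcomp P n m i x y \<in> I (n + m - 1))"

text \<open>The ideal generated by a subset \<open>S\<close> of the component of arity \<open>k\<close>.\<close>

definition ideal_generated :: "('k::field, 'x) operad \<Rightarrow> nat \<Rightarrow> 'x set \<Rightarrow> nat \<Rightarrow> 'x set"
  where "ideal_generated P k S n = \<Inter>{I n | I. operad_ideal P I \<and> S \<subseteq> I k}"

definition quot_operad :: "('k::field, 'x) operad \<Rightarrow> (nat \<Rightarrow> 'x set) \<Rightarrow> ('k, 'x set) operad"
  where "quot_operad P I = \<lparr>
    comps = (\<lambda>n. quot_module (comps P n) (I n)),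
    pact = (\<lambda>n A \<sigma>. \<Union>x\<in>A. I n +>\<^bsub>comps P n\<^esub> pact P n x \<sigma>),
    ident = I 1 +>\<^bsub>comps P 1\<^esub> ident P,
    pcomp = (\<lambda>n m i A B. \<Union>x\<in>A. \<Union>y\<in>B. I (n + m - 1) +>\<^bsub>comps P (n + m - 1)\<^esub> pcomp P n m i x y)\<rparr>"

text \<open>An operad in sets, and its linearization.\<close>

record 's set_operad =
  elems :: "nat \<Rightarrow> 's set"
  sact :: "nat \<Rightarrow> 's \<Rightarrow> (nat \<Rightarrow> nat) \<Rightarrow> 's"
  sident :: 's
  scomp :: "nat \<Rightarrow> nat \<Rightarrow> nat \<Rightarrow> 's \<Rightarrow> 's \<Rightarrow> 's"

definition linearize :: "'s set_operad \<Rightarrow> ('k::field, 's \<Rightarrow>\<^sub>0 'k) operad"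
  where "linearize S = \<lparr>
    comps = (\<lambda>n. free_module (elems S n)),
    pact = (\<lambda>n p \<sigma>. lin_ext (\<lambda>s. sact S n s \<sigma>) p),
    ident = Poly_Mapping.single (sident S) 1,
    pcomp = (\<lambda>n m i. bilin_ext (scomp S n m i))\<rparr>"

text \<open>The tensor product \<open>(P \<otimes> Q)(n) = P(n) \<otimes> Q(n)\<close> of operads, with the componentwise structure.\<close>

definition pair_operad :: "('k::field, 'x) operad \<Rightarrow> ('k, 'y) operad \<Rightarrow> ('x \<times> 'y) set_operad"
  where "pair_operad P Q = \<lparr>
    elems = (\<lambda>n. carrier (comps P n) \<times> carrier (comps Q n)),
    sact = (\<lambda>n (x, y) \<sigma>. (pact P n x \<sigma>, pact Q n y \<sigma>)),
    sident = (ident P, ident Q),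
    scomp = (\<lambda>n m i (x, y) (x', y'). (pcomp P n m i x x', pcomp Q n m i y y'))\<rparr>"

definition hadamard ::
    "('k::field, 'x) operad \<Rightarrow> ('k, 'y) operad \<Rightarrow> ('k, ('x \<times> 'y \<Rightarrow>\<^sub>0 'k) set) operad"
  where "hadamard P Q =
    quot_operad (linearize (pair_operad P Q)) (\<lambda>n. tensor_rels (comps P n) (comps Q n))"


section \<open>Free operads on binary generators\<close>

text \<open>A tree with leaves labelled by \<open>1, \<dots>, n\<close> is a composite of binary operations in the variables
  \<open>x\<^sub>1, \<dots>, x\<^sub>n\<close>: \<open>Node e s t\<close> is \<open>e(s, t)\<close>.\<close>

datatype 'e btree = Leaf nat | Node 'e "'e btree" "'e btree"

primrec leaves :: "'e btree \<Rightarrow> nat list" where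
  "leaves (Leaf i) = [i]"
| "leaves (Node e s t) = leaves s @ leaves t"

primrec tree_subst :: "(nat \<Rightarrow> 'e btree) \<Rightarrow> 'e btree \<Rightarrow> 'e btree" where
  "tree_subst f (Leaf i) = f i"
| "tree_subst f (Node e s t) = Node e (tree_subst f s) (tree_subst f t)"

text \<open>Conventions: \<open>(t\<sigma>)(x\<^sub>1, \<dots>, x\<^sub>n) = t(x\<^bsub>\<sigma>\<inverse>(1)\<^esub>, \<dots>, x\<^bsub>\<sigma>\<inverse>(n)\<^esub>)\<close> and
  \<open>(t \<circ>\<^sub>i s)(x\<^sub>1, \<dots>) = t(x\<^sub>1, \<dots>, x\<^bsub>i-1\<^esub>, s(x\<^sub>i, \<dots>, x\<^bsub>i+m-1\<^esub>), x\<^bsub>i+m\<^esub>, \<dots>)\<close>, both here and in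
  endomorphism operads.\<close>

definition tree_operad :: "'e set \<Rightarrow> 'e btree set_operad"
  where "tree_operad S = \<lparr>
    elems = (\<lambda>n. {t. set_btree t \<subseteq> S \<and> distinct (leaves t) \<and> set (leaves t) = {1..n}}),
    sact = (\<lambda>n t \<sigma>. tree_subst (\<lambda>j. Leaf (inv_into UNIV \<sigma> j)) t),
    sident = Leaf 1,
    scomp = (\<lambda>n m i t s. tree_subst (\<lambda>j.
      if j < i then Leaf j
      else if j = i then tree_subst (\<lambda>l. Leaf (l + (i - 1))) s
      else Leaf (j + m - 1)) t)\<rparr>"

text \<open>\<open>F(E)\<close> is the linearized operad of trees, modulo the ideal that makes the corolla
  \<open>e(x\<^sub>1, x\<^sub>2)\<close> linear in \<open>e\<close> and identifies \<open>(e(12))(x\<^sub>1, x\<^sub>2)\<close> with \<open>e(x\<^sub>2, x\<^sub>1)\<close>.\<close>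

definition free_rels :: "('k::field, 'e) s2module \<Rightarrow> nat \<Rightarrow> ('e btree \<Rightarrow>\<^sub>0 'k) set"
  where "free_rels E = ideal_generated (linearize (tree_operad (carrier E))) 2
   (let cor = (\<lambda>e. Node e (Leaf 1) (Leaf 2)) in
    {Poly_Mapping.single (cor (e \<oplus>\<^bsub>E\<^esub> e')) 1 - Poly_Mapping.single (cor e) 1 - Poly_Mapping.single (cor e') 1
       | e e'. e \<in> carrier E \<and> e' \<in> carrier E} \<union>
    {Poly_Mapping.single (cor (c \<odot>\<^bsub>E\<^esub> e)) 1 - Poly_Mapping.single (cor e) c
       | c e. e \<in> carrier E} \<union>
    {Poly_Mapping.single (cor (swap E e)) 1 - Poly_Mapping.single (Node e (Leaf 2) (Leaf 1)) 1
       | e. e \<in> carrier E})"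

definition free_operad :: "('k::field, 'e) s2module \<Rightarrow> ('k, ('e btree \<Rightarrow>\<^sub>0 'k) set) operad"
  where "free_operad E = quot_operad (linearize (tree_operad (carrier E))) (free_rels E)"

definition tree_class :: "('k::field, 'e) s2module \<Rightarrow> nat \<Rightarrow> 'e btree \<Rightarrow> ('e btree \<Rightarrow>\<^sub>0 'k) set"
  where "tree_class E n t =
    free_rels E n +>\<^bsub>comps (linearize (tree_operad (carrier E))) n\<^esub> Poly_Mapping.single t 1"

definition corolla :: "('k::field, 'e) s2module \<Rightarrow> 'e \<Rightarrow> ('e btree \<Rightarrow>\<^sub>0 'k) set"
  where "corolla E e = tree_class E 2 (Node e (Leaf 1) (Leaf 2))"


section \<open>Binary quadratic operads\<close>

text \<open>The data \<open>(E, R)\<close> of a binary quadratic operad \<open>F(E)/(R)\<close>, with \<open>R \<subseteq> F(E)(3)\<close>.\<close>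

type_synonym ('k, 'e) quad_data = "('k, 'e) s2module \<times> ('e btree \<Rightarrow>\<^sub>0 'k) set set"

abbreviation gens :: "('k::field, 'e) quad_data \<Rightarrow> ('k, 'e) s2module"
  where "gens \<equiv> fst"

abbreviation rels :: "('k::field, 'e) quad_data \<Rightarrow> ('e btree \<Rightarrow>\<^sub>0 'k) set set"
  where "rels \<equiv> snd"

definition s3_stable :: "('k::field, 'x) operad \<Rightarrow> 'x set \<Rightarrow> bool"
  where "s3_stable P R \<longleftrightarrow> (\<forall>x\<in>R. \<forall>\<sigma>. \<sigma> permutes {1..3} \<longrightarrow> pact P 3 x \<sigma> \<in> R)"

definition binary_quadratic :: "('k::field, 'e) quad_data \<Rightarrow> bool"
  where "binary_quadratic P \<longleftrightarrow>
    s2_module (gens P) \<and> finite_dim (gens P) \<and>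
    submodule (rels P) KK (comps (free_operad (gens P)) 3) \<and>
    s3_stable (free_operad (gens P)) (rels P)"

definition rel_ideal :: "('k::field, 'e) quad_data \<Rightarrow> nat \<Rightarrow> ('e btree \<Rightarrow>\<^sub>0 'k) set set"
  where "rel_ideal P = ideal_generated (free_operad (gens P)) 3 (rels P)"

definition operad_of :: "('k::field, 'e) quad_data \<Rightarrow> ('k, ('e btree \<Rightarrow>\<^sub>0 'k) set set) operad"
  where "operad_of P = quot_operad (free_operad (gens P)) (rel_ideal P)"

text \<open>The element of \<open>P(2)\<close> given by a generator.\<close>

definition generator :: "('k::field, 'e) quad_data \<Rightarrow> 'e \<Rightarrow> ('e btree \<Rightarrow>\<^sub>0 'k) set set"
  where "generator P e = rel_ideal P 2 +>\<^bsub>comps (free_operad (gens P)) 2\<^esub> corolla (gens P) e"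


subsection \<open>The Koszul dual\<close>

definition cyclic_triples :: "(nat \<times> nat \<times> nat) set"
  where "cyclic_triples = {(1, 2, 3), (3, 1, 2), (2, 3, 1)}"

text \<open>The element \<open>e(e'(x\<^sub>i, x\<^sub>j), x\<^sub>k)\<close> of \<open>F(E)(3)\<close>, that is, \<open>e \<otimes> e' \<otimes> (i, j, k)\<close>.\<close>

definition cubic :: "('k::field, 'e) s2module \<Rightarrow> 'e \<Rightarrow> 'e \<Rightarrow> nat \<times> nat \<times> nat \<Rightarrow> ('e btree \<Rightarrow>\<^sub>0 'k) set"
  where "cubic E e e' = (\<lambda>(i, j, k). tree_class E 3 (Node e (Node e' (Leaf i) (Leaf j)) (Leaf k)))"

text \<open>The elements \<open>e \<otimes> e' \<otimes> (i, j, k)\<close> with \<open>(i, j, k)\<close> cyclic span \<open>F(E)(3) \<cong> \<Oplus> E \<otimes> E\<close>, so that a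
  bilinear form as follows exists and is unique on \<open>F(E)(3) \<times> F(E\<^sup>\<or>)(3)\<close>.\<close>

definition is_pairing ::
    "('k::field, 'e) s2module \<Rightarrow> (('e btree \<Rightarrow>\<^sub>0 'k) set \<Rightarrow> (('e \<Rightarrow> 'k) btree \<Rightarrow>\<^sub>0 'k) set \<Rightarrow> 'k) \<Rightarrow> bool"
  where "is_pairing E B \<longleftrightarrow>
   (let V = comps (free_operad E) 3; W = comps (free_operad (dual E)) 3 in
    (\<forall>x\<in>carrier V. \<forall>x'\<in>carrier V. \<forall>y\<in>carrier W. B (x \<oplus>\<^bsub>V\<^esub> x') y = B x y + B x' y) \<and>
    (\<forall>x\<in>carrier V. \<forall>y\<in>carrier W. \<forall>y'\<in>carrier W. B x (y \<oplus>\<^bsub>W\<^esub> y') = B x y + B x y') \<and>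
    (\<forall>c. \<forall>x\<in>carrier V. \<forall>y\<in>carrier W. B (c \<odot>\<^bsub>V\<^esub> x) y = c * B x y \<and> B x (c \<odot>\<^bsub>W\<^esub> y) = c * B x y) \<and>
    (\<forall>e\<in>carrier E. \<forall>e'\<in>carrier E. \<forall>f\<in>carrier (dual E). \<forall>f'\<in>carrier (dual E).
     \<forall>u\<in>cyclic_triples. \<forall>v\<in>cyclic_triples.
       B (cubic E e e' u) (cubic (dual E) f f' v) = (if u = v then f e * f' e' else 0)))"

definition pairing ::
    "('k::field, 'e) s2module \<Rightarrow> ('e btree \<Rightarrow>\<^sub>0 'k) set \<Rightarrow> (('e \<Rightarrow> 'k) btree \<Rightarrow>\<^sub>0 'k) set \<Rightarrow> 'k"
  where "pairing E = (SOME B. is_pairing E B)"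

definition orthogonal ::
    "('k::field, 'e) s2module \<Rightarrow> ('e btree \<Rightarrow>\<^sub>0 'k) set set \<Rightarrow> (('e \<Rightarrow> 'k) btree \<Rightarrow>\<^sub>0 'k) set set"
  where "orthogonal E R =
    {y \<in> carrier (comps (free_operad (dual E)) 3). \<forall>x\<in>R. pairing E x y = 0}"

definition koszul_dual :: "('k::field, 'e) quad_data \<Rightarrow> ('k, 'e \<Rightarrow> 'k) quad_data"
  where "koszul_dual P = (dual (gens P), orthogonal (gens P) (rels P))"


subsection \<open>Manin products\<close>

text \<open>The operad morphism \<open>\<Phi> : F(E \<otimes> F) \<rightarrow> F(E) \<otimes> F(F)\<close> that extends the identity of \<open>E \<otimes> F\<close>; it is unique
  on the components of \<open>F(E \<otimes> F)\<close>.\<close>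

definition manin_map ::
    "('k::field, 'e) s2module \<Rightarrow> ('k, 'f) s2module \<Rightarrow>
     nat \<Rightarrow> (('e \<times> 'f \<Rightarrow>\<^sub>0 'k) set btree \<Rightarrow>\<^sub>0 'k) set \<Rightarrow>
     (('e btree \<Rightarrow>\<^sub>0 'k) set \<times> ('f btree \<Rightarrow>\<^sub>0 'k) set \<Rightarrow>\<^sub>0 'k) set"
  where "manin_map E F = (SOME \<Phi>.
    operad_hom (free_operad (s2_tensor E F)) (hadamard (free_operad E) (free_operad F)) \<Phi> \<and>
    (\<forall>e\<in>carrier E. \<forall>f\<in>carrier F. \<Phi> 2 (corolla (s2_tensor E F) (pure_tensor E F e f)) =
       pure_tensor (comps (free_operad E) 2) (comps (free_operad F) 2) (corolla E e) (corolla F f)))"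

definition white_product ::
    "('k::field, 'e) quad_data \<Rightarrow> ('k, 'f) quad_data \<Rightarrow> ('k, ('e \<times> 'f \<Rightarrow>\<^sub>0 'k) set) quad_data"
  where "white_product P Q =
   (let E = gens P; F = gens Q; V = comps (free_operad E) 3; W = comps (free_operad F) 3 in
    (s2_tensor E F,
     {x \<in> carrier (comps (free_operad (s2_tensor E F)) 3).
       manin_map E F 3 x \<in> lin_span (tensor V W)
         ({pure_tensor V W r y | r y. r \<in> rels P \<and> y \<in> carrier W} \<union>
          {pure_tensor V W y r | y r. y \<in> carrier V \<and> r \<in> rels Q})}))"

text \<open>The black product of the Koszul duals: \<open>P\<^sup>! \<bullet> Q\<^sup>! = (P \<circ> Q)\<^sup>!\<close>.\<close>

definition black_product_duals ::
    "('k::field, 'e) quad_data \<Rightarrow> ('k, 'f) quad_data \<Rightarrow> ('k, ('e \<times> 'f \<Rightarrow>\<^sub>0 'k) set \<Rightarrow> 'k) quad_data"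
  where "black_product_duals P Q = koszul_dual (white_product P Q)"


subsection \<open>Permutation algebras and preLie algebras\<close>

text \<open>\<open>Perm(2)\<close> is the plane with basis \<open>(1, 0) = x\<^sub>1 * x\<^sub>2\<close>, \<open>(0, 1) = x\<^sub>2 * x\<^sub>1\<close>.\<close>

definition perm_gens :: "('k::field, 'k \<times> 'k) s2module"
  where "perm_gens = \<lparr>
    carrier = UNIV,
    monoid.mult = undefined, one = undefined,
    zero = (0, 0),
    add = (\<lambda>(a, b) (c, d). (a + c, b + d)),
    module.smult = (\<lambda>c (a, b). (c * a, c * b)),
    swap = (\<lambda>(a, b). (b, a)),
    hdeg = 0\<rparr>"

abbreviation e22 :: "'k::field \<times> 'k" where "e22 \<equiv> (1, 0)"
abbreviation e21 :: "'k::field \<times> 'k" where "e21 \<equiv> (0, 1)"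

definition Perm :: "('k::field, 'k \<times> 'k) quad_data"
  where "Perm =
   (let F = free_operad perm_gens;
        x12_3 = tree_class perm_gens 3 (Node e22 (Node e22 (Leaf 1) (Leaf 2)) (Leaf 3));
        x1_23 = tree_class perm_gens 3 (Node e22 (Leaf 1) (Node e22 (Leaf 2) (Leaf 3)));
        x21_3 = tree_class perm_gens 3 (Node e22 (Node e22 (Leaf 2) (Leaf 1)) (Leaf 3)) in
    (perm_gens,
     (\<lambda>R. submodule R KK (comps F 3) \<and> s3_stable F R) hull
       {x12_3 \<ominus>\<^bsub>comps F 3\<^esub> x1_23, x12_3 \<ominus>\<^bsub>comps F 3\<^esub> x21_3}))"

definition preLie_black ::
    "('k::field, 'e) quad_data \<Rightarrow> ('k, (('k \<times> 'k) \<times> 'e \<Rightarrow>\<^sub>0 'k) set \<Rightarrow> 'k) quad_data"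
  \<comment> \<open>\<open>preLie \<bullet> P\<^sup>!\<close>, where \<open>preLie = Perm\<^sup>!\<close>\<close>
  where "preLie_black P = black_product_duals Perm P"

text \<open>The symbols \<open>\<beta>x\<^sub>1 * x\<^sub>2\<close> and \<open>x\<^sub>1 * \<beta>x\<^sub>2\<close> for \<open>* \<in> E\<^sup>\<or>\<close>, as elements of \<open>(Perm(2) \<otimes> E)\<^sup>\<or>\<close>.\<close>

definition beta_left :: "('k::field, 'e) s2module \<Rightarrow> ('e \<Rightarrow> 'k) \<Rightarrow> (('k \<times> 'k) \<times> 'e \<Rightarrow>\<^sub>0 'k) set \<Rightarrow> 'k"
  where "beta_left E f = (THE g. g \<in> carrier (dual (s2_tensor perm_gens E)) \<and>
    (\<forall>\<mu>\<in>carrier E. g (pure_tensor perm_gens E e22 \<mu>) = f \<mu> \<and> g (pure_tensor perm_gens E e21 \<mu>) = 0))"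

definition beta_right :: "('k::field, 'e) s2module \<Rightarrow> ('e \<Rightarrow> 'k) \<Rightarrow> (('k \<times> 'k) \<times> 'e \<Rightarrow>\<^sub>0 'k) set \<Rightarrow> 'k"
  where "beta_right E f = (THE g. g \<in> carrier (dual (s2_tensor perm_gens E)) \<and>
    (\<forall>\<mu>\<in>carrier E. g (pure_tensor perm_gens E e21 \<mu>) = f \<mu> \<and> g (pure_tensor perm_gens E e22 \<mu>) = 0))"


section \<open>Algebras over an operad\<close>

definition graded_space :: "('k::field \<Rightarrow> 'a::ab_group_add \<Rightarrow> 'a) \<Rightarrow> (int \<Rightarrow> 'a set) \<Rightarrow> bool"
  where "graded_space s gr \<longleftrightarrow> vector_space s \<and> (\<forall>k. module.subspace s (gr k)) \<and>
    (\<forall>a. \<exists>!c. (\<forall>k. c k \<in> gr k) \<and> finite {k. c k \<noteq> 0} \<and> a = (\<Sum>k | c k \<noteq> 0. c k))"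

text \<open>The sign of the rearrangement of \<open>x\<^sub>1, \<dots>, x\<^sub>n\<close>, of degrees \<open>ks\<close>, into
  \<open>x\<^bsub>\<tau>(1)\<^esub>, \<dots>, x\<^bsub>\<tau>(n)\<^esub>\<close>.\<close>

definition koszul_sign :: "nat \<Rightarrow> (nat \<Rightarrow> nat) \<Rightarrow> int list \<Rightarrow> 'k::field"
  where "koszul_sign n \<tau> ks =
    (\<Prod>(i, j) | 1 \<le> i \<and> i < j \<and> j \<le> n \<and> \<tau> i > \<tau> j.
       if odd (ks ! (\<tau> i - 1)) \<and> odd (ks ! (\<tau> j - 1)) then - 1 else 1)"

text \<open>The \<open>n\<close>-linear maps \<open>A\<^sup>n \<rightarrow> A\<close> of degree \<open>d(n-1)\<close>, represented as functions on lists (of value \<open>0\<close> on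
  lists of other lengths).\<close>

definition endo_maps ::
    "('k::field \<Rightarrow> 'a::ab_group_add \<Rightarrow> 'a) \<Rightarrow> (int \<Rightarrow> 'a set) \<Rightarrow> int \<Rightarrow> nat \<Rightarrow> ('a list \<Rightarrow> 'a) set"
  where "endo_maps s gr d n = {f.
    (\<forall>xs. length xs \<noteq> n \<longrightarrow> f xs = 0) \<and>
    (\<forall>xs a b ys. length xs + 1 + length ys = n \<longrightarrow>
       f (xs @ [a + b] @ ys) = f (xs @ [a] @ ys) + f (xs @ [b] @ ys)) \<and>
    (\<forall>xs c a ys. length xs + 1 + length ys = n \<longrightarrow> f (xs @ [s c a] @ ys) = s c (f (xs @ [a] @ ys))) \<and>
    (\<forall>ks xs. length xs = n \<and> list_all2 (\<lambda>k x. x \<in> gr k) ks xs \<longrightarrow>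
       f xs \<in> gr (sum_list ks + d * (int n - 1)))}"

text \<open>The suboperad of \<open>End(A)\<close> consisting of the maps of degree \<open>d(n-1)\<close> in arity \<open>n\<close>. An operad generated by
  binary operations of degree \<open>d\<close> has degree \<open>d(n-1)\<close> in arity \<open>n\<close>, so every (degree-preserving) operad
  morphism from it to \<open>End(A)\<close> has values in this suboperad. The composition has no Koszul signs because
  \<open>d\<close> is assumed to be even; the symmetric groups act with the Koszul signs of the arguments.
  For \<open>A\<close> ungraded, take \<open>d = 0\<close> and \<open>A\<close> in degree \<open>0\<close>.\<close>

definition End_operad ::
    "('k::field \<Rightarrow> 'a::ab_group_add \<Rightarrow> 'a) \<Rightarrow> (int \<Rightarrow> 'a set) \<Rightarrow> int \<Rightarrow> ('k, 'a list \<Rightarrow> 'a) operad"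
  where "End_operad s gr d = \<lparr>
    comps = (\<lambda>n. \<lparr>carrier = endo_maps s gr d n, monoid.mult = undefined, one = undefined,
      zero = (\<lambda>xs. 0), add = (\<lambda>f g xs. f xs + g xs), module.smult = (\<lambda>c f xs. s c (f xs))\<rparr>),
    pact = (\<lambda>n f \<sigma>. THE g. g \<in> endo_maps s gr d n \<and>
      (\<forall>ks xs. length xs = n \<and> list_all2 (\<lambda>k x. x \<in> gr k) ks xs \<longrightarrow>
        g xs = s (koszul_sign n (inv_into UNIV \<sigma>) ks) (f (map (\<lambda>i. xs ! (inv_into UNIV \<sigma> i - 1)) [1..<Suc n])))),
    ident = (\<lambda>xs. if length xs = 1 then hd xs else 0),
    pcomp = (\<lambda>n m i f g xs. if length xs = n + m - 1
      then f (take (i - 1) xs @ [g (take m (drop (i - 1) xs))] @ drop (i - 1 + m) xs)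
      else 0)\<rparr>"

definition algebra_over ::
    "('k::field, 'e) quad_data \<Rightarrow> ('k \<Rightarrow> 'a::ab_group_add \<Rightarrow> 'a) \<Rightarrow> (int \<Rightarrow> 'a set) \<Rightarrow>
     (nat \<Rightarrow> ('e btree \<Rightarrow>\<^sub>0 'k) set set \<Rightarrow> 'a list \<Rightarrow> 'a) \<Rightarrow> bool"
  where "algebra_over P s gr \<rho> \<longleftrightarrow> operad_hom (operad_of P) (End_operad s gr (hdeg (gens P))) \<rho>"

text \<open>A Rota-Baxter operator of weight zero (and degree \<open>0\<close>) on a \<open>P\<close>-algebra.\<close>

definition rota_baxter ::
    "('k::field, 'e) quad_data \<Rightarrow> ('k \<Rightarrow> 'a::ab_group_add \<Rightarrow> 'a) \<Rightarrow> (int \<Rightarrow> 'a set) \<Rightarrow>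
     (nat \<Rightarrow> ('e btree \<Rightarrow>\<^sub>0 'k) set set \<Rightarrow> 'a list \<Rightarrow> 'a) \<Rightarrow> ('a \<Rightarrow> 'a) \<Rightarrow> bool"
  where "rota_baxter P s gr \<rho> \<beta> \<longleftrightarrow>
    Vector_Spaces.linear s s \<beta> \<and> (\<forall>k. \<beta> ` gr k \<subseteq> gr k) \<and>
    (\<forall>e\<in>carrier (gens P). \<forall>x y. let m = (\<lambda>x y. \<rho> 2 (generator P e) [x, y]) in
       m (\<beta> x) (\<beta> y) = \<beta> (m (\<beta> x) y + m x (\<beta> y)))"

end

theory Submission
  imports Defs "HOL-Library.Function_Algebras"
begin

text \<open>Write \<open>g\<^sub>1, g\<^sub>2 \<in> E\<^sup>\<or>\<close> for the restrictions of \<open>g \<in> (Perm(2) \<otimes> E)\<^sup>\<or>\<close> to \<open>e\<^sup>2\<^sub>2 \<otimes> E\<close> and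
  \<open>e\<^sup>2\<^sub>1 \<otimes> E\<close>. The products \<open>\<beta>(x) g\<^sub>1 y + x g\<^sub>2 \<beta>(y)\<close> define a morphism from the free operad to
  \<open>End(A)\<close>, and it has to kill the orthogonal space of the relations of \<open>Perm \<circ> P\<close>. Modulo the
  relations of \<open>Perm\<close> a monomial in \<open>x\<^sub>1, x\<^sub>2, x\<^sub>3\<close> is determined by its last variable \<open>x\<^sub>l\<close>, so that each
  \<open>l\<close> lifts a relation of \<open>P\<close> to a relation of \<open>Perm \<circ> P\<close>; dually, each element \<open>y\<close> of the orthogonal
  space has three projections \<open>z\<^sub>l\<close> orthogonal to the relations of \<open>P\<close>. By the Rota-Baxter identity
  the operation of \<open>y\<close> is the sum over \<open>l\<close> of the operations of \<open>z\<^sub>l\<close> with \<open>\<beta>\<close> applied to all variables but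
  \<open>x\<^sub>l\<close>, up to terms \<open>g\<^sub>1(\<beta>((h\<^sub>1 - h\<^sub>2)(x\<^sub>i, \<beta>(x\<^sub>j))), x\<^sub>k)\<close>. These cancel because of the
  relations \<open>(x\<^sub>i x\<^sub>j) x\<^sub>k = (x\<^sub>j x\<^sub>i) x\<^sub>k\<close>.\<close>

section \<open>Modules over the ground field\<close>

text \<open>\<open>pairing\<close> and \<open>manin_map\<close> are chosen by \<open>SOME\<close>,
  and the symmetric groups act on \<open>End_operad\<close> through \<open>THE\<close>, so each of
  these has to be shown to exist before anything can be computed. A normal form for free operads is
  avoided. Linear maps out of \<open>free_operad E\<close> come from the universal property, by
  evaluating trees in a suitable algebra; in the other direction it is enough that the elements
  \<open>cubic\<close> over cyclic triples span arity 3. In particular the pairing is built from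
  coordinate functionals that are themselves evaluations in a small algebra. The space of relations
  of the white product is not determined. Two families of elements inside it are exhibited, and an
  element y of the orthogonal space enters only through the fact that it annihilates both. Gradings
  are handled by parities: \<open>d\<close> is even and \<beta> has degree 0, so all Koszul signs
  depend only on which arguments are odd. A prescription with such signs makes sense only on
  homogeneous arguments; splitting each argument into its even and its odd part turns it into a
  multilinear map on the whole space.\<close>

lemma KK_simps [simp]:
  "carrier KK = UNIV" "x \<oplus>\<^bsub>KK\<^esub> y = x + y" "x \<otimes>\<^bsub>KK\<^esub> y = x * y" "\<one>\<^bsub>KK\<^esub> = 1" "\<zero>\<^bsub>KK\<^esub> = 0"
  by (simp_all add: ring_of_type_algebra_def)

lemma cring_KK: "cring (KK :: 'k::field ring)"
  by (rule cring_from_type_algebra)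

text \<open>The inverse of \<open>x\<close> is \<open>(- 1) \<odot> x\<close>, so a single equation
  takes the place of the existence of inverses.\<close>

lemma module_KK_I:
  fixes M :: "('k::field, 'x, 'm) module_scheme"
  assumes "\<And>x y. x \<in> carrier M \<Longrightarrow> y \<in> carrier M \<Longrightarrow> x \<oplus>\<^bsub>M\<^esub> y \<in> carrier M"
    and "\<zero>\<^bsub>M\<^esub> \<in> carrier M"
    and "\<And>x y z. \<lbrakk>x \<in> carrier M; y \<in> carrier M; z \<in> carrier M\<rbrakk> \<Longrightarrow> (x \<oplus>\<^bsub>M\<^esub> y) \<oplus>\<^bsub>M\<^esub> z = x \<oplus>\<^bsub>M\<^esub> (y \<oplus>\<^bsub>M\<^esub> z)"
    and "\<And>x y. \<lbrakk>x \<in> carrier M; y \<in> carrier M\<rbrakk> \<Longrightarrow> x \<oplus>\<^bsub>M\<^esub> y = y \<oplus>\<^bsub>M\<^esub> x"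
    and zero: "\<And>x. x \<in> carrier M \<Longrightarrow> \<zero>\<^bsub>M\<^esub> \<oplus>\<^bsub>M\<^esub> x = x"
    and neg: "\<And>x. x \<in> carrier M \<Longrightarrow> (- 1) \<odot>\<^bsub>M\<^esub> x \<oplus>\<^bsub>M\<^esub> x = \<zero>\<^bsub>M\<^esub>"
    and closed: "\<And>c x. x \<in> carrier M \<Longrightarrow> c \<odot>\<^bsub>M\<^esub> x \<in> carrier M"
    and "\<And>c d x. x \<in> carrier M \<Longrightarrow> (c + d) \<odot>\<^bsub>M\<^esub> x = c \<odot>\<^bsub>M\<^esub> x \<oplus>\<^bsub>M\<^esub> d \<odot>\<^bsub>M\<^esub> x"
    and "\<And>c x y. \<lbrakk>x \<in> carrier M; y \<in> carrier M\<rbrakk> \<Longrightarrow> c \<odot>\<^bsub>M\<^esub> (x \<oplus>\<^bsub>M\<^esub> y) = c \<odot>\<^bsub>M\<^esub> x \<oplus>\<^bsub>M\<^esub> c \<odot>\<^bsub>M\<^esub> y"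
    and "\<And>c d x. x \<in> carrier M \<Longrightarrow> (c * d) \<odot>\<^bsub>M\<^esub> x = c \<odot>\<^bsub>M\<^esub> (d \<odot>\<^bsub>M\<^esub> x)"
    and "\<And>x. x \<in> carrier M \<Longrightarrow> 1 \<odot>\<^bsub>M\<^esub> x = x"
  shows "module KK M"
proof (rule moduleI)
  show "abelian_group M"
  proof (rule abelian_groupI)
    fix x assume "x \<in> carrier M"
    then show "\<exists>y\<in>carrier M. y \<oplus>\<^bsub>M\<^esub> x = \<zero>\<^bsub>M\<^esub>" using closed neg by blast
  qed (fact assms)+
qed (simp_all add: assms cring_KK)

locale kmodule = module KK M for M :: "('k::field, 'x, 'm) module_scheme" (structure)
begin

lemma k_closed [simp]: "x \<in> carrier M \<Longrightarrow> c \<odot> x \<in> carrier M"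
  using smult_closed by simp

lemma k_l_distr: "x \<in> carrier M \<Longrightarrow> (c + d) \<odot> x = c \<odot> x \<oplus> d \<odot> x"
  using smult_l_distr by simp

lemma k_r_distr: "x \<in> carrier M \<Longrightarrow> y \<in> carrier M \<Longrightarrow> c \<odot> (x \<oplus> y) = c \<odot> x \<oplus> c \<odot> y"
  using smult_r_distr by simp

lemma k_assoc: "x \<in> carrier M \<Longrightarrow> (c * d) \<odot> x = c \<odot> (d \<odot> x)"
  using smult_assoc1 by simp

lemma k_one [simp]: "x \<in> carrier M \<Longrightarrow> 1 \<odot> x = x"
  using smult_one by simp

lemma k_zero [simp]: "x \<in> carrier M \<Longrightarrow> 0 \<odot> x = \<zero>"
  using k_l_distr[of x 0 0] by (metis M.add.l_cancel_one' add_0 k_closed)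

lemma k_zero2 [simp]: "c \<odot> \<zero> = \<zero>"
  using k_r_distr[of \<zero> \<zero> c] by (metis M.add.l_cancel_one' M.r_zero M.zero_closed k_closed)

lemma k_neg: "x \<in> carrier M \<Longrightarrow> (- 1) \<odot> x = \<ominus> x"
proof -
  assume x: "x \<in> carrier M"
  have "(- 1) \<odot> x \<oplus> x = (- 1 + 1) \<odot> x"
    using x by (simp only: k_l_distr k_one)
  also have "\<dots> = \<zero>" using x by simp
  finally show ?thesis using x M.minus_equality by simp
qed

lemma minus_as_smult: "x \<in> carrier M \<Longrightarrow> y \<in> carrier M \<Longrightarrow> x \<ominus> y = x \<oplus> (- 1) \<odot> y"
  by (simp add: k_neg M.minus_eq)

lemma eq_of_minus:
  assumes "x \<in> carrier M" "y \<in> carrier M" "x \<ominus> y = \<zero>"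
  shows "x = y"
proof -
  have "x = (x \<ominus> y) \<oplus> y" using assms(1,2) by (simp add: M.minus_eq M.a_assoc M.l_neg)
  then show ?thesis using assms by simp
qed

text \<open>Ordered rewriting with \<open>a_ac\<close> separates \<open>x\<close> from
  \<open>\<ominus> x\<close>; this rule and the next let the simplifier cancel them across the
  summands that end up in between.\<close>

lemma cancel: "x \<in> carrier M \<Longrightarrow> y \<in> carrier M \<Longrightarrow> x \<oplus> (y \<oplus> \<ominus> x) = y"
  by (simp add: M.a_comm[of y] M.r_neg2)

lemma cancel2: "x \<in> carrier M \<Longrightarrow> y \<in> carrier M \<Longrightarrow> z \<in> carrier M \<Longrightarrow> x \<oplus> (y \<oplus> (z \<oplus> \<ominus> x)) = y \<oplus> z"
  using cancel[of x "y \<oplus> z"] by (simp add: M.a_assoc)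

text \<open>Closure under negatives does not appear on the right because \<open>\<ominus> a\<close>
  is \<open>(- 1) \<odot> a\<close>.\<close>

lemma submodule_iff:
  "submodule N KK M \<longleftrightarrow> N \<subseteq> carrier M \<and> \<zero> \<in> N \<and> (\<forall>x\<in>N. \<forall>y\<in>N. x \<oplus> y \<in> N) \<and> (\<forall>c. \<forall>x\<in>N. c \<odot> x \<in> N)"
  (is "_ \<longleftrightarrow> ?R")
proof
  assume N: "submodule N KK M"
  have "\<zero> \<in> N" using submodule.axioms(1)[OF N] subgroup.one_closed by fastforce
  then show ?R using submoduleE[OF N] by auto
next
  assume R: ?R
  show "submodule N KK M"
  proof (rule submoduleI)
    fix a assume "a \<in> N"
    then show "\<ominus> a \<in> N" using R k_neg by (metis subsetD)
  qed (use R in auto)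
qed

lemma submodule_Inter:
  assumes "\<And>N. N \<in> A \<Longrightarrow> submodule N KK M" "A \<noteq> {}"
  shows "submodule (\<Inter>A) KK M"
  using assms unfolding submodule_iff by blast

lemma lin_span_submodule: "S \<subseteq> carrier M \<Longrightarrow> submodule (lin_span M S) KK M"
  unfolding lin_span_def hull_def
  by (rule submodule_Inter) (use carrier_is_submodule in auto)

end

lemma lin_span_superset: "S \<subseteq> lin_span M S"
  unfolding lin_span_def by (rule hull_subset)

lemma lin_span_minimal: "S \<subseteq> N \<Longrightarrow> submodule N KK M \<Longrightarrow> lin_span M S \<subseteq> N"
  unfolding lin_span_def by (rule hull_minimal)

lemma linear_betweenI:
  assumes "\<And>x. x \<in> carrier M \<Longrightarrow> h x \<in> carrier N"
    and "\<And>x y. x \<in> carrier M \<Longrightarrow> y \<in> carrier M \<Longrightarrow> h (x \<oplus>\<^bsub>M\<^esub> y) = h x \<oplus>\<^bsub>N\<^esub> h y"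
    and "\<And>c x. x \<in> carrier M \<Longrightarrow> h (c \<odot>\<^bsub>M\<^esub> x) = c \<odot>\<^bsub>N\<^esub> h x"
  shows "linear_between M N h"
  using assms by (auto simp: linear_between_def)

lemma linear_betweenD:
  assumes "linear_between M N h"
  shows "\<And>x. x \<in> carrier M \<Longrightarrow> h x \<in> carrier N"
    and "\<And>x y. x \<in> carrier M \<Longrightarrow> y \<in> carrier M \<Longrightarrow> h (x \<oplus>\<^bsub>M\<^esub> y) = h x \<oplus>\<^bsub>N\<^esub> h y"
    and "\<And>c x. x \<in> carrier M \<Longrightarrow> h (c \<odot>\<^bsub>M\<^esub> x) = c \<odot>\<^bsub>N\<^esub> h x"
  using assms by (auto simp: linear_between_def)

lemma linear_between_comp:
  assumes "linear_between M N h" "linear_between N L k"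
  shows "linear_between M L (\<lambda>x. k (h x))"
  by (rule linear_betweenI) (simp_all add: linear_betweenD[OF assms(1)] linear_betweenD[OF assms(2)])

lemma linear_between_zero:
  assumes "module KK M" "module KK N" "linear_between M N h"
  shows "h \<zero>\<^bsub>M\<^esub> = \<zero>\<^bsub>N\<^esub>"
proof -
  interpret M: kmodule M by (simp add: kmodule_def assms)
  interpret N: kmodule N by (simp add: kmodule_def assms)
  have "h (0 \<odot>\<^bsub>M\<^esub> \<zero>\<^bsub>M\<^esub>) = 0 \<odot>\<^bsub>N\<^esub> h \<zero>\<^bsub>M\<^esub>"
    using linear_betweenD[OF assms(3)] by blast
  then show ?thesis using linear_betweenD(1)[OF assms(3)] by simp
qed

lemma linear_between_minus:
  assumes "module KK M" "module KK N" "linear_between M N h" "x \<in> carrier M" "y \<in> carrier M"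
  shows "h (x \<ominus>\<^bsub>M\<^esub> y) = h x \<ominus>\<^bsub>N\<^esub> h y"
proof -
  interpret M: kmodule M by (simp add: kmodule_def assms)
  interpret N: kmodule N by (simp add: kmodule_def assms)
  show ?thesis
    using assms(4,5) by (simp add: M.minus_as_smult N.minus_as_smult linear_betweenD[OF assms(3)])
qed

lemma submodule_vimage:
  assumes "module KK M" "module KK N" "linear_between M N h" "submodule L KK N"
  shows "submodule {x \<in> carrier M. h x \<in> L} KK M"
proof -
  interpret M: kmodule M by (simp add: kmodule_def assms)
  interpret N: kmodule N by (simp add: kmodule_def assms)
  show ?thesis
    using assms(4) linear_betweenD[OF assms(3)] linear_between_zero[OF assms(1-3)]
    unfolding M.submodule_iff N.submodule_iff by simp
qed

lemma submodule_zero: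
  assumes "module KK M"
  shows "submodule {\<zero>\<^bsub>M\<^esub>} KK M"
proof -
  interpret M: kmodule M by (simp add: kmodule_def assms)
  show ?thesis unfolding M.submodule_iff by simp
qed

text \<open>The module axioms are identities, once inverses are written as multiples by -1, and
  identities descend along a surjection that respects the operations. This serves quotients and,
  with \<open>h = id\<close>, the passage from \<open>tensor\<close> to the larger record
  \<open>s2_tensor\<close>.\<close>

lemma module_surj_image:
  fixes M :: "('k::field, 'x, 'm) module_scheme" and N :: "('k, 'y, 'n) module_scheme"
  assumes "module KK M" and car: "carrier N = h ` carrier M"
    and add: "\<And>x y. x \<in> carrier M \<Longrightarrow> y \<in> carrier M \<Longrightarrow> h x \<oplus>\<^bsub>N\<^esub> h y = h (x \<oplus>\<^bsub>M\<^esub> y)"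
    and smult: "\<And>c x. x \<in> carrier M \<Longrightarrow> c \<odot>\<^bsub>N\<^esub> h x = h (c \<odot>\<^bsub>M\<^esub> x)"
    and zero: "\<zero>\<^bsub>N\<^esub> = h \<zero>\<^bsub>M\<^esub>"
  shows "module KK N"
proof -
  interpret M: kmodule M by (simp add: kmodule_def assms)
  show ?thesis
    by (rule module_KK_I)
      (auto simp: car add smult zero M.k_l_distr M.k_r_distr M.k_assoc M.k_neg M.M.a_assoc M.M.l_neg
        intro!: imageI arg_cong[where f = h] intro: M.M.a_comm)
qed

section \<open>Quotients of modules\<close>

locale kquot = kmodule M for M :: "('k::field, 'x, 'm) module_scheme" (structure) +
  fixes N :: "'x set"
  assumes sub: "submodule N KK M"
begin

lemma N_facts: "N \<subseteq> carrier M" "\<zero> \<in> N" "x \<in> N \<Longrightarrow> y \<in> N \<Longrightarrow> x \<oplus> y \<in> N" "x \<in> N \<Longrightarrow> c \<odot> x \<in> N"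
  using sub unfolding submodule_iff by auto

lemma coset_mem:
  assumes x: "x \<in> carrier M"
  shows "z \<in> N +> x \<longleftrightarrow> z \<in> carrier M \<and> z \<ominus> x \<in> N"
proof
  assume "z \<in> N +> x"
  then obtain n where "n \<in> N" "z = n \<oplus> x" by (auto simp: a_r_coset_def')
  moreover from this N_facts(1) have "n \<in> carrier M" by auto
  ultimately show "z \<in> carrier M \<and> z \<ominus> x \<in> N"
    using x by (simp add: M.minus_eq M.a_assoc M.r_neg)
next
  assume z: "z \<in> carrier M \<and> z \<ominus> x \<in> N"
  then have "z = (z \<ominus> x) \<oplus> x" using x by (simp add: M.minus_eq M.a_assoc M.l_neg)
  with z show "z \<in> N +> x" unfolding a_r_coset_def' by blast
qed

lemma minus_N: "x \<in> N \<Longrightarrow> y \<in> N \<Longrightarrow> x \<ominus> y \<in> N"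
  using N_facts(1) by (simp add: minus_as_smult N_facts subset_iff)

lemma coset_eq: "x \<in> carrier M \<Longrightarrow> y \<in> carrier M \<Longrightarrow> N +> x = N +> y \<longleftrightarrow> x \<ominus> y \<in> N"
proof
  assume x: "x \<in> carrier M" and y: "y \<in> carrier M"
  { assume "N +> x = N +> y"
    moreover have "x \<in> N +> x" using x by (simp add: coset_mem N_facts M.minus_eq M.r_neg)
    ultimately show "x \<ominus> y \<in> N" using y by (simp add: coset_mem) }
  assume d: "x \<ominus> y \<in> N"
  have eq: "z \<ominus> y = (z \<ominus> x) \<oplus> (x \<ominus> y)" "z \<ominus> x = (z \<ominus> y) \<ominus> (x \<ominus> y)" if "z \<in> carrier M" for z
    using that x y by (simp_all add: M.minus_eq M.minus_add M.a_ac cancel cancel2 M.r_neg1 M.r_neg2)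
  show "N +> x = N +> y"
    using x y d by (auto simp: coset_mem) (metis eq(1) N_facts(3), metis eq(2) minus_N)
qed

lemma self_mem: "x \<in> carrier M \<Longrightarrow> x \<in> N +> x"
  by (simp add: coset_mem N_facts M.minus_eq M.r_neg)

lemma coset_zero: "N +> \<zero> = N"
  using coset_mem[of \<zero>] N_facts(1) by (auto simp: M.minus_eq)

lemma coset_eq_N: "x \<in> carrier M \<Longrightarrow> N +> x = N \<longleftrightarrow> x \<in> N"
  using coset_eq[of x \<zero>] M.minus_equality[of \<zero> \<zero>] by (simp add: coset_zero M.minus_eq)

text \<open>Operations on quotients are defined as unions over all representatives of a coset. Such
  a union collapses to one member as soon as the family is constant on the coset, because the coset
  contains \<open>x\<close>.\<close>

lemma UN_coset:
  assumes "x \<in> carrier M" "\<And>y. y \<in> carrier M \<Longrightarrow> y \<ominus> x \<in> N \<Longrightarrow> H y = H x"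
  shows "(\<Union>y\<in>N +> x. H y) = H x"
proof -
  have "H y = H x" if "y \<in> N +> x" for y
    using that coset_mem[OF assms(1)] assms(2) by blast
  then show ?thesis using self_mem[OF assms(1)] by blast
qed

lemma quot_carrier: "carrier (quot_module M N) = (\<lambda>x. N +> x) ` carrier M"
  by (auto simp: quot_module_def A_RCOSETS_def')

lemma quot_zero: "\<zero>\<^bsub>quot_module M N\<^esub> = N +> \<zero>"
  by (simp add: quot_module_def coset_zero)

lemma quot_add: "x \<in> carrier M \<Longrightarrow> y \<in> carrier M \<Longrightarrow> (N +> x) \<oplus>\<^bsub>quot_module M N\<^esub> (N +> y) = N +> (x \<oplus> y)"
proof -
  assume x: "x \<in> carrier M" and y: "y \<in> carrier M"
  interpret A: abelian_subgroup N M
    using sub by (intro abelian_subgroupI2 a_comm_group) (simp add: submodule_def)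
  show ?thesis using x y A.a_rcos_sum by (simp add: quot_module_def)
qed

lemma smult_minus: "x \<in> carrier M \<Longrightarrow> y \<in> carrier M \<Longrightarrow> c \<odot> x \<ominus> c \<odot> y = c \<odot> (x \<ominus> y)"
  using k_assoc[of y c "- 1"] k_assoc[of y "- 1" c] by (simp add: minus_as_smult k_r_distr)

lemma quot_smult:
  assumes "x \<in> carrier M"
  shows "c \<odot>\<^bsub>quot_module M N\<^esub> (N +> x) = N +> (c \<odot> x)"
proof -
  have "(\<Union>y\<in>N +> x. N +> (c \<odot> y)) = N +> (c \<odot> x)"
  proof (rule UN_coset[OF assms])
    fix y assume "y \<in> carrier M" "y \<ominus> x \<in> N"
    then show "N +> (c \<odot> y) = N +> (c \<odot> x)"
      using assms N_facts(4) by (simp add: coset_eq smult_minus)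
  qed
  then show ?thesis by (simp add: quot_module_def)
qed

lemma module_M: "module KK M"
  by unfold_locales

lemma quot_module: "module KK (quot_module M N)"
proof (rule module_surj_image[OF module_M quot_carrier])
qed (simp_all only: quot_add quot_smult quot_zero)

lemma proj_linear: "linear_between M (quot_module M N) (\<lambda>x. N +> x)"
  by (rule linear_betweenI) (simp_all add: quot_carrier quot_add quot_smult)

lemma quot_linear_induced:
  assumes L: "module KK L" and h: "linear_between M L h" and ker: "\<And>x. x \<in> N \<Longrightarrow> h x = \<zero>\<^bsub>L\<^esub>"
  obtains k where "linear_between (quot_module M N) L k" "\<And>x. x \<in> carrier M \<Longrightarrow> k (N +> x) = h x"
proof -
  interpret L: kmodule L by (simp add: kmodule_def L)
  \<comment> \<open>Any representative will do: two of them differ by an element of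
    \<open>N\<close>, which \<open>h\<close> sends to zero.\<close>
  define k where "k A = h (SOME x. x \<in> A)" for A
  have k: "k (N +> x) = h x" if x: "x \<in> carrier M" for x
  proof -
    have "(SOME y. y \<in> N +> x) \<in> N +> x" using self_mem[OF x] by (rule someI)
    then obtain y where y: "k (N +> x) = h y" "y \<in> carrier M" "y \<ominus> x \<in> N"
      using x by (auto simp: k_def coset_mem)
    then have "h y \<ominus>\<^bsub>L\<^esub> h x = \<zero>\<^bsub>L\<^esub>"
      using linear_between_minus[OF module_M L h] x ker by metis
    then show ?thesis using y x linear_betweenD(1)[OF h] L.eq_of_minus by simp
  qed
  have "linear_between (quot_module M N) L k"
    by (rule linear_betweenI) (auto simp: quot_carrier quot_add quot_smult k linear_betweenD[OF h])
  then show ?thesis using k that by blast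
qed

end

section \<open>Free modules on sets\<close>

lemma single_smult [simp]: "Poly_Mapping.map ((*) (c::'k::field)) (Poly_Mapping.single s d) = Poly_Mapping.single s (c * d)"
  by simp

lemma lookup_smult [simp]: "Poly_Mapping.lookup (Poly_Mapping.map ((*) (c::'k::field)) p) s = c * Poly_Mapping.lookup p s"
  by (simp add: map.rep_eq when_def)

lemma free_module_simps [simp]:
  "carrier (free_module S) = {p. Poly_Mapping.keys p \<subseteq> S}"
  "\<zero>\<^bsub>free_module S\<^esub> = 0" "p \<oplus>\<^bsub>free_module S\<^esub> q = p + q"
  "c \<odot>\<^bsub>free_module S\<^esub> p = Poly_Mapping.map ((*) c) p"
  by (simp_all add: free_module_def)

lemma keys_smult: "Poly_Mapping.keys (Poly_Mapping.map ((*) (c::'k::field)) p) \<subseteq> Poly_Mapping.keys p"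
  by (auto simp: in_keys_iff)

lemma free_module_module: "module KK (free_module S :: ('k::field, 's \<Rightarrow>\<^sub>0 'k) module)"
  by (rule module_KK_I)
    (simp_all add: subset_trans[OF keys_add] subset_trans[OF keys_smult] poly_mapping_eq_iff fun_eq_iff
      lookup_add algebra_simps)

lemma free_module_minus:
  assumes "p \<in> carrier (free_module S)" "q \<in> carrier (free_module S)"
  shows "p \<ominus>\<^bsub>free_module S\<^esub> q = p - (q :: 's \<Rightarrow>\<^sub>0 'k::field)"
proof -
  interpret kmodule "free_module S :: ('k, 's \<Rightarrow>\<^sub>0 'k) module"
    by (simp add: kmodule_def free_module_module)
  show ?thesis using assms
    by (subst minus_as_smult) (auto intro!: poly_mapping_eqI simp: lookup_add lookup_minus)
qed

text \<open>\<open>update_induct\<close> sets a coefficient outside the support, and this amounts to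
  adding a monomial.\<close>

lemma free_module_induct [consumes 1, case_names zero add]:
  assumes "Poly_Mapping.keys p \<subseteq> S" and "Q 0"
    and "\<And>p s c. Poly_Mapping.keys p \<subseteq> S \<Longrightarrow> s \<in> S \<Longrightarrow> Q p \<Longrightarrow> Q (p + Poly_Mapping.single s (c::'k::field))"
  shows "Q p"
  using assms(1)
proof (induction p rule: update_induct)
  case const show ?case by (rule assms(2))
next
  case (update p s c)
  have "Poly_Mapping.update s c p = p + Poly_Mapping.single s c"
    using update.hyps by (intro poly_mapping_eqI) (auto simp: lookup_update lookup_add lookup_single when_def in_keys_iff)
  moreover have "Poly_Mapping.keys (Poly_Mapping.update s c p) = insert s (Poly_Mapping.keys p)"
    using update.hyps by (auto simp: keys_update)
  ultimately show ?case using update assms(3) by simp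
qed

lemma free_module_linear_eq:
  fixes p :: "'s \<Rightarrow>\<^sub>0 'k::field"
  assumes M: "module KK M" and f: "linear_between (free_module S) M f" and g: "linear_between (free_module S) M g"
    and eq: "\<And>s. s \<in> S \<Longrightarrow> f (Poly_Mapping.single s 1) = g (Poly_Mapping.single s 1)"
    and p: "Poly_Mapping.keys p \<subseteq> S"
  shows "f p = g p"
  using p
proof (induction p rule: free_module_induct)
  case zero
  show ?case using linear_between_zero[OF free_module_module M] f g by (metis free_module_simps(2))
next
  case (add p s c)
  have s: "Poly_Mapping.single s c = c \<odot>\<^bsub>free_module S\<^esub> Poly_Mapping.single s 1" by simp
  have 1: "Poly_Mapping.single s c \<in> carrier (free_module S)" "Poly_Mapping.single s (1::'k) \<in> carrier (free_module S)"
    "p \<in> carrier (free_module S)" using add by auto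
  have "f (Poly_Mapping.single s c) = g (Poly_Mapping.single s c)"
    unfolding s using 1 by (simp only: linear_betweenD[OF f] linear_betweenD[OF g] eq[OF add(2)])
  then show ?case
    using add 1 linear_betweenD(2)[OF f] linear_betweenD(2)[OF g] by (metis free_module_simps(3))
qed

lemma free_module_extend:
  fixes M :: "('k::field, 'x, 'm) module_scheme" and S :: "'s set"
  assumes M: "module KK M" and h: "\<And>s. s \<in> S \<Longrightarrow> h s \<in> carrier M"
  obtains L where "linear_between (free_module S) M L"
    and "\<And>s c. s \<in> S \<Longrightarrow> L (Poly_Mapping.single s c) = c \<odot>\<^bsub>M\<^esub> h s"
proof -
  interpret M: kmodule M by (simp add: kmodule_def M)
  define L where "L p = finsum M (\<lambda>s. Poly_Mapping.lookup p s \<odot>\<^bsub>M\<^esub> h s) (Poly_Mapping.keys p)" for p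
  \<comment> \<open>The sum may run over any finite set between the support and \<open>S\<close>.
    This allows \<open>p\<close>, \<open>q\<close> and \<open>p + q\<close>, whose supports differ,
    to be summed over one common set.\<close>
  have L: "L p = finsum M (\<lambda>s. Poly_Mapping.lookup p s \<odot>\<^bsub>M\<^esub> h s) A"
    if "finite A" "Poly_Mapping.keys p \<subseteq> A" "A \<subseteq> S" for p A
    unfolding L_def
    by (rule M.add.finprod_mono_neutral_cong_left)
       (use that h in \<open>auto simp: in_keys_iff\<close>)
  have cl: "L p \<in> carrier M" if "Poly_Mapping.keys p \<subseteq> S" for p
    unfolding L_def by (rule M.finsum_closed) (use that h in auto)
  have "linear_between (free_module S) M L"
  proof (rule linear_betweenI)
    fix p q :: "'s \<Rightarrow>\<^sub>0 'k" assume "p \<in> carrier (free_module S)" "q \<in> carrier (free_module S)"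
    then have k: "Poly_Mapping.keys p \<subseteq> S" "Poly_Mapping.keys q \<subseteq> S" by auto
    let ?A = "Poly_Mapping.keys p \<union> Poly_Mapping.keys q"
    have A: "finite ?A" "Poly_Mapping.keys p \<subseteq> ?A" "Poly_Mapping.keys q \<subseteq> ?A"
      "Poly_Mapping.keys (p + q) \<subseteq> ?A" "?A \<subseteq> S"
      using k keys_add[of p q] by auto
    have hA: "h s \<in> carrier M" if "s \<in> ?A" for s using that A h by auto
    have "L (p + q) = finsum M (\<lambda>s. Poly_Mapping.lookup p s \<odot>\<^bsub>M\<^esub> h s \<oplus>\<^bsub>M\<^esub> Poly_Mapping.lookup q s \<odot>\<^bsub>M\<^esub> h s) ?A"
      using L[OF A(1,4,5)] by (simp add: lookup_add) (rule M.finsum_cong', use hA in \<open>auto simp: M.k_l_distr\<close>)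
    also have "\<dots> = L p \<oplus>\<^bsub>M\<^esub> L q"
      using L[OF A(1,2,5)] L[OF A(1,3,5)] hA by (simp add: M.finsum_addf Pi_def)
    finally show "L (p \<oplus>\<^bsub>free_module S\<^esub> q) = L p \<oplus>\<^bsub>M\<^esub> L q" by simp
  next
    fix c and p :: "'s \<Rightarrow>\<^sub>0 'k" assume "p \<in> carrier (free_module S)"
    then have k: "Poly_Mapping.keys p \<subseteq> S" by simp
    have "L (Poly_Mapping.map ((*) c) p) = finsum M (\<lambda>s. c \<odot>\<^bsub>M\<^esub> (Poly_Mapping.lookup p s \<odot>\<^bsub>M\<^esub> h s)) (Poly_Mapping.keys p)"
      using L[OF _ keys_smult k, of c]
      by simp (rule M.finsum_cong', use k h in \<open>auto simp: M.k_assoc\<close>)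
    also have "\<dots> = c \<odot>\<^bsub>M\<^esub> L p"
      unfolding L_def using k h by (subst M.finsum_smult_ldistr) auto
    finally show "L (c \<odot>\<^bsub>free_module S\<^esub> p) = c \<odot>\<^bsub>M\<^esub> L p" by simp
  qed (use cl in simp)
  moreover have "L (Poly_Mapping.single s c) = c \<odot>\<^bsub>M\<^esub> h s" if "s \<in> S" for s c
    using L[of "{s}" "Poly_Mapping.single s c"] that h by simp
  ultimately show ?thesis using that by blast
qed

section \<open>Linear and bilinear extensions of maps of sets\<close>

lemma lin_ext_superset:
  assumes "finite A" "Poly_Mapping.keys p \<subseteq> A"
  shows "lin_ext g p = (\<Sum>s\<in>A. Poly_Mapping.single (g s) (Poly_Mapping.lookup p s))"
  unfolding lin_ext_def by (rule sum.mono_neutral_left) (use assms in \<open>auto simp: in_keys_iff\<close>)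

lemma lin_ext_single [simp]: "lin_ext g (Poly_Mapping.single s c) = Poly_Mapping.single (g s) c"
  by (subst lin_ext_superset[of "{s}"]) auto

lemma lin_ext_zero [simp]: "lin_ext g 0 = 0"
  by (simp add: lin_ext_def)

lemma lin_ext_add: "lin_ext g (p + q) = lin_ext g p + lin_ext g q"
proof -
  let ?A = "Poly_Mapping.keys p \<union> Poly_Mapping.keys q"
  show ?thesis
    using keys_add[of p q]
    by (simp add: lin_ext_superset[of ?A] lookup_add single_add sum.distrib)
qed

lemma map_smult_sum: "Poly_Mapping.map ((*) (c::'k::field)) (sum f A) = (\<Sum>x\<in>A. Poly_Mapping.map ((*) c) (f x))"
  by (rule poly_mapping_eqI) (simp add: lookup_sum sum_distrib_left)

lemma lin_ext_smult: "lin_ext g (Poly_Mapping.map ((*) c) p) = Poly_Mapping.map ((*) c) (lin_ext g p)"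
  using keys_smult[of c p] by (simp add: lin_ext_superset[of "Poly_Mapping.keys p"] map_smult_sum)

lemma keys_sum_subset: "(\<And>x. x \<in> A \<Longrightarrow> Poly_Mapping.keys (f x) \<subseteq> S) \<Longrightarrow> Poly_Mapping.keys (sum f A) \<subseteq> S"
proof (induction A rule: infinite_finite_induct)
  case (insert x A)
  then show ?case using keys_add[of "f x" "sum f A"] by fastforce
qed auto

lemma lin_ext_linear:
  assumes "\<And>s. s \<in> S \<Longrightarrow> g s \<in> T"
  shows "linear_between (free_module S) (free_module T) (lin_ext g)"
proof (rule linear_betweenI)
  fix p assume "p \<in> carrier (free_module S)"
  then show "lin_ext g p \<in> carrier (free_module T)"
    using assms unfolding lin_ext_def by (auto intro!: keys_sum_subset split: if_splits)
qed (simp_all add: lin_ext_add lin_ext_smult)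

text \<open>With one variable frozen the double sum is a linear combination of values of
  \<open>lin_ext\<close>, so linearity in the other variable is inherited from
  \<open>lin_ext\<close>. The next lemma does the same for the other side.\<close>

lemma bilin_ext_right: "bilin_ext g p q = (\<Sum>s\<in>Poly_Mapping.keys p. Poly_Mapping.map ((*) (Poly_Mapping.lookup p s)) (lin_ext (g s) q))"
  by (simp add: bilin_ext_def lin_ext_def map_smult_sum)

lemma bilin_ext_left: "bilin_ext g p q = (\<Sum>t\<in>Poly_Mapping.keys q. Poly_Mapping.map ((*) (Poly_Mapping.lookup q t)) (lin_ext (\<lambda>s. g s t) p))"
  unfolding bilin_ext_def lin_ext_def map_smult_sum
  by (subst sum.swap) (simp add: mult.commute)

lemma map_smult_add: "Poly_Mapping.map ((*) (c::'k::field)) (p + q) = Poly_Mapping.map ((*) c) p + Poly_Mapping.map ((*) c) q"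
  by (rule poly_mapping_eqI) (simp add: lookup_add algebra_simps)

lemma map_smult_smult: "Poly_Mapping.map ((*) (c::'k::field)) (Poly_Mapping.map ((*) d) p) = Poly_Mapping.map ((*) d) (Poly_Mapping.map ((*) c) p)"
  by (rule poly_mapping_eqI) (simp add: algebra_simps)

lemma bilin_ext_add_right: "bilin_ext g p (q + q') = bilin_ext g p q + bilin_ext g p q'"
  by (simp add: bilin_ext_right lin_ext_add map_smult_add sum.distrib)

lemma bilin_ext_add_left: "bilin_ext g (p + p') q = bilin_ext g p q + bilin_ext g p' q"
  by (simp add: bilin_ext_left lin_ext_add map_smult_add sum.distrib)

lemma bilin_ext_smult_right: "bilin_ext g p (Poly_Mapping.map ((*) c) q) = Poly_Mapping.map ((*) c) (bilin_ext g p q)"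
  unfolding bilin_ext_right lin_ext_smult map_smult_sum
  by (rule sum.cong[OF refl], rule map_smult_smult)

lemma bilin_ext_smult_left: "bilin_ext g (Poly_Mapping.map ((*) c) p) q = Poly_Mapping.map ((*) c) (bilin_ext g p q)"
  unfolding bilin_ext_left lin_ext_smult map_smult_sum
  by (rule sum.cong[OF refl], rule map_smult_smult)

lemma bilin_ext_single [simp]:
  "bilin_ext g (Poly_Mapping.single s c) (Poly_Mapping.single t d) = Poly_Mapping.single (g s t) (c * d)"
  by (cases "c = 0"; cases "d = 0") (simp_all add: bilin_ext_def)

lemma bilin_ext_keys:
  assumes "Poly_Mapping.keys p \<subseteq> S" "Poly_Mapping.keys q \<subseteq> T" "\<And>s t. s \<in> S \<Longrightarrow> t \<in> T \<Longrightarrow> g s t \<in> U"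
  shows "Poly_Mapping.keys (bilin_ext g p q) \<subseteq> U"
  unfolding bilin_ext_def by (intro keys_sum_subset) (use assms in auto)

section \<open>Linear operads, ideals and quotients\<close>

text \<open>These are the closure and linearity properties by which kernels of morphisms are ideals
  and the operations of a quotient are well defined. It is a condition on each structure map
  separately, not on the identities between them.\<close>

definition lin_operad :: "('k::field, 'x) operad \<Rightarrow> bool"
  where "lin_operad P \<longleftrightarrow>
    (\<forall>n. module KK (comps P n)) \<and> ident P \<in> carrier (comps P 1) \<and>
    (\<forall>n\<ge>1. \<forall>\<sigma>. \<sigma> permutes {1..n} \<longrightarrow> linear_between (comps P n) (comps P n) (\<lambda>x. pact P n x \<sigma>)) \<and>
    (\<forall>n\<ge>1. \<forall>m\<ge>1. \<forall>i\<in>{1..n}.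
      (\<forall>x\<in>carrier (comps P n). linear_between (comps P m) (comps P (n + m - 1)) (pcomp P n m i x)) \<and>
      (\<forall>y\<in>carrier (comps P m). linear_between (comps P n) (comps P (n + m - 1)) (\<lambda>x. pcomp P n m i x y)))"

lemma lin_operadD:
  assumes "lin_operad P"
  shows lin_operad_module: "module KK (comps P n)"
    and lin_operad_ident: "ident P \<in> carrier (comps P 1)"
    and lin_operad_pact: "n \<ge> 1 \<Longrightarrow> \<sigma> permutes {1..n} \<Longrightarrow> linear_between (comps P n) (comps P n) (\<lambda>x. pact P n x \<sigma>)"
    and lin_operad_pcomp_right: "n \<ge> 1 \<Longrightarrow> m \<ge> 1 \<Longrightarrow> i \<in> {1..n} \<Longrightarrow> x \<in> carrier (comps P n) \<Longrightarrow>
      linear_between (comps P m) (comps P (n + m - 1)) (pcomp P n m i x)"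
    and lin_operad_pcomp_left: "n \<ge> 1 \<Longrightarrow> m \<ge> 1 \<Longrightarrow> i \<in> {1..n} \<Longrightarrow> y \<in> carrier (comps P m) \<Longrightarrow>
      linear_between (comps P n) (comps P (n + m - 1)) (\<lambda>x. pcomp P n m i x y)"
  using assms by (auto simp: lin_operad_def)

lemma lin_operad_pcomp_closed:
  assumes "lin_operad P" "n \<ge> 1" "m \<ge> 1" "i \<in> {1..n}" "x \<in> carrier (comps P n)" "y \<in> carrier (comps P m)"
  shows "pcomp P n m i x y \<in> carrier (comps P (n + m - 1))"
  using linear_betweenD(1)[OF lin_operad_pcomp_right[OF assms(1-5)]] assms(6) .

lemma lin_operad_pact_closed:
  assumes "lin_operad P" "n \<ge> 1" "\<sigma> permutes {1..n}" "x \<in> carrier (comps P n)"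
  shows "pact P n x \<sigma> \<in> carrier (comps P n)"
  using linear_betweenD(1)[OF lin_operad_pact[OF assms(1-3)]] assms(4) .

lemma operad_homD:
  assumes "operad_hom P Q \<phi>"
  shows operad_hom_linear: "n \<ge> 1 \<Longrightarrow> linear_between (comps P n) (comps Q n) (\<phi> n)"
    and operad_hom_pact: "n \<ge> 1 \<Longrightarrow> x \<in> carrier (comps P n) \<Longrightarrow> \<sigma> permutes {1..n} \<Longrightarrow>
      \<phi> n (pact P n x \<sigma>) = pact Q n (\<phi> n x) \<sigma>"
    and operad_hom_ident: "\<phi> 1 (ident P) = ident Q"
    and operad_hom_pcomp: "n \<ge> 1 \<Longrightarrow> m \<ge> 1 \<Longrightarrow> i \<in> {1..n} \<Longrightarrow> x \<in> carrier (comps P n) \<Longrightarrow> y \<in> carrier (comps P m) \<Longrightarrow>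
      \<phi> (n + m - 1) (pcomp P n m i x y) = pcomp Q n m i (\<phi> n x) (\<phi> m y)"
  using assms unfolding operad_hom_def by blast+

lemma operad_hom_closed: "operad_hom P Q \<phi> \<Longrightarrow> n \<ge> 1 \<Longrightarrow> x \<in> carrier (comps P n) \<Longrightarrow> \<phi> n x \<in> carrier (comps Q n)"
  by (rule linear_betweenD(1)[OF operad_hom_linear])

lemma operad_hom_comp:
  assumes f: "operad_hom P Q \<phi>" and g: "operad_hom Q R \<psi>"
  shows "operad_hom P R (\<lambda>n x. \<psi> n (\<phi> n x))"
  unfolding operad_hom_def
proof (intro conjI allI impI ballI)
  show "linear_between (comps P n) (comps R n) (\<lambda>x. \<psi> n (\<phi> n x))" if "n \<ge> 1" for n
    by (rule linear_between_comp[OF operad_hom_linear[OF f that] operad_hom_linear[OF g that]])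
qed (simp_all add: operad_homD[OF f] operad_homD[OF g] operad_hom_closed[OF f] del: One_nat_def)

text \<open>A morphism is unconstrained in arity 0, whereas an ideal has to be a submodule in every
  arity. The guard \<open>n \<ge> 1\<close> makes the kernel the whole component in arity 0.\<close>

lemma operad_ideal_ker:
  assumes P: "lin_operad P" and Q: "lin_operad Q" and \<phi>: "operad_hom P Q \<phi>"
  shows "operad_ideal P (\<lambda>n. {x \<in> carrier (comps P n). n \<ge> 1 \<longrightarrow> \<phi> n x = \<zero>\<^bsub>comps Q n\<^esub>})" (is "operad_ideal P ?I")
  unfolding operad_ideal_def
proof (intro conjI allI impI ballI)
  fix n
  show "submodule (?I n) KK (comps P n)"
  proof (cases "n \<ge> 1")
    case True
    then have "?I n = {x \<in> carrier (comps P n). \<phi> n x \<in> {\<zero>\<^bsub>comps Q n\<^esub>}}" by auto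
    with submodule_vimage[OF lin_operad_module[OF P] lin_operad_module[OF Q] operad_hom_linear[OF \<phi> True]
      submodule_zero[OF lin_operad_module[OF Q]]]
    show ?thesis by (metis (no_types, lifting))
  next
    case False
    then have "?I n = carrier (comps P n)" by auto
    then show ?thesis using module.carrier_is_submodule[OF lin_operad_module[OF P]] by simp
  qed
next
  fix n x \<sigma> assume *: "(n::nat) \<ge> 1" "x \<in> ?I n" "\<sigma> permutes {1..n}"
  then have "\<phi> n (pact P n x \<sigma>) = pact Q n \<zero>\<^bsub>comps Q n\<^esub> \<sigma>"
    using operad_hom_pact[OF \<phi>] by auto
  also have "\<dots> = \<zero>\<^bsub>comps Q n\<^esub>"
    by (rule linear_between_zero[OF lin_operad_module[OF Q] lin_operad_module[OF Q] lin_operad_pact[OF Q *(1,3)]])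
  finally show "pact P n x \<sigma> \<in> ?I n" using * lin_operad_pact_closed[OF P] by auto
next
  fix n m i x y
  assume *: "(n::nat) \<ge> 1" "(m::nat) \<ge> 1" "i \<in> {1..n}" "x \<in> carrier (comps P n)" "y \<in> carrier (comps P m)"
    and or: "x \<in> ?I n \<or> y \<in> ?I m"
  note Qc = operad_hom_closed[OF \<phi> *(1,4)] operad_hom_closed[OF \<phi> *(2,5)]
  have "\<phi> (n + m - 1) (pcomp P n m i x y) = pcomp Q n m i (\<phi> n x) (\<phi> m y)"
    using operad_hom_pcomp[OF \<phi> *] .
  also have "\<dots> = \<zero>\<^bsub>comps Q (n + m - 1)\<^esub>"
    using or
  proof
    assume "x \<in> ?I n"
    then have "\<phi> n x = \<zero>\<^bsub>comps Q n\<^esub>" using * by auto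
    then show ?thesis
      using linear_between_zero[OF lin_operad_module[OF Q] lin_operad_module[OF Q] lin_operad_pcomp_left[OF Q *(1-3) Qc(2)]]
      by simp
  next
    assume "y \<in> ?I m"
    then have "\<phi> m y = \<zero>\<^bsub>comps Q m\<^esub>" using * by auto
    then show ?thesis
      using linear_between_zero[OF lin_operad_module[OF Q] lin_operad_module[OF Q] lin_operad_pcomp_right[OF Q *(1-3) Qc(1)]]
      by simp
  qed
  finally show "pcomp P n m i x y \<in> ?I (n + m - 1)" using lin_operad_pcomp_closed[OF P *] by auto
qed

lemma operad_ideal_carrier:
  assumes P: "lin_operad P"
  shows "operad_ideal P (\<lambda>n. carrier (comps P n))"
  unfolding operad_ideal_def
  using module.carrier_is_submodule[OF lin_operad_module[OF P]] lin_operad_pact_closed[OF P] lin_operad_pcomp_closed[OF P]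
  by blast

lemma operad_ideal_generated:
  assumes P: "lin_operad P" and S: "S \<subseteq> carrier (comps P k)"
  shows "operad_ideal P (ideal_generated P k S)"
proof -
  let ?A = "{I. operad_ideal P I \<and> S \<subseteq> I k}"
  have eq: "ideal_generated P k S n = (\<Inter>I\<in>?A. I n)" for n
    unfolding ideal_generated_def by auto
  \<comment> \<open>The family of ideals must be nonempty for its intersection to lie in the
    carriers; the ideal of all elements belongs to it because \<open>S\<close> consists of elements
    of arity \<open>k\<close>.\<close>
  have ne: "(\<lambda>n. carrier (comps P n)) \<in> ?A" using operad_ideal_carrier[OF P] S by simp
  show ?thesis
    unfolding operad_ideal_def
  proof (intro conjI allI impI ballI)
    fix n
    interpret kmodule "comps P n" using lin_operad_module[OF P] by (simp add: kmodule_def)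
    show "submodule (ideal_generated P k S n) KK (comps P n)"
      unfolding eq by (rule submodule_Inter) (use ne in \<open>auto simp: operad_ideal_def\<close>)
  next
    fix n x \<sigma> assume "(n::nat) \<ge> 1" "x \<in> ideal_generated P k S n" "\<sigma> permutes {1..n}"
    then show "pact P n x \<sigma> \<in> ideal_generated P k S n" by (auto simp: eq operad_ideal_def)
  next
    fix n m i x y
    assume *: "(n::nat) \<ge> 1" "(m::nat) \<ge> 1" "i \<in> {1..n}" "x \<in> carrier (comps P n)" "y \<in> carrier (comps P m)"
      and or: "x \<in> ideal_generated P k S n \<or> y \<in> ideal_generated P k S m"
    show "pcomp P n m i x y \<in> ideal_generated P k S (n + m - 1)"
      unfolding eq
    proof (rule INT_I)
      fix I assume I: "I \<in> ?A"
      then have "x \<in> I n \<or> y \<in> I m" using or by (auto simp: eq)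
      with I * show "pcomp P n m i x y \<in> I (n + m - 1)" unfolding operad_ideal_def by blast
    qed
  qed
qed

lemma ideal_generated_superset: "S \<subseteq> ideal_generated P k S k"
  unfolding ideal_generated_def by auto

lemma ideal_generated_minimal: "operad_ideal P I \<Longrightarrow> S \<subseteq> I k \<Longrightarrow> ideal_generated P k S n \<subseteq> I n"
  unfolding ideal_generated_def by auto

section \<open>Quotients of operads by ideals\<close>

locale operad_quotient =
  fixes P :: "('k::field, 'x) operad" and I :: "nat \<Rightarrow> 'x set"
  assumes P: "lin_operad P" and I: "operad_ideal P I"
begin

lemma kq: "kquot (comps P n) (I n)"
  using lin_operad_module[OF P] I by (simp add: kquot_def kmodule_def kquot_axioms_def operad_ideal_def)

abbreviation cls :: "nat \<Rightarrow> 'x \<Rightarrow> 'x set"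
  where "cls n x \<equiv> I n +>\<^bsub>comps P n\<^esub> x"

lemma comps_quot: "comps (quot_operad P I) n = quot_module (comps P n) (I n)"
  by (simp add: quot_operad_def)

lemma carrier_quot: "carrier (comps (quot_operad P I) n) = cls n ` carrier (comps P n)"
  by (simp add: comps_quot kquot.quot_carrier[OF kq])

lemma pact_quot:
  assumes "n \<ge> 1" "\<sigma> permutes {1..n}" "x \<in> carrier (comps P n)"
  shows "pact (quot_operad P I) n (cls n x) \<sigma> = cls n (pact P n x \<sigma>)"
proof -
  note L = lin_operad_pact[OF P assms(1,2)]
  have "(\<Union>y\<in>cls n x. cls n (pact P n y \<sigma>)) = cls n (pact P n x \<sigma>)"
  proof (rule kquot.UN_coset[OF kq assms(3)])
    fix y assume y: "y \<in> carrier (comps P n)" "y \<ominus>\<^bsub>comps P n\<^esub> x \<in> I n"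
    then have "pact P n (y \<ominus>\<^bsub>comps P n\<^esub> x) \<sigma> \<in> I n"
      using I assms unfolding operad_ideal_def by blast
    then have "pact P n y \<sigma> \<ominus>\<^bsub>comps P n\<^esub> pact P n x \<sigma> \<in> I n"
      using linear_between_minus[OF lin_operad_module[OF P] lin_operad_module[OF P] L y(1) assms(3)] by simp
    then show "cls n (pact P n y \<sigma>) = cls n (pact P n x \<sigma>)"
      using kquot.coset_eq[OF kq] linear_betweenD(1)[OF L] y assms by simp
  qed
  then show ?thesis by (simp add: quot_operad_def)
qed

lemma pcomp_quot:
  assumes *: "n \<ge> 1" "m \<ge> 1" "i \<in> {1..n}" and x: "x \<in> carrier (comps P n)" and y: "y \<in> carrier (comps P m)"
  shows "pcomp (quot_operad P I) n m i (cls n x) (cls m y) = cls (n + m - 1) (pcomp P n m i x y)"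
proof -
  let ?N = "n + m - 1"
  \<comment> \<open>The double union collapses one variable at a time: first the second argument,
    for each fixed first one, then the first. Each collapse uses that the ideal absorbs compositions
    on that side.\<close>
  have inner: "(\<Union>b\<in>cls m y. cls ?N (pcomp P n m i a b)) = cls ?N (pcomp P n m i a y)"
    if a: "a \<in> carrier (comps P n)" for a
  proof (rule kquot.UN_coset[OF kq y])
    fix b assume b: "b \<in> carrier (comps P m)" "b \<ominus>\<^bsub>comps P m\<^esub> y \<in> I m"
    note L = lin_operad_pcomp_right[OF P * a]
    have "b \<ominus>\<^bsub>comps P m\<^esub> y \<in> carrier (comps P m)"
      using b(2) kquot.N_facts(1)[OF kq] by blast
    then have "pcomp P n m i a (b \<ominus>\<^bsub>comps P m\<^esub> y) \<in> I ?N"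
      using I * a b(2) unfolding operad_ideal_def by blast
    then have "pcomp P n m i a b \<ominus>\<^bsub>comps P ?N\<^esub> pcomp P n m i a y \<in> I ?N"
      using linear_between_minus[OF lin_operad_module[OF P] lin_operad_module[OF P] L b(1) y] by simp
    then show "cls ?N (pcomp P n m i a b) = cls ?N (pcomp P n m i a y)"
      using kquot.coset_eq[OF kq] linear_betweenD(1)[OF L] b y by simp
  qed
  have "(\<Union>a\<in>cls n x. cls ?N (pcomp P n m i a y)) = cls ?N (pcomp P n m i x y)"
  proof (rule kquot.UN_coset[OF kq x])
    fix a assume a: "a \<in> carrier (comps P n)" "a \<ominus>\<^bsub>comps P n\<^esub> x \<in> I n"
    note L = lin_operad_pcomp_left[OF P * y]
    have "a \<ominus>\<^bsub>comps P n\<^esub> x \<in> carrier (comps P n)"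
      using a(2) kquot.N_facts(1)[OF kq] by blast
    then have "pcomp P n m i (a \<ominus>\<^bsub>comps P n\<^esub> x) y \<in> I ?N"
      using I * y a(2) unfolding operad_ideal_def by blast
    then have "pcomp P n m i a y \<ominus>\<^bsub>comps P ?N\<^esub> pcomp P n m i x y \<in> I ?N"
      using linear_between_minus[OF lin_operad_module[OF P] lin_operad_module[OF P] L a(1) x] by simp
    then show "cls ?N (pcomp P n m i a y) = cls ?N (pcomp P n m i x y)"
      using kquot.coset_eq[OF kq] linear_betweenD(1)[OF L] a x by simp
  qed
  moreover have "(\<Union>a\<in>cls n x. \<Union>b\<in>cls m y. cls ?N (pcomp P n m i a b)) = (\<Union>a\<in>cls n x. cls ?N (pcomp P n m i a y))"
    using inner kquot.coset_mem[OF kq x] by auto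
  ultimately show ?thesis by (simp add: quot_operad_def)
qed

lemma proj_hom: "operad_hom P (quot_operad P I) cls"
  unfolding operad_hom_def
proof (intro conjI allI impI ballI)
  show "cls 1 (ident P) = ident (quot_operad P I)" by (simp add: quot_operad_def)
qed (simp_all only: comps_quot kquot.proj_linear[OF kq] pact_quot pcomp_quot)

lemma lin_quot: "lin_operad (quot_operad P I)"
  unfolding lin_operad_def
proof (intro conjI allI impI ballI)
  show "module KK (comps (quot_operad P I) n)" for n
    by (simp add: comps_quot kquot.quot_module[OF kq])
  show "ident (quot_operad P I) \<in> carrier (comps (quot_operad P I) 1)"
    using operad_hom_ident[OF proj_hom] operad_hom_closed[OF proj_hom _ lin_operad_ident[OF P]] by simp
next
  fix n \<sigma> assume *: "(n::nat) \<ge> 1" "\<sigma> permutes {1..n}"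
  note L = linear_betweenD[OF lin_operad_pact[OF P *]]
  show "linear_between (comps (quot_operad P I) n) (comps (quot_operad P I) n) (\<lambda>x. pact (quot_operad P I) n x \<sigma>)"
    by (rule linear_betweenI)
      (auto simp: comps_quot kquot.quot_carrier[OF kq] kquot.quot_add[OF kq] kquot.quot_smult[OF kq] pact_quot[OF *] L
         module.smult_closed[OF lin_operad_module[OF P]]
         abelian_monoid.a_closed[OF abelian_group.axioms(1)[OF module.axioms(2)[OF lin_operad_module[OF P]]]])
next
  fix n m i A assume *: "(n::nat) \<ge> 1" "(m::nat) \<ge> 1" "i \<in> {1..n}"
    and "A \<in> carrier (comps (quot_operad P I) n)"
  then obtain x where x: "x \<in> carrier (comps P n)" "A = cls n x" by (auto simp: carrier_quot)
  note L = linear_betweenD[OF lin_operad_pcomp_right[OF P * x(1)]]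
  show "linear_between (comps (quot_operad P I) m) (comps (quot_operad P I) (n + m - 1)) (pcomp (quot_operad P I) n m i A)"
    unfolding x(2)
    by (rule linear_betweenI)
      (auto simp: comps_quot kquot.quot_carrier[OF kq] kquot.quot_add[OF kq] kquot.quot_smult[OF kq] pcomp_quot[OF * x(1)] L
         module.smult_closed[OF lin_operad_module[OF P]]
         abelian_monoid.a_closed[OF abelian_group.axioms(1)[OF module.axioms(2)[OF lin_operad_module[OF P]]]]
       simp del: One_nat_def)
next
  fix n m i B assume *: "(n::nat) \<ge> 1" "(m::nat) \<ge> 1" "i \<in> {1..n}"
    and "B \<in> carrier (comps (quot_operad P I) m)"
  then obtain y where y: "y \<in> carrier (comps P m)" "B = cls m y" by (auto simp: carrier_quot)
  note L = linear_betweenD[OF lin_operad_pcomp_left[OF P * y(1)]]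
  show "linear_between (comps (quot_operad P I) n) (comps (quot_operad P I) (n + m - 1)) (\<lambda>x. pcomp (quot_operad P I) n m i x B)"
    unfolding y(2)
    by (rule linear_betweenI)
      (auto simp: comps_quot kquot.quot_carrier[OF kq] kquot.quot_add[OF kq] kquot.quot_smult[OF kq] pcomp_quot[OF * _ y(1)] L
         module.smult_closed[OF lin_operad_module[OF P]]
         abelian_monoid.a_closed[OF abelian_group.axioms(1)[OF module.axioms(2)[OF lin_operad_module[OF P]]]]
       simp del: One_nat_def)
qed

lemma hom_induced:
  assumes Q: "lin_operad Q" and \<phi>: "operad_hom P Q \<phi>"
    and ker: "\<And>n x. n \<ge> 1 \<Longrightarrow> x \<in> I n \<Longrightarrow> \<phi> n x = \<zero>\<^bsub>comps Q n\<^esub>"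
  obtains \<psi> where "operad_hom (quot_operad P I) Q \<psi>"
    and "\<And>n x. n \<ge> 1 \<Longrightarrow> x \<in> carrier (comps P n) \<Longrightarrow> \<psi> n (cls n x) = \<phi> n x"
proof -
  have "\<forall>n\<in>{1..}. \<exists>k. linear_between (quot_module (comps P n) (I n)) (comps Q n) k \<and>
    (\<forall>x\<in>carrier (comps P n). k (cls n x) = \<phi> n x)"
  proof
    fix n :: nat assume "n \<in> {1..}"
    then have n: "n \<ge> 1" by simp
    obtain k where "linear_between (quot_module (comps P n) (I n)) (comps Q n) k"
      "\<And>x. x \<in> carrier (comps P n) \<Longrightarrow> k (cls n x) = \<phi> n x"
      using kquot.quot_linear_induced[OF kq lin_operad_module[OF Q] operad_hom_linear[OF \<phi> n] ker[OF n]] by blast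
    then show "\<exists>k. linear_between (quot_module (comps P n) (I n)) (comps Q n) k \<and>
      (\<forall>x\<in>carrier (comps P n). k (cls n x) = \<phi> n x)" by blast
  qed
  from bchoice[OF this] obtain \<psi> where lin: "\<And>n. n \<ge> 1 \<Longrightarrow> linear_between (quot_module (comps P n) (I n)) (comps Q n) (\<psi> n)"
    and \<psi>: "\<And>n x. n \<ge> 1 \<Longrightarrow> x \<in> carrier (comps P n) \<Longrightarrow> \<psi> n (cls n x) = \<phi> n x"
    by auto
  have "operad_hom (quot_operad P I) Q \<psi>"
    unfolding operad_hom_def
  proof (intro conjI allI impI ballI)
    show "linear_between (comps (quot_operad P I) n) (comps Q n) (\<psi> n)" if "n \<ge> 1" for n
      using lin[OF that] by (simp add: comps_quot)
    show "\<psi> 1 (ident (quot_operad P I)) = ident Q"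
      using \<psi>[OF _ lin_operad_ident[OF P]] operad_hom_ident[OF \<phi>] operad_hom_ident[OF proj_hom] by simp
  next
    fix n A \<sigma> assume *: "(n::nat) \<ge> 1" "A \<in> carrier (comps (quot_operad P I) n)" "\<sigma> permutes {1..n}"
    then obtain x where x: "x \<in> carrier (comps P n)" "A = cls n x" by (auto simp: carrier_quot)
    show "\<psi> n (pact (quot_operad P I) n A \<sigma>) = pact Q n (\<psi> n A) \<sigma>"
      using * x by (simp add: pact_quot \<psi> lin_operad_pact_closed[OF P] operad_hom_pact[OF \<phi>])
  next
    fix n m i A B
    assume *: "(n::nat) \<ge> 1" "(m::nat) \<ge> 1" "i \<in> {1..n}" "A \<in> carrier (comps (quot_operad P I) n)"
      "B \<in> carrier (comps (quot_operad P I) m)"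
    then obtain x y where xy: "x \<in> carrier (comps P n)" "A = cls n x" "y \<in> carrier (comps P m)" "B = cls m y"
      by (auto simp: carrier_quot)
    have "n + m - 1 \<ge> 1" using * by auto
    then show "\<psi> (n + m - 1) (pcomp (quot_operad P I) n m i A B) = pcomp Q n m i (\<psi> n A) (\<psi> m B)"
      unfolding xy pcomp_quot[OF *(1-3) xy(1,3)]
      using \<psi> * xy operad_hom_pcomp[OF \<phi> *(1-3) xy(1,3)] lin_operad_pcomp_closed[OF P *(1-3) xy(1,3)] by simp
  qed
  then show ?thesis using \<psi> that by blast
qed

end

text \<open>The kernel of \<open>\<phi>\<close> is itself an ideal and contains \<open>S\<close>,
  hence it contains the ideal generated by \<open>S\<close>; so only the generators, in a single
  arity, have to be tested.\<close>

lemma hom_quot_generated: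
  assumes P: "lin_operad P" and S: "S \<subseteq> carrier (comps P k)" and Q: "lin_operad Q" and \<phi>: "operad_hom P Q \<phi>"
    and ker: "\<And>x. x \<in> S \<Longrightarrow> \<phi> k x = \<zero>\<^bsub>comps Q k\<^esub>"
  defines "I \<equiv> ideal_generated P k S"
  obtains \<psi> where "operad_hom (quot_operad P I) Q \<psi>"
    and "\<And>n x. n \<ge> 1 \<Longrightarrow> x \<in> carrier (comps P n) \<Longrightarrow> \<psi> n (I n +>\<^bsub>comps P n\<^esub> x) = \<phi> n x"
proof -
  interpret operad_quotient P I
    using P operad_ideal_generated[OF P S] by unfold_locales (simp_all add: I_def)
  have "I n \<subseteq> {x \<in> carrier (comps P n). n \<ge> 1 \<longrightarrow> \<phi> n x = \<zero>\<^bsub>comps Q n\<^esub>}" for n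
    unfolding I_def by (rule ideal_generated_minimal[OF operad_ideal_ker[OF P Q \<phi>]]) (use S ker in auto)
  then show ?thesis
    using hom_induced[OF Q \<phi>] that by blast
qed

section \<open>Linearizations of operads in sets\<close>

definition set_operad_closed :: "'s set_operad \<Rightarrow> bool"
  where "set_operad_closed S \<longleftrightarrow> sident S \<in> elems S 1 \<and>
    (\<forall>n\<ge>1. \<forall>\<sigma>. \<sigma> permutes {1..n} \<longrightarrow> (\<forall>s\<in>elems S n. sact S n s \<sigma> \<in> elems S n)) \<and>
    (\<forall>n\<ge>1. \<forall>m\<ge>1. \<forall>i\<in>{1..n}. \<forall>s\<in>elems S n. \<forall>t\<in>elems S m. scomp S n m i s t \<in> elems S (n + m - 1))"

lemma linearize_simps [simp]:
  "comps (linearize S) n = free_module (elems S n)"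
  "pact (linearize S) n p \<sigma> = lin_ext (\<lambda>s. sact S n s \<sigma>) p"
  "ident (linearize S) = Poly_Mapping.single (sident S) 1"
  "pcomp (linearize S) n m i p q = bilin_ext (scomp S n m i) p q"
  by (simp_all add: linearize_def)

lemma lin_operad_linearize:
  assumes "set_operad_closed S"
  shows "lin_operad (linearize S :: ('k::field, _) operad)"
  unfolding lin_operad_def
proof (intro conjI allI impI ballI)
  show "module KK (comps (linearize S :: ('k::field, _) operad) n)" for n by (simp add: free_module_module)
  show "ident (linearize S :: ('k::field, _) operad) \<in> carrier (comps (linearize S) 1)"
    using assms by (simp add: set_operad_closed_def)
next
  fix n \<sigma> assume "(n::nat) \<ge> 1" "\<sigma> permutes {1..n}"
  then show "linear_between (comps (linearize S :: ('k::field, _) operad) n) (comps (linearize S) n) (\<lambda>x. pact (linearize S) n x \<sigma>)"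
    using assms by (simp add: set_operad_closed_def lin_ext_linear del: One_nat_def)
next
  fix n m i and x :: "'a \<Rightarrow>\<^sub>0 'k" assume *: "(n::nat) \<ge> 1" "(m::nat) \<ge> 1" "i \<in> {1..n}" "x \<in> carrier (comps (linearize S) n)"
  show "linear_between (comps (linearize S) m) (comps (linearize S) (n + m - 1)) (pcomp (linearize S) n m i x)"
  proof (rule linear_betweenI)
    fix y :: "'a \<Rightarrow>\<^sub>0 'k" assume "y \<in> carrier (comps (linearize S) m)"
    with * have "Poly_Mapping.keys (bilin_ext (scomp S n m i) x y) \<subseteq> elems S (n + m - 1)"
      by (intro bilin_ext_keys[of x "elems S n" y "elems S m"]) (use assms in \<open>simp_all add: set_operad_closed_def\<close>)
    then show "pcomp (linearize S) n m i x y \<in> carrier (comps (linearize S) (n + m - 1))" by simp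
  qed (simp_all add: bilin_ext_add_right bilin_ext_smult_right)
next
  fix n m i and x :: "'a \<Rightarrow>\<^sub>0 'k" assume *: "(n::nat) \<ge> 1" "(m::nat) \<ge> 1" "i \<in> {1..n}" "x \<in> carrier (comps (linearize S) m)"
  show "linear_between (comps (linearize S) n) (comps (linearize S) (n + m - 1)) (\<lambda>y. pcomp (linearize S) n m i y x)"
  proof (rule linear_betweenI)
    fix y :: "'a \<Rightarrow>\<^sub>0 'k" assume "y \<in> carrier (comps (linearize S) n)"
    with * have "Poly_Mapping.keys (bilin_ext (scomp S n m i) y x) \<subseteq> elems S (n + m - 1)"
      by (intro bilin_ext_keys[of y "elems S n" x "elems S m"]) (use assms in \<open>simp_all add: set_operad_closed_def\<close>)
    then show "pcomp (linearize S) n m i y x \<in> carrier (comps (linearize S) (n + m - 1))" by simp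
  qed (simp_all add: bilin_ext_add_left bilin_ext_smult_left)
qed

text \<open>This is the universal property of the linearization. Both sides of every equation
  required of a morphism are linear in each argument, so they agree once they agree on basis
  elements, where the equations are the assumptions on \<open>h\<close>.\<close>

lemma hom_linearize:
  fixes Q :: "('k::field, 'x) operad" and S :: "'s set_operad"
  assumes S: "set_operad_closed S" and Q: "lin_operad Q"
    and car: "\<And>n s. n \<ge> 1 \<Longrightarrow> s \<in> elems S n \<Longrightarrow> h n s \<in> carrier (comps Q n)"
    and act: "\<And>n s \<sigma>. n \<ge> 1 \<Longrightarrow> s \<in> elems S n \<Longrightarrow> \<sigma> permutes {1..n} \<Longrightarrow> h n (sact S n s \<sigma>) = pact Q n (h n s) \<sigma>"
    and id: "h 1 (sident S) = ident Q"
    and comp: "\<And>n m i s t. n \<ge> 1 \<Longrightarrow> m \<ge> 1 \<Longrightarrow> i \<in> {1..n} \<Longrightarrow> s \<in> elems S n \<Longrightarrow> t \<in> elems S m \<Longrightarrow>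
      h (n + m - 1) (scomp S n m i s t) = pcomp Q n m i (h n s) (h m t)"
  obtains \<phi> where "operad_hom (linearize S) Q \<phi>"
    and "\<And>n s c. n \<ge> 1 \<Longrightarrow> s \<in> elems S n \<Longrightarrow> \<phi> n (Poly_Mapping.single s c) = c \<odot>\<^bsub>comps Q n\<^esub> h n s"
proof -
  let ?L = "linearize S :: ('k, _) operad"
  note LL = lin_operad_linearize[OF S, where 'k='k]
  have "\<forall>n\<in>{1..}. \<exists>L. linear_between (free_module (elems S n)) (comps Q n) L \<and>
      (\<forall>s\<in>elems S n. \<forall>c. L (Poly_Mapping.single s c) = c \<odot>\<^bsub>comps Q n\<^esub> h n s)"
  proof
    fix n :: nat assume "n \<in> {1..}"
    then have n: "n \<ge> 1" by simp
    obtain L where "linear_between (free_module (elems S n)) (comps Q n) L"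
      "\<And>s c. s \<in> elems S n \<Longrightarrow> L (Poly_Mapping.single s c) = c \<odot>\<^bsub>comps Q n\<^esub> h n s"
    proof (rule free_module_extend[where S = "elems S n" and h = "h n", OF lin_operad_module[OF Q] car[OF n]])
    qed (assumption | blast)+
    then show "\<exists>L. linear_between (free_module (elems S n)) (comps Q n) L \<and>
      (\<forall>s\<in>elems S n. \<forall>c. L (Poly_Mapping.single s c) = c \<odot>\<^bsub>comps Q n\<^esub> h n s)" by blast
  qed
  from bchoice[OF this] obtain \<phi> where lin: "\<And>n. n \<ge> 1 \<Longrightarrow> linear_between (free_module (elems S n)) (comps Q n) (\<phi> n)"
    and \<phi>: "\<And>n s c. n \<ge> 1 \<Longrightarrow> s \<in> elems S n \<Longrightarrow> \<phi> n (Poly_Mapping.single s c) = c \<odot>\<^bsub>comps Q n\<^esub> h n s"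
    by auto
  have one: "\<phi> n (Poly_Mapping.single s 1) = h n s" if "n \<ge> 1" "s \<in> elems S n" for n s
  proof -
    interpret kmodule "comps Q n" using lin_operad_module[OF Q] by (simp add: kmodule_def)
    show ?thesis using \<phi>[OF that] car[OF that] by simp
  qed
  have "operad_hom ?L Q \<phi>"
    unfolding operad_hom_def
  proof (intro conjI allI impI ballI)
    show "linear_between (comps ?L n) (comps Q n) (\<phi> n)" if "n \<ge> 1" for n
      using lin[OF that] by simp
    show "\<phi> 1 (ident ?L) = ident Q"
      using one[of 1 "sident S"] id S by (simp add: set_operad_closed_def)
  next
    fix n x \<sigma> assume *: "(n::nat) \<ge> 1" "x \<in> carrier (comps ?L n)" "\<sigma> permutes {1..n}"
    have s: "sact S n s \<sigma> \<in> elems S n" if "s \<in> elems S n" for s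
      using S * that by (auto simp: set_operad_closed_def)
    have "linear_between (free_module (elems S n)) (comps Q n) (\<lambda>x. \<phi> n (pact ?L n x \<sigma>))"
      by (rule linear_between_comp[OF _ lin[OF *(1)]]) (use lin_operad_pact[OF LL *(1,3)] in simp)
    from free_module_linear_eq[OF lin_operad_module[OF Q] this
        linear_between_comp[OF lin[OF *(1)] lin_operad_pact[OF Q *(1,3)]], of x]
    show "\<phi> n (pact ?L n x \<sigma>) = pact Q n (\<phi> n x) \<sigma>"
      using * s by (simp add: one act del: One_nat_def)
  next
    fix n m i x y
    assume *: "(n::nat) \<ge> 1" "(m::nat) \<ge> 1" "i \<in> {1..n}" and x: "x \<in> carrier (comps ?L n)" and y: "y \<in> carrier (comps ?L m)"
    have N: "n + m - 1 \<ge> 1" using * by auto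
    have st: "scomp S n m i s t \<in> elems S (n + m - 1)" if "s \<in> elems S n" "t \<in> elems S m" for s t
      using S * that by (auto simp: set_operad_closed_def)
    \<comment> \<open>The equation is extended linearly in \<open>y\<close> while the first argument
      is a basis element, and only afterwards in \<open>x\<close>.\<close>
    have singl: "\<phi> (n + m - 1) (pcomp ?L n m i (Poly_Mapping.single s 1) y) = pcomp Q n m i (h n s) (\<phi> m y)"
      if s: "s \<in> elems S n" for s
    proof -
      have "linear_between (free_module (elems S m)) (free_module (elems S (n + m - 1))) (pcomp ?L n m i (Poly_Mapping.single s 1))"
        using lin_operad_pcomp_right[OF LL *, of "Poly_Mapping.single s 1"] s by simp
      from free_module_linear_eq[OF lin_operad_module[OF Q] linear_between_comp[OF this lin[OF N]]
          linear_between_comp[OF lin[OF *(2)] lin_operad_pcomp_right[OF Q * car[OF *(1) s]]], of y]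
      show ?thesis using * s st N y by (simp add: one comp del: One_nat_def)
    qed
    show "\<phi> (n + m - 1) (pcomp ?L n m i x y) = pcomp Q n m i (\<phi> n x) (\<phi> m y)"
    proof -
      have 1: "linear_between (free_module (elems S n)) (free_module (elems S (n + m - 1))) (\<lambda>x. pcomp ?L n m i x y)"
        using lin_operad_pcomp_left[OF LL * y] by simp
      have "\<phi> m y \<in> carrier (comps Q m)" using linear_betweenD(1)[OF lin[OF *(2)]] y by simp
      from free_module_linear_eq[OF lin_operad_module[OF Q] linear_between_comp[OF 1 lin[OF N]]
          linear_between_comp[OF lin[OF *(1)] lin_operad_pcomp_left[OF Q * this]], of x]
      show ?thesis using * singl x by (simp add: one del: One_nat_def linearize_simps(4))
    qed
  qed
  then show ?thesis using \<phi> that by blast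
qed

section \<open>The operad of trees\<close>

lemma leaves_subst: "leaves (tree_subst f t) = concat (map (\<lambda>j. leaves (f j)) (leaves t))"
  by (induction t) auto

lemma leaves_subst_Leaf: "leaves (tree_subst (\<lambda>j. Leaf (g j)) t) = map g (leaves t)"
  by (induction t) auto

lemma set_btree_subst: "set_btree (tree_subst f t) = set_btree t \<union> (\<Union>j\<in>set (leaves t). set_btree (f j))"
  by (induction t) auto

lemma tree_subst_cong: "(\<And>j. j \<in> set (leaves t) \<Longrightarrow> f j = g j) \<Longrightarrow> tree_subst f t = tree_subst g t"
  by (induction t) auto

abbreviation graft :: "nat \<Rightarrow> nat \<Rightarrow> 'e btree \<Rightarrow> nat \<Rightarrow> 'e btree"
  where "graft m i s \<equiv> (\<lambda>j. if j < i then Leaf j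
      else if j = i then tree_subst (\<lambda>l. Leaf (l + (i - 1))) s
      else Leaf (j + m - 1))"

text \<open>The labels that take the place of the leaf \<open>j\<close>, \<open>L\<close> being the
  leaves of the grafted tree. Grafting concatenates these blocks; both the closure of the tree
  operad and the Koszul sign of a composition are read off from them.\<close>

abbreviation graft_block :: "nat \<Rightarrow> nat \<Rightarrow> nat list \<Rightarrow> nat \<Rightarrow> nat list"
  where "graft_block m i L \<equiv> (\<lambda>j. if j < i then [j] else if j = i then map (\<lambda>l. l + (i - 1)) L else [j + m - 1])"

lemma tree_operad_simps [simp]:
  "elems (tree_operad S) n = {t. set_btree t \<subseteq> S \<and> distinct (leaves t) \<and> set (leaves t) = {1..n}}"
  "sact (tree_operad S) n t \<sigma> = tree_subst (\<lambda>j. Leaf (inv_into UNIV \<sigma> j)) t"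
  "sident (tree_operad S) = Leaf 1"
  "scomp (tree_operad S) n m i t s = tree_subst (graft m i s) t"
  by (simp_all add: tree_operad_def)

lemma leaves_graft: "leaves (tree_subst (graft m i s) t) = concat (map (graft_block m i (leaves s)) (leaves t))"
  unfolding leaves_subst by (intro arg_cong[where f = concat] map_cong) (auto simp: leaves_subst_Leaf)

lemma set_graft_blocks:
  assumes "i \<in> {1..n}" "m \<ge> 1" "set L = {1..m}"
  shows "(\<Union>j\<in>{1..n}. set (graft_block m i L j)) = {1..n + m - 1}" (is "?A = _")
proof
  show "?A \<subseteq> {1..n + m - 1}"
  proof
    fix x assume "x \<in> ?A"
    then obtain j where j: "j \<in> {1..n}" "x \<in> set (graft_block m i L j)" by blast
    consider "j < i" | "j = i" | "j > i" by linarith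
    then show "x \<in> {1..n + m - 1}"
    proof cases
      case 2
      then obtain l where "l \<in> {1..m}" "x = l + (i - 1)" using j assms by auto
      then show ?thesis using assms(1,2) by auto
    qed (use j assms(1,2) in auto)
  qed
  show "{1..n + m - 1} \<subseteq> ?A"
  proof
    fix x assume x: "x \<in> {1..n + m - 1}"
    consider "x < i" | "i \<le> x" "x < i + m" | "i + m \<le> x" by linarith
    then show "x \<in> ?A"
    proof cases
      case 1
      with x assms show ?thesis by (intro UN_I[of x]) auto
    next
      case 2
      then have "x - (i - 1) \<in> set L" "x = (x - (i - 1)) + (i - 1)" using assms by auto
      then have "x \<in> set (graft_block m i L i)" by auto
      with assms show ?thesis by blast
    next
      case 3
      with x assms have "x - (m - 1) \<in> {1..n}" "x \<in> set (graft_block m i L (x - (m - 1)))" by auto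
      then show ?thesis by blast
    qed
  qed
qed

lemma distinct_concat_map:
  assumes "distinct K" "\<And>a. distinct (B a)" "\<And>a b. a \<noteq> b \<Longrightarrow> set (B a) \<inter> set (B b) = {}"
  shows "distinct (concat (map B K))"
  using assms(1)
proof (induction K)
  case (Cons a K)
  have "set (B a) \<inter> set (B b) = {}" if "b \<in> set K" for b
    using Cons(2) that by (intro assms(3)) auto
  then show ?case using Cons assms(2) by auto
qed simp

lemma distinct_graft_blocks:
  assumes "distinct L" "distinct K" "set L = {1..m}" "i \<ge> 1" "m \<ge> 1"
  shows "distinct (concat (map (graft_block m i L) K))"
proof (rule distinct_concat_map[OF assms(2)])
  show "distinct (graft_block m i L a)" for a
    using assms(1) by (auto simp: distinct_map inj_on_def)
  show "set (graft_block m i L a) \<inter> set (graft_block m i L b) = {}" if "a \<noteq> b" for a b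
    using that assms(3-5) by (auto split: if_splits)
qed

lemma tree_operad_closed: "set_operad_closed (tree_operad S)"
  unfolding set_operad_closed_def
proof (intro conjI allI impI ballI)
  show "sident (tree_operad S) \<in> elems (tree_operad S) 1" by simp
next
  fix n \<sigma> t assume *: "\<sigma> permutes {1..n::nat}" "t \<in> elems (tree_operad S) n"
  then have "bij (inv_into UNIV \<sigma>)" "inv_into UNIV \<sigma> ` {1..n} = {1..n}"
    using permutes_inv[OF *(1)] permutes_bij permutes_image by blast+
  then show "sact (tree_operad S) n t \<sigma> \<in> elems (tree_operad S) n"
    using * by (auto simp: leaves_subst_Leaf distinct_map bij_def inj_on_def set_btree_subst)
next
  fix n m i s t assume *: "(n::nat) \<ge> 1" "(m::nat) \<ge> 1" "i \<in> {1..n}" "t \<in> elems (tree_operad S) n" "s \<in> elems (tree_operad S) m"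
  have "set (leaves (tree_subst (graft m i s) t)) = {1..n + m - 1}"
  proof -
    have "set (concat (map B K)) = (\<Union>j\<in>set K. set (B j))" for B :: "nat \<Rightarrow> nat list" and K by simp
    moreover have "set (leaves t) = {1..n}" "set (leaves s) = {1..m}" using * by simp_all
    ultimately show ?thesis using set_graft_blocks[OF *(3,2)] by (simp only: leaves_graft)
  qed
  moreover have "distinct (leaves (tree_subst (graft m i s) t))"
    unfolding leaves_graft by (rule distinct_graft_blocks) (use * in auto)
  moreover have "set_btree (tree_subst (graft m i s) t) \<subseteq> S"
    using * by (auto simp: set_btree_subst split: if_splits)
  ultimately show "scomp (tree_operad S) n m i t s \<in> elems (tree_operad S) (n + m - 1)" by simp
qed

lemmas lin_operad_trees = lin_operad_linearize[OF tree_operad_closed]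

section \<open>Koszul signs\<close>

text \<open>A product over all pairs of entries, the earlier one first. Koszul signs are put in this
  form because concatenation, relabelling and division into blocks then act on them by plain
  algebra.\<close>

primrec pair_prod :: "('x \<Rightarrow> 'x \<Rightarrow> 'k::comm_ring_1) \<Rightarrow> 'x list \<Rightarrow> 'k" where
  "pair_prod F [] = 1"
| "pair_prod F (a # L) = (\<Prod>b\<leftarrow>L. F a b) * pair_prod F L"

lemma prod_list_mult: "(\<Prod>x\<leftarrow>L. f x * g x) = (\<Prod>x\<leftarrow>L. f x) * (\<Prod>x\<leftarrow>L. g x :: 'k::comm_ring_1)"
  by (induction L) (auto simp: algebra_simps)

lemma prod_list_one: "(\<And>x. x \<in> set L \<Longrightarrow> f x = 1) \<Longrightarrow> (\<Prod>x\<leftarrow>L. f x) = (1 :: 'k::comm_ring_1)"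
  by (induction L) auto

lemma pair_prod_append:
  "pair_prod F (L @ K) = pair_prod F L * pair_prod F K * (\<Prod>a\<leftarrow>L. \<Prod>b\<leftarrow>K. F a b)"
  by (induction L) (auto simp: algebra_simps)

lemma pair_prod_map: "pair_prod F (map g L) = pair_prod (\<lambda>a b. F (g a) (g b)) L"
  by (induction L) (auto simp: o_def)

lemma pair_prod_mult: "pair_prod (\<lambda>a b. F a b * G a b) L = pair_prod F L * pair_prod G L"
  by (induction L) (auto simp: prod_list_mult algebra_simps)

lemma pair_prod_cong:
  assumes "distinct L" "\<And>a b. a \<in> set L \<Longrightarrow> b \<in> set L \<Longrightarrow> a \<noteq> b \<Longrightarrow> F a b = G a b"
  shows "pair_prod F L = pair_prod G L"
  using assms
proof (induction L)
  case (Cons a L)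
  have "(\<Prod>b\<leftarrow>L. F a b) = (\<Prod>b\<leftarrow>L. G a b)"
    using Cons.prems by (intro arg_cong[where f = prod_list] map_cong) auto
  then show ?case using Cons by auto
qed simp

lemma pair_prod_sorted: "sorted_wrt (\<lambda>a b. F a b = 1) L \<Longrightarrow> pair_prod F L = 1"
  by (induction L) (auto intro: prod_list_one)

lemma pair_prod_remove1:
  assumes "a \<in> set L" "\<And>b. b \<in> set L \<Longrightarrow> F b a = F a b"
  shows "pair_prod F L = (\<Prod>b\<leftarrow>remove1 a L. F a b) * pair_prod F (remove1 a L)"
  using assms
proof (induction L)
  case (Cons c L)
  show ?case
  proof (cases "a = c")
    case False
    then have a: "a \<in> set L" using Cons.prems(1) by simp
    then have "(\<Prod>b\<leftarrow>L. F c b) = F c a * (\<Prod>b\<leftarrow>remove1 a L. F c b)"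
      by (induction L) (auto simp: algebra_simps)
    moreover have "F c a = F a c" using Cons.prems(2) by simp
    moreover have "pair_prod F L = (\<Prod>b\<leftarrow>remove1 a L. F a b) * pair_prod F (remove1 a L)"
      using Cons.IH[OF a] Cons.prems(2) by simp
    ultimately show ?thesis using False by (simp add: algebra_simps)
  qed simp
qed simp

lemma prod_list_mset: "mset L = mset K \<Longrightarrow> (\<Prod>b\<leftarrow>L. f b) = (\<Prod>b\<leftarrow>K. f b :: 'k::comm_ring_1)"
  by (metis mset_map prod_mset_prod_list)

text \<open>When \<open>F\<close> is symmetric on the entries, an entry can be moved to the front
  without changing the product, so the order of the list does not matter.\<close>

lemma pair_prod_mset:
  assumes "mset L = mset K" "\<And>a b. a \<in> set L \<Longrightarrow> b \<in> set L \<Longrightarrow> F a b = F b a"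
  shows "pair_prod F L = pair_prod F K"
  using assms
proof (induction L arbitrary: K)
  case (Cons a L)
  have K: "set K = set (a # L)" using Cons.prems(1) by (metis mset_eq_setD)
  have r: "mset L = mset (remove1 a K)" using Cons.prems(1) by (metis add_mset_remove_trivial mset.simps(2) mset_remove1)
  have "pair_prod F K = (\<Prod>b\<leftarrow>remove1 a K. F a b) * pair_prod F (remove1 a K)"
    by (rule pair_prod_remove1) (use K Cons.prems(2) in auto)
  also have "(\<Prod>b\<leftarrow>remove1 a K. F a b) = (\<Prod>b\<leftarrow>L. F a b)"
    by (rule prod_list_mset) (simp only: r)
  also have "pair_prod F (remove1 a K) = pair_prod F L"
    using Cons.IH[OF r] Cons.prems(2) by simp
  finally show ?case by simp
qed simp

lemma prod_list_concat_swap: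
  "(\<Prod>x\<leftarrow>xs. \<Prod>y\<leftarrow>concat (map B L). F x y) = (\<Prod>b\<leftarrow>L. \<Prod>x\<leftarrow>xs. \<Prod>y\<leftarrow>B b. F x y :: 'k::comm_ring_1)"
proof (induction L)
  case Nil
  show ?case by (simp, rule prod_list_one, simp)
qed (simp add: prod_list_mult)

text \<open>A pair of entries lies either inside one block or in two blocks at different
  positions.\<close>

lemma pair_prod_concat_map:
  "pair_prod F (concat (map B L)) = (\<Prod>a\<leftarrow>L. pair_prod F (B a)) * pair_prod (\<lambda>a b. \<Prod>x\<leftarrow>B a. \<Prod>y\<leftarrow>B b. F x y) L"
proof (induction L)
  case (Cons a L)
  show ?case
    unfolding list.map concat.simps pair_prod_append prod_list_concat_swap Cons by (simp add: ac_simps)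
qed simp

text \<open>The form with index pairs is the one that can be compared with the product in
  \<open>koszul_sign\<close>.\<close>

lemma pair_prod_index: "pair_prod F L = (\<Prod>(p, q) | p < q \<and> q < length L. F (L ! p) (L ! q))"
proof (induction L)
  case (Cons a L)
  let ?T = "{(p, q). p < q \<and> q < length (a # L)}" and ?S = "{(p, q). p < q \<and> q < length L}"
  have T: "?T = (\<lambda>q. (0, Suc q)) ` {..<length L} \<union> map_prod Suc Suc ` ?S"
  proof (rule Set.set_eqI)
    fix x :: "nat \<times> nat"
    obtain p q where "x = (p, q)" by fastforce
    then show "x \<in> ?T \<longleftrightarrow> x \<in> (\<lambda>q. (0, Suc q)) ` {..<length L} \<union> map_prod Suc Suc ` ?S"
      by (cases p; cases q) (auto simp: image_iff)
  qed
  have fin: "finite ?S" by (rule finite_subset[of _ "{..<length L} \<times> {..<length L}"]) auto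
  have "prod (\<lambda>(p, q). F ((a # L) ! p) ((a # L) ! q)) ?T =
     prod (\<lambda>(p, q). F ((a # L) ! p) ((a # L) ! q)) ((\<lambda>q. (0, Suc q)) ` {..<length L}) *
     prod (\<lambda>(p, q). F ((a # L) ! p) ((a # L) ! q)) (map_prod Suc Suc ` ?S)"
    unfolding T by (rule prod.union_disjoint) (use fin in auto)
  also have "prod (\<lambda>(p, q). F ((a # L) ! p) ((a # L) ! q)) ((\<lambda>q. (0, Suc q)) ` {..<length L}) = (\<Prod>q<length L. F a (L ! q))"
    by (subst prod.reindex) (auto simp: inj_on_def)
  also have "\<dots> = (\<Prod>b\<leftarrow>L. F a b)"
    by (induction L rule: rev_induct) (auto simp: nth_append lessThan_Suc intro!: prod.cong)
  also have "prod (\<lambda>(p, q). F ((a # L) ! p) ((a # L) ! q)) (map_prod Suc Suc ` ?S) = prod (\<lambda>(p, q). F (L ! p) (L ! q)) ?S"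
    by (subst prod.reindex) (auto simp: inj_on_def intro!: prod.cong)
  finally show ?case using Cons by simp
qed simp

text \<open>The sign of the rearrangement of \<open>x\<^sub>1, x\<^sub>2, \<dots>\<close> in the order given by a list of indices, where \<open>A\<close>
  consists of the indices of odd elements.\<close>

definition inversion_sign :: "nat set \<Rightarrow> nat \<Rightarrow> nat \<Rightarrow> 'k::field"
  where "inversion_sign A a b = (if b < a \<and> a \<in> A \<and> b \<in> A then - 1 else 1)"

abbreviation list_sign :: "nat set \<Rightarrow> nat list \<Rightarrow> 'k::field"
  where "list_sign A \<equiv> pair_prod (inversion_sign A)"

lemma list_sign_sq: "list_sign A L * list_sign A L = (1::'k::field)"
proof -
  have "list_sign A L * list_sign A L = pair_prod (\<lambda>a b. inversion_sign A a b * inversion_sign A a b :: 'k) L"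
    by (simp add: pair_prod_mult)
  also have "(\<lambda>a b. inversion_sign A a b * inversion_sign A a b :: 'k) = (\<lambda>a b. 1)"
    by (auto simp: fun_eq_iff inversion_sign_def)
  finally show ?thesis by (simp add: pair_prod_sorted)
qed

lemma list_sign_cong:
  assumes "distinct L" "A \<inter> set L = B \<inter> set L"
  shows "list_sign A L = (list_sign B L :: 'k::field)"
  by (rule pair_prod_cong[OF assms(1)]) (use assms(2) in \<open>auto simp: inversion_sign_def\<close>)

lemma list_sign_upt: "list_sign A [i..<n] = (1::'k::field)"
  by (rule pair_prod_sorted) (auto simp: sorted_wrt_iff_nth_less inversion_sign_def)

text \<open>\<open>koszul_sign\<close> multiplies over inversions only; all other pairs contribute
  1. The shift by \<open>Suc\<close> reconciles list positions, counted from 0, with arguments,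
  counted from 1.\<close>

lemma koszul_sign_eq:
  assumes "length ks = n" and \<tau>: "\<tau> permutes {1..n}"
  shows "koszul_sign n \<tau> ks = (list_sign {j \<in> {1..n}. odd (ks ! (j - 1))} (map \<tau> [1..<Suc n]) :: 'k::field)"
proof -
  let ?A = "{j \<in> {1..n}. odd (ks ! (j - 1))}"
  let ?S = "{(p, q). p < q \<and> q < n}" and ?T = "{(i, j). 1 \<le> i \<and> i < j \<and> j \<le> n}"
  have T: "?T = map_prod Suc Suc ` ?S"
  proof (rule Set.set_eqI)
    fix x :: "nat \<times> nat"
    obtain p q where "x = (p, q)" by fastforce
    then show "x \<in> ?T \<longleftrightarrow> x \<in> map_prod Suc Suc ` ?S"
      by (cases p; cases q) (auto simp: image_iff)
  qed
  have fin: "finite ?T" by (rule finite_subset[of _ "{..n} \<times> {..n}"]) auto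
  have "list_sign ?A (map \<tau> [1..<Suc n]) = (\<Prod>(p, q)\<in>?S. inversion_sign ?A (\<tau> (Suc p)) (\<tau> (Suc q)) :: 'k)"
    unfolding pair_prod_map pair_prod_index by (rule prod.cong) (auto simp del: upt_Suc)
  also have "\<dots> = (\<Prod>(i, j)\<in>?T. inversion_sign ?A (\<tau> i) (\<tau> j))"
    unfolding T by (subst prod.reindex) (auto simp: inj_on_def intro!: prod.cong)
  also have "\<dots> = (\<Prod>(i, j) | 1 \<le> i \<and> i < j \<and> j \<le> n \<and> \<tau> i > \<tau> j. inversion_sign ?A (\<tau> i) (\<tau> j))"
    by (rule prod.mono_neutral_right) (use fin in \<open>auto simp: inversion_sign_def split: if_splits\<close>)
  also have "\<dots> = koszul_sign n \<tau> ks"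
    unfolding koszul_sign_def
  proof (rule prod.cong[OF refl])
    fix x assume "x \<in> {(i, j). 1 \<le> i \<and> i < j \<and> j \<le> n \<and> \<tau> i > \<tau> j}"
    then obtain i j where x: "x = (i, j)" "1 \<le> i" "i < j" "j \<le> n" "\<tau> i > \<tau> j" by blast
    then have "\<tau> i \<in> {1..n}" "\<tau> j \<in> {1..n}"
      using permutes_in_image[OF \<tau>, of i] permutes_in_image[OF \<tau>, of j] by auto
    with x show "(case x of (i, j) \<Rightarrow> inversion_sign ?A (\<tau> i) (\<tau> j)) =
        (case x of (i, j) \<Rightarrow> if odd (ks ! (\<tau> i - 1)) \<and> odd (ks ! (\<tau> j - 1)) then - 1 else (1 :: 'k))"
      by (auto simp: inversion_sign_def)
  qed
  finally show ?thesis by simp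
qed

text \<open>If \<open>a\<close> and \<open>b\<close> are exchanged, where \<tau> sends both to odd
  indices, then the inversion sign of \<open>\<tau> a\<close>, \<open>\<tau> b\<close> and that of
  \<open>a\<close>, \<open>b\<close> change together. Their product is therefore symmetric and does
  not see the order of \<open>L\<close>, which may be replaced by the increasing list, where the
  second sign is 1. As signs have square 1, the second sign can be moved to the other side.\<close>

lemma list_sign_cocycle:
  assumes L: "distinct L" "set L = {1..n}" and \<tau>: "inj \<tau>"
  shows "list_sign A (map \<tau> L) = list_sign A (map \<tau> [1..<Suc n]) * (list_sign (\<tau> -` A) L :: 'k::field)"
proof -
  let ?F = "\<lambda>a b. inversion_sign A (\<tau> a) (\<tau> b) :: 'k" and ?G = "inversion_sign (\<tau> -` A) :: nat \<Rightarrow> nat \<Rightarrow> 'k"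
  have sym: "?F a b * ?G a b = ?F b a * ?G b a" for a b
    using injD[OF \<tau>] by (cases "a = b") (auto simp: inversion_sign_def not_less le_less)
  have m: "mset L = mset [1..<Suc n]"
    using set_eq_iff_mset_eq_distinct[OF L(1) distinct_upt[of 1 "Suc n"]] L(2)
    by (simp del: upt_Suc add: atLeastLessThanSuc_atLeastAtMost)
  have "pair_prod ?F L * pair_prod ?G L = pair_prod ?F [1..<Suc n] * pair_prod ?G [1..<Suc n]"
    unfolding pair_prod_mult[symmetric] by (rule pair_prod_mset[OF m]) (rule sym)
  also have "pair_prod ?G [1..<Suc n] = 1" by (rule list_sign_upt)
  finally have "pair_prod ?F L * (pair_prod ?G L * pair_prod ?G L) = pair_prod ?F [1..<Suc n] * pair_prod ?G L"
    by (simp only: mult.assoc[symmetric] mult_1_right)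
  then show ?thesis by (simp only: list_sign_sq mult_1_right pair_prod_map)
qed

lemma prod_list_sign:
  assumes "distinct L"
  shows "(\<Prod>x\<leftarrow>L. if P x then - 1 else 1) = (if odd (card {x \<in> set L. P x}) then - 1 else 1 :: 'k::field)"
  using assms
proof (induction L)
  case (Cons a L)
  have "{x \<in> set (a # L). P x} = (if P a then insert a {x \<in> set L. P x} else {x \<in> set L. P x})" by auto
  then show ?case using Cons by auto
qed simp

text \<open>Entries of different blocks compare as the labels of their blocks do, so an inverted
  pair of blocks contributes -1 for every pair of odd entries taken one from each. The number of
  such pairs is a product of two cardinalities: a block behaves like one element whose parity is
  that of its number of odd entries.\<close>

lemma list_sign_blocks:
  assumes "distinct L" and B: "\<And>a. a \<in> set L \<Longrightarrow> distinct (B a)"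
    and ordered: "\<And>a b x y. a \<in> set L \<Longrightarrow> b \<in> set L \<Longrightarrow> a < b \<Longrightarrow> x \<in> set (B a) \<Longrightarrow> y \<in> set (B b) \<Longrightarrow> x < y"
  shows "list_sign A (concat (map B L)) =
    (\<Prod>a\<leftarrow>L. list_sign A (B a)) * (list_sign {a. odd (card (A \<inter> set (B a)))} L :: 'k::field)"
proof -
  let ?odd = "\<lambda>a. odd (card (A \<inter> set (B a)))"
  have "(\<Prod>x\<leftarrow>B a. \<Prod>y\<leftarrow>B b. inversion_sign A x y) = (inversion_sign {a. ?odd a} a b :: 'k)"
    if ab: "a \<in> set L" "b \<in> set L" "a \<noteq> b" for a b
  proof (cases "a < b")
    case True
    then have "inversion_sign A x y = (1::'k)" if "x \<in> set (B a)" "y \<in> set (B b)" for x y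
      using ordered[OF ab(1,2) True that] by (simp add: inversion_sign_def)
    then show ?thesis using True by (simp add: prod_list_one inversion_sign_def)
  next
    case False
    then have "b < a" using ab by simp
    then have "(\<Prod>x\<leftarrow>B a. \<Prod>y\<leftarrow>B b. inversion_sign A x y :: 'k) = (\<Prod>x\<leftarrow>B a. \<Prod>y\<leftarrow>B b. if x \<in> A \<and> y \<in> A then - 1 else 1)"
      using ordered[OF ab(2,1)]
      by (intro arg_cong[where f = prod_list] map_cong refl) (auto simp: inversion_sign_def)
    also have "\<dots> = (\<Prod>x\<leftarrow>B a. if x \<in> A \<and> ?odd b then - 1 else 1)"
    proof (intro arg_cong[where f = prod_list] map_cong refl)
      fix x
      show "(\<Prod>y\<leftarrow>B b. if x \<in> A \<and> y \<in> A then - 1 else 1) = (if x \<in> A \<and> ?odd b then - 1 else (1 :: 'k))"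
        using prod_list_sign[OF B[OF ab(2)], of "\<lambda>y. y \<in> A", where 'k = 'k]
        by (cases "x \<in> A") (simp_all add: prod_list_one Collect_conj_eq Int_commute)
    qed
    also have "\<dots> = (if ?odd a \<and> ?odd b then - 1 else 1)"
      using prod_list_sign[OF B[OF ab(1)], of "\<lambda>y. y \<in> A", where 'k = 'k]
      by (cases "?odd b") (simp_all add: prod_list_one Collect_conj_eq Int_commute)
    finally show ?thesis using \<open>b < a\<close> by (simp add: inversion_sign_def)
  qed
  from pair_prod_cong[OF assms(1) this] show ?thesis
    unfolding pair_prod_concat_map by (rule arg_cong)
qed

lemma list_sign_shift: "list_sign A (map (\<lambda>l. l + (i::nat)) L) = (list_sign {l. l + i \<in> A} L :: 'k::field)"
proof -
  have "inversion_sign A (a + i) (b + i) = (inversion_sign {l. l + i \<in> A} a b :: 'k)" for a b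
    by (simp add: inversion_sign_def)
  then show ?thesis by (simp only: pair_prod_map)
qed

text \<open>In the block formula only the block of \<open>i\<close> can contain inversions of its
  own, and these are the inversions of \<open>K\<close>. The result is the sign rule for a partial
  composition.\<close>

lemma list_sign_graft:
  assumes L: "distinct L" "set L = {1..n}" and K: "distinct K" "set K = {1..m}" and i: "i \<in> {1..n}" and m: "m \<ge> 1"
  shows "list_sign A (concat (map (graft_block m i K) L)) =
    list_sign {l. l + (i - 1) \<in> A} K * (list_sign {a. odd (card (A \<inter> set (graft_block m i K a)))} L :: 'k::field)"
proof -
  let ?B = "graft_block m i K"
  have d: "distinct (?B a)" for a
    using K by (auto simp: distinct_map inj_on_def)
  have o: "x < y" if ab: "a < b" "x \<in> set (?B a)" "y \<in> set (?B b)" "a \<in> set L" "b \<in> set L" for a b x y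
  proof -
    consider "b < i" | "b = i" | "a = i" | "a < i" "b > i" | "a > i" using \<open>a < b\<close> by linarith
    then show ?thesis
    proof cases
      case 2
      then obtain l where "y = l + (i - 1)" "l \<in> set K" using ab(3) by auto
      with K(2) have "y = l + (i - 1)" "l \<ge> 1" by auto
      then show ?thesis using ab 2 i by auto
    next
      case 3
      then obtain l where "x = l + (i - 1)" "l \<in> set K" using ab(2) by auto
      with K(2) have "x = l + (i - 1)" "l \<le> m" by auto
      then show ?thesis using ab 3 i m by auto
    qed (use ab m in auto)
  qed
  have "(\<Prod>a\<leftarrow>L. list_sign A (?B a)) = (\<Prod>a\<in>set L. list_sign A (?B a) :: 'k)"
    using L(1) by (simp add: prod.distinct_set_conv_list)
  also have "\<dots> = (\<Prod>a\<in>{i}. list_sign A (?B a))"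
    by (rule prod.mono_neutral_right) (use L i in auto)
  also have "\<dots> = list_sign {l. l + (i - 1) \<in> A} K" by (simp add: list_sign_shift)
  finally have prod: "(\<Prod>a\<leftarrow>L. list_sign A (?B a)) = (list_sign {l. l + (i - 1) \<in> A} K :: 'k)" .
  have "list_sign A (concat (map ?B L)) =
    (\<Prod>a\<leftarrow>L. list_sign A (?B a)) * (list_sign {a. odd (card (A \<inter> set (?B a)))} L :: 'k)"
    by (rule list_sign_blocks[OF L(1) d]) (rule o; assumption)
  then show ?thesis unfolding prod .
qed

section \<open>Evaluation of trees\<close>

primrec tree_eval :: "('e \<Rightarrow> 'a \<Rightarrow> 'a \<Rightarrow> 'a) \<Rightarrow> 'e btree \<Rightarrow> (nat \<Rightarrow> 'a) \<Rightarrow> 'a" where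
  "tree_eval m (Leaf i) v = v i"
| "tree_eval m (Node e s t) v = m e (tree_eval m s v) (tree_eval m t v)"

lemma tree_eval_subst: "tree_eval m (tree_subst f t) v = tree_eval m t (\<lambda>j. tree_eval m (f j) v)"
  by (induction t) auto

lemma tree_eval_cong: "(\<And>i. i \<in> set (leaves t) \<Longrightarrow> v i = w i) \<Longrightarrow> tree_eval m t v = tree_eval m t w"
  by (induction t) auto

lemma tree_eval_update [simp]: "i \<notin> set (leaves t) \<Longrightarrow> tree_eval m t (v(i := a)) = tree_eval m t v"
  by (rule tree_eval_cong) auto

lemma tree_eval_add:
  fixes m :: "'e \<Rightarrow> 'a \<Rightarrow> 'a \<Rightarrow> 'a::plus"
  assumes "set_btree t \<subseteq> S" "distinct (leaves t)" "i \<in> set (leaves t)"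
    and "\<And>e a b c. e \<in> S \<Longrightarrow> m e (a + b) c = m e a c + m e b c"
    and "\<And>e a b c. e \<in> S \<Longrightarrow> m e c (a + b) = m e c a + m e c b"
  shows "tree_eval m t (v(i := a + b)) = tree_eval m t (v(i := a)) + tree_eval m t (v(i := b))"
  using assms(1-3)
proof (induction t)
  case (Node e s t)
  show ?case
  proof (cases "i \<in> set (leaves s)")
    case True
    then have "i \<notin> set (leaves t)" using Node.prems by auto
    note u = tree_eval_update[OF this]
    moreover have "tree_eval m s (v(i := a + b)) = tree_eval m s (v(i := a)) + tree_eval m s (v(i := b))"
      by (rule Node.IH(1)) (use Node.prems True in simp_all)
    moreover have "e \<in> S" using Node.prems by simp
    ultimately show ?thesis by (simp only: tree_eval.simps u assms(4))
  next
    case False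
    note u = tree_eval_update[OF this]
    moreover have "tree_eval m t (v(i := a + b)) = tree_eval m t (v(i := a)) + tree_eval m t (v(i := b))"
      by (rule Node.IH(2)) (use Node.prems False in simp_all)
    moreover have "e \<in> S" using Node.prems by simp
    ultimately show ?thesis by (simp only: tree_eval.simps u assms(5))
  qed
qed simp

text \<open>\<open>h\<close> is any map that commutes with the operations; it will be a scalar
  multiplication in a vector space, and also one on linear combinations of trees.\<close>

lemma tree_eval_scale:
  assumes "set_btree t \<subseteq> S" "distinct (leaves t)" "i \<in> set (leaves t)"
    and "\<And>e b c. e \<in> S \<Longrightarrow> m e (h b) c = h (m e b c)"
    and "\<And>e b c. e \<in> S \<Longrightarrow> m e c (h b) = h (m e c b)"
  shows "tree_eval m t (v(i := h a)) = h (tree_eval m t (v(i := a)))"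
  using assms(1-3)
proof (induction t)
  case (Node e s t)
  show ?case
  proof (cases "i \<in> set (leaves s)")
    case True
    then have "i \<notin> set (leaves t)" using Node.prems by auto
    note u = tree_eval_update[OF this]
    moreover have "tree_eval m s (v(i := h a)) = h (tree_eval m s (v(i := a)))"
      by (rule Node.IH(1)) (use Node.prems True in simp_all)
    moreover have "e \<in> S" using Node.prems by simp
    ultimately show ?thesis by (simp only: tree_eval.simps u assms(4))
  next
    case False
    note u = tree_eval_update[OF this]
    moreover have "tree_eval m t (v(i := h a)) = h (tree_eval m t (v(i := a)))"
      by (rule Node.IH(2)) (use Node.prems False in simp_all)
    moreover have "e \<in> S" using Node.prems by simp
    ultimately show ?thesis by (simp only: tree_eval.simps u assms(5))
  qed
qed simp

section \<open>Morphisms from free operads\<close>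

lemma s2_moduleD:
  assumes "s2_module E"
  shows "module KK E" "linear_between E E (swap E)" "e \<in> carrier E \<Longrightarrow> swap E (swap E e) = e"
    "e \<in> carrier E \<Longrightarrow> swap E e \<in> carrier E"
    "e \<in> carrier E \<Longrightarrow> e' \<in> carrier E \<Longrightarrow> e \<oplus>\<^bsub>E\<^esub> e' \<in> carrier E"
    "e \<in> carrier E \<Longrightarrow> c \<odot>\<^bsub>E\<^esub> e \<in> carrier E"
proof -
  show 1: "module KK E" "linear_between E E (swap E)" "e \<in> carrier E \<Longrightarrow> swap E (swap E e) = e"
    using assms by (auto simp: s2_module_def)
  show "e \<in> carrier E \<Longrightarrow> swap E e \<in> carrier E" by (rule linear_betweenD(1)[OF 1(2)])
  interpret kmodule E using 1(1) by (simp add: kmodule_def)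
  show "e \<in> carrier E \<Longrightarrow> e' \<in> carrier E \<Longrightarrow> e \<oplus>\<^bsub>E\<^esub> e' \<in> carrier E" "e \<in> carrier E \<Longrightarrow> c \<odot>\<^bsub>E\<^esub> e \<in> carrier E"
    by simp_all
qed

abbreviation cor_tree :: "'e \<Rightarrow> 'e btree"
  where "cor_tree e \<equiv> Node e (Leaf 1) (Leaf 2)"

text \<open>The generating set that occurs inside \<open>free_rels\<close>, named so that its three
  kinds of elements can be told apart in proofs.\<close>

definition free_gens :: "('k::field, 'e) s2module \<Rightarrow> ('e btree \<Rightarrow>\<^sub>0 'k) set"
  where "free_gens E =
    {Poly_Mapping.single (cor_tree (e \<oplus>\<^bsub>E\<^esub> e')) 1 - Poly_Mapping.single (cor_tree e) 1 - Poly_Mapping.single (cor_tree e') 1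
       | e e'. e \<in> carrier E \<and> e' \<in> carrier E} \<union>
    {Poly_Mapping.single (cor_tree (c \<odot>\<^bsub>E\<^esub> e)) 1 - Poly_Mapping.single (cor_tree e) c
       | c e. e \<in> carrier E} \<union>
    {Poly_Mapping.single (cor_tree (swap E e)) 1 - Poly_Mapping.single (Node e (Leaf 2) (Leaf 1)) 1
       | e. e \<in> carrier E}"

lemma free_rels_eq: "free_rels E = ideal_generated (linearize (tree_operad (carrier E))) 2 (free_gens E)"
  by (simp add: free_rels_def free_gens_def Let_def)

lemma keys_minus_subset: "Poly_Mapping.keys p \<subseteq> S \<Longrightarrow> Poly_Mapping.keys q \<subseteq> S \<Longrightarrow> Poly_Mapping.keys (p - q :: 's \<Rightarrow>\<^sub>0 'k::field) \<subseteq> S"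
  by (auto simp: in_keys_iff lookup_minus subset_iff) (metis diff_zero)

lemma cor_tree_mem: "e \<in> S \<Longrightarrow> cor_tree e \<in> elems (tree_operad S) 2" "e \<in> S \<Longrightarrow> Node e (Leaf 2) (Leaf 1) \<in> elems (tree_operad S) 2"
  by auto

lemma free_gens_closed:
  assumes "s2_module E"
  shows "free_gens E \<subseteq> carrier (comps (linearize (tree_operad (carrier E))) 2)"
proof
  fix x :: "'a btree \<Rightarrow>\<^sub>0 'b" assume x: "x \<in> free_gens E"
  have diff: "p - q \<in> carrier (comps (linearize (tree_operad (carrier E))) 2)"
    if "p \<in> carrier (comps (linearize (tree_operad (carrier E))) 2)"
      "q \<in> carrier (comps (linearize (tree_operad (carrier E))) 2)" for p q :: "'a btree \<Rightarrow>\<^sub>0 'b"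
    using that keys_minus_subset by simp
  have sing: "Poly_Mapping.single t c \<in> carrier (comps (linearize (tree_operad (carrier E))) 2)"
    if "t \<in> elems (tree_operad (carrier E)) 2" for t and c :: 'b
    using that by simp
  show "x \<in> carrier (comps (linearize (tree_operad (carrier E))) 2)"
    using x unfolding free_gens_def
    by (elim UnE CollectE exE conjE; hypsubst)
      (intro diff sing cor_tree_mem s2_moduleD(4-6)[OF assms]; assumption)+
qed

lemma free_operad_quotient:
  assumes "s2_module E"
  shows "operad_quotient (linearize (tree_operad (carrier E))) (free_rels E)"
  using lin_operad_trees operad_ideal_generated[OF lin_operad_trees free_gens_closed[OF assms]]
  by (simp add: operad_quotient_def free_rels_eq)

lemma lin_operad_free: "s2_module E \<Longrightarrow> lin_operad (free_operad E)"
  unfolding free_operad_def by (rule operad_quotient.lin_quot[OF free_operad_quotient])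

text \<open>A morphism defined on all trees descends to the free operad as soon as its values on
  corollas are linear in the label and respect the transposition, because the relations imposed on
  trees are generated by exactly these conditions in arity 2.\<close>

lemma free_operad_hom:
  fixes E :: "('k::field, 'e) s2module" and Q :: "('k, 'x) operad"
  assumes E: "s2_module E" and Q: "lin_operad Q"
    and \<phi>: "operad_hom (linearize (tree_operad (carrier E))) Q \<phi>"
    and add: "\<And>e e'. e \<in> carrier E \<Longrightarrow> e' \<in> carrier E \<Longrightarrow>
      \<phi> 2 (Poly_Mapping.single (cor_tree (e \<oplus>\<^bsub>E\<^esub> e')) 1) =
      \<phi> 2 (Poly_Mapping.single (cor_tree e) 1) \<oplus>\<^bsub>comps Q 2\<^esub> \<phi> 2 (Poly_Mapping.single (cor_tree e') 1)"
    and smult: "\<And>c e. e \<in> carrier E \<Longrightarrow> \<phi> 2 (Poly_Mapping.single (cor_tree (c \<odot>\<^bsub>E\<^esub> e)) 1) =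
      c \<odot>\<^bsub>comps Q 2\<^esub> \<phi> 2 (Poly_Mapping.single (cor_tree e) 1)"
    and swap: "\<And>e. e \<in> carrier E \<Longrightarrow> \<phi> 2 (Poly_Mapping.single (cor_tree (swap E e)) 1) =
      \<phi> 2 (Poly_Mapping.single (Node e (Leaf 2) (Leaf 1)) 1)"
  obtains \<psi> where "operad_hom (free_operad E) Q \<psi>"
    and "\<And>n t. n \<ge> 1 \<Longrightarrow> t \<in> elems (tree_operad (carrier E)) n \<Longrightarrow>
      \<psi> n (tree_class E n t) = \<phi> n (Poly_Mapping.single t 1)"
proof -
  let ?T = "linearize (tree_operad (carrier E)) :: ('k, _) operad"
  interpret Q2: kmodule "comps Q 2" using lin_operad_module[OF Q] by (simp add: kmodule_def)
  have lin: "linear_between (comps ?T 2) (comps Q 2) (\<phi> 2)" using operad_hom_linear[OF \<phi>] by simp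
  have sub: "\<phi> 2 (p - q) = \<phi> 2 p \<ominus>\<^bsub>comps Q 2\<^esub> \<phi> 2 q" if "p \<in> carrier (comps ?T 2)" "q \<in> carrier (comps ?T 2)" for p q
    using linear_between_minus[OF lin_operad_module[OF lin_operad_trees] lin_operad_module[OF Q] lin that]
      free_module_minus[of p "elems (tree_operad (carrier E)) 2" q] that by simp
  have sing: "Poly_Mapping.single (cor_tree e) c \<in> carrier (comps ?T 2)"
    "Poly_Mapping.single (Node e (Leaf 2) (Leaf 1)) c \<in> carrier (comps ?T 2)" if "e \<in> carrier E" for e and c :: 'k
    using cor_tree_mem[OF that] by (simp_all del: tree_operad_simps)
  have diff: "p - q \<in> carrier (comps ?T 2)" if "p \<in> carrier (comps ?T 2)" "q \<in> carrier (comps ?T 2)" for p q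
    using that keys_minus_subset by simp
  have clo: "\<phi> 2 p \<in> carrier (comps Q 2)" if "p \<in> carrier (comps ?T 2)" for p
    by (rule linear_betweenD(1)[OF lin that])
  have cc: "\<phi> 2 (Poly_Mapping.single (cor_tree e) c) = c \<odot>\<^bsub>comps Q 2\<^esub> \<phi> 2 (Poly_Mapping.single (cor_tree e) 1)"
    if "e \<in> carrier E" for e c
    using linear_betweenD(3)[OF lin sing(1)[OF that, of 1], of c] by simp
  have zero: "x \<oplus>\<^bsub>comps Q 2\<^esub> y \<ominus>\<^bsub>comps Q 2\<^esub> x \<ominus>\<^bsub>comps Q 2\<^esub> y = \<zero>\<^bsub>comps Q 2\<^esub>"
    if "x \<in> carrier (comps Q 2)" "y \<in> carrier (comps Q 2)" for x y
    using that by (simp add: Q2.M.minus_eq Q2.M.a_ac Q2.cancel Q2.M.r_neg)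
  have zero2: "x \<ominus>\<^bsub>comps Q 2\<^esub> x = \<zero>\<^bsub>comps Q 2\<^esub>" if "x \<in> carrier (comps Q 2)" for x
    using that by (simp add: Q2.M.minus_eq Q2.M.r_neg)
  have "\<phi> 2 x = \<zero>\<^bsub>comps Q 2\<^esub>" if "x \<in> free_gens E" for x
  proof -
    consider (1) e e' where "e \<in> carrier E" "e' \<in> carrier E"
        "x = Poly_Mapping.single (cor_tree (e \<oplus>\<^bsub>E\<^esub> e')) 1 - Poly_Mapping.single (cor_tree e) 1 - Poly_Mapping.single (cor_tree e') 1"
      | (2) c e where "e \<in> carrier E" "x = Poly_Mapping.single (cor_tree (c \<odot>\<^bsub>E\<^esub> e)) 1 - Poly_Mapping.single (cor_tree e) c"
      | (3) e where "e \<in> carrier E" "x = Poly_Mapping.single (cor_tree (swap E e)) 1 - Poly_Mapping.single (Node e (Leaf 2) (Leaf 1)) 1"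
      using \<open>x \<in> free_gens E\<close> unfolding free_gens_def by blast
    then show ?thesis
    proof cases
      case 1
      have "\<phi> 2 x = \<phi> 2 (Poly_Mapping.single (cor_tree (e \<oplus>\<^bsub>E\<^esub> e')) 1) \<ominus>\<^bsub>comps Q 2\<^esub> \<phi> 2 (Poly_Mapping.single (cor_tree e) 1)
        \<ominus>\<^bsub>comps Q 2\<^esub> \<phi> 2 (Poly_Mapping.single (cor_tree e') 1)"
        unfolding 1(3) using 1(1,2) s2_moduleD(5)[OF E] sing diff by (simp only: sub)
      then show ?thesis
        using zero[OF clo[OF sing(1)[OF 1(1)]] clo[OF sing(1)[OF 1(2)]]] add[OF 1(1,2)] by simp
    next
      case 2
      show ?thesis
        unfolding 2(2) sub[OF sing(1)[OF s2_moduleD(6)[OF E 2(1)]] sing(1)[OF 2(1)]] smult[OF 2(1)] cc[OF 2(1), of c]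
        by (intro zero2 Q2.k_closed clo sing 2)
    next
      case 3
      show ?thesis
        unfolding 3(2) sub[OF sing(1)[OF s2_moduleD(4)[OF E 3(1)]] sing(2)[OF 3(1)]] swap[OF 3(1)]
        by (intro zero2 clo sing 3)
    qed
  qed
  from hom_quot_generated[OF lin_operad_trees free_gens_closed[OF E] Q \<phi> this]
  obtain \<psi> where \<psi>: "operad_hom (free_operad E) Q \<psi>"
    "\<And>n x. n \<ge> 1 \<Longrightarrow> x \<in> carrier (comps ?T n) \<Longrightarrow> \<psi> n (free_rels E n +>\<^bsub>comps ?T n\<^esub> x) = \<phi> n x"
    unfolding free_operad_def free_rels_eq by blast
  have "\<psi> n (tree_class E n t) = \<phi> n (Poly_Mapping.single t 1)"
    if "n \<ge> 1" "t \<in> elems (tree_operad (carrier E)) n" for n t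
    unfolding tree_class_def by (rule \<psi>(2)[OF that(1)]) (use that in simp)
  then show ?thesis using \<psi>(1) that by blast
qed

section \<open>Endomorphism operads\<close>

text \<open>An \<open>n\<close>-ary operation is written as a function of the family of its arguments \<open>v 1, \<dots>, v n\<close>.\<close>

definition op_of :: "nat \<Rightarrow> ('a list \<Rightarrow> 'a) \<Rightarrow> (nat \<Rightarrow> 'a) \<Rightarrow> 'a"
  where "op_of n f v = f (map v [1..<Suc n])"

definition list_op :: "nat \<Rightarrow> ((nat \<Rightarrow> 'a) \<Rightarrow> 'a) \<Rightarrow> 'a list \<Rightarrow> 'a::zero"
  where "list_op n F xs = (if length xs = n then F (\<lambda>i. xs ! (i - 1)) else 0)"

definition homogeneous :: "(int \<Rightarrow> 'a set) \<Rightarrow> nat \<Rightarrow> (nat \<Rightarrow> int) \<Rightarrow> (nat \<Rightarrow> 'a) \<Rightarrow> bool"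
  where "homogeneous gr n k v \<longleftrightarrow> (\<forall>i\<in>{1..n}. v i \<in> gr (k i))"

abbreviation odd_indices :: "nat \<Rightarrow> (nat \<Rightarrow> int) \<Rightarrow> nat set"
  where "odd_indices n k \<equiv> {i \<in> {1..n}. odd (k i)}"

text \<open>The first clause, dependence on \<open>v 1\<close>, ..., \<open>v n\<close> alone,
  corresponds to the convention that the elements of \<open>endo_maps\<close> vanish on lists of the
  wrong length.\<close>

definition multilinear ::
    "('k::field \<Rightarrow> 'a::ab_group_add \<Rightarrow> 'a) \<Rightarrow> (int \<Rightarrow> 'a set) \<Rightarrow> int \<Rightarrow> nat \<Rightarrow> ((nat \<Rightarrow> 'a) \<Rightarrow> 'a) \<Rightarrow> bool"
  where "multilinear s gr d n F \<longleftrightarrow>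
    (\<forall>v w. (\<forall>i\<in>{1..n}. v i = w i) \<longrightarrow> F v = F w) \<and>
    (\<forall>v. \<forall>i\<in>{1..n}. \<forall>a b. F (v(i := a + b)) = F (v(i := a)) + F (v(i := b))) \<and>
    (\<forall>v. \<forall>i\<in>{1..n}. \<forall>c a. F (v(i := s c a)) = s c (F (v(i := a)))) \<and>
    (\<forall>k v. homogeneous gr n k v \<longrightarrow> F v \<in> gr ((\<Sum>i=1..n. k i) + d * (int n - 1)))"

lemma multilinearD:
  assumes "multilinear s gr d n F"
  shows multilinear_cong: "\<And>v w. (\<And>i. i \<in> {1..n} \<Longrightarrow> v i = w i) \<Longrightarrow> F v = F w"
    and multilinear_add: "\<And>v i a b. i \<in> {1..n} \<Longrightarrow> F (v(i := a + b)) = F (v(i := a)) + F (v(i := b))"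
    and multilinear_scale: "\<And>v i c a. i \<in> {1..n} \<Longrightarrow> F (v(i := s c a)) = s c (F (v(i := a)))"
    and multilinear_deg: "\<And>k v. homogeneous gr n k v \<Longrightarrow> F v \<in> gr ((\<Sum>i=1..n. k i) + d * (int n - 1))"
  using assms unfolding multilinear_def by blast+

lemma op_of_list_op:
  assumes "multilinear s gr d n F"
  shows "op_of n (list_op n F) v = F v"
proof -
  have "F (\<lambda>i. map v [1..<Suc n] ! (i - 1)) = F v"
    by (rule multilinear_cong[OF assms]) (auto simp del: upt_Suc)
  then show ?thesis by (simp add: op_of_def list_op_def del: upt_Suc)
qed

lemma map_nth_shift: "length xs = n \<Longrightarrow> map (\<lambda>i. xs ! (i - 1)) [1..<Suc n] = xs"
  by (rule nth_equalityI) (auto simp del: upt_Suc)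

lemma list_op_op_of:
  assumes "f \<in> endo_maps s gr d n"
  shows "list_op n (op_of n f) = f"
proof
  fix xs
  show "list_op n (op_of n f) xs = f xs"
    using assms map_nth_shift[of xs n] by (simp add: list_op_def op_of_def endo_maps_def del: upt_Suc)
qed

lemma op_of_eqI:
  assumes "f \<in> endo_maps s gr d n" "g \<in> endo_maps s gr d n" "\<And>v. op_of n f v = op_of n g v"
  shows "f = g"
  using list_op_op_of[OF assms(1)] list_op_op_of[OF assms(2)] assms(3) by (metis ext)

lemma list_op_endo:
  fixes s :: "'k::field \<Rightarrow> 'a::ab_group_add \<Rightarrow> 'a"
  assumes F: "multilinear s gr d n F"
  shows "list_op n F \<in> endo_maps s gr d n"
proof -
  \<comment> \<open>The list position \<open>length xs\<close> is the argument number
    \<open>Suc (length xs)\<close>. The entry 0 is a filler that the update overwrites; it makes the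
    base family independent of \<open>a\<close>.\<close>
  have upd: "list_op n F (xs @ [a] @ ys) = F ((\<lambda>j. (xs @ [0] @ ys) ! (j - 1))(Suc (length xs) := a))"
    if "length xs + 1 + length ys = n" for xs a ys
  proof -
    have "F (\<lambda>i. (xs @ [a] @ ys) ! (i - 1)) = F ((\<lambda>j. (xs @ [0] @ ys) ! (j - 1))(Suc (length xs) := a))"
    proof (rule multilinear_cong[OF F])
      fix i assume "i \<in> {1..n}"
      then obtain j where "i = Suc j" by (cases i) auto
      then show "(xs @ [a] @ ys) ! (i - 1) = ((\<lambda>j. (xs @ [0] @ ys) ! (j - 1))(Suc (length xs) := a)) i"
        by (auto simp: nth_append nth_Cons')
    qed
    then show ?thesis using that by (simp add: list_op_def)
  qed
  have deg: "list_op n F xs \<in> gr (sum_list ks + d * (int n - 1))"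
    if "length xs = n" "list_all2 (\<lambda>k x. x \<in> gr k) ks xs" for ks xs
  proof -
    have "homogeneous gr n (\<lambda>i. ks ! (i - 1)) (\<lambda>i. xs ! (i - 1))"
      unfolding homogeneous_def
    proof
      fix i assume "i \<in> {1..n}"
      then show "xs ! (i - 1) \<in> gr (ks ! (i - 1))" using that list_all2_nthD2[OF that(2), of "i - 1"] by auto
    qed
    moreover have "(\<Sum>i=1..n. ks ! (i - 1)) = sum_list ks"
      using list_all2_lengthD[OF that(2)] that(1)
      by (simp add: sum_list_sum_nth sum.atLeast1_atMost_eq lessThan_atLeast0)
    ultimately show ?thesis using multilinear_deg[OF F] that(1) by (metis list_op_def)
  qed
  show ?thesis
    unfolding endo_maps_def mem_Collect_eq
  proof (intro conjI allI impI)
    fix xs ys :: "'a list" and a b :: 'a assume l: "length xs + 1 + length ys = n"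
    then have i: "Suc (length xs) \<in> {1..n}" by auto
    show "list_op n F (xs @ [a + b] @ ys) = list_op n F (xs @ [a] @ ys) + list_op n F (xs @ [b] @ ys)"
      unfolding upd[OF l] by (rule multilinear_add[OF F i])
  next
    fix xs ys :: "'a list" and c :: 'k and a :: 'a assume l: "length xs + 1 + length ys = n"
    then have i: "Suc (length xs) \<in> {1..n}" by auto
    show "list_op n F (xs @ [s c a] @ ys) = s c (list_op n F (xs @ [a] @ ys))"
      unfolding upd[OF l] by (rule multilinear_scale[OF F i])
  qed (use deg in \<open>auto simp: list_op_def\<close>)
qed

lemma upt_split: "i \<in> {1..n} \<Longrightarrow> [1..<Suc n] = [1..<i] @ [i] @ [Suc i..<Suc n]"
  using upt_add_eq_append[of 1 i "Suc n - i"] upt_conv_Cons[of i "Suc n"] by auto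

lemma op_of_multilinear:
  fixes s :: "'k::field \<Rightarrow> 'a::ab_group_add \<Rightarrow> 'a"
  assumes f: "f \<in> endo_maps s gr d n"
  shows "multilinear s gr d n (op_of n f)"
proof -
  have upd: "op_of n f (v(i := a)) = f (map v [1..<i] @ [a] @ map v [Suc i..<Suc n])"
    and len: "length (map v [1..<i]) + 1 + length (map v [Suc i..<Suc n]) = n" if "i \<in> {1..n}" for v i a
    using that unfolding op_of_def upt_split[OF that] by (auto simp del: upt_Suc)
  show ?thesis
    unfolding multilinear_def
  proof (intro conjI allI ballI impI)
    fix v w :: "nat \<Rightarrow> 'a" assume "\<forall>i\<in>{1..n}. v i = w i"
    then have "map v [1..<Suc n] = map w [1..<Suc n]" by auto
    then show "op_of n f v = op_of n f w" by (simp only: op_of_def)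
  next
    fix v :: "nat \<Rightarrow> 'a" and i a b assume i: "i \<in> {1..n}"
    then show "op_of n f (v(i := a + b)) = op_of n f (v(i := a)) + op_of n f (v(i := b))"
      using f len[OF i] unfolding upd[OF i] endo_maps_def by blast
  next
    fix v :: "nat \<Rightarrow> 'a" and i c a assume i: "i \<in> {1..n}"
    then show "op_of n f (v(i := s c a)) = s c (op_of n f (v(i := a)))"
      using f len[OF i] unfolding upd[OF i] endo_maps_def by blast
  next
    fix k :: "nat \<Rightarrow> int" and v :: "nat \<Rightarrow> 'a" assume h: "homogeneous gr n k v"
    have "list_all2 (\<lambda>k x. x \<in> gr k) (map k [1..<Suc n]) (map v [1..<Suc n])"
      using h by (auto simp: list_all2_conv_all_nth homogeneous_def simp del: upt_Suc)
    then have "f (map v [1..<Suc n]) \<in> gr (sum_list (map k [1..<Suc n]) + d * (int n - 1))"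
      using f unfolding endo_maps_def by (auto simp del: upt_Suc)
    moreover have "sum_list (map k [1..<Suc n]) = (\<Sum>i=1..n. k i)"
      by (subst sum_list_distinct_conv_sum_set) (auto simp del: upt_Suc simp: atLeastLessThanSuc_atLeastAtMost)
    ultimately show "op_of n f v \<in> gr ((\<Sum>i=1..n. k i) + d * (int n - 1))" by (simp only: op_of_def)
  qed
qed

section \<open>Graded spaces, homogeneous components and parities\<close>

locale graded =
  fixes s :: "'k::field \<Rightarrow> 'a::ab_group_add \<Rightarrow> 'a" and gr :: "int \<Rightarrow> 'a set"
  assumes graded: "graded_space s gr"
begin

sublocale V: vector_space s
  using graded by (simp add: graded_space_def)

lemma subspace: "V.subspace (gr k)"
  using graded by (simp add: graded_space_def)

lemma gr_closed: "0 \<in> gr k" "x \<in> gr k \<Longrightarrow> y \<in> gr k \<Longrightarrow> x + y \<in> gr k" "x \<in> gr k \<Longrightarrow> s c x \<in> gr k"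
  using subspace[of k] by (auto simp: V.subspace_def)

definition part :: "'a \<Rightarrow> int \<Rightarrow> 'a"
  where "part a = (THE c. (\<forall>k. c k \<in> gr k) \<and> finite {k. c k \<noteq> 0} \<and> a = (\<Sum>k | c k \<noteq> 0. c k))"

lemma part: "part a k \<in> gr k" "finite {k. part a k \<noteq> 0}" "a = (\<Sum>k | part a k \<noteq> 0. part a k)"
proof -
  have "\<exists>!c. (\<forall>k. c k \<in> gr k) \<and> finite {k. c k \<noteq> 0} \<and> a = (\<Sum>k | c k \<noteq> 0. c k)"
    using graded unfolding graded_space_def by blast
  from theI'[OF this] show "part a k \<in> gr k" "finite {k. part a k \<noteq> 0}" "a = (\<Sum>k | part a k \<noteq> 0. part a k)"
    unfolding part_def by blast+
qed

lemma part_sum: "finite K \<Longrightarrow> {k. part a k \<noteq> 0} \<subseteq> K \<Longrightarrow> a = (\<Sum>k\<in>K. part a k)"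
  using part(3)[of a] by (metis (mono_tags, lifting) mem_Collect_eq sum.mono_neutral_cong_left DiffD2)

lemma part_eqI:
  assumes "\<And>k. c k \<in> gr k" "finite K" "\<And>k. k \<notin> K \<Longrightarrow> c k = 0" "a = (\<Sum>k\<in>K. c k)"
  shows "part a = c"
proof -
  have sub: "{k. c k \<noteq> 0} \<subseteq> K" using assms(3) by auto
  have "a = (\<Sum>k | c k \<noteq> 0. c k)"
    unfolding assms(4) by (rule sum.mono_neutral_right) (use assms(2) sub in auto)
  moreover have "finite {k. c k \<noteq> 0}" using sub assms(2) finite_subset by blast
  moreover have "\<exists>!c. (\<forall>k. c k \<in> gr k) \<and> finite {k. c k \<noteq> 0} \<and> a = (\<Sum>k | c k \<noteq> 0. c k)"
    using graded unfolding graded_space_def by blast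
  ultimately show ?thesis
    unfolding part_def using assms(1) by (intro the1_equality) auto
qed

lemma part_add: "part (a + b) k = part a k + part b k"
proof -
  let ?K = "{k. part a k \<noteq> 0} \<union> {k. part b k \<noteq> 0}"
  have "part (a + b) = (\<lambda>k. part a k + part b k)"
  proof (rule part_eqI[where K = ?K])
    show "finite ?K" using part(2) by blast
    then show "a + b = (\<Sum>k\<in>?K. part a k + part b k)"
      using part_sum[of ?K a] part_sum[of ?K b] by (simp add: sum.distrib)
  qed (use part(1) gr_closed(2) in auto)
  then show ?thesis by simp
qed

lemma part_scale: "part (s c a) k = s c (part a k)"
proof -
  have "part (s c a) = (\<lambda>k. s c (part a k))"
  proof (rule part_eqI[where K = "{k. part a k \<noteq> 0}"])
    show "s c a = (\<Sum>k | part a k \<noteq> 0. s c (part a k))"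
      using arg_cong[OF part(3)[of a], of "s c"] unfolding V.scale_sum_right .
  qed (use part(1,2) gr_closed(3) in auto)
  then show ?thesis by simp
qed

lemma part_homogeneous: "a \<in> gr l \<Longrightarrow> part a k = (if k = l then a else 0)"
  using part_eqI[of "\<lambda>k. if k = l then a else 0" "{l}" a] gr_closed(1) by auto

text \<open>The even or the odd half of an element. Koszul signs see only parities, so finitely many
  choices of halves suffice where the degrees themselves range over all integers.\<close>

definition parity_part :: "bool \<Rightarrow> 'a \<Rightarrow> 'a"
  where "parity_part p a = (\<Sum>k | part a k \<noteq> 0 \<and> (odd k \<longleftrightarrow> p). part a k)"

lemma parity_part_sum:
  "finite K \<Longrightarrow> {k. part a k \<noteq> 0} \<subseteq> K \<Longrightarrow> parity_part p a = (\<Sum>k\<in>K. if odd k \<longleftrightarrow> p then part a k else 0)"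
  unfolding parity_part_def by (subst sum.inter_filter[symmetric]) (auto intro!: sum.mono_neutral_left)

lemma parity_part_add: "parity_part p (a + b) = parity_part p a + parity_part p b"
proof -
  let ?K = "{k. part a k \<noteq> 0} \<union> {k. part b k \<noteq> 0}"
  have "finite ?K" using part(2) by blast
  moreover have "{k. part (a + b) k \<noteq> 0} \<subseteq> ?K" by (auto simp: part_add)
  ultimately show ?thesis
    by (simp add: parity_part_sum[of ?K] part_add sum.distrib[symmetric] if_distrib cong: if_cong)
qed

lemma parity_part_scale: "parity_part p (s c a) = s c (parity_part p a)"
proof -
  let ?K = "{k. part a k \<noteq> 0}"
  have "finite ?K" by (rule part(2))
  moreover have "{k. part (s c a) k \<noteq> 0} \<subseteq> ?K" by (auto simp: part_scale)
  ultimately show ?thesis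
    by (simp add: parity_part_sum[of ?K] part_scale V.scale_sum_right) (rule sum.cong, auto simp: part_scale)
qed

lemma parity_part_homogeneous: "a \<in> gr l \<Longrightarrow> parity_part p a = (if odd l \<longleftrightarrow> p then a else 0)"
  by (subst parity_part_sum[of "{l}"]) (auto simp: part_homogeneous)

lemma homogeneous_induct:
  assumes F: "multilinear s gr d n F" and G: "multilinear s gr d n G"
    and eq: "\<And>k v. homogeneous gr n k v \<Longrightarrow> F v = G v"
  shows "F v = G v"
proof -
  have zero: "H (v(i := 0)) = 0" if "multilinear s gr d n H" "i \<in> {1..n}" for H v i
    using multilinear_scale[OF that, of v 0 0] by simp
  have sum: "H (v(i := sum x K)) = (\<Sum>k\<in>K. H (v(i := x k)))"
    if "multilinear s gr d n H" "i \<in> {1..n}" "finite K" for H v i and x :: "int \<Rightarrow> 'a" and K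
    using that(3)
    by (induction K) (simp_all add: zero[OF that(1,2)] multilinear_add[OF that(1,2)] del: fun_upd_apply)
  \<comment> \<open>Induction on the number \<open>j\<close> of initial arguments that may be
    arbitrary, the later ones being homogeneous. Raising \<open>j\<close> decomposes one further
    argument into its homogeneous components.\<close>
  have "\<forall>v. (\<forall>i\<in>{1..n}. i > j \<longrightarrow> (\<exists>k. v i \<in> gr k)) \<longrightarrow> F v = G v" if "j \<le> n" for j
    using that
  proof (induction j)
    case 0
    show ?case
    proof (intro allI impI)
      fix v assume "\<forall>i\<in>{1..n}. 0 < i \<longrightarrow> (\<exists>k. v i \<in> gr k)"
      then have "\<forall>i\<in>{1..n}. \<exists>k. v i \<in> gr k" by auto
      from bchoice[OF this] show "F v = G v" using eq unfolding homogeneous_def by blast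
    qed
  next
    case (Suc j)
    then have j: "Suc j \<in> {1..n}" by simp
    show ?case
    proof (intro allI impI)
      fix v assume v: "\<forall>i\<in>{1..n}. Suc j < i \<longrightarrow> (\<exists>k. v i \<in> gr k)"
      let ?K = "{k. part (v (Suc j)) k \<noteq> 0}"
      have fin: "finite ?K" by (rule part(2))
      have dec: "v = v(Suc j := sum (part (v (Suc j))) ?K)"
        using part(3)[of "v (Suc j)"] by (simp add: fun_eq_iff)
      have "F (v(Suc j := part (v (Suc j)) k)) = G (v(Suc j := part (v (Suc j)) k))" for k
      proof -
        have "\<forall>i\<in>{1..n}. i > j \<longrightarrow> (\<exists>l. (v(Suc j := part (v (Suc j)) k)) i \<in> gr l)"
          using v part(1)[of "v (Suc j)" k] by auto
        then show ?thesis using Suc by (meson Suc_leD)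
      qed
      then have "F (v(Suc j := sum (part (v (Suc j))) ?K)) = G (v(Suc j := sum (part (v (Suc j))) ?K))"
        unfolding sum[OF F j fin] sum[OF G j fin] by (simp only:)
      then show "F v = G v" using dec by simp
    qed
  qed
  from this[of n] show ?thesis by auto
qed

lemma endo_eqI:
  assumes "f \<in> endo_maps s gr d n" "g \<in> endo_maps s gr d n"
    and "\<And>k v. homogeneous gr n k v \<Longrightarrow> op_of n f v = op_of n g v"
  shows "f = g"
  using op_of_eqI[OF assms(1,2)] homogeneous_induct[OF op_of_multilinear[OF assms(1)] op_of_multilinear[OF assms(2)] assms(3)]
  by simp

text \<open>A sign rule is prescribed on homogeneous arguments only. Summing over all sets
  \<open>A\<close> of positions, with the odd half taken at the positions in \<open>A\<close> and
  the even half elsewhere, gives a map that is visibly multilinear; on homogeneous arguments the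
  single set \<open>A = odd_indices n k\<close> survives.\<close>

lemma parity_twist:
  assumes F: "multilinear s gr d n F"
  obtains G where "multilinear s gr d n G"
    and "\<And>k v. homogeneous gr n k v \<Longrightarrow> G v = s (\<epsilon> (odd_indices n k)) (F v)"
proof -
  define G where "G v = (\<Sum>A\<in>Pow {1..n}. s (\<epsilon> A) (F (\<lambda>i. parity_part (i \<in> A) (v i))))" for v
  have upd: "(\<lambda>j. parity_part (j \<in> A) ((v(i := a)) j)) = (\<lambda>j. parity_part (j \<in> A) (v j))(i := parity_part (i \<in> A) a)" for A v i a
    by auto
  have val: "G v = s (\<epsilon> (odd_indices n k)) (F v)" if h: "homogeneous gr n k v" for k v
  proof -
    have "F (\<lambda>i. parity_part (i \<in> A) (v i)) = (if A = odd_indices n k then F v else 0)" if A: "A \<in> Pow {1..n}" for A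
    proof (cases "A = odd_indices n k")
      case True
      have "F (\<lambda>i. parity_part (i \<in> A) (v i)) = F v"
      proof (rule multilinear_cong[OF F])
        fix i assume i: "i \<in> {1..n}"
        then have "v i \<in> gr (k i)" using h by (simp add: homogeneous_def)
        from parity_part_homogeneous[OF this] show "parity_part (i \<in> A) (v i) = v i" using i True by simp
      qed
      then show ?thesis using True by simp
    next
      case False
      \<comment> \<open>If \<open>A\<close> is not the set of odd positions, some argument is
        homogeneous of the other parity; the half taken of it is 0 and \<open>F\<close>
        vanishes.\<close>
      have "\<exists>i\<in>{1..n}. \<not> (odd (k i) \<longleftrightarrow> i \<in> A)"
      proof (rule ccontr)
        assume "\<not> (\<exists>i\<in>{1..n}. \<not> (odd (k i) \<longleftrightarrow> i \<in> A))"
        then have "\<forall>i\<in>{1..n}. odd (k i) \<longleftrightarrow> i \<in> A" by blast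
        then have "A = odd_indices n k" using A by blast
        with False show False by blast
      qed
      then obtain i where i: "i \<in> {1..n}" "\<not> (odd (k i) \<longleftrightarrow> i \<in> A)" by blast
      let ?w = "\<lambda>i. parity_part (i \<in> A) (v i)"
      have "v i \<in> gr (k i)" using h i by (simp add: homogeneous_def)
      from parity_part_homogeneous[OF this] have "?w i = 0" using i by simp
      then have "?w = ?w(i := s 0 0)" by auto
      then have "F ?w = F (?w(i := s 0 0))" by (rule arg_cong)
      also have "\<dots> = s 0 (F (?w(i := 0)))" by (rule multilinear_scale[OF F i(1)])
      also have "\<dots> = 0" by (rule V.scale_zero_left)
      finally show ?thesis using False by simp
    qed
    then have "G v = (\<Sum>A\<in>Pow {1..n}. s (\<epsilon> A) (if A = odd_indices n k then F v else 0))"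
      unfolding G_def by (intro sum.cong) auto
    also have "\<dots> = (\<Sum>A\<in>Pow {1..n}. if A = odd_indices n k then s (\<epsilon> A) (F v) else 0)"
      by (rule sum.cong) auto
    also have "\<dots> = s (\<epsilon> (odd_indices n k)) (F v)"
      by (subst sum.delta) auto
    finally show ?thesis .
  qed
  have "multilinear s gr d n G"
    unfolding multilinear_def
  proof (intro conjI allI ballI impI)
    fix v w :: "nat \<Rightarrow> 'a" assume vw: "\<forall>i\<in>{1..n}. v i = w i"
    have "F (\<lambda>i. parity_part (i \<in> A) (v i)) = F (\<lambda>i. parity_part (i \<in> A) (w i))" for A
      by (rule multilinear_cong[OF F]) (use vw in simp)
    then show "G v = G w" by (simp only: G_def)
  next
    fix v i a b assume i: "i \<in> {1..n}"
    show "G (v(i := a + b)) = G (v(i := a)) + G (v(i := b))"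
      unfolding G_def upd parity_part_add multilinear_add[OF F i] V.scale_right_distrib by (rule sum.distrib)
  next
    fix v i c a assume i: "i \<in> {1..n}"
    show "G (v(i := s c a)) = s c (G (v(i := a)))"
      unfolding G_def upd parity_part_scale multilinear_scale[OF F i] V.scale_sum_right
      by (rule sum.cong[OF refl]) (rule V.scale_left_commute)
  next
    fix k v assume h: "homogeneous gr n k v"
    show "G v \<in> gr ((\<Sum>i=1..n. k i) + d * (int n - 1))"
      unfolding val[OF h] by (rule gr_closed(3)[OF multilinear_deg[OF F h]])
  qed
  then show ?thesis using val that by blast
qed

section \<open>The operad structure on multilinear maps\<close>

lemma End_comps [simp]:
  "carrier (comps (End_operad s gr d) n) = endo_maps s gr d n"
  "\<zero>\<^bsub>comps (End_operad s gr d) n\<^esub> = (\<lambda>xs. 0)"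
  "f \<oplus>\<^bsub>comps (End_operad s gr d) n\<^esub> g = (\<lambda>xs. f xs + g xs)"
  "c \<odot>\<^bsub>comps (End_operad s gr d) n\<^esub> f = (\<lambda>xs. s c (f xs))"
  by (simp_all add: End_operad_def)

lemma endo_add: "f \<in> endo_maps s gr d n \<Longrightarrow> g \<in> endo_maps s gr d n \<Longrightarrow> (\<lambda>xs. f xs + g xs) \<in> endo_maps s gr d n"
  unfolding endo_maps_def mem_Collect_eq
  by (intro conjI allI impI; elim conjE) (simp_all add: V.scale_right_distrib algebra_simps gr_closed)

lemma endo_scale: "f \<in> endo_maps s gr d n \<Longrightarrow> (\<lambda>xs. s c (f xs)) \<in> endo_maps s gr d n"
  unfolding endo_maps_def mem_Collect_eq
  by (intro conjI allI impI; elim conjE) (simp_all add: V.scale_right_distrib V.scale_left_commute gr_closed)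

lemma endo_zero: "(\<lambda>xs. 0) \<in> endo_maps s gr d n"
  by (simp add: endo_maps_def gr_closed)

lemma End_module: "module KK (comps (End_operad s gr d) n)"
  by (rule module_KK_I)
    (simp_all add: endo_add endo_scale endo_zero fun_eq_iff V.scale_left_distrib V.scale_right_distrib add_ac)

lemma op_of_add: "op_of n (\<lambda>xs. f xs + g xs) v = op_of n f v + op_of n g v"
  and op_of_scale: "op_of n (\<lambda>xs. s c (f xs)) v = s c (op_of n f v)"
  by (simp_all add: op_of_def)

text \<open>Translates the specification of the action, written with lists and
  \<open>koszul_sign\<close>, into families of arguments and \<open>list_sign\<close>. The
  permutation \<tau> stands for the inverse of the acting one.\<close>

lemma pact_condition:
  assumes \<tau>: "\<tau> permutes {1..n}"
  shows "(\<forall>ks xs. length xs = n \<and> list_all2 (\<lambda>k x. x \<in> gr k) ks xs \<longrightarrow>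
        g xs = s (koszul_sign n \<tau> ks) (f (map (\<lambda>i. xs ! (\<tau> i - 1)) [1..<Suc n]))) \<longleftrightarrow>
    (\<forall>k v. homogeneous gr n k v \<longrightarrow>
        op_of n g v = s (list_sign (odd_indices n k) (map \<tau> [1..<Suc n])) (op_of n f (\<lambda>i. v (\<tau> i))))"
    (is "?L \<longleftrightarrow> ?R")
proof
  assume L: ?L
  show ?R
  proof (intro allI impI)
    fix k v assume h: "homogeneous gr n k v"
    let ?ks = "map k [1..<Suc n]" and ?xs = "map v [1..<Suc n]"
    have all: "list_all2 (\<lambda>k x. x \<in> gr k) ?ks ?xs"
      using h by (auto simp: list_all2_conv_all_nth homogeneous_def simp del: upt_Suc)
    have nth: "?ks ! (i - 1) = k i" "?xs ! (i - 1) = v i" if "i \<in> {1..n}" for i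
      using that by (auto simp del: upt_Suc)
    have A: "{j \<in> {1..n}. odd (?ks ! (j - 1))} = odd_indices n k" using nth by auto
    have "map (\<lambda>i. ?xs ! (\<tau> i - 1)) [1..<Suc n] = map (\<lambda>i. v (\<tau> i)) [1..<Suc n]"
    proof (rule map_cong[OF refl])
      fix i assume "i \<in> set [1..<Suc n]"
      then have "\<tau> i \<in> {1..n}" using permutes_in_image[OF \<tau>, of i] by auto
      then show "?xs ! (\<tau> i - 1) = v (\<tau> i)" by (rule nth(2))
    qed
    moreover have "koszul_sign n \<tau> ?ks = (list_sign (odd_indices n k) (map \<tau> [1..<Suc n]) :: 'k)"
      using koszul_sign_eq[OF _ \<tau>, of ?ks] unfolding A by (simp del: upt_Suc)
    moreover have "g ?xs = s (koszul_sign n \<tau> ?ks) (f (map (\<lambda>i. ?xs ! (\<tau> i - 1)) [1..<Suc n]))"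
      using L all by (simp del: upt_Suc)
    ultimately show "op_of n g v = s (list_sign (odd_indices n k) (map \<tau> [1..<Suc n])) (op_of n f (\<lambda>i. v (\<tau> i)))"
      by (simp only: op_of_def)
  qed
next
  assume R: ?R
  show ?L
  proof (intro allI impI, elim conjE)
    fix ks xs assume n: "length xs = n" and all: "list_all2 (\<lambda>k x. x \<in> gr k) ks xs"
    let ?k = "\<lambda>i. ks ! (i - 1)" and ?v = "\<lambda>i. xs ! (i - 1)"
    have "homogeneous gr n ?k ?v"
      unfolding homogeneous_def
    proof
      fix i assume "i \<in> {1..n}"
      then show "xs ! (i - 1) \<in> gr (ks ! (i - 1))" using n list_all2_nthD2[OF all, of "i - 1"] by auto
    qed
    then have "op_of n g ?v = s (list_sign (odd_indices n ?k) (map \<tau> [1..<Suc n])) (op_of n f (\<lambda>i. ?v (\<tau> i)))"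
      using R by blast
    then show "g xs = s (koszul_sign n \<tau> ks) (f (map (\<lambda>i. xs ! (\<tau> i - 1)) [1..<Suc n]))"
      using koszul_sign_eq[OF _ \<tau>, of ks, where 'k = 'k] map_nth_shift[OF n] n list_all2_lengthD[OF all]
      by (simp add: op_of_def del: upt_Suc)
  qed
qed

lemma multilinear_permute:
  assumes F: "multilinear s gr d n F" and \<tau>: "\<tau> permutes {1..n}"
  shows "multilinear s gr d n (\<lambda>v. F (\<lambda>i. v (\<tau> i)))"
proof -
  have upd: "(\<lambda>i. (v(j := a)) (\<tau> i)) = (\<lambda>i. v (\<tau> i))(inv_into UNIV \<tau> j := a)" for v :: "nat \<Rightarrow> 'a" and j a
    using permutes_inverses[OF \<tau>] by (auto simp: fun_eq_iff)
  have im: "i \<in> {1..n} \<Longrightarrow> \<tau> i \<in> {1..n}" "i \<in> {1..n} \<Longrightarrow> inv_into UNIV \<tau> i \<in> {1..n}" for i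
    using permutes_in_image[OF \<tau>] permutes_in_image[OF permutes_inv[OF \<tau>]] by blast+
  show ?thesis
    unfolding multilinear_def
  proof (intro conjI allI ballI impI)
    fix v w :: "nat \<Rightarrow> 'a" assume "\<forall>i\<in>{1..n}. v i = w i"
    then show "F (\<lambda>i. v (\<tau> i)) = F (\<lambda>i. w (\<tau> i))" using im by (intro multilinear_cong[OF F]) blast
  next
    fix v i a b assume i: "i \<in> {1..n}"
    show "F (\<lambda>j. (v(i := a + b)) (\<tau> j)) = F (\<lambda>j. (v(i := a)) (\<tau> j)) + F (\<lambda>j. (v(i := b)) (\<tau> j))"
      unfolding upd by (rule multilinear_add[OF F im(2)[OF i]])
  next
    fix v i c a assume i: "i \<in> {1..n}"
    show "F (\<lambda>j. (v(i := s c a)) (\<tau> j)) = s c (F (\<lambda>j. (v(i := a)) (\<tau> j)))"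
      unfolding upd by (rule multilinear_scale[OF F im(2)[OF i]])
  next
    fix k v assume "homogeneous gr n k v"
    then have "homogeneous gr n (\<lambda>i. k (\<tau> i)) (\<lambda>i. v (\<tau> i))" using im unfolding homogeneous_def by blast
    from multilinear_deg[OF F this] show "F (\<lambda>i. v (\<tau> i)) \<in> gr ((\<Sum>i=1..n. k i) + d * (int n - 1))"
      using sum.permute[OF \<tau>, of k] by (simp add: o_def)
  qed
qed

text \<open>The action is a definite description. \<open>parity_twist\<close> provides a map with
  the required signs, and it is unique because multilinear maps that agree on homogeneous arguments
  are equal.\<close>

lemma End_pact:
  assumes f: "f \<in> endo_maps s gr d n" and \<sigma>: "\<sigma> permutes {1..n}"
  shows End_pact_closed: "pact (End_operad s gr d) n f \<sigma> \<in> endo_maps s gr d n"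
    and End_pact_eq: "\<And>k v. homogeneous gr n k v \<Longrightarrow>
      op_of n (pact (End_operad s gr d) n f \<sigma>) v =
        s (list_sign (odd_indices n k) (map (inv_into UNIV \<sigma>) [1..<Suc n])) (op_of n f (\<lambda>i. v (inv_into UNIV \<sigma> i)))"
proof -
  let ?\<tau> = "inv_into UNIV \<sigma>"
  have \<tau>: "?\<tau> permutes {1..n}" by (rule permutes_inv[OF \<sigma>])
  let ?P = "\<lambda>g. g \<in> endo_maps s gr d n \<and> (\<forall>k v. homogeneous gr n k v \<longrightarrow>
        op_of n g v = s (list_sign (odd_indices n k) (map ?\<tau> [1..<Suc n])) (op_of n f (\<lambda>i. v (?\<tau> i))))"
  obtain G where G: "multilinear s gr d n G" "\<And>k v. homogeneous gr n k v \<Longrightarrow>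
      G v = s (list_sign (odd_indices n k) (map ?\<tau> [1..<Suc n])) (op_of n f (\<lambda>i. v (?\<tau> i)))"
    using parity_twist[OF multilinear_permute[OF op_of_multilinear[OF f] \<tau>],
        of "\<lambda>A. list_sign A (map ?\<tau> [1..<Suc n])"] by blast
  have 1: "?P (list_op n G)"
    using list_op_endo[OF G(1)] G(2) by (simp add: op_of_list_op[OF G(1)] del: upt_Suc)
  have eq: "g = list_op n G" if "?P g" for g
    by (rule endo_eqI) (use that 1 in auto)
  have "pact (End_operad s gr d) n f \<sigma> = (THE g. ?P g)"
    unfolding End_operad_def by (simp only: operad.simps pact_condition[OF \<tau>])
  also have "\<dots> = list_op n G"
  proof (rule the_equality)
    show "?P (list_op n G)" by (rule 1)
    show "g = list_op n G" if "?P g" for g by (rule eq[OF that])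
  qed
  finally have "?P (pact (End_operad s gr d) n f \<sigma>)" using 1 by simp
  then show "pact (End_operad s gr d) n f \<sigma> \<in> endo_maps s gr d n"
    "\<And>k v. homogeneous gr n k v \<Longrightarrow> op_of n (pact (End_operad s gr d) n f \<sigma>) v =
        s (list_sign (odd_indices n k) (map ?\<tau> [1..<Suc n])) (op_of n f (\<lambda>i. v (?\<tau> i)))"
    by blast+
qed

text \<open>The family of arguments that the outer operation receives in a partial composition at
  \<open>i\<close> with the inner operation \<open>G\<close>.\<close>

definition graft_op :: "nat \<Rightarrow> nat \<Rightarrow> ((nat \<Rightarrow> 'a) \<Rightarrow> 'a) \<Rightarrow> (nat \<Rightarrow> 'a) \<Rightarrow> nat \<Rightarrow> 'a"
  where "graft_op m i G v = (\<lambda>j. if j < i then v j else if j = i then G (\<lambda>l. v (l + (i - 1))) else v (j + m - 1))"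

lemma graft_op_simps:
  "j < i \<Longrightarrow> graft_op m i G v j = v j" "graft_op m i G v i = G (\<lambda>l. v (l + (i - 1)))"
  "i < j \<Longrightarrow> graft_op m i G v j = v (j + m - 1)"
  by (simp_all add: graft_op_def)

text \<open>The degrees of the arguments in \<open>graft_op\<close>, with \<open>e\<close> the
  degree of the inner operation.\<close>

definition graft_deg :: "nat \<Rightarrow> nat \<Rightarrow> int \<Rightarrow> (nat \<Rightarrow> int) \<Rightarrow> nat \<Rightarrow> int"
  where "graft_deg m i e k = (\<lambda>j. if j < i then k j else if j = i then (\<Sum>l=1..m. k (l + (i - 1))) + e else k (j + m - 1))"

lemma op_of_pcomp:
  assumes n: "n \<ge> 1" "m \<ge> 1" "i \<in> {1..n}"
  shows "op_of (n + m - 1) (pcomp (End_operad s gr d) n m i f g) v = op_of n f (graft_op m i (op_of m g) v)"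
proof -
  let ?xs = "map v [1..<Suc (n + m - 1)]"
  have len: "length ?xs = n + m - 1" by (simp del: upt_Suc)
  have take: "take (i - 1) ?xs = map v [1..<i]"
    using n by (intro nth_equalityI) (auto simp del: upt_Suc)
  have mid: "take m (drop (i - 1) ?xs) = map (\<lambda>l. v (l + (i - 1))) [1..<Suc m]"
    using n by (intro nth_equalityI) (auto simp del: upt_Suc simp: add_ac)
  have drop: "drop (i - 1 + m) ?xs = map (\<lambda>j. v (j + m - 1)) [Suc i..<Suc n]"
    using n by (intro nth_equalityI) (auto simp del: upt_Suc simp: add_ac)
  have "map (graft_op m i (op_of m g) v) [1..<Suc n] = map v [1..<i] @ [op_of m g (\<lambda>l. v (l + (i - 1)))] @ map (\<lambda>j. v (j + m - 1)) [Suc i..<Suc n]"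
    unfolding upt_split[OF n(3)] by (auto simp: graft_op_def simp del: upt_Suc)
  moreover have "pcomp (End_operad s gr d) n m i f g ?xs = f (take (i - 1) ?xs @ [g (take m (drop (i - 1) ?xs))] @ drop (i - 1 + m) ?xs)"
    using len by (simp add: End_operad_def del: upt_Suc)
  ultimately show ?thesis
    unfolding take mid drop by (simp only: op_of_def)
qed

lemma homogeneous_graft:
  assumes G: "multilinear s gr d m G" and h: "homogeneous gr (n + m - 1) k v"
    and n: "n \<ge> 1" "m \<ge> 1" "i \<in> {1..n}"
  shows "homogeneous gr n (graft_deg m i (d * (int m - 1)) k) (graft_op m i G v)"
  unfolding homogeneous_def
proof
  fix j assume j: "j \<in> {1..n}"
  have mem: "v l \<in> gr (k l)" if "l \<in> {1..n + m - 1}" for l using h that by (simp add: homogeneous_def)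
  have "homogeneous gr m (\<lambda>l. k (l + (i - 1))) (\<lambda>l. v (l + (i - 1)))"
    unfolding homogeneous_def by (intro ballI mem) (use n in auto)
  note eq = multilinear_deg[OF G this]
  show "graft_op m i G v j \<in> gr (graft_deg m i (d * (int m - 1)) k j)"
  proof (cases j i rule: linorder_cases)
    case less
    then have "v j \<in> gr (k j)" using n j by (intro mem) auto
    with less show ?thesis by (simp add: graft_op_def graft_deg_def)
  next
    case equal
    with eq show ?thesis by (simp add: graft_op_def graft_deg_def)
  next
    case greater
    then have "v (j + m - 1) \<in> gr (k (j + m - 1))" using n j by (intro mem) auto
    with greater show ?thesis by (simp add: graft_op_def graft_deg_def)
  qed
qed

lemma sum_graft_deg:
  assumes n: "n \<ge> 1" "m \<ge> 1" "i \<in> {1..n}"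
  shows "(\<Sum>j=1..n. graft_deg m i e k j) = (\<Sum>j=1..n + m - 1. k j) + e"
proof -
  let ?g = "graft_deg m i e k"
  have "(\<Sum>j=1..n. ?g j) = (\<Sum>j\<in>{1..<i}. ?g j) + ?g i + (\<Sum>j\<in>{Suc i..n}. ?g j)"
  proof -
    have "{1..n} = {1..<i} \<union> {i} \<union> {Suc i..n}" using n by auto
    then show ?thesis by (simp only:) (subst sum.union_disjoint, auto)+
  qed
  also have "(\<Sum>j\<in>{1..<i}. ?g j) = (\<Sum>j\<in>{1..<i}. k j)" by (rule sum.cong) (auto simp: graft_deg_def)
  also have "?g i = (\<Sum>j\<in>{i..<i + m}. k j) + e"
  proof -
    have "(\<Sum>l=1..m. k (l + (i - 1))) = (\<Sum>j\<in>{i..<i + m}. k j)"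
      by (rule sum.reindex_bij_witness[where i = "\<lambda>j. j - (i - 1)" and j = "\<lambda>l. l + (i - 1)"]) (use n in auto)
    then show ?thesis by (simp add: graft_deg_def)
  qed
  also have "(\<Sum>j\<in>{Suc i..n}. ?g j) = (\<Sum>j\<in>{i + m..n + m - 1}. k j)"
    by (rule sum.reindex_bij_witness[where i = "\<lambda>j. j - (m - 1)" and j = "\<lambda>j. j + m - 1"])
      (use n in \<open>auto simp: graft_deg_def\<close>)
  finally have *: "(\<Sum>j=1..n. ?g j) = (\<Sum>j\<in>{1..<i}. k j) + ((\<Sum>j\<in>{i..<i + m}. k j) + e) + (\<Sum>j\<in>{i + m..n + m - 1}. k j)" .
  have "{1..n + m - 1} = {1..<i} \<union> {i..<i + m} \<union> {i + m..n + m - 1}" using n by auto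
  then have "(\<Sum>j=1..n + m - 1. k j) = (\<Sum>j\<in>{1..<i}. k j) + (\<Sum>j\<in>{i..<i + m}. k j) + (\<Sum>j\<in>{i + m..n + m - 1}. k j)"
    by (simp only:) (subst sum.union_disjoint, auto)+
  with * show ?thesis by simp
qed

lemma multilinear_graft:
  assumes F: "multilinear s gr d n F" and G: "multilinear s gr d m G"
    and n: "n \<ge> 1" "m \<ge> 1" "i \<in> {1..n}"
  shows "multilinear s gr d (n + m - 1) (\<lambda>v. F (graft_op m i G v))"
proof -
  \<comment> \<open>Changing one argument of the composite changes exactly one argument of
    \<open>F\<close>: the same one if it precedes the inserted block, the one shifted by
    \<open>m - 1\<close> if it follows it, and otherwise the argument \<open>i\<close>, through
    \<open>G\<close>.\<close>
  have upd: "(j < i \<and> (\<forall>a. graft_op m i G (v(j := a)) = (graft_op m i G v)(j := a))) \<or>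
    (\<exists>l\<in>{1..m}. \<forall>a. graft_op m i G (v(j := a)) = (graft_op m i G v)(i := G ((\<lambda>l. v (l + (i - 1)))(l := a)))) \<or>
    (j \<ge> i + m \<and> (\<forall>a. graft_op m i G (v(j := a)) = (graft_op m i G v)(j - (m - 1) := a)))"
    if j: "j \<in> {1..n + m - 1}" for j and v :: "nat \<Rightarrow> 'a"
  proof -
    have G_cong: "G (\<lambda>l. (v(j := a)) (l + (i - 1))) = G (\<lambda>l. v (l + (i - 1)))" if "j < i \<or> i + m \<le> j" for a
      by (rule multilinear_cong[OF G]) (use that n in auto)
    consider "j < i" | "i \<le> j" "j < i + m" | "i + m \<le> j" by linarith
    then show ?thesis
    proof cases
      case 1
      have "graft_op m i G (v(j := a)) = (graft_op m i G v)(j := a)" for a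
      proof
        fix x
        show "graft_op m i G (v(j := a)) x = ((graft_op m i G v)(j := a)) x"
        proof (cases "x = i")
          case True
          then have "x \<noteq> j" using 1 by auto
          then show ?thesis using G_cong[OF disjI1[OF 1], of a] True by (simp only: graft_op_simps fun_upd_other not_False_eq_True)
        next
          case False
          then show ?thesis using 1 n by (cases "x < i") (auto simp: graft_op_simps)
        qed
      qed
      then show ?thesis using 1 by blast
    next
      case 2
      then have l: "j - (i - 1) \<in> {1..m}" using n by auto
      have "(\<lambda>l. (v(j := a)) (l + (i - 1))) = (\<lambda>l. v (l + (i - 1)))(j - (i - 1) := a)" for a
        using 2 n by (auto simp: fun_eq_iff)
      then have G_eq: "G (\<lambda>l. (v(j := a)) (l + (i - 1))) = G ((\<lambda>l. v (l + (i - 1)))(j - (i - 1) := a))" for a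
        by (rule arg_cong)
      have "graft_op m i G (v(j := a)) = (graft_op m i G v)(i := G ((\<lambda>l. v (l + (i - 1)))(j - (i - 1) := a)))" for a
      proof
        fix x
        consider "x < i" | "x = i" | "i < x" by linarith
        then show "graft_op m i G (v(j := a)) x = ((graft_op m i G v)(i := G ((\<lambda>l. v (l + (i - 1)))(j - (i - 1) := a)))) x"
        proof cases
          case 2
          then show ?thesis by (simp only: graft_op_simps fun_upd_same G_eq)
        qed (use 2 n in \<open>auto simp: graft_op_simps\<close>)
      qed
      then show ?thesis using l by blast
    next
      case 3
      have "graft_op m i G (v(j := a)) = (graft_op m i G v)(j - (m - 1) := a)" for a
      proof
        fix x
        show "graft_op m i G (v(j := a)) x = ((graft_op m i G v)(j - (m - 1) := a)) x"
        proof (cases "x = i")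
          case True
          then have "x \<noteq> j - (m - 1)" using 3 n by auto
          then show ?thesis using G_cong[OF disjI2[OF 3], of a] True by (simp only: graft_op_simps fun_upd_other not_False_eq_True)
        next
          case False
          then show ?thesis using 3 n by (cases "x < i") (auto simp: graft_op_simps)
        qed
      qed
      then show ?thesis using 3 by blast
    qed
  qed
  show ?thesis
    unfolding multilinear_def
  proof (intro conjI allI ballI impI)
    fix v w :: "nat \<Rightarrow> 'a" assume vw: "\<forall>i\<in>{1..n + m - 1}. v i = w i"
    have vw': "v l = w l" if "l \<in> {1..n + m - 1}" for l using vw that by blast
    have G_eq: "G (\<lambda>l. v (l + (i - 1))) = G (\<lambda>l. w (l + (i - 1)))"
      by (rule multilinear_cong[OF G], rule vw') (use n in auto)
    show "F (graft_op m i G v) = F (graft_op m i G w)"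
    proof (rule multilinear_cong[OF F])
      fix j assume j: "j \<in> {1..n}"
      show "graft_op m i G v j = graft_op m i G w j"
      proof (cases j i rule: linorder_cases)
        case less
        have "v j = w j" by (rule vw') (use j n in auto)
        with less show ?thesis by (simp only: graft_op_simps)
      next
        case equal
        with G_eq show ?thesis by (simp only: graft_op_simps)
      next
        case greater
        have "v (j + m - 1) = w (j + m - 1)" by (rule vw') (use j n in auto)
        with greater show ?thesis by (simp only: graft_op_simps)
      qed
    qed
  next
    fix v j a b assume j: "j \<in> {1..n + m - 1}"
    from upd[OF j, of v] show "F (graft_op m i G (v(j := a + b))) = F (graft_op m i G (v(j := a))) + F (graft_op m i G (v(j := b)))"
    proof (elim disjE conjE bexE)
      assume "j < i" "\<forall>a. graft_op m i G (v(j := a)) = (graft_op m i G v)(j := a)"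
      moreover from this j n have "j \<in> {1..n}" by auto
      ultimately show ?thesis by (simp only: multilinear_add[OF F])
    next
      fix l assume "l \<in> {1..m}" "\<forall>a. graft_op m i G (v(j := a)) = (graft_op m i G v)(i := G ((\<lambda>l. v (l + (i - 1)))(l := a)))"
      then show ?thesis by (simp only: multilinear_add[OF G] multilinear_add[OF F n(3)])
    next
      assume "i + m \<le> j" "\<forall>a. graft_op m i G (v(j := a)) = (graft_op m i G v)(j - (m - 1) := a)"
      moreover from this j n have "j - (m - 1) \<in> {1..n}" by auto
      ultimately show ?thesis by (simp only: multilinear_add[OF F])
    qed
  next
    fix v j c a assume j: "j \<in> {1..n + m - 1}"
    from upd[OF j, of v] show "F (graft_op m i G (v(j := s c a))) = s c (F (graft_op m i G (v(j := a))))"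
    proof (elim disjE conjE bexE)
      assume "j < i" "\<forall>a. graft_op m i G (v(j := a)) = (graft_op m i G v)(j := a)"
      moreover from this j n have "j \<in> {1..n}" by auto
      ultimately show ?thesis by (simp only: multilinear_scale[OF F])
    next
      fix l assume "l \<in> {1..m}" "\<forall>a. graft_op m i G (v(j := a)) = (graft_op m i G v)(i := G ((\<lambda>l. v (l + (i - 1)))(l := a)))"
      then show ?thesis by (simp only: multilinear_scale[OF G] multilinear_scale[OF F n(3)])
    next
      assume "i + m \<le> j" "\<forall>a. graft_op m i G (v(j := a)) = (graft_op m i G v)(j - (m - 1) := a)"
      moreover from this j n have "j - (m - 1) \<in> {1..n}" by auto
      ultimately show ?thesis by (simp only: multilinear_scale[OF F])
    qed
  next
    fix k v assume h: "homogeneous gr (n + m - 1) k v"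
    have "F (graft_op m i G v) \<in> gr ((\<Sum>j=1..n. graft_deg m i (d * (int m - 1)) k j) + d * (int n - 1))"
      by (rule multilinear_deg[OF F homogeneous_graft[OF G h n]])
    \<comment> \<open>The degrees \<open>d * (m - 1)\<close> and \<open>d * (n - 1)\<close> of the
      two operations add up to the degree of an operation of arity \<open>n + m - 1\<close>.\<close>
    moreover have "(\<Sum>j=1..n. graft_deg m i (d * (int m - 1)) k j) + d * (int n - 1) =
        (\<Sum>j=1..n + m - 1. k j) + d * (int (n + m - 1) - 1)"
      unfolding sum_graft_deg[OF n] using n(1,2) by (simp add: of_nat_diff algebra_simps)
    ultimately show "F (graft_op m i G v) \<in> gr ((\<Sum>j=1..n + m - 1. k j) + d * (int (n + m - 1) - 1))" by simp
  qed
qed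

lemma End_pcomp_closed:
  assumes "f \<in> endo_maps s gr d n" "g \<in> endo_maps s gr d m" "n \<ge> 1" "m \<ge> 1" "i \<in> {1..n}"
  shows "pcomp (End_operad s gr d) n m i f g \<in> endo_maps s gr d (n + m - 1)"
proof -
  let ?F = "\<lambda>v. op_of n f (graft_op m i (op_of m g) v)"
  have F: "multilinear s gr d (n + m - 1) ?F"
    by (rule multilinear_graft[OF op_of_multilinear[OF assms(1)] op_of_multilinear[OF assms(2)] assms(3-5)])
  have "pcomp (End_operad s gr d) n m i f g = list_op (n + m - 1) ?F"
  proof
    fix xs
    show "pcomp (End_operad s gr d) n m i f g xs = list_op (n + m - 1) ?F xs"
    proof (cases "length xs = n + m - 1")
      case True
      then have "pcomp (End_operad s gr d) n m i f g xs = op_of (n + m - 1) (pcomp (End_operad s gr d) n m i f g) (\<lambda>i. xs ! (i - 1))"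
        unfolding op_of_def by (simp only: map_nth_shift)
      then show ?thesis using True by (simp only: op_of_pcomp[OF assms(3-5)] list_op_def if_True simp_thms)
    next
      case False
      then show ?thesis by (simp add: End_operad_def list_op_def)
    qed
  qed
  then show ?thesis using list_op_endo[OF F] by simp
qed

lemma lin_operad_End: "lin_operad (End_operad s gr d)"
  unfolding lin_operad_def
proof (intro conjI allI impI ballI)
  show "module KK (comps (End_operad s gr d) n)" for n by (rule End_module)
next
  have "ident (End_operad s gr d) = list_op 1 (\<lambda>v. v 1)"
    by (auto simp: End_operad_def list_op_def fun_eq_iff length_Suc_conv)
  moreover have "multilinear s gr d 1 (\<lambda>v. v 1)"
    by (simp add: multilinear_def homogeneous_def)
  ultimately show "ident (End_operad s gr d) \<in> carrier (comps (End_operad s gr d) 1)"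
    using list_op_endo by simp
next
  fix n \<sigma> assume \<sigma>: "\<sigma> permutes {1..n::nat}"
  show "linear_between (comps (End_operad s gr d) n) (comps (End_operad s gr d) n) (\<lambda>x. pact (End_operad s gr d) n x \<sigma>)"
  proof (rule linear_betweenI)
    fix f g assume "f \<in> carrier (comps (End_operad s gr d) n)" "g \<in> carrier (comps (End_operad s gr d) n)"
    then have f: "f \<in> endo_maps s gr d n" and g: "g \<in> endo_maps s gr d n" by simp_all
    show "pact (End_operad s gr d) n (f \<oplus>\<^bsub>comps (End_operad s gr d) n\<^esub> g) \<sigma> =
        pact (End_operad s gr d) n f \<sigma> \<oplus>\<^bsub>comps (End_operad s gr d) n\<^esub> pact (End_operad s gr d) n g \<sigma>"
      unfolding End_comps
      by (rule endo_eqI[OF End_pact_closed[OF endo_add[OF f g] \<sigma>] endo_add[OF End_pact_closed[OF f \<sigma>] End_pact_closed[OF g \<sigma>]]])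
        (simp only: op_of_add End_pact_eq[OF endo_add[OF f g] \<sigma>] End_pact_eq[OF f \<sigma>] End_pact_eq[OF g \<sigma>] V.scale_right_distrib)
  next
    fix f c assume "f \<in> carrier (comps (End_operad s gr d) n)"
    then have f: "f \<in> endo_maps s gr d n" by simp
    show "pact (End_operad s gr d) n (c \<odot>\<^bsub>comps (End_operad s gr d) n\<^esub> f) \<sigma> =
        c \<odot>\<^bsub>comps (End_operad s gr d) n\<^esub> pact (End_operad s gr d) n f \<sigma>"
      unfolding End_comps
    proof (rule endo_eqI[OF End_pact_closed[OF endo_scale[OF f] \<sigma>] endo_scale[OF End_pact_closed[OF f \<sigma>]]])
      fix k v assume h: "homogeneous gr n k v"
      show "op_of n (pact (End_operad s gr d) n (\<lambda>xs. s c (f xs)) \<sigma>) v = op_of n (\<lambda>xs. s c (pact (End_operad s gr d) n f \<sigma> xs)) v"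
        unfolding op_of_scale End_pact_eq[OF endo_scale[OF f] \<sigma> h] End_pact_eq[OF f \<sigma> h] by (rule V.scale_left_commute)
    qed
  qed (use End_pact_closed[OF _ \<sigma>] in simp)
next
  fix n m i f assume *: "(n::nat) \<ge> 1" "(m::nat) \<ge> 1" "i \<in> {1..n}" "f \<in> carrier (comps (End_operad s gr d) n)"
  then have f: "f \<in> endo_maps s gr d n" by simp
  have upd: "graft_op m i G v = (graft_op m i G v)(i := G (\<lambda>l. v (l + (i - 1))))" for G v
    by (auto simp: graft_op_def)
  \<comment> \<open>The inner operation affects only the argument \<open>i\<close>, so additivity in
    the inner operation becomes additivity of \<open>f\<close> in that argument.\<close>
  have upd2: "graft_op m i G v = (graft_op m i H v)(i := G (\<lambda>l. v (l + (i - 1))))" for G H v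
    by (auto simp: graft_op_def)
  show "linear_between (comps (End_operad s gr d) m) (comps (End_operad s gr d) (n + m - 1)) (pcomp (End_operad s gr d) n m i f)"
  proof (rule linear_betweenI)
    fix g h assume "g \<in> carrier (comps (End_operad s gr d) m)" "h \<in> carrier (comps (End_operad s gr d) m)"
    then have g: "g \<in> endo_maps s gr d m" and h: "h \<in> endo_maps s gr d m" by simp_all
    show "pcomp (End_operad s gr d) n m i f (g \<oplus>\<^bsub>comps (End_operad s gr d) m\<^esub> h) =
        pcomp (End_operad s gr d) n m i f g \<oplus>\<^bsub>comps (End_operad s gr d) (n + m - 1)\<^esub> pcomp (End_operad s gr d) n m i f h"
      unfolding End_comps
    proof (rule endo_eqI[OF End_pcomp_closed[OF f endo_add[OF g h] *(1-3)]
          endo_add[OF End_pcomp_closed[OF f g *(1-3)] End_pcomp_closed[OF f h *(1-3)]]])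
      fix v
      show "op_of (n + m - 1) (pcomp (End_operad s gr d) n m i f (\<lambda>xs. g xs + h xs)) v =
        op_of (n + m - 1) (\<lambda>xs. pcomp (End_operad s gr d) n m i f g xs + pcomp (End_operad s gr d) n m i f h xs) v"
      proof -
        let ?z = "\<lambda>l. v (l + (i - 1))" and ?W = "graft_op m i (op_of m g) v"
        have "op_of n f (graft_op m i (op_of m (\<lambda>xs. g xs + h xs)) v) = op_of n f (?W(i := op_of m g ?z + op_of m h ?z))"
          using arg_cong[OF upd2[of "op_of m (\<lambda>xs. g xs + h xs)" v "op_of m g"], of "op_of n f"] unfolding op_of_add .
        also have "\<dots> = op_of n f (?W(i := op_of m g ?z)) + op_of n f (?W(i := op_of m h ?z))"
          by (rule multilinear_add[OF op_of_multilinear[OF f] *(3)])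
        finally show ?thesis
          unfolding op_of_add op_of_pcomp[OF *(1-3)] upd2[of "op_of m h" v "op_of m g", symmetric] upd[of "op_of m g" v, symmetric] .
      qed
    qed
  next
    fix g c assume "g \<in> carrier (comps (End_operad s gr d) m)"
    then have g: "g \<in> endo_maps s gr d m" by simp
    show "pcomp (End_operad s gr d) n m i f (c \<odot>\<^bsub>comps (End_operad s gr d) m\<^esub> g) =
        c \<odot>\<^bsub>comps (End_operad s gr d) (n + m - 1)\<^esub> pcomp (End_operad s gr d) n m i f g"
      unfolding End_comps
    proof (rule endo_eqI[OF End_pcomp_closed[OF f endo_scale[OF g] *(1-3)] endo_scale[OF End_pcomp_closed[OF f g *(1-3)]]])
      fix v
      show "op_of (n + m - 1) (pcomp (End_operad s gr d) n m i f (\<lambda>xs. s c (g xs))) v =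
        op_of (n + m - 1) (\<lambda>xs. s c (pcomp (End_operad s gr d) n m i f g xs)) v"
      proof -
        let ?z = "\<lambda>l. v (l + (i - 1))" and ?W = "graft_op m i (op_of m g) v"
        have "op_of n f (graft_op m i (op_of m (\<lambda>xs. s c (g xs))) v) = op_of n f (?W(i := s c (op_of m g ?z)))"
          using arg_cong[OF upd2[of "op_of m (\<lambda>xs. s c (g xs))" v "op_of m g"], of "op_of n f"] unfolding op_of_scale .
        also have "\<dots> = s c (op_of n f (?W(i := op_of m g ?z)))"
          by (rule multilinear_scale[OF op_of_multilinear[OF f] *(3)])
        finally show ?thesis
          unfolding op_of_scale op_of_pcomp[OF *(1-3)] upd[of "op_of m g" v, symmetric] .
      qed
    qed
  qed (use End_pcomp_closed[OF f _ *(1-3)] in simp)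
next
  fix n m i g assume *: "(n::nat) \<ge> 1" "(m::nat) \<ge> 1" "i \<in> {1..n}" "g \<in> carrier (comps (End_operad s gr d) m)"
  show "linear_between (comps (End_operad s gr d) n) (comps (End_operad s gr d) (n + m - 1)) (\<lambda>f. pcomp (End_operad s gr d) n m i f g)"
  proof (rule linear_betweenI)
    fix f assume "f \<in> carrier (comps (End_operad s gr d) n)"
    then show "pcomp (End_operad s gr d) n m i f g \<in> carrier (comps (End_operad s gr d) (n + m - 1))"
      using End_pcomp_closed[OF _ _ *(1-3)] * by simp
  qed (auto simp: End_operad_def fun_eq_iff)
qed

end

section \<open>Corollas and cubic elements of free operads\<close>

text \<open>The action of a permutation relabels the leaves by its inverse. Taking the inverse here
  makes the action of \<open>triple_perm (i, j, k)\<close> turn the leaves 1, 2, 3 into i, j,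
  k.\<close>

definition triple_perm :: "nat \<times> nat \<times> nat \<Rightarrow> nat \<Rightarrow> nat"
  where "triple_perm = (\<lambda>(i, j, k). inv_into UNIV (\<lambda>x. if x = 1 then i else if x = 2 then j else if x = 3 then k else x))"

lemma triple_perm:
  assumes "distinct [i, j, k]" "{i, j, k} = {1..3::nat}"
  shows "triple_perm (i, j, k) permutes {1..3}" "inv_into UNIV (triple_perm (i, j, k)) 1 = i"
    "inv_into UNIV (triple_perm (i, j, k)) 2 = j" "inv_into UNIV (triple_perm (i, j, k)) 3 = k"
proof -
  let ?\<tau> = "\<lambda>x. if x = 1 then i else if x = 2 then j else if x = 3 then k else x"
  have 3: "{1..3} = {1, 2, 3::nat}" by auto
  have \<tau>: "?\<tau> permutes {1..3}"
  proof (rule bij_imp_permutes)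
    have "?\<tau> ` {1, 2, 3} = {i, j, k}" by auto
    then have im: "?\<tau> ` {1..3} = {1..3}" using assms(2) by (simp only: 3)
    have "inj_on ?\<tau> {1..3}" by (rule finite_surj_inj) (simp_all only: im finite_atLeastAtMost order_refl)
    with im show "bij_betw ?\<tau> {1..3} {1..3}" by (simp only: bij_betw_def)
  qed auto
  have "inv_into UNIV (inv_into UNIV ?\<tau>) = ?\<tau>" by (rule permutes_inv_inv[OF \<tau>])
  then show "triple_perm (i, j, k) permutes {1..3}" "inv_into UNIV (triple_perm (i, j, k)) 1 = i"
    "inv_into UNIV (triple_perm (i, j, k)) 2 = j" "inv_into UNIV (triple_perm (i, j, k)) 3 = k"
    using permutes_inv[OF \<tau>] by (simp_all add: triple_perm_def)
qed

lemma cyclic_triples_perm: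
  assumes "(i, j, k) \<in> cyclic_triples"
  shows "distinct [i, j, k]" "{i, j, k} = {1..3}"
  using assms by (auto simp: cyclic_triples_def)

lemma length_leaves_pos: "length (leaves t) \<ge> 1"
  by (induction t) auto

lemma leaves_1: "length (leaves t) = 1 \<Longrightarrow> \<exists>i. t = Leaf i"
proof (cases t)
  case (Node e a b)
  assume "length (leaves t) = 1"
  then show ?thesis using length_leaves_pos[of a] length_leaves_pos[of b] Node by simp
qed simp

lemma leaves_2: "length (leaves t) = 2 \<Longrightarrow> \<exists>e i j. t = Node e (Leaf i) (Leaf j)"
proof (cases t)
  case (Node e a b)
  assume "length (leaves t) = 2"
  then have "length (leaves a) = 1" "length (leaves b) = 1"
    using length_leaves_pos[of a] length_leaves_pos[of b] Node by auto
  then show ?thesis using leaves_1 Node by blast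
qed simp

text \<open>The cyclic rotations have index two in the symmetric group on three letters, and
  exchanging the first two entries leads into the other coset.\<close>

lemma cyclic_triples_cases:
  assumes "distinct [i, j, k]" "{i, j, k} = {1..3::nat}"
  shows "(i, j, k) \<in> cyclic_triples \<or> (j, i, k) \<in> cyclic_triples"
proof -
  have "i \<in> {1..3}" "j \<in> {1..3}" "k \<in> {1..3}" using assms(2) by auto
  then have "i = 1 \<or> i = 2 \<or> i = 3" "j = 1 \<or> j = 2 \<or> j = 3" "k = 1 \<or> k = 2 \<or> k = 3" by auto
  then show ?thesis using assms(1) unfolding cyclic_triples_def by auto
qed

text \<open>Elements of arity 3 are handled through lists of terms. Different lists may have the
  same sum, so linear maps are not defined on lists but only evaluated on them.\<close>

definition cubic_sum :: "('k::field, 'e) s2module \<Rightarrow> ('k \<times> 'e \<times> 'e \<times> nat \<times> nat \<times> nat) list \<Rightarrow> ('e btree \<Rightarrow>\<^sub>0 'k) set"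
  where "cubic_sum E ts = foldr (\<lambda>(c, e, e', u) x. c \<odot>\<^bsub>comps (free_operad E) 3\<^esub> cubic E e e' u \<oplus>\<^bsub>comps (free_operad E) 3\<^esub> x)
    ts \<zero>\<^bsub>comps (free_operad E) 3\<^esub>"

lemma cubic_sum_simps [simp]:
  "cubic_sum E [] = \<zero>\<^bsub>comps (free_operad E) 3\<^esub>"
  "cubic_sum E ((c, e, e', u) # ts) = c \<odot>\<^bsub>comps (free_operad E) 3\<^esub> cubic E e e' u \<oplus>\<^bsub>comps (free_operad E) 3\<^esub> cubic_sum E ts"
  by (simp_all add: cubic_sum_def)

definition cubic_terms :: "('k::field, 'e) s2module \<Rightarrow> ('k \<times> 'e \<times> 'e \<times> nat \<times> nat \<times> nat) list \<Rightarrow> bool"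
  where "cubic_terms E ts \<longleftrightarrow> (\<forall>(c, e, e', u)\<in>set ts. e \<in> carrier E \<and> e' \<in> carrier E \<and> u \<in> cyclic_triples)"

lemma cubic_terms_simps [simp]:
  "cubic_terms E []"
  "cubic_terms E ((c, e, e', u) # ts) \<longleftrightarrow> e \<in> carrier E \<and> e' \<in> carrier E \<and> u \<in> cyclic_triples \<and> cubic_terms E ts"
  by (simp_all add: cubic_terms_def)

section \<open>Arities two and three of a free operad\<close>

context
  fixes E :: "('k::field, 'e) s2module"
  assumes E: "s2_module E"
begin

interpretation FQ: operad_quotient "linearize (tree_operad (carrier E)) :: ('k, _) operad" "free_rels E"
  by (rule free_operad_quotient[OF E])

lemma free_comps: "comps (free_operad E) n = quot_module (free_module (elems (tree_operad (carrier E)) n)) (free_rels E n)"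
  unfolding free_operad_def by (simp add: FQ.comps_quot del: tree_operad_simps)

lemma tree_class_closed: "t \<in> elems (tree_operad (carrier E)) n \<Longrightarrow> tree_class E n t \<in> carrier (comps (free_operad E) n)"
  unfolding free_operad_def FQ.carrier_quot tree_class_def by (rule imageI) simp

lemma tree_class_pact:
  assumes "n \<ge> 1" "\<sigma> permutes {1..n}" "t \<in> elems (tree_operad (carrier E)) n"
  shows "pact (free_operad E) n (tree_class E n t) \<sigma> = tree_class E n (sact (tree_operad (carrier E)) n t \<sigma>)"
  unfolding free_operad_def tree_class_def
  by (subst FQ.pact_quot[OF assms(1,2)]) (use assms(3) in simp_all)

lemma tree_class_pcomp:
  assumes "n \<ge> 1" "m \<ge> 1" "i \<in> {1..n}" "t \<in> elems (tree_operad (carrier E)) n" "s \<in> elems (tree_operad (carrier E)) m"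
  shows "pcomp (free_operad E) n m i (tree_class E n t) (tree_class E m s) =
    tree_class E (n + m - 1) (scomp (tree_operad (carrier E)) n m i t s)"
  unfolding free_operad_def tree_class_def
  by (subst FQ.pcomp_quot[OF assms(1-3)]) (use assms(4,5) in \<open>simp_all del: tree_operad_simps(4)\<close>)

lemma corolla_closed: "e \<in> carrier E \<Longrightarrow> corolla E e \<in> carrier (comps (free_operad E) 2)"
  unfolding corolla_def by (rule tree_class_closed) (rule cor_tree_mem)

lemma free_gens_rels: "free_gens E \<subseteq> free_rels E 2"
  unfolding free_rels_eq by (rule ideal_generated_superset)

lemma tree_class_eqI:
  assumes "t \<in> elems (tree_operad (carrier E)) n" "Poly_Mapping.keys q \<subseteq> elems (tree_operad (carrier E)) n"
    and "Poly_Mapping.single t 1 - q \<in> free_rels E n"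
  shows "tree_class E n t = free_rels E n +>\<^bsub>free_module (elems (tree_operad (carrier E)) n)\<^esub> q"
  using kquot.coset_eq[OF FQ.kq, of "Poly_Mapping.single t 1" n q] assms
    free_module_minus[of "Poly_Mapping.single t 1" "elems (tree_operad (carrier E)) n" q]
  by (simp add: tree_class_def del: tree_operad_simps)

lemma corolla_add:
  assumes "e \<in> carrier E" "e' \<in> carrier E"
  shows "corolla E (e \<oplus>\<^bsub>E\<^esub> e') = corolla E e \<oplus>\<^bsub>comps (free_operad E) 2\<^esub> corolla E e'"
proof -
  let ?q = "Poly_Mapping.single (cor_tree e) (1::'k) + Poly_Mapping.single (cor_tree e') 1"
  have "Poly_Mapping.single (cor_tree (e \<oplus>\<^bsub>E\<^esub> e')) 1 - ?q \<in> free_rels E 2"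
    using free_gens_rels assms unfolding free_gens_def diff_diff_add[symmetric] by blast
  moreover have "Poly_Mapping.keys ?q \<subseteq> elems (tree_operad (carrier E)) 2"
    using keys_add[of "Poly_Mapping.single (cor_tree e) (1::'k)" "Poly_Mapping.single (cor_tree e') 1"]
      cor_tree_mem(1)[OF assms(1)] cor_tree_mem(1)[OF assms(2)] by (auto simp del: tree_operad_simps)
  ultimately have "corolla E (e \<oplus>\<^bsub>E\<^esub> e') = free_rels E 2 +>\<^bsub>free_module (elems (tree_operad (carrier E)) 2)\<^esub> ?q"
    unfolding corolla_def by (intro tree_class_eqI cor_tree_mem s2_moduleD(5)[OF E] assms)
  also have "\<dots> = corolla E e \<oplus>\<^bsub>comps (free_operad E) 2\<^esub> corolla E e'"
    using kquot.quot_add[OF FQ.kq, of "Poly_Mapping.single (cor_tree e) 1" 2 "Poly_Mapping.single (cor_tree e') 1"]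
      cor_tree_mem(1)[OF assms(1)] cor_tree_mem(1)[OF assms(2)]
    by (simp add: free_comps corolla_def tree_class_def del: tree_operad_simps)
  finally show ?thesis .
qed

lemma corolla_smult:
  assumes "e \<in> carrier E"
  shows "corolla E (c \<odot>\<^bsub>E\<^esub> e) = c \<odot>\<^bsub>comps (free_operad E) 2\<^esub> corolla E e"
proof -
  let ?q = "Poly_Mapping.single (cor_tree e) c"
  have "Poly_Mapping.single (cor_tree (c \<odot>\<^bsub>E\<^esub> e)) 1 - ?q \<in> free_rels E 2"
    using free_gens_rels assms unfolding free_gens_def by blast
  moreover have "Poly_Mapping.keys ?q \<subseteq> elems (tree_operad (carrier E)) 2"
    using cor_tree_mem(1)[OF assms(1)] by (auto simp del: tree_operad_simps)
  ultimately have "corolla E (c \<odot>\<^bsub>E\<^esub> e) = free_rels E 2 +>\<^bsub>free_module (elems (tree_operad (carrier E)) 2)\<^esub> ?q"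
    unfolding corolla_def by (intro tree_class_eqI cor_tree_mem s2_moduleD(6)[OF E] assms)
  also have "\<dots> = c \<odot>\<^bsub>comps (free_operad E) 2\<^esub> corolla E e"
    using kquot.quot_smult[OF FQ.kq, of "Poly_Mapping.single (cor_tree e) 1" 2 c] cor_tree_mem(1)[OF assms(1)]
    by (simp add: free_comps corolla_def tree_class_def del: tree_operad_simps)
  finally show ?thesis .
qed

lemma corolla_swap: "e \<in> carrier E \<Longrightarrow> corolla E (swap E e) = tree_class E 2 (Node e (Leaf 2) (Leaf 1))"
proof -
  assume e: "e \<in> carrier E"
  have "Poly_Mapping.single (cor_tree (swap E e)) 1 - Poly_Mapping.single (Node e (Leaf 2) (Leaf 1)) 1 \<in> free_rels E 2"
    using free_gens_rels e unfolding free_gens_def by blast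
  moreover have "Poly_Mapping.keys (Poly_Mapping.single (Node e (Leaf 2) (Leaf 1)) (1::'k)) \<subseteq> elems (tree_operad (carrier E)) 2"
    using cor_tree_mem(2)[OF e] by (auto simp del: tree_operad_simps)
  ultimately have "corolla E (swap E e) =
      free_rels E 2 +>\<^bsub>free_module (elems (tree_operad (carrier E)) 2)\<^esub> Poly_Mapping.single (Node e (Leaf 2) (Leaf 1)) 1"
    unfolding corolla_def by (intro tree_class_eqI cor_tree_mem s2_moduleD(4)[OF E] e)
  then show ?thesis by (simp add: tree_class_def del: tree_operad_simps)
qed

text \<open>The relation for \<open>swap\<close> lives in arity 2. Composing with a corolla carries
  it to arity 3, once for the inner and once for the outer vertex; these are the composites that
  occur.\<close>

lemma pcomp_class_2_2:
  assumes "e \<in> carrier E" "e' \<in> carrier E"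
  shows "pcomp (free_operad E) 2 2 1 (corolla E e) (corolla E e') =
      tree_class E 3 (Node e (Node e' (Leaf 1) (Leaf 2)) (Leaf 3))"
    and "pcomp (free_operad E) 2 2 1 (corolla E e) (tree_class E 2 (Node e' (Leaf 2) (Leaf 1))) =
      tree_class E 3 (Node e (Node e' (Leaf 2) (Leaf 1)) (Leaf 3))"
    and "pcomp (free_operad E) 2 2 1 (tree_class E 2 (Node e (Leaf 2) (Leaf 1))) (corolla E e') =
      tree_class E 3 (Node e (Leaf 3) (Node e' (Leaf 1) (Leaf 2)))"
proof -
  have s: "scomp (tree_operad (carrier E)) 2 2 1 (cor_tree e) (cor_tree e') = Node e (Node e' (Leaf 1) (Leaf 2)) (Leaf 3)"
    "scomp (tree_operad (carrier E)) 2 2 1 (cor_tree e) (Node e' (Leaf 2) (Leaf 1)) = Node e (Node e' (Leaf 2) (Leaf 1)) (Leaf 3)"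
    "scomp (tree_operad (carrier E)) 2 2 1 (Node e (Leaf 2) (Leaf 1)) (cor_tree e') = Node e (Leaf 3) (Node e' (Leaf 1) (Leaf 2))"
    by simp_all
  have p: "pcomp (free_operad E) 2 2 1 (tree_class E 2 t) (tree_class E 2 t') =
      tree_class E 3 (scomp (tree_operad (carrier E)) 2 2 1 t t')"
    if "t \<in> elems (tree_operad (carrier E)) 2" "t' \<in> elems (tree_operad (carrier E)) 2" for t t'
    using tree_class_pcomp[of 2 2 1 t t'] that by (simp del: tree_operad_simps)
  note m = cor_tree_mem[OF assms(1)] cor_tree_mem[OF assms(2)]
  show "pcomp (free_operad E) 2 2 1 (corolla E e) (corolla E e') =
      tree_class E 3 (Node e (Node e' (Leaf 1) (Leaf 2)) (Leaf 3))"
    unfolding corolla_def p[OF m(1,3)] s ..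
  show "pcomp (free_operad E) 2 2 1 (corolla E e) (tree_class E 2 (Node e' (Leaf 2) (Leaf 1))) =
      tree_class E 3 (Node e (Node e' (Leaf 2) (Leaf 1)) (Leaf 3))"
    unfolding corolla_def p[OF m(1,4)] s ..
  show "pcomp (free_operad E) 2 2 1 (tree_class E 2 (Node e (Leaf 2) (Leaf 1))) (corolla E e') =
      tree_class E 3 (Node e (Leaf 3) (Node e' (Leaf 1) (Leaf 2)))"
    unfolding corolla_def p[OF m(2,3)] s ..
qed

lemma tree_class_relabel:
  assumes "\<sigma> permutes {1..3}" "t \<in> elems (tree_operad (carrier E)) 3"
  shows "pact (free_operad E) 3 (tree_class E 3 t) \<sigma> = tree_class E 3 (tree_subst (\<lambda>j. Leaf (inv_into UNIV \<sigma> j)) t)"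
  using tree_class_pact[of 3 \<sigma> t] assms by simp

lemma tree3_mem:
  assumes "e \<in> carrier E" "e' \<in> carrier E" "distinct [i, j, k]" "{i, j, k} = {1..3::nat}"
  shows "Node e (Node e' (Leaf i) (Leaf j)) (Leaf k) \<in> elems (tree_operad (carrier E)) 3"
    and "Node e (Leaf k) (Node e' (Leaf i) (Leaf j)) \<in> elems (tree_operad (carrier E)) 3"
  using assms by auto

text \<open>One composition of corollas followed by one permutation: in this form a morphism can be
  evaluated on cubic elements from its values in arity 2.\<close>

lemma cubic_eq_pact:
  assumes "u \<in> cyclic_triples" "e \<in> carrier E" "e' \<in> carrier E"
  shows "cubic E e e' u = pact (free_operad E) 3 (pcomp (free_operad E) 2 2 1 (corolla E e) (corolla E e')) (triple_perm u)"
proof -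
  obtain i j k where u: "u = (i, j, k)" by (cases u)
  note \<sigma> = triple_perm[OF cyclic_triples_perm[OF assms(1)[unfolded u]]]
  show ?thesis
    unfolding pcomp_class_2_2(1)[OF assms(2,3)] u
    by (subst tree_class_relabel[OF \<sigma>(1) tree3_mem(1)[OF assms(2,3)]]) (use \<sigma> in \<open>auto simp: cubic_def\<close>)
qed

text \<open>For the labels 1, 2, 3 this is the relation for \<open>swap\<close> composed with a
  corolla; the action of \<open>triple_perm\<close> yields every other labelling.\<close>

lemma tree_class_swap_inner:
  assumes "e \<in> carrier E" "e' \<in> carrier E" "distinct [i, j, k]" "{i, j, k} = {1..3}"
  shows "tree_class E 3 (Node e (Node e' (Leaf j) (Leaf i)) (Leaf k)) =
    tree_class E 3 (Node e (Node (swap E e') (Leaf i) (Leaf j)) (Leaf k))"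
proof -
  let ?\<sigma> = "triple_perm (i, j, k)"
  note \<sigma> = triple_perm[OF assms(3,4)]
  have "tree_class E 3 (Node e (Node e' (Leaf 2) (Leaf 1)) (Leaf 3)) =
    tree_class E 3 (Node e (Node (swap E e') (Leaf 1) (Leaf 2)) (Leaf 3))"
    unfolding pcomp_class_2_2(1)[OF assms(1) s2_moduleD(4)[OF E assms(2)], symmetric] corolla_swap[OF assms(2)]
    by (rule pcomp_class_2_2(2)[OF assms(1,2), symmetric])
  then have "pact (free_operad E) 3 (tree_class E 3 (Node e (Node e' (Leaf 2) (Leaf 1)) (Leaf 3))) ?\<sigma> =
    pact (free_operad E) 3 (tree_class E 3 (Node e (Node (swap E e') (Leaf 1) (Leaf 2)) (Leaf 3))) ?\<sigma>" by simp
  then show ?thesis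
    using tree_class_relabel[OF \<sigma>(1) tree3_mem(1)[OF assms(1,2), of 2 1 3]]
      tree_class_relabel[OF \<sigma>(1) tree3_mem(1)[OF assms(1) s2_moduleD(4)[OF E assms(2)], of 1 2 3]] \<sigma>
    by (force simp: insert_commute)
qed

lemma tree_class_swap_outer:
  assumes "e \<in> carrier E" "e' \<in> carrier E" "distinct [i, j, k]" "{i, j, k} = {1..3}"
  shows "tree_class E 3 (Node e (Leaf k) (Node e' (Leaf i) (Leaf j))) =
    tree_class E 3 (Node (swap E e) (Node e' (Leaf i) (Leaf j)) (Leaf k))"
proof -
  let ?\<sigma> = "triple_perm (i, j, k)"
  note \<sigma> = triple_perm[OF assms(3,4)]
  have "tree_class E 3 (Node e (Leaf 3) (Node e' (Leaf 1) (Leaf 2))) =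
    tree_class E 3 (Node (swap E e) (Node e' (Leaf 1) (Leaf 2)) (Leaf 3))"
    unfolding pcomp_class_2_2(1)[OF s2_moduleD(4)[OF E assms(1)] assms(2), symmetric] corolla_swap[OF assms(1)]
    by (rule pcomp_class_2_2(3)[OF assms(1,2), symmetric])
  then have "pact (free_operad E) 3 (tree_class E 3 (Node e (Leaf 3) (Node e' (Leaf 1) (Leaf 2)))) ?\<sigma> =
    pact (free_operad E) 3 (tree_class E 3 (Node (swap E e) (Node e' (Leaf 1) (Leaf 2)) (Leaf 3))) ?\<sigma>" by simp
  then show ?thesis
    using tree_class_relabel[OF \<sigma>(1) tree3_mem(2)[OF assms(1,2), of 1 2 3]]
      tree_class_relabel[OF \<sigma>(1) tree3_mem(1)[OF s2_moduleD(4)[OF E assms(1)] assms(2), of 1 2 3]] \<sigma>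
    by force
qed

lemma cubic_closed:
  assumes "e \<in> carrier E" "e' \<in> carrier E" "u \<in> cyclic_triples"
  shows "cubic E e e' u \<in> carrier (comps (free_operad E) 3)"
proof -
  obtain i j k where u: "u = (i, j, k)" by (cases u)
  show ?thesis
    unfolding u cubic_def using tree_class_closed tree3_mem(1)[OF assms(1,2) cyclic_triples_perm[OF assms(3)[unfolded u]]] by simp
qed

lemma tree3_cases:
  assumes "t \<in> elems (tree_operad (carrier E)) 3"
  obtains e e' i j k where "e \<in> carrier E" "e' \<in> carrier E" "distinct [i, j, k]" "{i, j, k} = {1..3}"
    "t = Node e (Node e' (Leaf i) (Leaf j)) (Leaf k) \<or> t = Node e (Leaf k) (Node e' (Leaf i) (Leaf j))"
proof (cases t)
  case (Leaf i)
  have "card {1..3::nat} = 3" by simp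
  moreover have "{i} = {1..3}" using assms Leaf by simp
  ultimately have False by (metis card_1_singleton_iff numeral_eq_one_iff semiring_norm(84) is_singletonI is_singleton_altdef)
  then show ?thesis ..
next
  case (Node e a b)
  have "card (set (leaves t)) = length (leaves t)" using assms by (intro distinct_card) simp
  then have "length (leaves a) + length (leaves b) = 3" using assms Node by simp
  then consider "length (leaves a) = 1" "length (leaves b) = 2" | "length (leaves a) = 2" "length (leaves b) = 1"
    using length_leaves_pos[of a] length_leaves_pos[of b] by linarith
  then show ?thesis
  proof cases
    case 1
    then obtain k e' i j where "a = Leaf k" "b = Node e' (Leaf i) (Leaf j)" using leaves_1 leaves_2 by blast
    then show ?thesis using assms Node by (intro that[of e e' i j k]) auto
  next
    case 2
    then obtain k e' i j where "b = Leaf k" "a = Node e' (Leaf i) (Leaf j)" using leaves_1 leaves_2 by blast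
    then show ?thesis using assms Node by (intro that[of e e' i j k]) auto
  qed
qed

text \<open>Swapping at the root brings the inner vertex to the left; if the triple is then not
  cyclic, a swap at the inner vertex makes it so.\<close>

lemma tree3_class_cubic:
  assumes "t \<in> elems (tree_operad (carrier E)) 3"
  obtains e e' u where "e \<in> carrier E" "e' \<in> carrier E" "u \<in> cyclic_triples" "tree_class E 3 t = cubic E e e' u"
proof -
  obtain e e' i j k where t: "e \<in> carrier E" "e' \<in> carrier E" "distinct [i, j, k]" "{i, j, k} = {1..3}"
    "t = Node e (Node e' (Leaf i) (Leaf j)) (Leaf k) \<or> t = Node e (Leaf k) (Node e' (Leaf i) (Leaf j))"
    using tree3_cases[OF assms] by blast
  obtain e2 where e2: "e2 \<in> carrier E" "tree_class E 3 t = tree_class E 3 (Node e2 (Node e' (Leaf i) (Leaf j)) (Leaf k))"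
    using t(5) tree_class_swap_outer[OF t(1-4)] t(1) s2_moduleD(4)[OF E t(1)] by blast
  from cyclic_triples_cases[OF t(3,4)] show ?thesis
  proof
    assume "(i, j, k) \<in> cyclic_triples"
    then show ?thesis using e2 t(2) by (intro that[of e2 e' "(i, j, k)"]) (simp_all add: cubic_def)
  next
    assume "(j, i, k) \<in> cyclic_triples"
    moreover have "tree_class E 3 (Node e2 (Node e' (Leaf i) (Leaf j)) (Leaf k)) =
        tree_class E 3 (Node e2 (Node (swap E e') (Leaf j) (Leaf i)) (Leaf k))"
      by (rule tree_class_swap_inner[OF e2(1) t(2)]) (use t(3,4) in auto)
    ultimately show ?thesis
      using e2 t(2) s2_moduleD(4)[OF E t(2)] by (intro that[of e2 "swap E e'" "(j, i, k)"]) (simp_all add: cubic_def)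
  qed
qed

lemma free_module_3: "kmodule (comps (free_operad E) n)"
  using lin_operad_module[OF lin_operad_free[OF E]] by (simp add: kmodule_def)

lemma cubic_sum_closed: "cubic_terms E ts \<Longrightarrow> cubic_sum E ts \<in> carrier (comps (free_operad E) 3)"
proof (induction ts)
  case Nil
  interpret kmodule "comps (free_operad E) 3" by (rule free_module_3)
  show ?case by simp
next
  case (Cons a ts)
  interpret kmodule "comps (free_operad E) 3" by (rule free_module_3)
  obtain c e e' u where "a = (c, e, e', u)" by (cases a)
  then show ?case using Cons cubic_closed by simp
qed

text \<open>This is the spanning half of the decomposition of \<open>F(E)(3)\<close> into three
  copies of \<open>E \<otimes> E\<close>. What is used of the other half is the existence of
  coordinate functionals, in \<open>cubic_functional\<close>.\<close>

lemma cubic_span: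
  assumes "x \<in> carrier (comps (free_operad E) 3)"
  obtains ts where "cubic_terms E ts" "x = cubic_sum E ts"
proof -
  let ?F = "comps (free_operad E) 3" and ?T = "elems (tree_operad (carrier E)) 3"
  let ?c = "\<lambda>p. free_rels E 3 +>\<^bsub>free_module ?T\<^esub> p"
  obtain p where p: "Poly_Mapping.keys p \<subseteq> ?T" "x = ?c p"
    using assms unfolding free_operad_def FQ.carrier_quot by (auto simp del: tree_operad_simps)
  have "\<exists>ts. cubic_terms E ts \<and> ?c p = cubic_sum E ts"
    using p(1)
  proof (induction p rule: free_module_induct)
    case zero
    have "?c 0 = \<zero>\<^bsub>?F\<^esub>"
      using kquot.quot_zero[OF FQ.kq, of 3] by (simp add: free_comps del: tree_operad_simps)
    then show ?case by (intro exI[of _ "[]"]) simp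
  next
    case (add p t c)
    interpret kmodule ?F by (rule free_module_3)
    obtain ts where ts: "cubic_terms E ts" "?c p = cubic_sum E ts" using add.IH by blast
    obtain e e' u where t: "e \<in> carrier E" "e' \<in> carrier E" "u \<in> cyclic_triples" "tree_class E 3 t = cubic E e e' u"
      using tree3_class_cubic[OF add.hyps(2)] by blast
    have "?c (p + Poly_Mapping.single t c) = ?c p \<oplus>\<^bsub>?F\<^esub> ?c (Poly_Mapping.single t c)"
      using kquot.quot_add[OF FQ.kq, of p 3 "Poly_Mapping.single t c"] add.hyps
      by (simp add: free_comps del: tree_operad_simps)
    also have "?c (Poly_Mapping.single t c) = c \<odot>\<^bsub>?F\<^esub> tree_class E 3 t"
      using kquot.quot_smult[OF FQ.kq, of "Poly_Mapping.single t 1" 3 c] add.hyps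
      by (simp add: free_comps tree_class_def del: tree_operad_simps)
    also have "?c p \<oplus>\<^bsub>?F\<^esub> c \<odot>\<^bsub>?F\<^esub> tree_class E 3 t = cubic_sum E ((c, e, e', u) # ts)"
      using t ts cubic_closed[OF t(1-3)] cubic_sum_closed[OF ts(1)] by (simp add: M.a_comm)
    finally show ?case using t ts by (intro exI[of _ "(c, e, e', u) # ts"]) simp
  qed
  then show ?thesis using p(2) that by blast
qed

lemma linear_cubic_sum:
  assumes L: "module KK L" and h: "linear_between (comps (free_operad E) 3) L h" and "cubic_terms E ts"
  shows "h (cubic_sum E ts) = foldr (\<lambda>(c, e, e', u) x. c \<odot>\<^bsub>L\<^esub> h (cubic E e e' u) \<oplus>\<^bsub>L\<^esub> x) ts \<zero>\<^bsub>L\<^esub>"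
  using assms(3)
proof (induction ts)
  case Nil
  show ?case using linear_between_zero[OF _ L h] lin_operad_module[OF lin_operad_free[OF E]] by simp
next
  case (Cons a ts)
  interpret kmodule "comps (free_operad E) 3" by (rule free_module_3)
  obtain c e e' u where a: "a = (c, e, e', u)" by (cases a)
  then show ?case
    using Cons cubic_closed[of e e' u] cubic_sum_closed[of ts]
    by (simp add: linear_betweenD[OF h])
qed

lemma hom_cubic:
  assumes \<phi>: "operad_hom (free_operad E) Q \<phi>" and u: "u \<in> cyclic_triples"
    and e: "e \<in> carrier E" "e' \<in> carrier E"
  shows "\<phi> 3 (cubic E e e' u) = pact Q 3 (pcomp Q 2 2 1 (\<phi> 2 (corolla E e)) (\<phi> 2 (corolla E e'))) (triple_perm u)"
proof -
  obtain i j k where ijk: "u = (i, j, k)" by (cases u)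
  note \<sigma> = triple_perm(1)[OF cyclic_triples_perm[OF u[unfolded ijk]], folded ijk]
  have c: "pcomp (free_operad E) 2 2 1 (corolla E e) (corolla E e') \<in> carrier (comps (free_operad E) 3)"
    using lin_operad_pcomp_closed[OF lin_operad_free[OF E], of 2 2 1] corolla_closed e by simp
  have "\<phi> 3 (pcomp (free_operad E) 2 2 1 (corolla E e) (corolla E e')) = pcomp Q 2 2 1 (\<phi> 2 (corolla E e)) (\<phi> 2 (corolla E e'))"
    using operad_hom_pcomp[OF \<phi>, of 2 2 1] corolla_closed e by simp
  then show ?thesis
    unfolding cubic_eq_pact[OF u e] using operad_hom_pact[OF \<phi> _ c \<sigma>] by simp
qed

end

section \<open>Morphisms from free operads to endomorphism operads\<close>

lemma odd_sum_iff: "finite A \<Longrightarrow> odd (sum f A :: int) \<longleftrightarrow> odd (card {a \<in> A. odd (f a)})"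
  using even_sum_iff[of A f] by simp

text \<open>An algebra over the free operad on \<open>E\<close>, given by its binary operations. The
  symmetry \<open>m_swap\<close> is demanded on homogeneous arguments, where its sign is meaningful;
  since \<open>d\<close> is even the operations themselves cause no signs.\<close>

locale tree_algebra = graded s gr
  for s :: "'k::field \<Rightarrow> 'a::ab_group_add \<Rightarrow> 'a" and gr :: "int \<Rightarrow> 'a set" +
  fixes E :: "('k, 'e) s2module" and d :: int and m :: "'e \<Rightarrow> 'a \<Rightarrow> 'a \<Rightarrow> 'a"
  assumes E: "s2_module E" and even_d: "even d"
    and m_add_left: "\<And>e a b c. e \<in> carrier E \<Longrightarrow> m e (a + b) c = m e a c + m e b c"
    and m_add_right: "\<And>e a b c. e \<in> carrier E \<Longrightarrow> m e c (a + b) = m e c a + m e c b"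
    and m_scale_left: "\<And>e r a b. e \<in> carrier E \<Longrightarrow> m e (s r a) b = s r (m e a b)"
    and m_scale_right: "\<And>e r a b. e \<in> carrier E \<Longrightarrow> m e b (s r a) = s r (m e b a)"
    and m_deg: "\<And>e k l a b. e \<in> carrier E \<Longrightarrow> a \<in> gr k \<Longrightarrow> b \<in> gr l \<Longrightarrow> m e a b \<in> gr (k + l + d)"
    and m_add: "\<And>e e' a b. e \<in> carrier E \<Longrightarrow> e' \<in> carrier E \<Longrightarrow> m (e \<oplus>\<^bsub>E\<^esub> e') a b = m e a b + m e' a b"
    and m_smult: "\<And>e r a b. e \<in> carrier E \<Longrightarrow> m (r \<odot>\<^bsub>E\<^esub> e) a b = s r (m e a b)"
    and m_swap: "\<And>e k l a b. e \<in> carrier E \<Longrightarrow> a \<in> gr k \<Longrightarrow> b \<in> gr l \<Longrightarrow>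
      m (swap E e) a b = s (if odd k \<and> odd l then - 1 else 1) (m e b a)"
begin

text \<open>A binary tree has one vertex less than it has leaves, and each vertex contributes the
  degree \<open>d\<close>.\<close>

lemma tree_eval_deg:
  assumes "set_btree t \<subseteq> carrier E" "distinct (leaves t)" "\<And>i. i \<in> set (leaves t) \<Longrightarrow> v i \<in> gr (k i)"
  shows "tree_eval m t v \<in> gr ((\<Sum>i\<in>set (leaves t). k i) + d * (int (length (leaves t)) - 1))"
  using assms
proof (induction t)
  case (Node e a b)
  have "m e (tree_eval m a v) (tree_eval m b v) \<in> gr (((\<Sum>i\<in>set (leaves a). k i) + d * (int (length (leaves a)) - 1)) +
      ((\<Sum>i\<in>set (leaves b). k i) + d * (int (length (leaves b)) - 1)) + d)"
    by (rule m_deg) (use Node in auto)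
  moreover have "(\<Sum>i\<in>set (leaves a) \<union> set (leaves b). k i) = (\<Sum>i\<in>set (leaves a). k i) + (\<Sum>i\<in>set (leaves b). k i)"
    using Node.prems by (intro sum.union_disjoint) auto
  ultimately show ?case by (simp add: algebra_simps)
qed simp

lemma tree_eval_multilinear:
  assumes "t \<in> elems (tree_operad (carrier E)) n"
  shows "multilinear s gr d n (tree_eval m t)"
proof -
  have t: "set_btree t \<subseteq> carrier E" "distinct (leaves t)" "set (leaves t) = {1..n}" using assms by auto
  then have len: "length (leaves t) = n" using distinct_card[OF t(2)] by simp
  show ?thesis
    unfolding multilinear_def
  proof (intro conjI allI ballI impI)
    fix v w :: "nat \<Rightarrow> 'a" assume "\<forall>i\<in>{1..n}. v i = w i"
    then show "tree_eval m t v = tree_eval m t w" using t(3) by (intro tree_eval_cong) auto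
  next
    fix v i a b assume "i \<in> {1..n}"
    then show "tree_eval m t (v(i := a + b)) = tree_eval m t (v(i := a)) + tree_eval m t (v(i := b))"
      using t(3) by (intro tree_eval_add[OF t(1,2)] m_add_left m_add_right) auto
  next
    fix v i c a assume "i \<in> {1..n}"
    then show "tree_eval m t (v(i := s c a)) = s c (tree_eval m t (v(i := a)))"
      using t(3) by (intro tree_eval_scale[OF t(1,2)] m_scale_left m_scale_right) auto
  next
    fix k v assume "homogeneous gr n k v"
    then show "tree_eval m t v \<in> gr ((\<Sum>i=1..n. k i) + d * (int n - 1))"
      using tree_eval_deg[OF t(1,2), of v k] t(3) len by (simp add: homogeneous_def)
  qed
qed

text \<open>Evaluating a tree uses the arguments in the order of its leaves, so as an operation on
  \<open>x_1\<close>, ..., \<open>x_n\<close> it carries the sign of that rearrangement. The sign is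
  known on homogeneous arguments; the multilinear map with these values is supplied by
  \<open>parity_twist\<close>.\<close>

definition tree_op :: "nat \<Rightarrow> 'e btree \<Rightarrow> 'a list \<Rightarrow> 'a"
  where "tree_op n t = (SOME f. f \<in> endo_maps s gr d n \<and> (\<forall>k v. homogeneous gr n k v \<longrightarrow>
    op_of n f v = s (list_sign (odd_indices n k) (leaves t)) (tree_eval m t v)))"

lemma tree_op:
  assumes t: "t \<in> elems (tree_operad (carrier E)) n"
  shows tree_op_endo: "tree_op n t \<in> endo_maps s gr d n"
    and tree_op_eq: "\<And>k v. homogeneous gr n k v \<Longrightarrow>
      op_of n (tree_op n t) v = s (list_sign (odd_indices n k) (leaves t)) (tree_eval m t v)"
proof -
  let ?P = "\<lambda>f. f \<in> endo_maps s gr d n \<and> (\<forall>k v. homogeneous gr n k v \<longrightarrow>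
    op_of n f v = s (list_sign (odd_indices n k) (leaves t)) (tree_eval m t v))"
  obtain G where G: "multilinear s gr d n G"
    "\<And>k v. homogeneous gr n k v \<Longrightarrow> G v = s (list_sign (odd_indices n k) (leaves t)) (tree_eval m t v)"
    using parity_twist[OF tree_eval_multilinear[OF t], of "\<lambda>A. list_sign A (leaves t)"] by blast
  have "?P (list_op n G)"
    using list_op_endo[OF G(1)] G(2) by (simp add: op_of_list_op[OF G(1)])
  from someI[of ?P, OF this] have "?P (tree_op n t)" unfolding tree_op_def .
  then show "tree_op n t \<in> endo_maps s gr d n" "\<And>k v. homogeneous gr n k v \<Longrightarrow>
      op_of n (tree_op n t) v = s (list_sign (odd_indices n k) (leaves t)) (tree_eval m t v)"
    by blast+
qed

lemma elems_leaves: "t \<in> elems (tree_operad S) n \<Longrightarrow> distinct (leaves t)" "t \<in> elems (tree_operad S) n \<Longrightarrow> set (leaves t) = {1..n}"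
  by simp_all

text \<open>Relabelling composes the order of the leaves with a permutation. By the cocycle rule the
  sign splits into that of the action and that of the original leaves for the permuted
  degrees.\<close>

lemma tree_op_act:
  assumes "n \<ge> 1" and t: "t \<in> elems (tree_operad (carrier E)) n" and \<sigma>: "\<sigma> permutes {1..n}"
  shows "tree_op n (sact (tree_operad (carrier E)) n t \<sigma>) = pact (End_operad s gr d) n (tree_op n t) \<sigma>"
proof -
  let ?\<tau> = "inv_into UNIV \<sigma>" and ?t = "sact (tree_operad (carrier E)) n t \<sigma>"
  have \<tau>: "?\<tau> permutes {1..n}" by (rule permutes_inv[OF \<sigma>])
  have t': "?t \<in> elems (tree_operad (carrier E)) n"
    using tree_operad_closed[of "carrier E"] assms unfolding set_operad_closed_def by blast
  show ?thesis
  proof (rule endo_eqI[OF tree_op_endo[OF t'] End_pact_closed[OF tree_op_endo[OF t] \<sigma>]])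
    fix k v assume h: "homogeneous gr n k v"
    let ?A = "odd_indices n k"
    have h': "homogeneous gr n (\<lambda>i. k (?\<tau> i)) (\<lambda>i. v (?\<tau> i))"
      unfolding homogeneous_def
    proof
      fix i assume "i \<in> {1..n}"
      then have "?\<tau> i \<in> {1..n}" using permutes_in_image[OF \<tau>] by blast
      with h show "v (?\<tau> i) \<in> gr (k (?\<tau> i))" by (simp add: homogeneous_def)
    qed
    have A: "odd_indices n (\<lambda>i. k (?\<tau> i)) = ?\<tau> -` ?A"
      using permutes_in_image[OF \<tau>] by auto
    have ev: "tree_eval m ?t v = tree_eval m t (\<lambda>i. v (?\<tau> i))" "leaves ?t = map ?\<tau> (leaves t)"
      by (simp_all add: tree_eval_subst leaves_subst_Leaf)
    have "op_of n (tree_op n ?t) v = s (list_sign ?A (map ?\<tau> (leaves t))) (tree_eval m t (\<lambda>i. v (?\<tau> i)))"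
      using tree_op_eq[OF t' h] unfolding ev .
    also have "list_sign ?A (map ?\<tau> (leaves t)) = list_sign ?A (map ?\<tau> [1..<Suc n]) * (list_sign (?\<tau> -` ?A) (leaves t) :: 'k)"
      by (rule list_sign_cocycle[OF elems_leaves[OF t] permutes_inj[OF \<tau>]])
    finally show "op_of n (tree_op n ?t) v = op_of n (pact (End_operad s gr d) n (tree_op n t) \<sigma>) v"
      unfolding End_pact_eq[OF tree_op_endo[OF t] \<sigma> h] tree_op_eq[OF t h'] A V.scale_scale .
  qed
qed

lemma tree_op_ident: "tree_op 1 (Leaf 1) = ident (End_operad s gr d)"
proof -
  have t: "Leaf 1 \<in> elems (tree_operad (carrier E)) 1" by simp
  have id: "ident (End_operad s gr d) \<in> endo_maps s gr d 1"
    using lin_operad_ident[OF lin_operad_End, of d] by simp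
  show ?thesis
  proof (rule endo_eqI[OF tree_op_endo[OF t] id])
    fix k v assume h: "homogeneous gr 1 k v"
    show "op_of 1 (tree_op 1 (Leaf 1)) v = op_of 1 (ident (End_operad s gr d)) v"
      unfolding tree_op_eq[OF t h] by (simp add: op_of_def End_operad_def)
  qed
qed

lemma graft_op_tree_eval:
  "(\<lambda>j. tree_eval m (graft l i r j) v) = graft_op l i (tree_eval m r) v"
  by (auto simp: fun_eq_iff graft_op_def tree_eval_subst)

text \<open>The argument at position \<open>i\<close> has the total degree of its block plus the
  even number \<open>e\<close>, so its parity is that of the number of odd arguments in the block.
  This matches the parity of blocks in \<open>list_sign_graft\<close>.\<close>

lemma odd_graft_deg:
  assumes "a \<in> {1..n}" "n \<ge> 1" "l \<ge> 1" "i \<in> {1..n}" "set K = {1..l}" "even e"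
  shows "odd (graft_deg l i e k a) \<longleftrightarrow> odd (card (odd_indices (n + l - 1) k \<inter> set (graft_block l i K a)))"
proof -
  let ?A = "odd_indices (n + l - 1) k"
  have single: "card (?A \<inter> {x}) = (if odd (k x) then 1 else 0)" if "x \<in> {1..n + l - 1}" for x
  proof -
    have "?A \<inter> {x} = (if odd (k x) then {x} else {})" using that by auto
    then show ?thesis by simp
  qed
  consider "a < i" | "a = i" | "i < a" by linarith
  then show ?thesis
  proof cases
    case 1
    then have "a \<in> {1..n + l - 1}" using assms by auto
    then show ?thesis using 1 single[of a] by (simp add: graft_deg_def)
  next
    case 2
    have "?A \<inter> (\<lambda>l. l + (i - 1)) ` {1..l} = (\<lambda>l. l + (i - 1)) ` {x \<in> {1..l}. odd (k (x + (i - 1)))}"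
      using assms(2-4) by auto
    then have "card (?A \<inter> (\<lambda>l. l + (i - 1)) ` {1..l}) = card {x \<in> {1..l}. odd (k (x + (i - 1)))}"
      by (simp only:) (rule card_image, simp add: inj_on_def)
    then have "odd (card (?A \<inter> (\<lambda>l. l + (i - 1)) ` {1..l})) \<longleftrightarrow> odd (\<Sum>x=1..l. k (x + (i - 1)))"
      using odd_sum_iff[of "{1..l}" "\<lambda>x. k (x + (i - 1))"] by (simp only: finite_atLeastAtMost simp_thms)
    moreover have "set (graft_block l i K a) = (\<lambda>l. l + (i - 1)) ` {1..l}"
      using 2 assms(5) by (simp only: set_map less_irrefl if_False if_True refl)
    moreover have "graft_deg l i e k a = (\<Sum>x=1..l. k (x + (i - 1))) + e"
      using 2 by (simp only: graft_deg_def less_irrefl if_False if_True refl)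
    ultimately show ?thesis using assms(6) by (simp only: even_add simp_thms)
  next
    case 3
    then have "a + l - 1 \<in> {1..n + l - 1}" using assms by auto
    then show ?thesis using 3 single[of "a + l - 1"] by (simp add: graft_deg_def)
  qed
qed

lemma tree_op_comp:
  assumes n: "n \<ge> 1" "l \<ge> 1" "i \<in> {1..n}" and t: "t \<in> elems (tree_operad (carrier E)) n"
    and r: "r \<in> elems (tree_operad (carrier E)) l"
  shows "tree_op (n + l - 1) (scomp (tree_operad (carrier E)) n l i t r) =
    pcomp (End_operad s gr d) n l i (tree_op n t) (tree_op l r)"
proof -
  let ?t = "scomp (tree_operad (carrier E)) n l i t r" and ?N = "n + l - 1"
  have t': "?t \<in> elems (tree_operad (carrier E)) ?N"
    using tree_operad_closed[of "carrier E"] assms unfolding set_operad_closed_def by blast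
  show ?thesis
  proof (rule endo_eqI[OF tree_op_endo[OF t'] End_pcomp_closed[OF tree_op_endo[OF t] tree_op_endo[OF r] n]])
    fix k v assume h: "homogeneous gr ?N k v"
    let ?A = "odd_indices ?N k" and ?k' = "graft_deg l i (d * (int l - 1)) k"
    let ?z = "\<lambda>x. v (x + (i - 1))" and ?kz = "\<lambda>x. k (x + (i - 1))"
    have hz: "homogeneous gr l ?kz ?z"
      unfolding homogeneous_def
    proof
      fix x assume "x \<in> {1..l}"
      then have "x + (i - 1) \<in> {1..?N}" using n by auto
      with h show "v (x + (i - 1)) \<in> gr (k (x + (i - 1)))" by (simp only: homogeneous_def)
    qed
    have hg: "homogeneous gr n ?k' (graft_op l i (op_of l (tree_op l r)) v)"
      by (rule homogeneous_graft[OF op_of_multilinear[OF tree_op_endo[OF r]] h n])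
    let ?c = "list_sign (odd_indices l ?kz) (leaves r) :: 'k"
    have upd: "graft_op l i (op_of l (tree_op l r)) v = (graft_op l i (tree_eval m r) v)(i := s ?c (tree_eval m r ?z))"
      using tree_op_eq[OF r hz] by (auto simp: graft_op_def fun_eq_iff)
    have upd2: "graft_op l i (tree_eval m r) v = (graft_op l i (tree_eval m r) v)(i := tree_eval m r ?z)"
      by (auto simp: graft_op_def fun_eq_iff)
    \<comment> \<open>The inner operation enters at one argument of \<open>t\<close>, so its sign is
      a scalar that multilinearity pulls out.\<close>
    have "tree_eval m t (graft_op l i (op_of l (tree_op l r)) v) = s ?c (tree_eval m t (graft_op l i (tree_eval m r) v))"
      unfolding upd multilinear_scale[OF tree_eval_multilinear[OF t] n(3)] upd2[symmetric] ..
    then have R: "op_of ?N (pcomp (End_operad s gr d) n l i (tree_op n t) (tree_op l r)) v =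
        s (list_sign (odd_indices n ?k') (leaves t) * ?c) (tree_eval m t (graft_op l i (tree_eval m r) v))"
      unfolding op_of_pcomp[OF n] tree_op_eq[OF t hg] by simp
    have ev: "tree_eval m ?t v = tree_eval m t (graft_op l i (tree_eval m r) v)"
      unfolding tree_operad_simps(4) tree_eval_subst graft_op_tree_eval ..
    have lv: "leaves ?t = concat (map (graft_block l i (leaves r)) (leaves t))"
      unfolding tree_operad_simps(4) leaves_graft ..
    have "list_sign ?A (leaves ?t) = list_sign {x. x + (i - 1) \<in> ?A} (leaves r) *
        (list_sign {a. odd (card (?A \<inter> set (graft_block l i (leaves r) a)))} (leaves t) :: 'k)"
      unfolding lv by (rule list_sign_graft[OF elems_leaves[OF t] elems_leaves[OF r] n(3,2)])
    also have "list_sign {x. x + (i - 1) \<in> ?A} (leaves r) = ?c"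
    proof (rule list_sign_cong[OF elems_leaves(1)[OF r]])
      show "{x. x + (i - 1) \<in> ?A} \<inter> set (leaves r) = odd_indices l ?kz \<inter> set (leaves r)"
        unfolding elems_leaves(2)[OF r] using n by auto
    qed
    also have "list_sign {a. odd (card (?A \<inter> set (graft_block l i (leaves r) a)))} (leaves t) =
        (list_sign (odd_indices n ?k') (leaves t) :: 'k)"
    proof (rule list_sign_cong[OF elems_leaves(1)[OF t]])
      show "{a. odd (card (?A \<inter> set (graft_block l i (leaves r) a)))} \<inter> set (leaves t) =
          odd_indices n ?k' \<inter> set (leaves t)"
      proof (rule Set.set_eqI)
        fix a
        show "a \<in> {a. odd (card (?A \<inter> set (graft_block l i (leaves r) a)))} \<inter> set (leaves t) \<longleftrightarrow>
          a \<in> odd_indices n ?k' \<inter> set (leaves t)"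
          using odd_graft_deg[OF _ n elems_leaves(2)[OF r], of a "d * (int l - 1)" k] even_d
          unfolding elems_leaves(2)[OF t] by (simp only: Int_iff mem_Collect_eq even_mult_iff) blast
      qed
    qed
    finally show "op_of ?N (tree_op ?N ?t) v = op_of ?N (pcomp (End_operad s gr d) n l i (tree_op n t) (tree_op l r)) v"
      unfolding R tree_op_eq[OF t' h] ev by (simp only: mult.commute)
  qed
qed

lemma list_sign_12: "list_sign A [1, 2] = (1::'k)" "list_sign A [2, 1] = (if 1 \<in> A \<and> 2 \<in> A then - 1 else (1::'k))"
  by (auto simp: inversion_sign_def)

text \<open>Besides the universal property for endomorphism operads this records the value on every
  tree, with its sign; the evaluations of cubic elements below rest on that formula.\<close>

theorem free_operad_to_End:
  obtains \<psi> where "operad_hom (free_operad E) (End_operad s gr d) \<psi>"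
    and "\<And>n t k v. n \<ge> 1 \<Longrightarrow> t \<in> elems (tree_operad (carrier E)) n \<Longrightarrow> homogeneous gr n k v \<Longrightarrow>
      op_of n (\<psi> n (tree_class E n t)) v = s (list_sign (odd_indices n k) (leaves t)) (tree_eval m t v)"
proof -
  let ?Q = "End_operad s gr d"
  have id: "tree_op 1 (sident (tree_operad (carrier E))) = ident ?Q"
    unfolding tree_operad_simps(3) by (rule tree_op_ident)
  have car: "tree_op n t \<in> carrier (comps ?Q n)" if "n \<ge> 1" "t \<in> elems (tree_operad (carrier E)) n" for n t
    unfolding End_comps by (rule tree_op_endo[OF that(2)])
  obtain \<phi> where \<phi>: "operad_hom (linearize (tree_operad (carrier E))) ?Q \<phi>"
    "\<And>n t c. n \<ge> 1 \<Longrightarrow> t \<in> elems (tree_operad (carrier E)) n \<Longrightarrow> \<phi> n (Poly_Mapping.single t c) = c \<odot>\<^bsub>comps ?Q n\<^esub> tree_op n t"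
    by (rule hom_linearize[OF tree_operad_closed lin_operad_End car tree_op_act id tree_op_comp])
      (assumption | (rule that; assumption))+
  have \<phi>1: "\<phi> n (Poly_Mapping.single t 1) = tree_op n t" if "n \<ge> 1" "t \<in> elems (tree_operad (carrier E)) n" for n t
    using \<phi>(2)[OF that, of 1] by (simp add: fun_eq_iff)
  have \<phi>2: "\<phi> 2 (Poly_Mapping.single t 1) = tree_op 2 t" if "t \<in> elems (tree_operad (carrier E)) 2" for t
    by (rule \<phi>1[OF _ that]) simp
  \<comment> \<open>For the corolla with leaves in the order 2, 1 the sign of the leaves is the
    Koszul sign of exchanging two arguments. So the relation for \<open>swap\<close> holds precisely
    by \<open>m_swap\<close>.\<close>
  have cor: "op_of 2 (tree_op 2 (cor_tree e)) v = m e (v 1) (v 2)"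
    "op_of 2 (tree_op 2 (Node e (Leaf 2) (Leaf 1))) v = s (if odd (k 1) \<and> odd (k 2) then - 1 else 1) (m e (v 2) (v 1))"
    if "e \<in> carrier E" "homogeneous gr 2 k v" for e k v
    unfolding tree_op_eq[OF cor_tree_mem(1)[OF that(1)] that(2)] tree_op_eq[OF cor_tree_mem(2)[OF that(1)] that(2)]
    using list_sign_12[of "odd_indices 2 k"] by simp_all
  have m1: "e \<in> carrier E \<Longrightarrow> tree_op 2 (cor_tree e) \<in> endo_maps s gr d 2" for e
    by (rule tree_op_endo[OF cor_tree_mem(1)])
  obtain \<psi> where \<psi>: "operad_hom (free_operad E) ?Q \<psi>"
    "\<And>n t. n \<ge> 1 \<Longrightarrow> t \<in> elems (tree_operad (carrier E)) n \<Longrightarrow> \<psi> n (tree_class E n t) = \<phi> n (Poly_Mapping.single t 1)"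
  proof (rule free_operad_hom[OF E lin_operad_End \<phi>(1)])
    fix e e' assume e: "e \<in> carrier E" "e' \<in> carrier E"
    have "tree_op 2 (cor_tree (e \<oplus>\<^bsub>E\<^esub> e')) = (\<lambda>xs. tree_op 2 (cor_tree e) xs + tree_op 2 (cor_tree e') xs)"
    proof (rule endo_eqI[OF m1[OF s2_moduleD(5)[OF E e]] endo_add[OF m1[OF e(1)] m1[OF e(2)]]])
      fix k v assume h: "homogeneous gr 2 k v"
      show "op_of 2 (tree_op 2 (cor_tree (e \<oplus>\<^bsub>E\<^esub> e'))) v =
          op_of 2 (\<lambda>xs. tree_op 2 (cor_tree e) xs + tree_op 2 (cor_tree e') xs) v"
        unfolding op_of_add cor(1)[OF e(1) h] cor(1)[OF e(2) h] cor(1)[OF s2_moduleD(5)[OF E e] h] by (rule m_add[OF e])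
    qed
    then show "\<phi> 2 (Poly_Mapping.single (cor_tree (e \<oplus>\<^bsub>E\<^esub> e')) 1) =
      \<phi> 2 (Poly_Mapping.single (cor_tree e) 1) \<oplus>\<^bsub>comps ?Q 2\<^esub> \<phi> 2 (Poly_Mapping.single (cor_tree e') 1)"
      unfolding \<phi>2[OF cor_tree_mem(1)[OF s2_moduleD(5)[OF E e]]] \<phi>2[OF cor_tree_mem(1)[OF e(1)]] \<phi>2[OF cor_tree_mem(1)[OF e(2)]]
      by simp
  next
    fix c e assume e: "e \<in> carrier E"
    have "tree_op 2 (cor_tree (c \<odot>\<^bsub>E\<^esub> e)) = (\<lambda>xs. s c (tree_op 2 (cor_tree e) xs))"
    proof (rule endo_eqI[OF m1[OF s2_moduleD(6)[OF E e]] endo_scale[OF m1[OF e]]])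
      fix k v assume h: "homogeneous gr 2 k v"
      show "op_of 2 (tree_op 2 (cor_tree (c \<odot>\<^bsub>E\<^esub> e))) v = op_of 2 (\<lambda>xs. s c (tree_op 2 (cor_tree e) xs)) v"
        unfolding op_of_scale cor(1)[OF e h] cor(1)[OF s2_moduleD(6)[OF E e] h] by (rule m_smult[OF e])
    qed
    then show "\<phi> 2 (Poly_Mapping.single (cor_tree (c \<odot>\<^bsub>E\<^esub> e)) 1) =
      c \<odot>\<^bsub>comps ?Q 2\<^esub> \<phi> 2 (Poly_Mapping.single (cor_tree e) 1)"
      unfolding \<phi>2[OF cor_tree_mem(1)[OF s2_moduleD(6)[OF E e]]] \<phi>2[OF cor_tree_mem(1)[OF e]] by simp
  next
    fix e assume e: "e \<in> carrier E"
    have "tree_op 2 (cor_tree (swap E e)) = tree_op 2 (Node e (Leaf 2) (Leaf 1))"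
    proof (rule endo_eqI[OF m1[OF s2_moduleD(4)[OF E e]] tree_op_endo[OF cor_tree_mem(2)[OF e]]])
      fix k v assume h: "homogeneous gr 2 k v"
      then have "v 1 \<in> gr (k 1)" "v 2 \<in> gr (k 2)" by (simp_all add: homogeneous_def)
      then show "op_of 2 (tree_op 2 (cor_tree (swap E e))) v = op_of 2 (tree_op 2 (Node e (Leaf 2) (Leaf 1))) v"
        unfolding cor(1)[OF s2_moduleD(4)[OF E e] h] cor(2)[OF e h] by (rule m_swap[OF e])
    qed
    then show "\<phi> 2 (Poly_Mapping.single (cor_tree (swap E e)) 1) = \<phi> 2 (Poly_Mapping.single (Node e (Leaf 2) (Leaf 1)) 1)"
      unfolding \<phi>2[OF cor_tree_mem(1)[OF s2_moduleD(4)[OF E e]]] \<phi>2[OF cor_tree_mem(2)[OF e]] .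
  qed blast
  have "op_of n (\<psi> n (tree_class E n t)) v = s (list_sign (odd_indices n k) (leaves t)) (tree_eval m t v)"
    if "n \<ge> 1" "t \<in> elems (tree_operad (carrier E)) n" "homogeneous gr n k v" for n t k v
    unfolding \<psi>(2)[OF that(1,2)] \<phi>1[OF that(1,2)] by (rule tree_op_eq[OF that(2,3)])
  with \<psi>(1) show ?thesis using that by blast
qed

text \<open>The leaves 1, 2 are in increasing order, so no sign occurs and the formula extends from
  homogeneous arguments to all of them.\<close>

lemma corolla_value:
  assumes \<psi>: "operad_hom (free_operad E) (End_operad s gr d) \<psi>"
    "\<And>n t k v. n \<ge> 1 \<Longrightarrow> t \<in> elems (tree_operad (carrier E)) n \<Longrightarrow> homogeneous gr n k v \<Longrightarrow>
      op_of n (\<psi> n (tree_class E n t)) v = s (list_sign (odd_indices n k) (leaves t)) (tree_eval m t v)"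
    and e: "e \<in> carrier E"
  shows "\<psi> 2 (corolla E e) [x, y] = m e x y"
proof -
  have "\<psi> 2 (corolla E e) \<in> endo_maps s gr d 2"
    using operad_hom_closed[OF \<psi>(1), of 2] corolla_closed[OF E e] by simp
  then have "op_of 2 (\<psi> 2 (corolla E e)) v = tree_eval m (cor_tree e) v" for v
  proof (rule homogeneous_induct[OF op_of_multilinear tree_eval_multilinear[OF cor_tree_mem(1)[OF e]]])
    fix k v assume "homogeneous gr 2 k v"
    then show "op_of 2 (\<psi> 2 (corolla E e)) v = tree_eval m (cor_tree e) v"
      unfolding corolla_def using \<psi>(2)[OF _ cor_tree_mem(1)[OF e]] list_sign_12(1) by simp
  qed
  from this[of "\<lambda>i. if i = 1 then x else y"] show ?thesis by (simp add: op_of_def numeral_2_eq_2)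
qed

lemma cubic_value:
  assumes \<psi>: "operad_hom (free_operad E) (End_operad s gr d) \<psi>"
    "\<And>n t k v. n \<ge> 1 \<Longrightarrow> t \<in> elems (tree_operad (carrier E)) n \<Longrightarrow> homogeneous gr n k v \<Longrightarrow>
      op_of n (\<psi> n (tree_class E n t)) v = s (list_sign (odd_indices n k) (leaves t)) (tree_eval m t v)"
    and e: "e \<in> carrier E" "e' \<in> carrier E" and u: "(p, q, r) \<in> cyclic_triples" and h: "homogeneous gr 3 k v"
  shows "op_of 3 (\<psi> 3 (cubic E e e' (p, q, r))) v = s (list_sign (odd_indices 3 k) [p, q, r]) (m e (m e' (v p) (v q)) (v r))"
  using \<psi>(2)[OF _ tree3_mem(1)[OF E e cyclic_triples_perm[OF u]] h] by (simp add: cubic_def)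

end

section \<open>The pairing\<close>

definition scalar_module :: "('k::field, 'k) module"
  where "scalar_module = \<lparr>carrier = UNIV, monoid.mult = undefined, one = undefined, zero = 0, add = (+), module.smult = (*)\<rparr>"

lemma scalar_module_simps [simp]:
  "carrier scalar_module = UNIV" "\<zero>\<^bsub>scalar_module\<^esub> = 0" "x \<oplus>\<^bsub>scalar_module\<^esub> y = x + y" "c \<odot>\<^bsub>scalar_module\<^esub> x = c * x"
  by (simp_all add: scalar_module_def)

lemma scalar_module_module: "module KK scalar_module"
  by (rule module_KK_I) (simp_all add: algebra_simps)

lemma linear_scalar_cubic_sum:
  assumes E: "s2_module E" and h: "linear_between (comps (free_operad E) 3) scalar_module h" and ts: "cubic_terms E ts"
  shows "h (cubic_sum E ts) = (\<Sum>(c, e, e', u)\<leftarrow>ts. c * h (cubic E e e' u))"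
  unfolding linear_cubic_sum[OF E scalar_module_module h ts] by (induction ts) auto

text \<open>\<open>carrier (dual E)\<close> without extensionality. The functionals needed on
  \<open>dual E\<close> are evaluations at elements of \<open>E\<close>, which are not restricted to
  the carrier.\<close>

definition dual_space :: "('k::field, 'e) s2module \<Rightarrow> ('e \<Rightarrow> 'k) set"
  where "dual_space E = {f. (\<forall>x\<in>carrier E. \<forall>y\<in>carrier E. f (x \<oplus>\<^bsub>E\<^esub> y) = f x + f y) \<and> (\<forall>c. \<forall>x\<in>carrier E. f (c \<odot>\<^bsub>E\<^esub> x) = c * f x)}"

lemma dual_spaceD:
  assumes "f \<in> dual_space E"
  shows "\<And>x y. x \<in> carrier E \<Longrightarrow> y \<in> carrier E \<Longrightarrow> f (x \<oplus>\<^bsub>E\<^esub> y) = f x + f y"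
    and "\<And>c x. x \<in> carrier E \<Longrightarrow> f (c \<odot>\<^bsub>E\<^esub> x) = c * f x"
  using assms by (auto simp: dual_space_def)

lemma dual_carrier: "carrier (dual E) = dual_space E \<inter> extensional (carrier E)"
  by (auto simp: dual_def dual_space_def)

lemma dual_simps:
  "\<zero>\<^bsub>dual E\<^esub> = (\<lambda>x\<in>carrier E. 0)" "f \<oplus>\<^bsub>dual E\<^esub> g = (\<lambda>x\<in>carrier E. f x + g x)"
  "c \<odot>\<^bsub>dual E\<^esub> f = (\<lambda>x\<in>carrier E. c * f x)" "swap (dual E) f = (\<lambda>x\<in>carrier E. - f (swap E x))"
  "hdeg (dual E) = - hdeg E"
  by (simp_all add: dual_def)

lemma dual_eqI: "f \<in> carrier (dual E) \<Longrightarrow> g \<in> carrier (dual E) \<Longrightarrow> (\<And>x. x \<in> carrier E \<Longrightarrow> f x = g x) \<Longrightarrow> f = g"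
  unfolding dual_carrier by (auto intro: extensionalityI)

lemma dual_s2_module:
  assumes E: "s2_module E"
  shows "s2_module (dual E)"
proof -
  interpret kmodule E using s2_moduleD(1)[OF E] by (simp add: kmodule_def)
  note Ec = s2_moduleD[OF E]
  have closed: "(\<lambda>x\<in>carrier E. h x) \<in> carrier (dual E)"
    if "\<And>x y. x \<in> carrier E \<Longrightarrow> y \<in> carrier E \<Longrightarrow> h (x \<oplus>\<^bsub>E\<^esub> y) = h x + h y"
      "\<And>c x. x \<in> carrier E \<Longrightarrow> h (c \<odot>\<^bsub>E\<^esub> x) = c * h x" for h
    unfolding dual_carrier dual_space_def using that by simp
  have lin: "f (x \<oplus>\<^bsub>E\<^esub> y) = f x + f y" "f (c \<odot>\<^bsub>E\<^esub> x) = c * f x"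
    if "f \<in> carrier (dual E)" "x \<in> carrier E" "y \<in> carrier E" for f x y c
    using that unfolding dual_carrier dual_space_def by auto
  have swap_lin: "swap E (x \<oplus>\<^bsub>E\<^esub> y) = swap E x \<oplus>\<^bsub>E\<^esub> swap E y" "swap E (c \<odot>\<^bsub>E\<^esub> x) = c \<odot>\<^bsub>E\<^esub> swap E x"
    if "x \<in> carrier E" "y \<in> carrier E" for x y c
    using linear_betweenD[OF Ec(2)] that by auto
  have add: "f \<oplus>\<^bsub>dual E\<^esub> g \<in> carrier (dual E)" if "f \<in> carrier (dual E)" "g \<in> carrier (dual E)" for f g
    unfolding dual_simps by (rule closed) (use lin[OF that(1)] lin[OF that(2)] in \<open>simp_all add: algebra_simps\<close>)
  have smult: "c \<odot>\<^bsub>dual E\<^esub> f \<in> carrier (dual E)" if "f \<in> carrier (dual E)" for f c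
    unfolding dual_simps by (rule closed) (use lin[OF that(1)] in \<open>simp_all add: algebra_simps\<close>)
  have zero: "\<zero>\<^bsub>dual E\<^esub> \<in> carrier (dual E)"
    unfolding dual_simps by (rule closed) simp_all
  have sw: "swap (dual E) f \<in> carrier (dual E)" if "f \<in> carrier (dual E)" for f
    unfolding dual_simps by (rule closed) (use lin[OF that(1)] Ec(4) swap_lin in simp_all)
  have ext: "f x = undefined" if "f \<in> carrier (dual E)" "x \<notin> carrier E" for f x
    using that by (auto simp: dual_carrier extensional_def)
  have "module KK (dual E)"
    by (rule module_KK_I; (intro add zero smult; assumption)?)
      (auto simp: dual_simps fun_eq_iff restrict_def algebra_simps Ec ext)
  moreover have "linear_between (dual E) (dual E) (swap (dual E))"
    by (rule linear_betweenI) (use sw Ec(4) in \<open>auto simp: dual_simps fun_eq_iff restrict_def\<close>)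
  moreover have "swap (dual E) (swap (dual E) f) = f" if "f \<in> carrier (dual E)" for f
    by (rule dual_eqI[OF sw[OF sw[OF that]] that]) (simp add: dual_simps Ec)
  ultimately show ?thesis by (simp add: s2_module_def)
qed

text \<open>With \<open>degree_zero\<close> this makes the functions on the natural numbers an
  ungraded space, which carries the auxiliary algebra behind the pairing; all Koszul signs are 1
  there.\<close>

definition fun_scale :: "'k::field \<Rightarrow> (nat \<Rightarrow> 'k) \<Rightarrow> nat \<Rightarrow> 'k"
  where "fun_scale c v = (\<lambda>n. c * v n)"

definition degree_zero :: "int \<Rightarrow> 'a::zero set"
  where "degree_zero k = (if k = 0 then UNIV else {0})"

lemma graded_fun: "graded (fun_scale :: 'k::field \<Rightarrow> _) degree_zero"
proof
  interpret vector_space "fun_scale :: 'k \<Rightarrow> _"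
    by unfold_locales (simp_all add: fun_scale_def fun_eq_iff algebra_simps)
  have "subspace (degree_zero k)" for k
    unfolding degree_zero_def by (auto simp: subspace_def)
  moreover have "\<exists>!c. (\<forall>k. c k \<in> degree_zero k) \<and> finite {k. c k \<noteq> 0} \<and> a = (\<Sum>k | c k \<noteq> 0. c k)" for a :: "nat \<Rightarrow> 'k"
  proof (rule ex1I[of _ "\<lambda>k. if k = 0 then a else 0"])
    have "{k::int. (if k = 0 then a else 0) \<noteq> 0} = (if a = 0 then {} else {0})" by auto
    then show "(\<forall>k. (if k = 0 then a else 0) \<in> degree_zero k) \<and> finite {k::int. (if k = 0 then a else 0) \<noteq> 0} \<and>
      a = (\<Sum>k | (if (k::int) = 0 then a else 0) \<noteq> 0. if k = 0 then a else 0)"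
      by (auto simp: degree_zero_def)
  next
    fix c :: "int \<Rightarrow> nat \<Rightarrow> 'k"
    assume c: "(\<forall>k. c k \<in> degree_zero k) \<and> finite {k. c k \<noteq> 0} \<and> a = (\<Sum>k | c k \<noteq> 0. c k)"
    then have z: "c k = 0" if "k \<noteq> 0" for k using that by (metis degree_zero_def singletonD)
    have "{k. c k \<noteq> 0} \<subseteq> {0}" using z by auto
    then have "(\<Sum>k | c k \<noteq> 0. c k) = (\<Sum>k\<in>{0}. c k)" by (intro sum.mono_neutral_left) auto
    then show "c = (\<lambda>k. if k = 0 then a else 0)" using c z by (auto simp: fun_eq_iff)
  qed
  ultimately show "graded_space (fun_scale :: 'k \<Rightarrow> _) degree_zero"
    unfolding graded_space_def using vector_space_axioms by blast
qed

lemma list_sign_empty: "list_sign {} L = (1 :: 'k::field)"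
  by (induction L) (simp_all add: inversion_sign_def prod_list_one)

text \<open>The functional is a coefficient of the value at \<open>(x\<^sub>i, x\<^sub>j, x\<^sub>k)\<close> in the algebra with basis
  \<open>x\<^sub>0, \<dots>, x\<^sub>4\<close> whose nonzero products are \<open>e(x\<^sub>i, x\<^sub>j) = g(e) x\<^sub>0\<close> and \<open>e(x\<^sub>0, x\<^sub>k) = f(e) x\<^sub>4\<close>,
  and those obtained from them by symmetry.\<close>

lemma cubic_functional:
  fixes E :: "('k::field, 'e) s2module"
  assumes E: "s2_module E" and f: "f \<in> dual_space E" and g: "g \<in> dual_space E" and u: "u \<in> cyclic_triples"
  obtains L where "linear_between (comps (free_operad E) 3) scalar_module L"
    and "\<And>e e' v. e \<in> carrier E \<Longrightarrow> e' \<in> carrier E \<Longrightarrow> v \<in> cyclic_triples \<Longrightarrow>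
      L (cubic E e e' v) = (if u = v then f e * g e' else 0)"
proof -
  obtain i j k where ijk: "u = (i, j, k)" by (cases u)
  define m :: "'e \<Rightarrow> (nat \<Rightarrow> 'k) \<Rightarrow> (nat \<Rightarrow> 'k) \<Rightarrow> nat \<Rightarrow> 'k" where
    "m e v w = (\<lambda>n. if n = 0 then g e * v i * w j + g (swap E e) * v j * w i
      else if n = 4 then f e * v 0 * w k + f (swap E e) * v k * w 0 else 0)" for e v w
  note Ec = s2_moduleD[OF E] and sl = linear_betweenD[OF s2_moduleD(2)[OF E]]
  interpret tree_algebra "fun_scale :: 'k \<Rightarrow> _" degree_zero E 0 m
  proof (intro tree_algebra.intro graded_fun tree_algebra_axioms.intro E)
    fix e and a b :: "nat \<Rightarrow> 'k" and k l assume "e \<in> carrier E" "a \<in> degree_zero k" "b \<in> degree_zero l"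
    then show "m e a b \<in> degree_zero (k + l + 0)"
      by (auto simp: degree_zero_def m_def fun_eq_iff split: if_splits)
  next
    fix e and a b :: "nat \<Rightarrow> 'k" and k l assume e: "e \<in> carrier E" and a: "a \<in> degree_zero k" "b \<in> degree_zero l"
    have "m (swap E e) a b = m e b a"
      using Ec(3)[OF e] by (simp add: m_def fun_eq_iff algebra_simps)
    moreover have "m e b a = 0" if "odd k"
      using that a by (auto simp: degree_zero_def m_def fun_eq_iff split: if_splits)
    ultimately show "m (swap E e) a b = fun_scale (if odd k \<and> odd l then - 1 else 1) (m e b a)"
      by (auto simp: fun_scale_def fun_eq_iff)
  qed (use Ec in \<open>simp_all add: m_def fun_scale_def fun_eq_iff algebra_simps dual_spaceD[OF f] dual_spaceD[OF g] sl\<close>)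
  obtain \<psi> where \<psi>: "operad_hom (free_operad E) (End_operad (fun_scale :: 'k \<Rightarrow> _) degree_zero 0) \<psi>"
    "\<And>n t k v. n \<ge> 1 \<Longrightarrow> t \<in> elems (tree_operad (carrier E)) n \<Longrightarrow> homogeneous degree_zero n k v \<Longrightarrow>
      op_of n (\<psi> n (tree_class E n t)) v = fun_scale (list_sign (odd_indices n k) (leaves t)) (tree_eval m t v)"
    using free_operad_to_End by blast
  define x :: "nat \<Rightarrow> nat \<Rightarrow> 'k" where "x p = (\<lambda>q. if p = q then 1 else 0)" for p
  define L where "L y = op_of 3 (\<psi> 3 y) x 4" for y
  have lin: "linear_between (comps (free_operad E) 3) (comps (End_operad (fun_scale :: 'k \<Rightarrow> _) degree_zero 0) 3) (\<psi> 3)"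
    by (rule operad_hom_linear[OF \<psi>(1)]) simp
  have "linear_between (comps (free_operad E) 3) scalar_module L"
    by (rule linear_betweenI) (simp_all add: L_def linear_betweenD[OF lin] op_of_def fun_scale_def)
  moreover have "L (cubic E e e' v) = (if u = v then f e * g e' else 0)"
    if e: "e \<in> carrier E" "e' \<in> carrier E" and v: "v \<in> cyclic_triples" for e e' v
  proof -
    obtain p q r where pqr: "v = (p, q, r)" by (cases v)
    have U: "i = 1 \<and> j = 2 \<and> k = 3 \<or> i = 3 \<and> j = 1 \<and> k = 2 \<or> i = 2 \<and> j = 3 \<and> k = 1"
      using u unfolding ijk cyclic_triples_def by simp
    have V: "p = 1 \<and> q = 2 \<and> r = 3 \<or> p = 3 \<and> q = 1 \<and> r = 2 \<or> p = 2 \<and> q = 3 \<and> r = 1"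
      using v unfolding pqr cyclic_triples_def by simp
    have h: "homogeneous degree_zero 3 (\<lambda>i. 0) x" by (simp add: homogeneous_def degree_zero_def)
    have "op_of 3 (\<psi> 3 (cubic E e e' (p, q, r))) x = fun_scale (list_sign (odd_indices 3 (\<lambda>i. 0)) [p, q, r]) (m e (m e' (x p) (x q)) (x r))"
      by (rule cubic_value[OF \<psi> e v[unfolded pqr] h])
    also have "odd_indices 3 (\<lambda>i. 0) = {}" by simp
    finally have "L (cubic E e e' v) = m e (m e' (x p) (x q)) (x r) 4"
      unfolding L_def pqr list_sign_empty by (simp add: fun_scale_def)
    also have "\<dots> = f e * m e' (x p) (x q) 0 * x r k + f (swap E e) * m e' (x p) (x q) k * x r 0"
      unfolding m_def[of e] by simp
    also have "m e' (x p) (x q) 0 = g e' * x p i * x q j + g (swap E e') * x p j * x q i"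
      unfolding m_def[of e'] by simp
    also have "x r 0 = 0" using V by (elim disjE conjE; simp add: x_def)
    also have "f e * (g e' * x p i * x q j + g (swap E e') * x p j * x q i) * x r k + f (swap E e) * m e' (x p) (x q) k * 0 =
        (if u = v then f e * g e' else 0)"
    proof -
      \<comment> \<open>The crossed product is nonzero only for
        \<open>(p, q, r) = (j, i, k)\<close>, and this cannot happen for two cyclic triples.\<close>
      have "x p i * x q j * x r k = (if u = v then 1 else 0)" "x p j * x q i * x r k = 0"
        using U V by (elim disjE conjE; simp add: ijk pqr x_def)+
      then have "f e * g e' * (x p i * x q j * x r k) + f e * g (swap E e') * (x p j * x q i * x r k) =
        (if u = v then f e * g e' else 0)" by simp
      then show ?thesis by (simp add: algebra_simps)
    qed
    finally show ?thesis .
  qed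
  ultimately show ?thesis using that by blast
qed

text \<open>\<open>B x y\<close> is computed from an arbitrarily chosen expansion \<open>T x\<close>
  of \<open>x\<close> into cubic elements, by functionals of \<open>y\<close>. Linearity in
  \<open>y\<close> is then clear, but linearity in \<open>x\<close> is not, since the choice of
  \<open>T\<close> need not be linear. It follows from a second description: for cubic
  \<open>y\<close> the value is also given by a functional of \<open>x\<close>, and such
  \<open>y\<close> span.\<close>

lemma pairing_exists:
  fixes E :: "('k::field, 'e) s2module"
  assumes E: "s2_module E"
  shows "\<exists>B. is_pairing E B"
proof -
  let ?V = "comps (free_operad E) 3" and ?W = "comps (free_operad (dual E)) 3"
  note E' = dual_s2_module[OF E]
  interpret V: kmodule ?V by (rule free_module_3[OF E])
  interpret W: kmodule ?W by (rule free_module_3[OF E'])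
  have ev: "(\<lambda>f. f e) \<in> dual_space (dual E)" if "e \<in> carrier E" for e
    using that by (auto simp: dual_space_def dual_simps)
  have "\<exists>L. linear_between ?W scalar_module L \<and> (\<forall>f\<in>carrier (dual E). \<forall>f'\<in>carrier (dual E). \<forall>v\<in>cyclic_triples.
      L (cubic (dual E) f f' v) = (if u = v then f e * f' e' else 0))"
    if "e \<in> carrier E \<and> e' \<in> carrier E \<and> u \<in> cyclic_triples" for e e' u
    using cubic_functional[OF E' ev[of e] ev[of e'], of u] that by metis
  then obtain L where L: "\<And>e e' u. e \<in> carrier E \<Longrightarrow> e' \<in> carrier E \<Longrightarrow> u \<in> cyclic_triples \<Longrightarrow> linear_between ?W scalar_module (L e e' u)"
    "\<And>e e' u f f' v. e \<in> carrier E \<Longrightarrow> e' \<in> carrier E \<Longrightarrow> u \<in> cyclic_triples \<Longrightarrow> f \<in> carrier (dual E) \<Longrightarrow>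
      f' \<in> carrier (dual E) \<Longrightarrow> v \<in> cyclic_triples \<Longrightarrow> L e e' u (cubic (dual E) f f' v) = (if u = v then f e * f' e' else 0)"
    by metis
  have "\<exists>ts. cubic_terms E ts \<and> x = cubic_sum E ts" if "x \<in> carrier ?V" for x
    using cubic_span[OF E that] by blast
  then obtain T where T: "\<And>x. x \<in> carrier ?V \<Longrightarrow> cubic_terms E (T x)" "\<And>x. x \<in> carrier ?V \<Longrightarrow> x = cubic_sum E (T x)"
    by metis
  define B where "B x y = (\<Sum>(c, e, e', u)\<leftarrow>T x. c * L e e' u y)" for x y
  have B_right: "linear_between ?W scalar_module (B x)" if "x \<in> carrier ?V" for x
  proof -
    have "linear_between ?W scalar_module (\<lambda>y. \<Sum>(c, e, e', u)\<leftarrow>ts. c * L e e' u y)" if "cubic_terms E ts" for ts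
      using that
    proof (induction ts)
      case Nil
      show ?case by (rule linear_betweenI) simp_all
    next
      case (Cons a ts)
      obtain c e e' u where a: "a = (c, e, e', u)" by (cases a)
      then have l: "linear_between ?W scalar_module (L e e' u)"
        "linear_between ?W scalar_module (\<lambda>y. \<Sum>(c, e, e', u)\<leftarrow>ts. c * L e e' u y)"
        using Cons L(1) by simp_all
      show ?case
        by (rule linear_betweenI) (simp_all add: a linear_betweenD[OF l(1)] linear_betweenD[OF l(2)] algebra_simps)
    qed
    then show ?thesis unfolding B_def[abs_def] using T(1)[OF that] by blast
  qed
  \<comment> \<open>The functional \<open>M\<close> of \<open>x\<close> comes from the same lemma,
    now applied to \<open>E\<close>. It agrees with \<open>B\<close> on the terms of the expansion
    of \<open>x\<close>, hence on \<open>x\<close>, whichever expansion was chosen.\<close>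
  have B_cubic: "\<exists>M. linear_between ?V scalar_module M \<and> (\<forall>x\<in>carrier ?V. B x (cubic (dual E) f f' v) = M x) \<and>
      (\<forall>e\<in>carrier E. \<forall>e'\<in>carrier E. \<forall>u\<in>cyclic_triples. M (cubic E e e' u) = (if u = v then f e * f' e' else 0))"
    if ff: "f \<in> carrier (dual E)" "f' \<in> carrier (dual E)" "v \<in> cyclic_triples" for f f' v
  proof -
    obtain M where M: "linear_between ?V scalar_module M"
      "\<And>e e' u. e \<in> carrier E \<Longrightarrow> e' \<in> carrier E \<Longrightarrow> u \<in> cyclic_triples \<Longrightarrow> M (cubic E e e' u) = (if v = u then f e * f' e' else 0)"
      using cubic_functional[OF E _ _ ff(3), of f f'] ff unfolding dual_carrier by blast
    have "B x (cubic (dual E) f f' v) = M x" if x: "x \<in> carrier ?V" for x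
    proof -
      have "(\<Sum>(c, e, e', u)\<leftarrow>ts. c * L e e' u (cubic (dual E) f f' v)) = (\<Sum>(c, e, e', u)\<leftarrow>ts. c * M (cubic E e e' u))"
        if "cubic_terms E ts" for ts
        using that
      proof (induction ts)
        case (Cons a ts)
        obtain c e e' u where a: "a = (c, e, e', u)" by (cases a)
        then have e: "e \<in> carrier E" "e' \<in> carrier E" "u \<in> cyclic_triples" "cubic_terms E ts" using Cons.prems by simp_all
        have "L e e' u (cubic (dual E) f f' v) = M (cubic E e e' u)"
          unfolding L(2)[OF e(1-3) ff] M(2)[OF e(1-3)] by (simp add: eq_commute)
        then show ?case using Cons.IH[OF e(4)] a by simp
      qed simp
      from this[OF T(1)[OF x]] have "B x (cubic (dual E) f f' v) = M (cubic_sum E (T x))"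
        unfolding B_def linear_scalar_cubic_sum[OF E M(1) T(1)[OF x]] .
      then show ?thesis using T(2)[OF x] by simp
    qed
    then show ?thesis using M by (intro exI[of _ M]) (simp add: eq_commute)
  qed
  have B_left: "linear_between ?V scalar_module (\<lambda>x. B x y)" if y: "y \<in> carrier ?W" for y
  proof -
    obtain ts where ts: "cubic_terms (dual E) ts" "y = cubic_sum (dual E) ts"
      using cubic_span[OF E' y] by blast
    show ?thesis
      using ts
    proof (induction ts arbitrary: y)
      case Nil
      have "B x y = 0" if "x \<in> carrier ?V" for x
        using linear_between_zero[OF W.module_axioms scalar_module_module B_right[OF that]] Nil by simp
      then show ?case by (intro linear_betweenI) simp_all
    next
      case (Cons a ts)
      obtain c f f' v where a: "a = (c, f, f', v)" by (cases a)
      then have ff: "f \<in> carrier (dual E)" "f' \<in> carrier (dual E)" "v \<in> cyclic_triples" "cubic_terms (dual E) ts"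
        using Cons.prems by simp_all
      obtain M where M: "linear_between ?V scalar_module M" "\<And>x. x \<in> carrier ?V \<Longrightarrow> B x (cubic (dual E) f f' v) = M x"
        using B_cubic[OF ff(1-3)] by blast
      note IH = Cons.IH[OF ff(4) refl]
      have "B x y = c * M x + B x (cubic_sum (dual E) ts)" if x: "x \<in> carrier ?V" for x
        using cubic_closed[OF E' ff(1-3)] cubic_sum_closed[OF E' ff(4)] Cons.prems(2) a M(2)[OF x]
        by (simp add: linear_betweenD[OF B_right[OF x]])
      then show ?case
        by (intro linear_betweenI) (simp_all add: linear_betweenD[OF M(1)] linear_betweenD[OF IH] algebra_simps)
    qed
  qed
  have "is_pairing E B"
    unfolding is_pairing_def Let_def
  proof (intro conjI ballI allI)
    fix e e' f f' u v assume *: "e \<in> carrier E" "e' \<in> carrier E" "f \<in> carrier (dual E)" "f' \<in> carrier (dual E)"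
      "u \<in> cyclic_triples" "v \<in> cyclic_triples"
    show "B (cubic E e e' u) (cubic (dual E) f f' v) = (if u = v then f e * f' e' else 0)"
      using B_cubic[OF *(3,4,6)] cubic_closed[OF E *(1,2,5)] *(1,2,5) by metis
  qed (simp_all add: linear_betweenD[OF B_right] linear_betweenD[OF B_left])
  then show ?thesis by blast
qed

lemma pairing: "s2_module E \<Longrightarrow> is_pairing E (pairing E)"
  unfolding pairing_def by (rule someI_ex[OF pairing_exists])

lemma pairing_linear:
  assumes E: "s2_module E"
  shows pairing_right: "x \<in> carrier (comps (free_operad E) 3) \<Longrightarrow> linear_between (comps (free_operad (dual E)) 3) scalar_module (pairing E x)"
    and pairing_left: "y \<in> carrier (comps (free_operad (dual E)) 3) \<Longrightarrow> linear_between (comps (free_operad E) 3) scalar_module (\<lambda>x. pairing E x y)"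
    and pairing_cubic: "e \<in> carrier E \<Longrightarrow> e' \<in> carrier E \<Longrightarrow> f \<in> carrier (dual E) \<Longrightarrow> f' \<in> carrier (dual E) \<Longrightarrow>
      u \<in> cyclic_triples \<Longrightarrow> v \<in> cyclic_triples \<Longrightarrow>
      pairing E (cubic E e e' u) (cubic (dual E) f f' v) = (if u = v then f e * f' e' else 0)"
  using pairing[OF E] unfolding is_pairing_def Let_def linear_between_def by auto

section \<open>Tensor products\<close>

definition tensor_gens ::
    "('k::field, 'x, 'm) module_scheme \<Rightarrow> ('k, 'y, 'n) module_scheme \<Rightarrow> ('x \<times> 'y \<Rightarrow>\<^sub>0 'k) set"
  where "tensor_gens V W =
   ({Poly_Mapping.single (v \<oplus>\<^bsub>V\<^esub> v', w) 1 - Poly_Mapping.single (v, w) 1 - Poly_Mapping.single (v', w) 1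
       | v v' w. v \<in> carrier V \<and> v' \<in> carrier V \<and> w \<in> carrier W} \<union>
    {Poly_Mapping.single (v, w \<oplus>\<^bsub>W\<^esub> w') 1 - Poly_Mapping.single (v, w) 1 - Poly_Mapping.single (v, w') 1
       | v w w'. v \<in> carrier V \<and> w \<in> carrier W \<and> w' \<in> carrier W} \<union>
    {Poly_Mapping.single (c \<odot>\<^bsub>V\<^esub> v, w) 1 - Poly_Mapping.single (v, w) c
       | c v w. v \<in> carrier V \<and> w \<in> carrier W} \<union>
    {Poly_Mapping.single (v, c \<odot>\<^bsub>W\<^esub> w) 1 - Poly_Mapping.single (v, w) c
       | c v w. v \<in> carrier V \<and> w \<in> carrier W})"

lemma tensor_rels_eq: "tensor_rels V W = lin_span (free_module (carrier V \<times> carrier W)) (tensor_gens V W)"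
  by (simp add: tensor_rels_def tensor_gens_def)

lemma tensor_gens_cases:
  assumes "x \<in> tensor_gens V W"
  obtains (add_left) v v' w where "v \<in> carrier V" "v' \<in> carrier V" "w \<in> carrier W"
      "x = Poly_Mapping.single (v \<oplus>\<^bsub>V\<^esub> v', w) 1 - Poly_Mapping.single (v, w) 1 - Poly_Mapping.single (v', w) 1"
    | (add_right) v w w' where "v \<in> carrier V" "w \<in> carrier W" "w' \<in> carrier W"
      "x = Poly_Mapping.single (v, w \<oplus>\<^bsub>W\<^esub> w') 1 - Poly_Mapping.single (v, w) 1 - Poly_Mapping.single (v, w') 1"
    | (smult_left) c v w where "v \<in> carrier V" "w \<in> carrier W"
      "x = Poly_Mapping.single (c \<odot>\<^bsub>V\<^esub> v, w) 1 - Poly_Mapping.single (v, w) c"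
    | (smult_right) c v w where "v \<in> carrier V" "w \<in> carrier W"
      "x = Poly_Mapping.single (v, c \<odot>\<^bsub>W\<^esub> w) 1 - Poly_Mapping.single (v, w) c"
  using assms unfolding tensor_gens_def by (elim UnE CollectE exE conjE) blast+

lemma free_module_diff_closed:
  "p \<in> carrier (free_module S) \<Longrightarrow> q \<in> carrier (free_module S) \<Longrightarrow> p - q \<in> carrier (free_module S :: ('k::field, _) module)"
  using keys_minus_subset by simp

lemma single_closed: "s \<in> S \<Longrightarrow> Poly_Mapping.single s c \<in> carrier (free_module S)"
  by simp

lemma free_linear_diff:
  fixes L :: "('s \<Rightarrow>\<^sub>0 'k::field) \<Rightarrow> 'x"
  assumes "module KK M" "linear_between (free_module S) M L" "p \<in> carrier (free_module S)" "q \<in> carrier (free_module S)"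
  shows "L (p - q) = L p \<ominus>\<^bsub>M\<^esub> L q"
  using linear_between_minus[OF free_module_module assms] free_module_minus[OF assms(3,4)] by simp

locale tensor_modules =
  fixes V :: "('k::field, 'x, 'm) module_scheme" and W :: "('k, 'y, 'n) module_scheme"
  assumes V: "module KK V" and W: "module KK W"
begin

sublocale V: kmodule V using V by (simp add: kmodule_def)
sublocale W: kmodule W using W by (simp add: kmodule_def)

abbreviation VW :: "('k, 'x \<times> 'y \<Rightarrow>\<^sub>0 'k) module"
  where "VW \<equiv> free_module (carrier V \<times> carrier W)"

lemma tensor_gens_closed: "tensor_gens V W \<subseteq> carrier VW"
proof
  fix x assume "x \<in> tensor_gens V W"
  then show "x \<in> carrier VW"
    by (cases rule: tensor_gens_cases; hypsubst)
      (intro free_module_diff_closed single_closed SigmaI V.M.a_closed W.M.a_closed V.k_closed W.k_closed; assumption)+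
qed

lemma tensor_rels_submodule: "submodule (tensor_rels V W) KK VW"
proof -
  interpret kmodule VW using free_module_module by (simp add: kmodule_def)
  show ?thesis unfolding tensor_rels_eq by (rule lin_span_submodule[OF tensor_gens_closed])
qed

sublocale T: kquot VW "tensor_rels V W"
  using tensor_rels_submodule free_module_module by (simp add: kquot_def kmodule_def kquot_axioms_def)

lemma tensor_module: "module KK (tensor V W)"
  unfolding tensor_def by (rule T.quot_module)

sublocale VxW: kmodule "tensor V W" using tensor_module by (simp add: kmodule_def)

lemma pure_closed: "v \<in> carrier V \<Longrightarrow> w \<in> carrier W \<Longrightarrow> pure_tensor V W v w \<in> carrier (tensor V W)"
  unfolding tensor_def T.quot_carrier pure_tensor_def by (rule imageI) simp

lemma gens_rels: "x \<in> tensor_gens V W \<Longrightarrow> x \<in> tensor_rels V W"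
  unfolding tensor_rels_eq by (rule subsetD[OF lin_span_superset])

lemma pure_eqI:
  assumes "v \<in> carrier V" "w \<in> carrier W" "q \<in> carrier VW" "Poly_Mapping.single (v, w) 1 - q \<in> tensor_rels V W"
  shows "pure_tensor V W v w = tensor_rels V W +>\<^bsub>VW\<^esub> q"
  unfolding pure_tensor_def
  by (subst T.coset_eq) (use assms free_module_minus[OF single_closed assms(3), of "(v, w)" 1] in simp_all)

lemma pure_add_left:
  assumes v: "v \<in> carrier V" "v' \<in> carrier V" "w \<in> carrier W"
  shows "pure_tensor V W (v \<oplus>\<^bsub>V\<^esub> v') w = pure_tensor V W v w \<oplus>\<^bsub>tensor V W\<^esub> pure_tensor V W v' w"
proof -
  let ?p = "Poly_Mapping.single (v, w) (1::'k)" and ?q = "Poly_Mapping.single (v', w) (1::'k)"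
  have c: "?p \<in> carrier VW" "?q \<in> carrier VW" by (intro single_closed SigmaI v)+
  have pq: "?p + ?q \<in> carrier VW" using T.M.a_closed[OF c] by simp
  have "Poly_Mapping.single (v \<oplus>\<^bsub>V\<^esub> v', w) 1 - (?p + ?q) \<in> tensor_rels V W"
    by (rule gens_rels) (use v in \<open>unfold tensor_gens_def diff_diff_add[symmetric], blast\<close>)
  from pure_eqI[OF V.M.a_closed[OF v(1,2)] v(3) pq this] show ?thesis
    unfolding tensor_def pure_tensor_def T.quot_add[OF c] by simp
qed

lemma pure_add_right:
  assumes v: "v \<in> carrier V" "w \<in> carrier W" "w' \<in> carrier W"
  shows "pure_tensor V W v (w \<oplus>\<^bsub>W\<^esub> w') = pure_tensor V W v w \<oplus>\<^bsub>tensor V W\<^esub> pure_tensor V W v w'"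
proof -
  let ?p = "Poly_Mapping.single (v, w) (1::'k)" and ?q = "Poly_Mapping.single (v, w') (1::'k)"
  have c: "?p \<in> carrier VW" "?q \<in> carrier VW" by (intro single_closed SigmaI v)+
  have pq: "?p + ?q \<in> carrier VW" using T.M.a_closed[OF c] by simp
  have "Poly_Mapping.single (v, w \<oplus>\<^bsub>W\<^esub> w') 1 - (?p + ?q) \<in> tensor_rels V W"
    by (rule gens_rels) (use v in \<open>unfold tensor_gens_def diff_diff_add[symmetric], blast\<close>)
  from pure_eqI[OF v(1) W.M.a_closed[OF v(2,3)] pq this] show ?thesis
    unfolding tensor_def pure_tensor_def T.quot_add[OF c] by simp
qed

lemma pure_smult_left:
  assumes v: "v \<in> carrier V" "w \<in> carrier W"
  shows "pure_tensor V W (c \<odot>\<^bsub>V\<^esub> v) w = c \<odot>\<^bsub>tensor V W\<^esub> pure_tensor V W v w"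
proof -
  let ?p = "Poly_Mapping.single (v, w) (1::'k)" and ?q = "Poly_Mapping.single (v, w) c"
  have c: "?p \<in> carrier VW" "?q \<in> carrier VW" by (intro single_closed SigmaI v)+
  have "Poly_Mapping.single (c \<odot>\<^bsub>V\<^esub> v, w) 1 - ?q \<in> tensor_rels V W"
    by (rule gens_rels) (use v in \<open>unfold tensor_gens_def, blast\<close>)
  from pure_eqI[OF V.k_closed[OF v(1)] v(2) c(2) this] show ?thesis
    unfolding tensor_def pure_tensor_def T.quot_smult[OF c(1)] by simp
qed

lemma pure_smult_right:
  assumes v: "v \<in> carrier V" "w \<in> carrier W"
  shows "pure_tensor V W v (c \<odot>\<^bsub>W\<^esub> w) = c \<odot>\<^bsub>tensor V W\<^esub> pure_tensor V W v w"
proof -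
  let ?p = "Poly_Mapping.single (v, w) (1::'k)" and ?q = "Poly_Mapping.single (v, w) c"
  have c: "?p \<in> carrier VW" "?q \<in> carrier VW" by (intro single_closed SigmaI v)+
  have "Poly_Mapping.single (v, c \<odot>\<^bsub>W\<^esub> w) 1 - ?q \<in> tensor_rels V W"
    by (rule gens_rels) (use v in \<open>unfold tensor_gens_def, blast\<close>)
  from pure_eqI[OF v(1) W.k_closed[OF v(2)] c(2) this] show ?thesis
    unfolding tensor_def pure_tensor_def T.quot_smult[OF c(1)] by simp
qed

text \<open>Stated on the free module of pairs rather than on the tensor product, because it is what
  makes a map factor through the tensor product, and because it also locates images of
  relations.\<close>

lemma linear_kills_rels:
  assumes M: "module KK M" and L: "linear_between VW M L"
    and "\<And>v v' w. v \<in> carrier V \<Longrightarrow> v' \<in> carrier V \<Longrightarrow> w \<in> carrier W \<Longrightarrow>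
      L (Poly_Mapping.single (v \<oplus>\<^bsub>V\<^esub> v', w) 1) = L (Poly_Mapping.single (v, w) 1) \<oplus>\<^bsub>M\<^esub> L (Poly_Mapping.single (v', w) 1)"
    and "\<And>v w w'. v \<in> carrier V \<Longrightarrow> w \<in> carrier W \<Longrightarrow> w' \<in> carrier W \<Longrightarrow>
      L (Poly_Mapping.single (v, w \<oplus>\<^bsub>W\<^esub> w') 1) = L (Poly_Mapping.single (v, w) 1) \<oplus>\<^bsub>M\<^esub> L (Poly_Mapping.single (v, w') 1)"
    and "\<And>c v w. v \<in> carrier V \<Longrightarrow> w \<in> carrier W \<Longrightarrow>
      L (Poly_Mapping.single (c \<odot>\<^bsub>V\<^esub> v, w) 1) = c \<odot>\<^bsub>M\<^esub> L (Poly_Mapping.single (v, w) 1)"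
    and "\<And>c v w. v \<in> carrier V \<Longrightarrow> w \<in> carrier W \<Longrightarrow>
      L (Poly_Mapping.single (v, c \<odot>\<^bsub>W\<^esub> w) 1) = c \<odot>\<^bsub>M\<^esub> L (Poly_Mapping.single (v, w) 1)"
    and x: "x \<in> tensor_rels V W"
  shows "L x = \<zero>\<^bsub>M\<^esub>"
proof -
  interpret M: kmodule M by (simp add: kmodule_def M)
  have car: "L (Poly_Mapping.single (v, w) c) \<in> carrier M" if "v \<in> carrier V" "w \<in> carrier W" for v w c
    by (rule linear_betweenD(1)[OF L single_closed]) (use that in simp)
  have sc: "L (Poly_Mapping.single (v, w) c) = c \<odot>\<^bsub>M\<^esub> L (Poly_Mapping.single (v, w) 1)" if "v \<in> carrier V" "w \<in> carrier W" for v w c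
    using linear_betweenD(3)[OF L single_closed, of "(v, w)" c 1] that by simp
  have zero: "a \<oplus>\<^bsub>M\<^esub> b \<ominus>\<^bsub>M\<^esub> a \<ominus>\<^bsub>M\<^esub> b = \<zero>\<^bsub>M\<^esub>" "a \<ominus>\<^bsub>M\<^esub> a = \<zero>\<^bsub>M\<^esub>" if "a \<in> carrier M" "b \<in> carrier M" for a b
    using that by (simp_all add: M.M.minus_eq M.M.a_ac M.cancel M.M.r_neg)
  have zero2: "a \<ominus>\<^bsub>M\<^esub> a = \<zero>\<^bsub>M\<^esub>" if "a \<in> carrier M" for a
    using zero(2)[OF that that] .
  note cl = free_module_diff_closed single_closed SigmaI V.M.a_closed W.M.a_closed V.k_closed W.k_closed
  note sub = free_linear_diff[OF M L]
  have gen: "L x = \<zero>\<^bsub>M\<^esub>" if "x \<in> tensor_gens V W" for x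
    using that
  proof (cases rule: tensor_gens_cases)
    case (add_left v v' w)
    have "L x = L (Poly_Mapping.single (v \<oplus>\<^bsub>V\<^esub> v', w) 1) \<ominus>\<^bsub>M\<^esub> L (Poly_Mapping.single (v, w) 1) \<ominus>\<^bsub>M\<^esub> L (Poly_Mapping.single (v', w) 1)"
      unfolding add_left(4) by (subst sub; (subst sub)?; (intro cl add_left)?) (rule refl)
    then show ?thesis unfolding assms(3)[OF add_left(1-3)] zero(1)[OF car[OF add_left(1,3)] car[OF add_left(2,3)]] .
  next
    case (add_right v w w')
    have "L x = L (Poly_Mapping.single (v, w \<oplus>\<^bsub>W\<^esub> w') 1) \<ominus>\<^bsub>M\<^esub> L (Poly_Mapping.single (v, w) 1) \<ominus>\<^bsub>M\<^esub> L (Poly_Mapping.single (v, w') 1)"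
      unfolding add_right(4) by (subst sub; (subst sub)?; (intro cl add_right)?) (rule refl)
    then show ?thesis unfolding assms(4)[OF add_right(1-3)] zero(1)[OF car[OF add_right(1,2)] car[OF add_right(1,3)]] .
  next
    case (smult_left c v w)
    have "L x = L (Poly_Mapping.single (c \<odot>\<^bsub>V\<^esub> v, w) 1) \<ominus>\<^bsub>M\<^esub> L (Poly_Mapping.single (v, w) c)"
      unfolding smult_left(3) by (rule sub) (intro cl smult_left)+
    then show ?thesis
      unfolding assms(5)[OF smult_left(1,2)] sc[OF smult_left(1,2), of c] zero2[OF M.k_closed[OF car[OF smult_left(1,2)]]] .
  next
    case (smult_right c v w)
    have "L x = L (Poly_Mapping.single (v, c \<odot>\<^bsub>W\<^esub> w) 1) \<ominus>\<^bsub>M\<^esub> L (Poly_Mapping.single (v, w) c)"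
      unfolding smult_right(3) by (rule sub) (intro cl smult_right)+
    then show ?thesis
      unfolding assms(6)[OF smult_right(1,2)] sc[OF smult_right(1,2), of c] zero2[OF M.k_closed[OF car[OF smult_right(1,2)]]] .
  qed
  have "tensor_rels V W \<subseteq> {x \<in> carrier VW. L x \<in> {\<zero>\<^bsub>M\<^esub>}}"
    unfolding tensor_rels_eq
    by (rule lin_span_minimal[OF _ submodule_vimage[OF free_module_module M L submodule_zero[OF M]]])
      (use gen tensor_gens_closed in blast)
  then show ?thesis using x by blast
qed

lemma tensor_extend:
  fixes M :: "('k, 'z, 'l) module_scheme"
  assumes M: "module KK M" and closed: "\<And>v w. v \<in> carrier V \<Longrightarrow> w \<in> carrier W \<Longrightarrow> b v w \<in> carrier M"
    and "\<And>v v' w. v \<in> carrier V \<Longrightarrow> v' \<in> carrier V \<Longrightarrow> w \<in> carrier W \<Longrightarrow> b (v \<oplus>\<^bsub>V\<^esub> v') w = b v w \<oplus>\<^bsub>M\<^esub> b v' w"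
    and "\<And>v w w'. v \<in> carrier V \<Longrightarrow> w \<in> carrier W \<Longrightarrow> w' \<in> carrier W \<Longrightarrow> b v (w \<oplus>\<^bsub>W\<^esub> w') = b v w \<oplus>\<^bsub>M\<^esub> b v w'"
    and "\<And>c v w. v \<in> carrier V \<Longrightarrow> w \<in> carrier W \<Longrightarrow> b (c \<odot>\<^bsub>V\<^esub> v) w = c \<odot>\<^bsub>M\<^esub> b v w"
    and "\<And>c v w. v \<in> carrier V \<Longrightarrow> w \<in> carrier W \<Longrightarrow> b v (c \<odot>\<^bsub>W\<^esub> w) = c \<odot>\<^bsub>M\<^esub> b v w"
  obtains L where "linear_between (tensor V W) M L"
    and "\<And>v w. v \<in> carrier V \<Longrightarrow> w \<in> carrier W \<Longrightarrow> L (pure_tensor V W v w) = b v w"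
proof -
  interpret M: kmodule M by (simp add: kmodule_def M)
  have c: "case_prod b s \<in> carrier M" if "s \<in> carrier V \<times> carrier W" for s
    using that closed by auto
  obtain h where h: "linear_between VW M h" "\<And>s c. s \<in> carrier V \<times> carrier W \<Longrightarrow> h (Poly_Mapping.single s c) = c \<odot>\<^bsub>M\<^esub> case_prod b s"
    by (rule free_module_extend[OF M c]) (assumption | (rule that; assumption))+
  have h1: "h (Poly_Mapping.single (v, w) 1) = b v w" if "v \<in> carrier V" "w \<in> carrier W" for v w
    using h(2)[of "(v, w)" 1] that closed by simp
  have ker: "h x = \<zero>\<^bsub>M\<^esub>" if "x \<in> tensor_rels V W" for x
    by (rule linear_kills_rels[OF M h(1) _ _ _ _ that]) (simp_all add: h1 assms(3-6))
  obtain L where "linear_between (tensor V W) M L" "\<And>x. x \<in> carrier VW \<Longrightarrow> L (tensor_rels V W +>\<^bsub>VW\<^esub> x) = h x"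
    using T.quot_linear_induced[OF M h(1) ker] unfolding tensor_def by blast
  then show ?thesis using h1 by (intro that[of L]) (simp_all add: pure_tensor_def)
qed

lemma tensor_linear_eq:
  assumes M: "module KK M" and f: "linear_between (tensor V W) M f" and g: "linear_between (tensor V W) M g"
    and eq: "\<And>v w. v \<in> carrier V \<Longrightarrow> w \<in> carrier W \<Longrightarrow> f (pure_tensor V W v w) = g (pure_tensor V W v w)"
    and x: "x \<in> carrier (tensor V W)"
  shows "f x = g x"
proof -
  obtain p where p: "p \<in> carrier VW" "x = tensor_rels V W +>\<^bsub>VW\<^esub> p"
    using x unfolding tensor_def T.quot_carrier by blast
  note proj = T.proj_linear[folded tensor_def]
  have "f (tensor_rels V W +>\<^bsub>VW\<^esub> p) = g (tensor_rels V W +>\<^bsub>VW\<^esub> p)"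
    by (rule free_module_linear_eq[OF M linear_between_comp[OF proj f] linear_between_comp[OF proj g], of p])
      (use p eq in \<open>auto simp: pure_tensor_def\<close>)
  then show ?thesis using p(2) by simp
qed

end

text \<open>Followed by the projection to \<open>tensor V' W'\<close>, the extension becomes
  bilinear in the original pairs and therefore kills the relations; the kernel of the projection is
  \<open>tensor_rels V' W'\<close>. The transposition on \<open>s2_tensor\<close> and the Hadamard
  product are well defined for this reason.\<close>

lemma lin_ext_tensor_rels:
  fixes f :: "'x \<Rightarrow> 'x2" and g :: "'y \<Rightarrow> 'y2"
  assumes "tensor_modules V W" "tensor_modules V' W'"
    and f: "linear_between V V' f" and g: "linear_between W W' g" and x: "x \<in> tensor_rels V W"
  shows "lin_ext (map_prod f g) x \<in> tensor_rels V' W'"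
proof -
  interpret A: tensor_modules V W by fact
  interpret B: tensor_modules V' W' by fact
  have lin: "linear_between A.VW B.VW (lin_ext (map_prod f g))"
    by (rule lin_ext_linear) (use linear_betweenD(1)[OF f] linear_betweenD(1)[OF g] in auto)
  let ?L = "\<lambda>x. tensor_rels V' W' +>\<^bsub>B.VW\<^esub> lin_ext (map_prod f g) x"
  have L: "linear_between A.VW (tensor V' W') ?L"
    unfolding tensor_def by (rule linear_between_comp[OF lin B.T.proj_linear])
  have single: "?L (Poly_Mapping.single (v, w) 1) = pure_tensor V' W' (f v) (g w)" for v w
    by (simp add: pure_tensor_def)
  have "?L x = \<zero>\<^bsub>tensor V' W'\<^esub>"
    by (rule A.linear_kills_rels[OF B.tensor_module L _ _ _ _ x])
      (simp_all only: single linear_betweenD[OF f] linear_betweenD[OF g] B.pure_add_left B.pure_add_right B.pure_smult_left B.pure_smult_right)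
  then have "?L x = tensor_rels V' W'"
    unfolding tensor_def B.T.quot_zero B.T.coset_zero .
  moreover have "lin_ext (map_prod f g) x \<in> carrier B.VW"
    by (rule linear_betweenD(1)[OF lin]) (use x A.T.N_facts(1) in blast)
  ultimately show ?thesis using B.T.coset_eq_N by blast
qed

subsection \<open>Tensor products of \<open>S\<^sub>2\<close>-modules\<close>

lemma s2_tensor_simps [simp]:
  "carrier (s2_tensor E F) = carrier (tensor E F)" "\<zero>\<^bsub>s2_tensor E F\<^esub> = \<zero>\<^bsub>tensor E F\<^esub>"
  "x \<oplus>\<^bsub>s2_tensor E F\<^esub> y = x \<oplus>\<^bsub>tensor E F\<^esub> y" "c \<odot>\<^bsub>s2_tensor E F\<^esub> x = c \<odot>\<^bsub>tensor E F\<^esub> x"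
  "hdeg (s2_tensor E F) = hdeg E + hdeg F"
  by (simp_all add: s2_tensor_def module.defs s2module.defs)

lemma s2_tensor_swap_def:
  "swap (s2_tensor E F) A = (\<Union>p\<in>A. tensor_rels E F +>\<^bsub>free_module (carrier E \<times> carrier F)\<^esub>
       lin_ext (map_prod (swap E) (swap F)) p)"
  by (simp add: s2_tensor_def module.defs s2module.defs)

locale s2_tensor_modules =
  fixes E :: "('k::field, 'e) s2module" and F :: "('k, 'f) s2module"
  assumes E: "s2_module E" and F: "s2_module F"
begin

sublocale tensor_modules E F
  using s2_moduleD(1)[OF E] s2_moduleD(1)[OF F] by (simp add: tensor_modules_def)

abbreviation tcls :: "('e \<times> 'f \<Rightarrow>\<^sub>0 'k) \<Rightarrow> ('e \<times> 'f \<Rightarrow>\<^sub>0 'k) set"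
  where "tcls p \<equiv> tensor_rels E F +>\<^bsub>VW\<^esub> p"

abbreviation swap_poly :: "('e \<times> 'f \<Rightarrow>\<^sub>0 'k) \<Rightarrow> ('e \<times> 'f \<Rightarrow>\<^sub>0 'k)"
  where "swap_poly \<equiv> lin_ext (map_prod (swap E) (swap F))"

lemma swap_poly_linear: "linear_between VW VW swap_poly"
  by (rule lin_ext_linear) (auto simp: s2_moduleD(4)[OF E] s2_moduleD(4)[OF F])

lemma swap_tcls:
  assumes "p \<in> carrier VW"
  shows "swap (s2_tensor E F) (tcls p) = tcls (swap_poly p)"
  unfolding s2_tensor_swap_def
proof (rule T.UN_coset[OF assms])
  fix q assume q: "q \<in> carrier VW" "q \<ominus>\<^bsub>VW\<^esub> p \<in> tensor_rels E F"
  have "tensor_modules E F" by (rule tensor_modules_axioms)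
  from lin_ext_tensor_rels[OF this this s2_moduleD(2)[OF E] s2_moduleD(2)[OF F] q(2)]
  have "swap_poly q \<ominus>\<^bsub>VW\<^esub> swap_poly p \<in> tensor_rels E F"
    unfolding linear_between_minus[OF free_module_module free_module_module swap_poly_linear q(1) assms] .
  then show "tcls (swap_poly q) = tcls (swap_poly p)"
    using T.coset_eq linear_betweenD(1)[OF swap_poly_linear] q(1) assms by blast
qed

lemma swap_pure:
  assumes "e \<in> carrier E" "f \<in> carrier F"
  shows "swap (s2_tensor E F) (pure_tensor E F e f) = pure_tensor E F (swap E e) (swap F f)"
  unfolding pure_tensor_def using swap_tcls[OF single_closed, of "(e, f)" 1] assms by simp

lemma tensor_cls: "x \<in> carrier (tensor E F) \<Longrightarrow> \<exists>p\<in>carrier VW. x = tcls p"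
  unfolding tensor_def T.quot_carrier by blast

lemma s2_tensor_module: "module KK (s2_tensor E F)"
  by (rule module_surj_image[OF tensor_module, where h = id]) (simp_all only: s2_tensor_simps id_apply image_id)

lemma s2_tensor_s2_module: "s2_module (s2_tensor E F)"
proof -
  have M: "module KK (s2_tensor E F)" by (rule s2_tensor_module)
  have lin: "linear_between (s2_tensor E F) (s2_tensor E F) (swap (s2_tensor E F))"
  proof (rule linear_betweenI)
    fix x assume "x \<in> carrier (s2_tensor E F)"
    then obtain p where p: "p \<in> carrier VW" "x = tcls p" using tensor_cls by auto
    show "swap (s2_tensor E F) x \<in> carrier (s2_tensor E F)"
      unfolding p(2) swap_tcls[OF p(1)] s2_tensor_simps tensor_def T.quot_carrier
      by (rule imageI) (rule linear_betweenD(1)[OF swap_poly_linear p(1)])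
  next
    fix x y assume "x \<in> carrier (s2_tensor E F)" "y \<in> carrier (s2_tensor E F)"
    then obtain p q where p: "p \<in> carrier VW" "x = tcls p" and q: "q \<in> carrier VW" "y = tcls q"
      using tensor_cls by (metis s2_tensor_simps(1))
    show "swap (s2_tensor E F) (x \<oplus>\<^bsub>s2_tensor E F\<^esub> y) = swap (s2_tensor E F) x \<oplus>\<^bsub>s2_tensor E F\<^esub> swap (s2_tensor E F) y"
      unfolding p(2) q(2) s2_tensor_simps tensor_def T.quot_add[OF p(1) q(1)] swap_tcls[OF p(1)] swap_tcls[OF q(1)]
        T.quot_add[OF linear_betweenD(1)[OF swap_poly_linear p(1)] linear_betweenD(1)[OF swap_poly_linear q(1)]]
        swap_tcls[OF T.M.a_closed[OF p(1) q(1)]] linear_betweenD(2)[OF swap_poly_linear p(1) q(1)] ..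
  next
    fix c x assume "x \<in> carrier (s2_tensor E F)"
    then obtain p where p: "p \<in> carrier VW" "x = tcls p" using tensor_cls by auto
    show "swap (s2_tensor E F) (c \<odot>\<^bsub>s2_tensor E F\<^esub> x) = c \<odot>\<^bsub>s2_tensor E F\<^esub> swap (s2_tensor E F) x"
      unfolding p(2) s2_tensor_simps tensor_def T.quot_smult[OF p(1)] swap_tcls[OF p(1)]
        T.quot_smult[OF linear_betweenD(1)[OF swap_poly_linear p(1)]]
        swap_tcls[OF T.k_closed[OF p(1)]] linear_betweenD(3)[OF swap_poly_linear p(1)] ..
  qed
  have lin': "linear_between (tensor E F) (tensor E F) (swap (s2_tensor E F))"
    using lin by (simp add: linear_between_def)
  have "swap (s2_tensor E F) (swap (s2_tensor E F) x) = x" if "x \<in> carrier (tensor E F)" for x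
  proof (rule tensor_linear_eq[OF tensor_module linear_between_comp[OF lin' lin'] _ _ that])
    show "linear_between (tensor E F) (tensor E F) (\<lambda>x. x)" by (rule linear_betweenI) simp_all
    fix v w assume "v \<in> carrier E" "w \<in> carrier F"
    then show "swap (s2_tensor E F) (swap (s2_tensor E F) (pure_tensor E F v w)) = pure_tensor E F v w"
      by (simp add: swap_pure s2_moduleD(3,4)[OF E] s2_moduleD(3,4)[OF F])
  qed
  with M lin show ?thesis by (simp add: s2_module_def)
qed

end

section \<open>Hadamard products\<close>

lemma bilin_ext_single_right: "bilin_ext g p (Poly_Mapping.single t c) = Poly_Mapping.map ((*) c) (lin_ext (\<lambda>s. g s t) p)"
  unfolding bilin_ext_left by (cases "c = 0") (auto intro!: poly_mapping_eqI)

lemma bilin_ext_single_left: "bilin_ext g (Poly_Mapping.single s c) q = Poly_Mapping.map ((*) c) (lin_ext (g s) q)"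
  unfolding bilin_ext_right by (cases "c = 0") (auto intro!: poly_mapping_eqI)

lemma pair_operad_simps [simp]:
  "elems (pair_operad P Q) n = carrier (comps P n) \<times> carrier (comps Q n)"
  "sact (pair_operad P Q) n (x, y) \<sigma> = (pact P n x \<sigma>, pact Q n y \<sigma>)"
  "sident (pair_operad P Q) = (ident P, ident Q)"
  "scomp (pair_operad P Q) n m i (x, y) (x', y') = (pcomp P n m i x x', pcomp Q n m i y y')"
  by (simp_all add: pair_operad_def)

locale two_operads =
  fixes P :: "('k::field, 'x) operad" and Q :: "('k, 'y) operad"
  assumes P: "lin_operad P" and Q: "lin_operad Q"
begin

lemma pair_operad_closed: "set_operad_closed (pair_operad P Q)"
  unfolding set_operad_closed_def
  by (auto simp: lin_operad_ident[OF P] lin_operad_ident[OF Q] lin_operad_pact_closed[OF P] lin_operad_pact_closed[OF Q]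
      lin_operad_pcomp_closed[OF P] lin_operad_pcomp_closed[OF Q] simp del: One_nat_def)

lemma tm: "tensor_modules (comps P n) (comps Q n)"
  by (simp add: tensor_modules_def lin_operad_module[OF P] lin_operad_module[OF Q])

text \<open>With one argument of a composition equal to a pair, the composition is a pair of linear
  maps in the other argument, to which \<open>lin_ext_tensor_rels\<close> applies. A general
  argument is reached by adding monomials.\<close>

lemma tensor_rels_ideal: "operad_ideal (linearize (pair_operad P Q)) (\<lambda>n. tensor_rels (comps P n) (comps Q n))"
  unfolding operad_ideal_def
proof (intro conjI allI impI ballI)
  show "submodule (tensor_rels (comps P n) (comps Q n)) KK (comps (linearize (pair_operad P Q)) n)" for n
    using tensor_modules.tensor_rels_submodule[OF tm] by simp
next
  fix n x \<sigma> assume *: "(n::nat) \<ge> 1" "x \<in> tensor_rels (comps P n) (comps Q n)" "\<sigma> permutes {1..n}"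
  have eq: "(\<lambda>s. sact (pair_operad P Q) n s \<sigma>) = map_prod (\<lambda>x. pact P n x \<sigma>) (\<lambda>y. pact Q n y \<sigma>)"
    by (auto simp: fun_eq_iff)
  show "pact (linearize (pair_operad P Q)) n x \<sigma> \<in> tensor_rels (comps P n) (comps Q n)"
    unfolding linearize_simps eq
    by (rule lin_ext_tensor_rels[OF tm tm lin_operad_pact[OF P *(1,3)] lin_operad_pact[OF Q *(1,3)] *(2)])
next
  fix n m i x y
  assume *: "(n::nat) \<ge> 1" "(m::nat) \<ge> 1" "i \<in> {1..n}" and x: "x \<in> carrier (comps (linearize (pair_operad P Q)) n)"
    and y: "y \<in> carrier (comps (linearize (pair_operad P Q)) m)"
    and or: "x \<in> tensor_rels (comps P n) (comps Q n) \<or> y \<in> tensor_rels (comps P m) (comps Q m)"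
  let ?N = "n + m - 1" and ?g = "scomp (pair_operad P Q) n m i"
  interpret N: tensor_modules "comps P ?N" "comps Q ?N" by (rule tm)
  have bilin_zero: "bilin_ext ?g 0 q = 0" "bilin_ext ?g p 0 = 0" for p q :: "'x \<times> 'y \<Rightarrow>\<^sub>0 'k"
    by (simp_all add: bilin_ext_def)
  have N0: "0 \<in> tensor_rels (comps P ?N) (comps Q ?N)" using N.T.N_facts(2) by simp
  have Nadd: "p + q \<in> tensor_rels (comps P ?N) (comps Q ?N)"
    if "p \<in> tensor_rels (comps P ?N) (comps Q ?N)" "q \<in> tensor_rels (comps P ?N) (comps Q ?N)" for p q
    using N.T.N_facts(3)[OF that] by simp
  have Nsm: "Poly_Mapping.map ((*) c) p \<in> tensor_rels (comps P ?N) (comps Q ?N)"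
    if "p \<in> tensor_rels (comps P ?N) (comps Q ?N)" for p c
    using N.T.N_facts(4)[OF that] by simp
  from or have "bilin_ext ?g x y \<in> tensor_rels (comps P ?N) (comps Q ?N)"
  proof
    assume x: "x \<in> tensor_rels (comps P n) (comps Q n)"
    have "Poly_Mapping.keys y \<subseteq> carrier (comps P m) \<times> carrier (comps Q m)" using y by simp
    then show ?thesis
    proof (induction y rule: free_module_induct)
      case zero
      show ?case unfolding bilin_zero by (rule N0)
    next
      case (add p t c)
      obtain a b where t: "t = (a, b)" "a \<in> carrier (comps P m)" "b \<in> carrier (comps Q m)" using add.hyps(2) by blast
      have "(\<lambda>s. ?g s t) = map_prod (\<lambda>x. pcomp P n m i x a) (\<lambda>y. pcomp Q n m i y b)"
        by (auto simp: fun_eq_iff t(1))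
      then have "lin_ext (\<lambda>s. ?g s t) x \<in> tensor_rels (comps P ?N) (comps Q ?N)"
        using lin_ext_tensor_rels[OF tm tm lin_operad_pcomp_left[OF P * t(2)] lin_operad_pcomp_left[OF Q * t(3)] x] by simp
      then show ?case
        unfolding bilin_ext_add_right bilin_ext_single_right by (intro Nadd Nsm add.IH)
    qed
  next
    assume y: "y \<in> tensor_rels (comps P m) (comps Q m)"
    have "Poly_Mapping.keys x \<subseteq> carrier (comps P n) \<times> carrier (comps Q n)" using x by simp
    then show ?thesis
    proof (induction x rule: free_module_induct)
      case zero
      show ?case unfolding bilin_zero by (rule N0)
    next
      case (add p t c)
      obtain a b where t: "t = (a, b)" "a \<in> carrier (comps P n)" "b \<in> carrier (comps Q n)" using add.hyps(2) by blast
      have "?g t = map_prod (pcomp P n m i a) (pcomp Q n m i b)"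
        by (auto simp: fun_eq_iff t(1))
      then have "lin_ext (?g t) y \<in> tensor_rels (comps P ?N) (comps Q ?N)"
        using lin_ext_tensor_rels[OF tm tm lin_operad_pcomp_right[OF P * t(2)] lin_operad_pcomp_right[OF Q * t(3)] y] by simp
      then show ?case
        unfolding bilin_ext_add_left bilin_ext_single_left by (intro Nadd Nsm add.IH)
    qed
  qed
  then show "pcomp (linearize (pair_operad P Q)) n m i x y \<in> tensor_rels (comps P ?N) (comps Q ?N)" by simp
qed

sublocale HQ: operad_quotient "linearize (pair_operad P Q)" "\<lambda>n. tensor_rels (comps P n) (comps Q n)"
  by (simp add: operad_quotient_def lin_operad_linearize[OF pair_operad_closed] tensor_rels_ideal)

lemma lin_operad_hadamard: "lin_operad (hadamard P Q)"
  unfolding hadamard_def by (rule HQ.lin_quot)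

lemma hadamard_comps: "comps (hadamard P Q) n = tensor (comps P n) (comps Q n)"
  unfolding hadamard_def HQ.comps_quot tensor_def by simp

lemma hadamard_pact:
  assumes "n \<ge> 1" "\<sigma> permutes {1..n}" "x \<in> carrier (comps P n)" "y \<in> carrier (comps Q n)"
  shows "pact (hadamard P Q) n (pure_tensor (comps P n) (comps Q n) x y) \<sigma> =
    pure_tensor (comps P n) (comps Q n) (pact P n x \<sigma>) (pact Q n y \<sigma>)"
  unfolding hadamard_def pure_tensor_def
  using HQ.pact_quot[OF assms(1,2), of "Poly_Mapping.single (x, y) 1"] assms by simp

lemma hadamard_pcomp:
  assumes "n \<ge> 1" "m \<ge> 1" "i \<in> {1..n}" "x \<in> carrier (comps P n)" "y \<in> carrier (comps Q n)"
    "x' \<in> carrier (comps P m)" "y' \<in> carrier (comps Q m)"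
  shows "pcomp (hadamard P Q) n m i (pure_tensor (comps P n) (comps Q n) x y) (pure_tensor (comps P m) (comps Q m) x' y') =
    pure_tensor (comps P (n + m - 1)) (comps Q (n + m - 1)) (pcomp P n m i x x') (pcomp Q n m i y y')"
  unfolding hadamard_def pure_tensor_def
  using HQ.pcomp_quot[OF assms(1-3), of "Poly_Mapping.single (x, y) 1" "Poly_Mapping.single (x', y') 1"] assms(4-7)
  by (simp del: One_nat_def)

lemma hadamard_ident: "ident (hadamard P Q) = pure_tensor (comps P 1) (comps Q 1) (ident P) (ident Q)"
  unfolding hadamard_def pure_tensor_def by (simp add: quot_operad_def)

end

section \<open>Multilinear expansion of trees\<close>

text \<open>A label in \<open>E \<otimes> F\<close> is a class of formal sums of pairs. Choosing a
  formal sum \<open>r c\<close> for each label and expanding multilinearly turns a tree into a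
  combination of trees labelled by pairs; this is the contribution of one vertex.\<close>

definition label_mult :: "('c \<Rightarrow> ('d \<Rightarrow>\<^sub>0 'k::field)) \<Rightarrow> 'c \<Rightarrow> ('d btree \<Rightarrow>\<^sub>0 'k) \<Rightarrow> ('d btree \<Rightarrow>\<^sub>0 'k) \<Rightarrow> ('d btree \<Rightarrow>\<^sub>0 'k)"
  where "label_mult r c p q = (\<Sum>x\<in>Poly_Mapping.keys (r c). Poly_Mapping.map ((*) (Poly_Mapping.lookup (r c) x)) (bilin_ext (Node x) p q))"

definition expand :: "('c \<Rightarrow> ('d \<Rightarrow>\<^sub>0 'k::field)) \<Rightarrow> 'c btree \<Rightarrow> ('d btree \<Rightarrow>\<^sub>0 'k)"
  where "expand r t = tree_eval (label_mult r) t (\<lambda>i. Poly_Mapping.single (Leaf i) 1)"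

lemma label_mult_add:
  "label_mult r c (p + p') q = label_mult r c p q + label_mult r c p' q"
  "label_mult r c p (q + q') = label_mult r c p q + label_mult r c p q'"
  by (simp_all add: label_mult_def bilin_ext_add_left bilin_ext_add_right map_smult_add sum.distrib)

lemma label_mult_smult:
  "label_mult r c (Poly_Mapping.map ((*) a) p) q = Poly_Mapping.map ((*) a) (label_mult r c p q)"
  "label_mult r c p (Poly_Mapping.map ((*) a) q) = Poly_Mapping.map ((*) a) (label_mult r c p q)"
  unfolding label_mult_def bilin_ext_smult_left bilin_ext_smult_right map_smult_sum
  by (rule sum.cong[OF refl], rule map_smult_smult)+

lemma poly_mapping_additive_eq:
  fixes F G :: "('s \<Rightarrow>\<^sub>0 'k::field) \<Rightarrow> 'b::ab_group_add"
  assumes "\<And>p q. F (p + q) = F p + F q" "\<And>p q. G (p + q) = G p + G q"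
    and "\<And>s c. F (Poly_Mapping.single s c) = G (Poly_Mapping.single s c)"
  shows "F p = G p"
proof -
  have 0: "F 0 = 0" "G 0 = 0"
    using assms(1)[of 0 0] assms(2)[of 0 0] by simp_all
  have "Poly_Mapping.keys p \<subseteq> UNIV" by simp
  then show ?thesis
    by (induction p rule: free_module_induct) (simp_all add: 0 assms)
qed

lemma lin_ext_bilin_ext:
  assumes "\<And>s t. g (h s t) = h' (g1 s) (g2 t)"
  shows "lin_ext g (bilin_ext h p q) = bilin_ext h' (lin_ext g1 p) (lin_ext g2 q)"
proof (rule poly_mapping_additive_eq[where p = p])
  fix s c
  show "lin_ext g (bilin_ext h (Poly_Mapping.single s c) q) = bilin_ext h' (lin_ext g1 (Poly_Mapping.single s c)) (lin_ext g2 q)"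
    by (rule poly_mapping_additive_eq[where p = q]) (simp_all add: bilin_ext_add_right lin_ext_add assms)
qed (simp_all add: bilin_ext_add_left lin_ext_add)

lemma lin_ext_sum: "lin_ext g (sum f A) = (\<Sum>x\<in>A. lin_ext g (f x))"
  by (induction A rule: infinite_finite_induct) (simp_all add: lin_ext_add)

lemma label_mult_lin_ext:
  "label_mult r c (lin_ext (tree_subst f) p) (lin_ext (tree_subst f) q) = lin_ext (tree_subst f) (label_mult r c p q)"
  unfolding label_mult_def lin_ext_sum lin_ext_smult
  by (rule sum.cong[OF refl], subst lin_ext_bilin_ext[where h' = "Node _"]) simp_all

lemma tree_eval_label:
  "tree_eval (label_mult r) t (\<lambda>j. Poly_Mapping.single (f j) 1) = lin_ext (tree_subst f) (expand r t)"
  unfolding expand_def by (induction t) (simp_all add: label_mult_lin_ext)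

lemma expand_relabel:
  "expand r (tree_subst (\<lambda>j. Leaf (g j)) t) = lin_ext (tree_subst (\<lambda>j. Leaf (g j))) (expand r t)"
  using tree_eval_label[of r t "\<lambda>j. Leaf (g j)"] by (simp add: expand_def tree_eval_subst)

text \<open>The leaf \<open>i\<close> occurs once in \<open>t\<close>, so evaluating
  \<open>t\<close> is linear in what is put there, and the expansion of \<open>u\<close> may be
  replaced by a single tree. For a single tree grafting is a substitution, and substitution commutes
  with expansion.\<close>

lemma expand_graft:
  fixes r :: "'c \<Rightarrow> ('d \<Rightarrow>\<^sub>0 'k::field)"
  assumes t: "distinct (leaves t)" "i \<in> set (leaves t)"
  shows "expand r (tree_subst (graft m i u) t) = bilin_ext (\<lambda>t u. tree_subst (graft m i u) t) (expand r t) (expand r u)"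
proof -
  let ?\<mu> = "label_mult r" and ?shift = "\<lambda>l. Leaf (l + (i - 1)) :: 'd btree"
  let ?v = "\<lambda>j. Poly_Mapping.single (if j < i then Leaf j else Leaf (j + m - 1) :: 'd btree) (1::'k)"
  note add = tree_eval_add[where S = UNIV and m = ?\<mu>, OF subset_UNIV t label_mult_add]
  have "(\<lambda>j. tree_eval ?\<mu> (graft m i u j) (\<lambda>i. Poly_Mapping.single (Leaf i) 1)) = ?v(i := lin_ext (tree_subst ?shift) (expand r u))"
    using expand_relabel[of r "\<lambda>l. l + (i - 1)" u] by (auto simp: fun_eq_iff expand_def)
  then have "expand r (tree_subst (graft m i u) t) = tree_eval ?\<mu> t (?v(i := lin_ext (tree_subst ?shift) (expand r u)))"
    unfolding expand_def[of r "tree_subst _ _"] tree_eval_subst by (simp only:)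
  also have "\<dots> = bilin_ext (\<lambda>t u. tree_subst (graft m i u) t) (expand r t) (expand r u)"
  proof (rule poly_mapping_additive_eq[where p = "expand r u"])
    fix p q
    show "tree_eval ?\<mu> t (?v(i := lin_ext (tree_subst ?shift) (p + q))) =
      tree_eval ?\<mu> t (?v(i := lin_ext (tree_subst ?shift) p)) + tree_eval ?\<mu> t (?v(i := lin_ext (tree_subst ?shift) q))"
      unfolding lin_ext_add by (rule add)
  next
    fix u :: "'d btree" and c :: 'k
    have sc: "tree_eval ?\<mu> t (?v(i := Poly_Mapping.map ((*) c) (Poly_Mapping.single (tree_subst ?shift u) 1))) =
        Poly_Mapping.map ((*) c) (tree_eval ?\<mu> t (?v(i := Poly_Mapping.single (tree_subst ?shift u) 1)))"
      by (rule tree_eval_scale[where S = UNIV, OF subset_UNIV t]) (simp_all only: label_mult_smult)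
    have "?v(i := Poly_Mapping.single (tree_subst ?shift u) 1) = (\<lambda>j. Poly_Mapping.single (graft m i u j) (1::'k))"
      by (auto simp: fun_eq_iff)
    then have "tree_eval ?\<mu> t (?v(i := Poly_Mapping.single (tree_subst ?shift u) 1)) = lin_ext (tree_subst (graft m i u)) (expand r t)"
      by (simp only: tree_eval_label)
    then show "tree_eval ?\<mu> t (?v(i := lin_ext (tree_subst ?shift) (Poly_Mapping.single u c))) =
      bilin_ext (\<lambda>t u. tree_subst (graft m i u) t) (expand r t) (Poly_Mapping.single u c)"
      unfolding bilin_ext_single_right lin_ext_single using sc by simp
  qed (rule bilin_ext_add_right)
  finally show ?thesis .
qed

lemma keys_expand:
  assumes "\<And>c. c \<in> set_btree t \<Longrightarrow> Poly_Mapping.keys (r c) \<subseteq> D"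
  shows "Poly_Mapping.keys (expand r t) \<subseteq> {t'. leaves t' = leaves t \<and> set_btree t' \<subseteq> D}"
  using assms
proof (induction t)
  case (Leaf i)
  then show ?case by (simp add: expand_def)
next
  case (Node c t1 t2)
  have "Poly_Mapping.keys (label_mult r c (expand r t1) (expand r t2)) \<subseteq> {t'. leaves t' = leaves (Node c t1 t2) \<and> set_btree t' \<subseteq> D}"
    unfolding label_mult_def
  proof (rule keys_sum_subset)
    fix x assume "x \<in> Poly_Mapping.keys (r c)"
    then have x: "x \<in> D" using Node.prems by auto
    have "Poly_Mapping.keys (bilin_ext (Node x) (expand r t1) (expand r t2)) \<subseteq> {t'. leaves t' = leaves (Node c t1 t2) \<and> set_btree t' \<subseteq> D}"
      by (rule bilin_ext_keys[OF Node.IH]) (use Node.prems x in auto)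
    then show "Poly_Mapping.keys (Poly_Mapping.map ((*) (Poly_Mapping.lookup (r c) x)) (bilin_ext (Node x) (expand r t1) (expand r t2)))
      \<subseteq> {t'. leaves t' = leaves (Node c t1 t2) \<and> set_btree t' \<subseteq> D}"
      by (rule subset_trans[OF keys_smult])
  qed
  then show ?case by (simp add: expand_def)
qed

lemma expand_corolla:
  "expand r (Node c (Leaf i) (Leaf j)) = lin_ext (\<lambda>x. Node x (Leaf i) (Leaf j)) (r c)"
  by (simp add: expand_def label_mult_def lin_ext_def)

section \<open>The morphism defining the white product\<close>

lemma map_btree_subst: "map_btree g (tree_subst f t) = tree_subst (\<lambda>j. map_btree g (f j)) (map_btree g t)"
  by (induction t) auto

lemma leaves_map_btree [simp]: "leaves (map_btree g t) = leaves t"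
  by (induction t) auto

lemma map_btree_graft: "map_btree g (tree_subst (graft m i u) t) = tree_subst (graft m i (map_btree g u)) (map_btree g t)"
  unfolding map_btree_subst by (rule tree_subst_cong) (auto simp: map_btree_subst)

context s2_tensor_modules
begin

interpretation FE: two_operads "free_operad E" "free_operad F"
  by (simp add: two_operads_def lin_operad_free[OF E] lin_operad_free[OF F])

abbreviation "H \<equiv> hadamard (free_operad E) (free_operad F)"
abbreviation "G \<equiv> s2_tensor E F"
abbreviation ht :: "nat \<Rightarrow> _ \<Rightarrow> _ \<Rightarrow> _"
  where "ht n \<equiv> pure_tensor (comps (free_operad E) n) (comps (free_operad F) n)"

text \<open>The expansion of a tree depends on these choices. Its image in the Hadamard product is
  nevertheless compatible with the relations of the free operad, as the values on corollas show in
  \<open>manin_hom_exists\<close>.\<close>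

definition rep :: "('e \<times> 'f \<Rightarrow>\<^sub>0 'k) set \<Rightarrow> ('e \<times> 'f \<Rightarrow>\<^sub>0 'k)"
  where "rep x = (SOME p. p \<in> carrier VW \<and> x = tcls p)"

lemma rep:
  assumes "x \<in> carrier (tensor E F)"
  shows "rep x \<in> carrier VW \<and> x = tcls (rep x)"
proof -
  have "\<exists>p. p \<in> carrier VW \<and> x = tcls p" using tensor_cls[OF assms] by blast
  from someI_ex[OF this] show ?thesis unfolding rep_def .
qed

lemma map_fst_mem: "t \<in> elems (tree_operad (carrier E \<times> carrier F)) n \<Longrightarrow> map_btree fst t \<in> elems (tree_operad (carrier E)) n"
  and map_snd_mem: "t \<in> elems (tree_operad (carrier E \<times> carrier F)) n \<Longrightarrow> map_btree snd t \<in> elems (tree_operad (carrier F)) n"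
  by (auto simp: btree.set_map)

text \<open>A tree labelled by pairs splits into two trees of the same shape. Relabelling and
  grafting respect the splitting, and the Hadamard product composes componentwise.\<close>

lemma pair_trees_hom:
  obtains \<eta> where "operad_hom (linearize (tree_operad (carrier E \<times> carrier F))) H \<eta>"
    and "\<And>n t. n \<ge> 1 \<Longrightarrow> t \<in> elems (tree_operad (carrier E \<times> carrier F)) n \<Longrightarrow>
      \<eta> n (Poly_Mapping.single t 1) = ht n (tree_class E n (map_btree fst t)) (tree_class F n (map_btree snd t))"
proof -
  let ?T = "tree_operad (carrier E \<times> carrier F)"
  define h where "h n t = ht n (tree_class E n (map_btree fst t)) (tree_class F n (map_btree snd t))" for n t
  note cE = tree_class_closed[OF E map_fst_mem] and cF = tree_class_closed[OF F map_snd_mem]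
  have car: "h n t \<in> carrier (comps H n)" if "n \<ge> 1" "t \<in> elems ?T n" for n t
    unfolding h_def FE.hadamard_comps using that(2) cE cF by (intro tensor_modules.pure_closed[OF FE.tm])
  have act: "h n (sact ?T n t \<sigma>) = pact H n (h n t) \<sigma>"
    if "n \<ge> 1" "t \<in> elems ?T n" "\<sigma> permutes {1..n}" for n t \<sigma>
  proof -
    have "h n (sact ?T n t \<sigma>) = ht n (pact (free_operad E) n (tree_class E n (map_btree fst t)) \<sigma>) (pact (free_operad F) n (tree_class F n (map_btree snd t)) \<sigma>)"
      unfolding h_def tree_class_pact[OF E that(1,3) map_fst_mem[OF that(2)]] tree_class_pact[OF F that(1,3) map_snd_mem[OF that(2)]]
      by (simp add: map_btree_subst)
    also have "\<dots> = pact H n (h n t) \<sigma>"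
      unfolding h_def by (rule FE.hadamard_pact[OF that(1,3) cE[OF that(2)] cF[OF that(2)], symmetric])
    finally show ?thesis .
  qed
  have id: "h 1 (sident ?T) = ident H"
  proof -
    have "tree_class E 1 (Leaf 1) = ident (free_operad E)" "tree_class F 1 (Leaf 1) = ident (free_operad F)"
      by (simp_all add: tree_class_def free_operad_def quot_operad_def)
    then show ?thesis unfolding FE.hadamard_ident h_def by simp
  qed
  have comp: "h (n + m - 1) (scomp ?T n m i t u) = pcomp H n m i (h n t) (h m u)"
    if n: "n \<ge> 1" "m \<ge> 1" "i \<in> {1..n}" and t: "t \<in> elems ?T n" and u: "u \<in> elems ?T m" for n m i t u
  proof -
    have "h (n + m - 1) (scomp ?T n m i t u) = ht (n + m - 1)
        (pcomp (free_operad E) n m i (tree_class E n (map_btree fst t)) (tree_class E m (map_btree fst u)))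
        (pcomp (free_operad F) n m i (tree_class F n (map_btree snd t)) (tree_class F m (map_btree snd u)))"
      unfolding h_def tree_class_pcomp[OF E n map_fst_mem[OF t] map_fst_mem[OF u]] tree_class_pcomp[OF F n map_snd_mem[OF t] map_snd_mem[OF u]]
      unfolding tree_operad_simps(4) map_btree_graft ..
    also have "\<dots> = pcomp H n m i (h n t) (h m u)"
      unfolding h_def by (rule FE.hadamard_pcomp[OF n cE[OF t] cF[OF t] cE[OF u] cF[OF u], symmetric])
    finally show ?thesis .
  qed
  obtain \<eta> where \<eta>: "operad_hom (linearize ?T) H \<eta>"
    "\<And>n t c. n \<ge> 1 \<Longrightarrow> t \<in> elems ?T n \<Longrightarrow> \<eta> n (Poly_Mapping.single t c) = c \<odot>\<^bsub>comps H n\<^esub> h n t"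
    by (rule hom_linearize[OF tree_operad_closed FE.lin_operad_hadamard car act id comp]) (assumption | (rule that; assumption))+
  have "\<eta> n (Poly_Mapping.single t 1) = h n t" if "n \<ge> 1" "t \<in> elems ?T n" for n t
  proof -
    interpret kmodule "comps H n" using lin_operad_module[OF FE.lin_operad_hadamard] by (simp add: kmodule_def)
    show ?thesis using \<eta>(2)[OF that, of 1] car[OF that] by simp
  qed
  then show ?thesis using \<eta>(1) unfolding h_def by (intro that[of \<eta>])
qed

lemma expand_hom:
  obtains \<chi> where "operad_hom (linearize (tree_operad (carrier G))) (linearize (tree_operad (carrier E \<times> carrier F)) :: ('k, _) operad) \<chi>"
    and "\<And>n t. n \<ge> 1 \<Longrightarrow> t \<in> elems (tree_operad (carrier G)) n \<Longrightarrow> \<chi> n (Poly_Mapping.single t 1) = expand rep t"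
proof -
  let ?T = "tree_operad (carrier E \<times> carrier F)" and ?C = "tree_operad (carrier G)"
  have car: "expand rep t \<in> carrier (comps (linearize ?T :: ('k, _) operad) n)" if "n \<ge> 1" "t \<in> elems ?C n" for n t
  proof -
    have "Poly_Mapping.keys (rep c) \<subseteq> carrier E \<times> carrier F" if "c \<in> set_btree t" for c
      using rep[of c] that \<open>t \<in> elems ?C n\<close> by auto
    then have "Poly_Mapping.keys (expand rep t) \<subseteq> {t'. leaves t' = leaves t \<and> set_btree t' \<subseteq> carrier E \<times> carrier F}"
      by (intro keys_expand)
    then show ?thesis using that(2) by auto
  qed
  have act: "expand rep (sact ?C n t \<sigma>) = pact (linearize ?T) n (expand rep t) \<sigma>"
    if "n \<ge> 1" "t \<in> elems ?C n" "\<sigma> permutes {1..n}" for n t \<sigma>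
    by (simp add: expand_relabel)
  have id: "expand rep (sident ?C) = ident (linearize ?T)"
    by (simp add: expand_def)
  have comp: "expand rep (scomp ?C n m i t u) = pcomp (linearize ?T) n m i (expand rep t) (expand rep u)"
    if n: "n \<ge> 1" "m \<ge> 1" "i \<in> {1..n}" and t: "t \<in> elems ?C n" and u: "u \<in> elems ?C m" for n m i t u
  proof -
    have "scomp ?T n m i = (\<lambda>t u. tree_subst (graft m i u) t)" by (simp add: fun_eq_iff)
    then show ?thesis unfolding linearize_simps tree_operad_simps(4) using expand_graft[where t = t and i = i and r = rep and m = m and u = u] t n(3) by simp
  qed
  obtain \<chi> where \<chi>: "operad_hom (linearize ?C) (linearize ?T :: ('k, _) operad) \<chi>"
    "\<And>n t c. n \<ge> 1 \<Longrightarrow> t \<in> elems ?C n \<Longrightarrow> \<chi> n (Poly_Mapping.single t c) = c \<odot>\<^bsub>comps (linearize ?T) n\<^esub> expand rep t"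
    by (rule hom_linearize[where h = "\<lambda>n. expand rep", OF tree_operad_closed lin_operad_trees car act id comp])
      (assumption | (rule that; assumption))+
  have "\<chi> n (Poly_Mapping.single t 1) = expand rep t" if "n \<ge> 1" "t \<in> elems ?C n" for n t
    using \<chi>(2)[OF that, of 1] by (auto intro!: poly_mapping_eqI)
  then show ?thesis using \<chi>(1) by (intro that[of \<chi>])
qed

lemma corolla_tensor:
  obtains K where "linear_between (tensor E F) (comps H 2) K"
    and "\<And>e f. e \<in> carrier E \<Longrightarrow> f \<in> carrier F \<Longrightarrow> K (pure_tensor E F e f) = ht 2 (corolla E e) (corolla F f)"
proof -
  interpret T2: tensor_modules "comps (free_operad E) 2" "comps (free_operad F) 2" by (rule FE.tm)
  note cE = corolla_closed[OF E] and cF = corolla_closed[OF F]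
  show ?thesis
    by (rule tensor_extend[OF lin_operad_module[OF FE.lin_operad_hadamard, of 2], of "\<lambda>e f. ht 2 (corolla E e) (corolla F f)"])
      (simp_all only: FE.hadamard_comps T2.pure_closed cE cF corolla_add[OF E] corolla_add[OF F] corolla_smult[OF E] corolla_smult[OF F]
        T2.pure_add_left T2.pure_add_right T2.pure_smult_left T2.pure_smult_right that)
qed

text \<open>The map on trees is expansion followed by splitting. On a corolla labelled
  \<open>c\<close> it equals \<open>K c\<close>, where \<open>K\<close> is linear on
  \<open>E \<otimes> F\<close> and does not mention \<open>rep\<close>; this gives the linearity
  relations, and the reversed corolla gives \<open>K (swap G c)\<close>, hence the relation for the
  transposition.\<close>

lemma manin_hom_exists:
  "\<exists>\<Phi>. operad_hom (free_operad G) H \<Phi> \<and>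
    (\<forall>e\<in>carrier E. \<forall>f\<in>carrier F. \<Phi> 2 (corolla G (pure_tensor E F e f)) = ht 2 (corolla E e) (corolla F f))"
proof -
  let ?T = "tree_operad (carrier E \<times> carrier F)" and ?C = "tree_operad (carrier G)"
  note Gs = s2_tensor_s2_module
  obtain \<eta> where \<eta>: "operad_hom (linearize ?T) H \<eta>"
    "\<And>n t. n \<ge> 1 \<Longrightarrow> t \<in> elems ?T n \<Longrightarrow>
      \<eta> n (Poly_Mapping.single t 1) = ht n (tree_class E n (map_btree fst t)) (tree_class F n (map_btree snd t))"
    using pair_trees_hom by blast
  obtain \<chi> where \<chi>: "operad_hom (linearize ?C) (linearize ?T :: ('k, _) operad) \<chi>"
    "\<And>n t. n \<ge> 1 \<Longrightarrow> t \<in> elems ?C n \<Longrightarrow> \<chi> n (Poly_Mapping.single t 1) = expand rep t"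
    using expand_hom by blast
  obtain K where K: "linear_between (tensor E F) (comps H 2) K"
    "\<And>e f. e \<in> carrier E \<Longrightarrow> f \<in> carrier F \<Longrightarrow> K (pure_tensor E F e f) = ht 2 (corolla E e) (corolla F f)"
    using corolla_tensor by blast
  let ?\<theta> = "\<lambda>n x. \<eta> n (\<chi> n x)"
  have \<theta>: "operad_hom (linearize ?C) H ?\<theta>" by (rule operad_hom_comp[OF \<chi>(1) \<eta>(1)])
  have H2: "module KK (comps H 2)" by (rule lin_operad_module[OF FE.lin_operad_hadamard])
  have \<eta>2: "linear_between (free_module (elems ?T 2)) (comps H 2) (\<eta> 2)"
    using operad_hom_linear[OF \<eta>(1), of 2] by (simp del: tree_operad_simps)
  have m1: "cor_tree x \<in> elems ?T 2" "Node x (Leaf 2) (Leaf 1) \<in> elems ?T 2" if "x \<in> carrier E \<times> carrier F" for x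
    by (rule cor_tree_mem[OF that])+
  note proj = T.proj_linear[folded tensor_def]
  have "\<eta> 2 (lin_ext cor_tree p) = K (tcls p)" if "p \<in> carrier VW" for p
  proof (rule free_module_linear_eq[OF H2 linear_between_comp[OF lin_ext_linear[OF m1(1)] \<eta>2] linear_between_comp[OF proj K(1)]])
    fix x assume x: "x \<in> carrier E \<times> carrier F"
    then obtain e f where ef: "x = (e, f)" "e \<in> carrier E" "f \<in> carrier F" by blast
    show "\<eta> 2 (lin_ext cor_tree (Poly_Mapping.single x 1)) = K (tcls (Poly_Mapping.single x 1))"
      using \<eta>(2)[OF _ m1(1)[OF x]] K(2)[OF ef(2,3)] by (simp add: ef(1) pure_tensor_def corolla_def)
  qed (use that in simp_all)
  then have cor: "?\<theta> 2 (Poly_Mapping.single (cor_tree c) 1) = K c" if "c \<in> carrier G" for c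
    using \<chi>(2)[OF _ cor_tree_mem(1)[OF that]] rep[of c] that by (simp add: expand_corolla)
  \<comment> \<open>Both sides are linear in \<open>p\<close>. For a single pair, reversing the
    leaves swaps both labels at once, and this is the transposition of the pure tensor.\<close>
  have "\<eta> 2 (lin_ext (\<lambda>x. Node x (Leaf 2) (Leaf 1)) p) = K (tcls (swap_poly p))" if "p \<in> carrier VW" for p
  proof (rule free_module_linear_eq[OF H2 linear_between_comp[OF lin_ext_linear[OF m1(2)] \<eta>2]
        linear_between_comp[OF linear_between_comp[OF swap_poly_linear proj] K(1)]])
    fix x assume x: "x \<in> carrier E \<times> carrier F"
    then obtain e f where ef: "x = (e, f)" "e \<in> carrier E" "f \<in> carrier F" by blast
    show "\<eta> 2 (lin_ext (\<lambda>x. Node x (Leaf 2) (Leaf 1)) (Poly_Mapping.single x 1)) = K (tcls (swap_poly (Poly_Mapping.single x 1)))"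
      using \<eta>(2)[OF _ m1(2)[OF x]] K(2)[OF s2_moduleD(4)[OF E ef(2)] s2_moduleD(4)[OF F ef(3)]]
      by (simp add: ef(1) pure_tensor_def corolla_swap[OF E ef(2)] corolla_swap[OF F ef(3)])
  qed (use that in simp_all)
  then have cor': "?\<theta> 2 (Poly_Mapping.single (Node c (Leaf 2) (Leaf 1)) 1) = K (swap G c)" if "c \<in> carrier G" for c
    using \<chi>(2)[OF _ cor_tree_mem(2)[OF that]] rep[of c] that swap_tcls[of "rep c"] by (simp add: expand_corolla)
  note Gc = s2_moduleD(4-6)[OF Gs]
  obtain \<Phi> where \<Phi>: "operad_hom (free_operad G) H \<Phi>"
    "\<And>n t. n \<ge> 1 \<Longrightarrow> t \<in> elems ?C n \<Longrightarrow> \<Phi> n (tree_class G n t) = ?\<theta> n (Poly_Mapping.single t 1)"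
  proof (rule free_operad_hom[OF Gs FE.lin_operad_hadamard \<theta>])
    fix c d assume c: "c \<in> carrier G" "d \<in> carrier G"
    show "?\<theta> 2 (Poly_Mapping.single (cor_tree (c \<oplus>\<^bsub>G\<^esub> d)) 1) =
        ?\<theta> 2 (Poly_Mapping.single (cor_tree c) 1) \<oplus>\<^bsub>comps H 2\<^esub> ?\<theta> 2 (Poly_Mapping.single (cor_tree d) 1)"
      unfolding cor[OF c(1)] cor[OF c(2)] cor[OF Gc(2)[OF c]] using linear_betweenD(2)[OF K(1)] c by simp
  next
    fix a c assume c: "c \<in> carrier G"
    show "?\<theta> 2 (Poly_Mapping.single (cor_tree (a \<odot>\<^bsub>G\<^esub> c)) 1) = a \<odot>\<^bsub>comps H 2\<^esub> ?\<theta> 2 (Poly_Mapping.single (cor_tree c) 1)"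
      unfolding cor[OF c] cor[OF Gc(3)[OF c]] using linear_betweenD(3)[OF K(1)] c by simp
  next
    fix c assume c: "c \<in> carrier G"
    show "?\<theta> 2 (Poly_Mapping.single (cor_tree (swap G c)) 1) = ?\<theta> 2 (Poly_Mapping.single (Node c (Leaf 2) (Leaf 1)) 1)"
      unfolding cor'[OF c] cor[OF Gc(1)[OF c]] ..
  qed blast
  have "\<Phi> 2 (corolla G (pure_tensor E F e f)) = ht 2 (corolla E e) (corolla F f)" if "e \<in> carrier E" "f \<in> carrier F" for e f
  proof -
    have c: "pure_tensor E F e f \<in> carrier G" using pure_closed[OF that] by simp
    show ?thesis
      unfolding corolla_def[of G] using \<Phi>(2)[OF _ cor_tree_mem(1)[OF c]] cor[OF c] K(2)[OF that] by simp
  qed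
  with \<Phi>(1) show ?thesis by blast
qed

lemma manin_map:
  shows manin_hom: "operad_hom (free_operad G) H (manin_map E F)"
    and manin_corolla: "\<And>e f. e \<in> carrier E \<Longrightarrow> f \<in> carrier F \<Longrightarrow>
      manin_map E F 2 (corolla G (pure_tensor E F e f)) = ht 2 (corolla E e) (corolla F f)"
  using someI_ex[OF manin_hom_exists] unfolding manin_map_def by blast+

text \<open>A cubic element is one composition and one permutation of corollas, and both act
  componentwise in the Hadamard product.\<close>

lemma manin_cubic:
  assumes e: "e \<in> carrier E" "e' \<in> carrier E" and f: "f \<in> carrier F" "f' \<in> carrier F" and u: "u \<in> cyclic_triples"
  shows "manin_map E F 3 (cubic G (pure_tensor E F e f) (pure_tensor E F e' f') u) = ht 3 (cubic E e e' u) (cubic F f f' u)"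
proof -
  obtain i j k where ijk: "u = (i, j, k)" by (cases u)
  note \<sigma> = triple_perm(1)[OF cyclic_triples_perm[OF u[unfolded ijk]], folded ijk]
  have c: "pure_tensor E F e f \<in> carrier G" "pure_tensor E F e' f' \<in> carrier G"
    using pure_closed e f by simp_all
  note cE = corolla_closed[OF E] and cF = corolla_closed[OF F]
  have pE: "pcomp (free_operad E) 2 2 1 (corolla E e) (corolla E e') \<in> carrier (comps (free_operad E) 3)"
    using lin_operad_pcomp_closed[OF lin_operad_free[OF E], of 2 2 1] cE e by simp
  have pF: "pcomp (free_operad F) 2 2 1 (corolla F f) (corolla F f') \<in> carrier (comps (free_operad F) 3)"
    using lin_operad_pcomp_closed[OF lin_operad_free[OF F], of 2 2 1] cF f by simp
  have "manin_map E F 3 (cubic G (pure_tensor E F e f) (pure_tensor E F e' f') u) =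
      pact H 3 (pcomp H 2 2 1 (ht 2 (corolla E e) (corolla F f)) (ht 2 (corolla E e') (corolla F f'))) (triple_perm u)"
    unfolding hom_cubic[OF s2_tensor_s2_module manin_hom u c] manin_corolla[OF e(1) f(1)] manin_corolla[OF e(2) f(2)] ..
  also have "pcomp H 2 2 1 (ht 2 (corolla E e) (corolla F f)) (ht 2 (corolla E e') (corolla F f')) =
      ht 3 (pcomp (free_operad E) 2 2 1 (corolla E e) (corolla E e')) (pcomp (free_operad F) 2 2 1 (corolla F f) (corolla F f'))"
    using FE.hadamard_pcomp[of 2 2 1, OF _ _ _ cE[OF e(1)] cF[OF f(1)] cE[OF e(2)] cF[OF f(2)]] by simp
  also have "pact H 3 \<dots> (triple_perm u) = ht 3 (cubic E e e' u) (cubic F f f' u)"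
    unfolding cubic_eq_pact[OF E u e] cubic_eq_pact[OF F u f] by (rule FE.hadamard_pact[OF _ \<sigma> pE pF]) simp
  finally show ?thesis .
qed

end

section \<open>Values of morphisms to endomorphism operads\<close>

context graded
begin

lemma endo2_eqI:
  assumes "f \<in> endo_maps s gr d 2" "g \<in> endo_maps s gr d 2" "\<And>x y. f [x, y] = g [x, y]"
  shows "f = g"
  by (rule op_of_eqI[OF assms(1,2)]) (simp add: op_of_def numeral_2_eq_2 assms(3))

lemma endo2_linear:
  assumes "f \<in> endo_maps s gr d 2"
  shows "f [a + b, c] = f [a, c] + f [b, c]" "f [c, a + b] = f [c, a] + f [c, b]"
    and "f [s r a, c] = s r (f [a, c])" "f [c, s r a] = s r (f [c, a])"
    and "a \<in> gr k \<Longrightarrow> c \<in> gr l \<Longrightarrow> f [a, c] \<in> gr (k + l + d)"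
proof -
  note M = op_of_multilinear[OF assms]
  let ?v = "\<lambda>x y i. if i = (1::nat) then x else y"
  have val: "op_of 2 f v = f [v 1, v 2]" for v by (simp add: op_of_def numeral_2_eq_2)
  show "f [a + b, c] = f [a, c] + f [b, c]" "f [c, a + b] = f [c, a] + f [c, b]"
    using multilinear_add[OF M, of 1 "?v a c" a b] multilinear_add[OF M, of 2 "?v c a" a b] by (simp_all add: val)
  show "f [s r a, c] = s r (f [a, c])" "f [c, s r a] = s r (f [c, a])"
    using multilinear_scale[OF M, of 1 "?v a c" r a] multilinear_scale[OF M, of 2 "?v c a" r a] by (simp_all add: val)
  show "f [a, c] \<in> gr (k + l + d)" if "a \<in> gr k" "c \<in> gr l"
  proof -
    have "homogeneous gr 2 (?v k l) (?v a c)" using that by (simp add: homogeneous_def)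
    from multilinear_deg[OF M this] have "f [a, c] \<in> gr ((\<Sum>i=1..2. ?v k l i) + d * (int 2 - 1))"
      by (simp add: val)
    also have "{1..2::nat} = {1, 2}" by auto
    finally show ?thesis by simp
  qed
qed

text \<open>The converse of \<open>free_operad_to_End\<close>. Only the symmetry takes work: it is
  equivariance under the transposition of 1 and 2, whose sign on two arguments is the sign in
  \<open>m_swap\<close>.\<close>

lemma hom_tree_algebra:
  assumes E: "s2_module E" and d: "even d" and \<rho>: "operad_hom (free_operad E) (End_operad s gr d) \<rho>"
  shows "tree_algebra s gr E d (\<lambda>e x y. \<rho> 2 (corolla E e) [x, y])"
proof -
  have endo: "\<rho> 2 (corolla E e) \<in> endo_maps s gr d 2" if "e \<in> carrier E" for e
    using operad_hom_closed[OF \<rho>, of 2] corolla_closed[OF E that] by simp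
  have lin: "linear_between (comps (free_operad E) 2) (comps (End_operad s gr d) 2) (\<rho> 2)"
    by (rule operad_hom_linear[OF \<rho>]) simp
  show ?thesis
  proof (intro tree_algebra.intro graded_axioms tree_algebra_axioms.intro E d)
    fix e e' a b assume "e \<in> carrier E" "e' \<in> carrier E"
    then show "\<rho> 2 (corolla E (e \<oplus>\<^bsub>E\<^esub> e')) [a, b] = \<rho> 2 (corolla E e) [a, b] + \<rho> 2 (corolla E e') [a, b]"
      using corolla_closed[OF E] by (simp add: corolla_add[OF E] linear_betweenD[OF lin])
  next
    fix e r a b assume "e \<in> carrier E"
    then show "\<rho> 2 (corolla E (r \<odot>\<^bsub>E\<^esub> e)) [a, b] = s r (\<rho> 2 (corolla E e) [a, b])"
      using corolla_closed[OF E] by (simp add: corolla_smult[OF E] linear_betweenD[OF lin])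
  next
    fix e k l a b assume e: "e \<in> carrier E" and ab: "a \<in> gr k" "b \<in> gr l"
    let ?\<sigma> = "\<lambda>x. if x = 1 then 2 else if x = (2::nat) then (1::nat) else x"
    have inv: "?\<sigma> \<circ> ?\<sigma> = id" by (auto simp: fun_eq_iff)
    have \<sigma>: "?\<sigma> permutes {1..2}"
    proof (rule bij_imp_permutes)
      have 2: "{1..2} = {1, 2::nat}" by auto
      have "?\<sigma> ` {1..2} = {1..2}" unfolding 2 by auto
      moreover have "inj ?\<sigma>" by (auto simp: inj_def split: if_splits)
      ultimately show "bij_betw ?\<sigma> {1..2} {1..2}" unfolding bij_betw_def by (meson inj_on_subset subset_UNIV)
    qed auto
    have inv_\<sigma>: "inv_into UNIV ?\<sigma> = ?\<sigma>" by (rule inv_unique_comp[OF inv inv])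
    have "corolla E (swap E e) = pact (free_operad E) 2 (corolla E e) ?\<sigma>"
      unfolding corolla_def[of E e]
      by (subst tree_class_pact[OF E _ \<sigma> cor_tree_mem(1)[OF e]]) (simp_all add: inv_\<sigma>[simplified] corolla_swap[OF E e])
    then have eq: "\<rho> 2 (corolla E (swap E e)) = pact (End_operad s gr d) 2 (\<rho> 2 (corolla E e)) ?\<sigma>"
      using operad_hom_pact[OF \<rho> _ corolla_closed[OF E e] \<sigma>] by simp
    let ?v = "\<lambda>i. if i = (1::nat) then a else b" and ?k = "\<lambda>i. if i = (1::nat) then k else l"
    have h: "homogeneous gr 2 ?k ?v" using ab by (simp add: homogeneous_def)
    have u: "[1..<Suc 2] = [1, 2]" by (simp add: numeral_2_eq_2)
    have "map (inv_into UNIV ?\<sigma>) [1..<Suc 2] = [2, 1]" unfolding inv_\<sigma> u by simp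
    then have "op_of 2 (\<rho> 2 (corolla E (swap E e))) ?v =
        s (list_sign (odd_indices 2 ?k) [2, 1]) (op_of 2 (\<rho> 2 (corolla E e)) (\<lambda>i. ?v (?\<sigma> i)))"
      using End_pact_eq[OF endo[OF e] \<sigma> h] unfolding eq inv_\<sigma> by (simp only:)
    also have "list_sign (odd_indices 2 ?k) [2, 1] = (if odd k \<and> odd l then - 1 else (1::'k))"
      by (auto simp: inversion_sign_def)
    finally show "\<rho> 2 (corolla E (swap E e)) [a, b] = s (if odd k \<and> odd l then - 1 else 1) (\<rho> 2 (corolla E e) [b, a])"
      unfolding op_of_def u by simp
  qed (use endo2_linear[OF endo] in simp_all)
qed

text \<open>The values of \<open>\<rho>\<close> in arity 2 form a tree algebra, whose morphism
  \<open>\<psi>\<close> has a known value on trees. On cubic elements \<open>\<rho>\<close> and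
  \<open>\<psi>\<close> agree, since both are determined there by arity 2.\<close>

lemma hom_cubic_value:
  assumes E: "s2_module E" and d: "even d" and \<rho>: "operad_hom (free_operad E) (End_operad s gr d) \<rho>"
    and e: "e \<in> carrier E" "e' \<in> carrier E" and u: "(p, q, r) \<in> cyclic_triples" and h: "homogeneous gr 3 k v"
  shows "op_of 3 (\<rho> 3 (cubic E e e' (p, q, r))) v =
    s (list_sign (odd_indices 3 k) [p, q, r]) (\<rho> 2 (corolla E e) [\<rho> 2 (corolla E e') [v p, v q], v r])"
proof -
  interpret tree_algebra s gr E d "\<lambda>e x y. \<rho> 2 (corolla E e) [x, y]"
    by (rule hom_tree_algebra[OF E d \<rho>])
  obtain \<psi> where \<psi>: "operad_hom (free_operad E) (End_operad s gr d) \<psi>"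
    "\<And>n t k v. n \<ge> 1 \<Longrightarrow> t \<in> elems (tree_operad (carrier E)) n \<Longrightarrow> homogeneous gr n k v \<Longrightarrow>
      op_of n (\<psi> n (tree_class E n t)) v = s (list_sign (odd_indices n k) (leaves t)) (tree_eval (\<lambda>e x y. \<rho> 2 (corolla E e) [x, y]) t v)"
    by (rule free_operad_to_End) (rule that; assumption)
  have "\<rho> 2 (corolla E e) = \<psi> 2 (corolla E e)" if "e \<in> carrier E" for e
  proof (rule endo2_eqI)
    note c = operad_hom_closed[OF _ one_le_numeral corolla_closed[OF E that], where Q = "End_operad s gr d"]
    show "\<rho> 2 (corolla E e) \<in> endo_maps s gr d 2"
      using c[OF \<rho>] by (simp only: End_comps)
    show "\<psi> 2 (corolla E e) \<in> endo_maps s gr d 2"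
      using c[OF \<psi>(1)] by (simp only: End_comps)
    show "\<rho> 2 (corolla E e) [x, y] = \<psi> 2 (corolla E e) [x, y]" for x y
      by (rule corolla_value[OF \<psi>(1) _ that, symmetric]) (rule \<psi>(2))
  qed
  then have "\<rho> 3 (cubic E e e' (p, q, r)) = \<psi> 3 (cubic E e e' (p, q, r))"
    unfolding hom_cubic[OF E \<rho> u e] hom_cubic[OF E \<psi>(1) u e] by (simp only: e)
  then show ?thesis using cubic_value[OF \<psi>(1) \<psi>(2) e u h] by (simp only:)
qed

lemma op_of_cubic_sum:
  assumes E: "s2_module E" and \<rho>: "operad_hom (free_operad E) (End_operad s gr d) \<rho>" and ts: "cubic_terms E ts"
  shows "op_of 3 (\<rho> 3 (cubic_sum E ts)) v = (\<Sum>(c, e, e', u)\<leftarrow>ts. s c (op_of 3 (\<rho> 3 (cubic E e e' u)) v))"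
proof -
  have lin: "linear_between (comps (free_operad E) 3) (comps (End_operad s gr d) 3) (\<rho> 3)"
    by (rule operad_hom_linear[OF \<rho>]) simp
  show ?thesis
    unfolding linear_cubic_sum[OF E lin_operad_module[OF lin_operad_End] lin ts]
    by (induction ts) (auto simp: op_of_add op_of_scale, simp add: op_of_def)
qed

end

section \<open>The operad of permutation algebras\<close>

lemma perm_gens_simps [simp]:
  "carrier perm_gens = UNIV" "\<zero>\<^bsub>perm_gens\<^esub> = (0, 0)" "(a, b) \<oplus>\<^bsub>perm_gens\<^esub> (c, d) = (a + c, b + d)"
  "c \<odot>\<^bsub>perm_gens\<^esub> (a, b) = (c * a, c * b)" "swap perm_gens (a, b) = (b, a)" "hdeg perm_gens = 0"
  by (simp_all add: perm_gens_def)

lemma perm_gens_s2_module: "s2_module (perm_gens :: ('k::field, 'k \<times> 'k) s2module)"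
proof -
  have "module KK (perm_gens :: ('k, 'k \<times> 'k) s2module)"
    by (rule module_KK_I) (auto simp: algebra_simps)
  moreover have "linear_between perm_gens perm_gens (swap (perm_gens :: ('k, 'k \<times> 'k) s2module))"
    by (rule linear_betweenI) auto
  ultimately show ?thesis by (auto simp: s2_module_def)
qed

abbreviation PG :: "('k::field, 'k \<times> 'k) s2module" where "PG \<equiv> perm_gens"

abbreviation V3 :: "('k::field, ((('k \<times> 'k) btree \<Rightarrow>\<^sub>0 'k) set)) module"
  where "V3 \<equiv> comps (free_operad perm_gens) 3"

lemmas PG_free = lin_operad_free[OF perm_gens_s2_module]

lemma V3_module: "kmodule (V3 :: ('k::field, _) module)"
  by (rule free_module_3[OF perm_gens_s2_module])

definition perm_rels :: "((('k::field \<times> 'k) btree \<Rightarrow>\<^sub>0 'k) set) set"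
  where "perm_rels = rels Perm"

text \<open>The monomial \<open>(x_i x_j) x_k\<close>; correspondingly
  \<open>right_monom k i j\<close> is \<open>x_k (x_i x_j)\<close>.\<close>

definition left_monom :: "nat \<Rightarrow> nat \<Rightarrow> nat \<Rightarrow> (('k::field \<times> 'k) btree \<Rightarrow>\<^sub>0 'k) set"
  where "left_monom i j k = tree_class PG 3 (Node e22 (Node e22 (Leaf i) (Leaf j)) (Leaf k))"

definition right_monom :: "nat \<Rightarrow> nat \<Rightarrow> nat \<Rightarrow> (('k::field \<times> 'k) btree \<Rightarrow>\<^sub>0 'k) set"
  where "right_monom k i j = tree_class PG 3 (Node e22 (Leaf k) (Node e22 (Leaf i) (Leaf j)))"

lemma monom_closed:
  assumes "distinct [i, j, k]" "{i, j, k} = {1..3}"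
  shows "left_monom i j k \<in> carrier (V3 :: ('k::field, _) module)" "right_monom k i j \<in> carrier (V3 :: ('k::field, _) module)"
  unfolding left_monom_def right_monom_def
  by (rule tree_class_closed[OF perm_gens_s2_module tree3_mem(1)[OF perm_gens_s2_module _ _ assms]]
    tree_class_closed[OF perm_gens_s2_module tree3_mem(2)[OF perm_gens_s2_module _ _ assms]]; simp)+

lemma monoms_closed:
  "left_monom 1 2 3 \<in> carrier (V3 :: ('k::field, _) module)"
  "left_monom 2 1 3 \<in> carrier (V3 :: ('k::field, _) module)"
  "right_monom 1 2 3 \<in> carrier (V3 :: ('k::field, _) module)"
proof -
  have s: "{1, 2, 3} = {1..3::nat}" "{2, 1, 3} = {1..3::nat}" "{2, 3, 1} = {1..3::nat}" by auto
  show "left_monom 1 2 3 \<in> carrier (V3 :: ('k::field, _) module)" by (rule monom_closed(1)[OF _ s(1)]) simp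
  show "left_monom 2 1 3 \<in> carrier (V3 :: ('k::field, _) module)" by (rule monom_closed(1)[OF _ s(2)]) simp
  show "right_monom 1 2 3 \<in> carrier (V3 :: ('k::field, _) module)" by (rule monom_closed(2)[OF _ s(3)]) simp
qed

lemma monom_pact:
  assumes "distinct [i, j, k]" "{i, j, k} = {1..3::nat}"
  shows "pact (free_operad PG) 3 (left_monom 1 2 3) (triple_perm (i, j, k)) = (left_monom i j k :: (('k::field \<times> 'k) btree \<Rightarrow>\<^sub>0 'k) set)"
    and "pact (free_operad PG) 3 (left_monom 2 1 3) (triple_perm (i, j, k)) = (left_monom j i k :: (('k::field \<times> 'k) btree \<Rightarrow>\<^sub>0 'k) set)"
    and "pact (free_operad PG) 3 (right_monom 1 2 3) (triple_perm (i, j, k)) = (right_monom i j k :: (('k::field \<times> 'k) btree \<Rightarrow>\<^sub>0 'k) set)"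
proof -
  note \<sigma> = triple_perm[OF assms]
  have m: "Node e22 (Node e22 (Leaf 1) (Leaf 2)) (Leaf 3) \<in> elems (tree_operad (carrier PG)) 3"
    "Node e22 (Node e22 (Leaf 2) (Leaf 1)) (Leaf 3) \<in> elems (tree_operad (carrier PG)) 3"
    "Node e22 (Leaf 1) (Node e22 (Leaf 2) (Leaf 3)) \<in> elems (tree_operad (carrier PG)) 3"
    by auto
  note r = tree_class_relabel[OF perm_gens_s2_module \<sigma>(1)]
  show "pact (free_operad PG) 3 (left_monom 1 2 3) (triple_perm (i, j, k)) = (left_monom i j k :: (('k \<times> 'k) btree \<Rightarrow>\<^sub>0 'k) set)"
    unfolding left_monom_def r[OF m(1)] by (simp only: tree_subst.simps \<sigma>)
  show "pact (free_operad PG) 3 (left_monom 2 1 3) (triple_perm (i, j, k)) = (left_monom j i k :: (('k \<times> 'k) btree \<Rightarrow>\<^sub>0 'k) set)"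
    unfolding left_monom_def r[OF m(2)] by (simp only: tree_subst.simps \<sigma>)
  show "pact (free_operad PG) 3 (right_monom 1 2 3) (triple_perm (i, j, k)) = (right_monom i j k :: (('k \<times> 'k) btree \<Rightarrow>\<^sub>0 'k) set)"
    unfolding right_monom_def r[OF m(3)] by (simp only: tree_subst.simps \<sigma>)
qed

lemma perm_rels_hull:
  "perm_rels = (\<lambda>R. submodule R KK V3 \<and> s3_stable (free_operad PG) R) hull
    {left_monom 1 2 3 \<ominus>\<^bsub>V3\<^esub> right_monom 1 2 3, left_monom 1 2 3 \<ominus>\<^bsub>V3\<^esub> left_monom 2 1 3}"
  by (simp add: perm_rels_def Perm_def Let_def left_monom_def right_monom_def)

lemma perm_rels:
  shows perm_rels_submodule: "submodule perm_rels KK (V3 :: ('k::field, _) module)"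
    and perm_rels_stable: "\<And>\<sigma> x. \<sigma> permutes {1..3} \<Longrightarrow> x \<in> perm_rels \<Longrightarrow> pact (free_operad PG) 3 x \<sigma> \<in> (perm_rels :: (('k \<times> 'k) btree \<Rightarrow>\<^sub>0 'k) set set)"
    and perm_rels_gens: "left_monom 1 2 3 \<ominus>\<^bsub>V3\<^esub> right_monom 1 2 3 \<in> (perm_rels :: (('k \<times> 'k) btree \<Rightarrow>\<^sub>0 'k) set set)"
      "left_monom 1 2 3 \<ominus>\<^bsub>V3\<^esub> left_monom 2 1 3 \<in> (perm_rels :: (('k \<times> 'k) btree \<Rightarrow>\<^sub>0 'k) set set)"
proof -
  interpret kmodule "V3 :: ('k, _) module" by (rule V3_module)
  let ?g = "{left_monom 1 2 3 \<ominus>\<^bsub>V3\<^esub> right_monom 1 2 3, left_monom 1 2 3 \<ominus>\<^bsub>V3\<^esub> left_monom 2 1 3} :: (('k \<times> 'k) btree \<Rightarrow>\<^sub>0 'k) set set"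
  let ?P = "\<lambda>R :: (('k \<times> 'k) btree \<Rightarrow>\<^sub>0 'k) set set. submodule R KK V3 \<and> s3_stable (free_operad PG) R"
  have eq: "perm_rels = \<Inter>{R. ?P R \<and> ?g \<subseteq> R}" unfolding perm_rels_hull hull_def ..
  have "?g \<subseteq> carrier V3"
    by (simp only: insert_subset empty_subsetI simp_thms) (intro conjI M.minus_closed monoms_closed)
  then have ne: "carrier V3 \<in> {R. ?P R \<and> ?g \<subseteq> R}"
    using carrier_is_submodule lin_operad_pact_closed[OF PG_free, of 3] by (auto simp: s3_stable_def)
  show "submodule perm_rels KK (V3 :: ('k, _) module)"
    unfolding eq
  proof (rule submodule_Inter)
    show "{R. ?P R \<and> ?g \<subseteq> R} \<noteq> {}" by (rule notI) (use ne in \<open>simp only: empty_iff\<close>)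
  qed (simp only: mem_Collect_eq)
  show "pact (free_operad PG) 3 x \<sigma> \<in> (perm_rels :: (('k \<times> 'k) btree \<Rightarrow>\<^sub>0 'k) set set)"
    if \<sigma>x: "\<sigma> permutes {1..3}" "x \<in> perm_rels" for \<sigma> x
    unfolding eq
  proof (rule InterI)
    fix R assume R: "R \<in> {R. ?P R \<and> ?g \<subseteq> R}"
    then have "x \<in> R" using \<sigma>x(2) unfolding eq by (rule InterD[rotated])
    moreover have "s3_stable (free_operad PG) R" using R by (simp only: mem_Collect_eq)
    ultimately show "pact (free_operad PG) 3 x \<sigma> \<in> R" using \<sigma>x(1) by (simp add: s3_stable_def)
  qed
  have "?g \<subseteq> perm_rels" unfolding perm_rels_hull by (rule hull_subset)
  then show "left_monom 1 2 3 \<ominus>\<^bsub>V3\<^esub> right_monom 1 2 3 \<in> (perm_rels :: (('k \<times> 'k) btree \<Rightarrow>\<^sub>0 'k) set set)"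
    "left_monom 1 2 3 \<ominus>\<^bsub>V3\<^esub> left_monom 2 1 3 \<in> (perm_rels :: (('k \<times> 'k) btree \<Rightarrow>\<^sub>0 'k) set set)"
    by (simp_all only: insert_subset)
qed

lemma perm_quot: "kquot (V3 :: ('k::field, _) module) perm_rels"
  using V3_module perm_rels_submodule by (simp add: kquot_def kquot_axioms_def)

abbreviation perm_cls :: "(('k::field \<times> 'k) btree \<Rightarrow>\<^sub>0 'k) set \<Rightarrow> (('k \<times> 'k) btree \<Rightarrow>\<^sub>0 'k) set set"
  where "perm_cls x \<equiv> perm_rels +>\<^bsub>V3\<^esub> x"

text \<open>The defining relations are written for \<open>x_1\<close>, \<open>x_2\<close>,
  \<open>x_3\<close>; the stability of \<open>perm_rels\<close> under permutations carries them to
  any order of the variables.\<close>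

lemma perm_monom_eq:
  assumes "distinct [i, j, k]" "{i, j, k} = {1..3::nat}"
  shows "perm_cls (left_monom i j k) = (perm_cls (right_monom i j k) :: (('k::field \<times> 'k) btree \<Rightarrow>\<^sub>0 'k) set set)"
    and "perm_cls (left_monom i j k) = (perm_cls (left_monom j i k) :: (('k::field \<times> 'k) btree \<Rightarrow>\<^sub>0 'k) set set)"
proof -
  note \<sigma> = triple_perm(1)[OF assms]
  have lin: "linear_between V3 V3 (\<lambda>x :: (('k \<times> 'k) btree \<Rightarrow>\<^sub>0 'k) set. pact (free_operad PG) 3 x (triple_perm (i, j, k)))"
    by (rule lin_operad_pact[OF PG_free _ \<sigma>]) simp
  note V = kmodule.axioms(1)[OF V3_module]
  note minus = linear_between_minus[OF V V lin]
  note m = monoms_closed[where 'k = 'k]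
  have s: "distinct [j, i, k]" "{j, i, k} = {1..3}" "distinct [j, k, i]" "{j, k, i} = {1..3}" using assms by auto
  have c: "left_monom i j k \<in> carrier (V3 :: ('k, _) module)" "left_monom j i k \<in> carrier (V3 :: ('k, _) module)"
    "right_monom i j k \<in> carrier (V3 :: ('k, _) module)"
    by (rule monom_closed(1)[OF assms] monom_closed(1)[OF s(1,2)] monom_closed(2)[OF s(3,4)])+
  have "left_monom i j k \<ominus>\<^bsub>V3\<^esub> right_monom i j k \<in> (perm_rels :: (('k \<times> 'k) btree \<Rightarrow>\<^sub>0 'k) set set)"
    using perm_rels_stable[OF \<sigma> perm_rels_gens(1)[where 'k='k]] minus[OF m(1,3)] monom_pact[OF assms, where 'k='k] by (simp only:)
  then show "perm_cls (left_monom i j k) = (perm_cls (right_monom i j k) :: (('k \<times> 'k) btree \<Rightarrow>\<^sub>0 'k) set set)"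
    using kquot.coset_eq[OF perm_quot] c by blast
  have "left_monom i j k \<ominus>\<^bsub>V3\<^esub> left_monom j i k \<in> (perm_rels :: (('k \<times> 'k) btree \<Rightarrow>\<^sub>0 'k) set set)"
    using perm_rels_stable[OF \<sigma> perm_rels_gens(2)[where 'k='k]] minus[OF m(1,2)] monom_pact[OF assms, where 'k='k] by (simp only:)
  then show "perm_cls (left_monom i j k) = (perm_cls (left_monom j i k) :: (('k \<times> 'k) btree \<Rightarrow>\<^sub>0 'k) set set)"
    using kquot.coset_eq[OF perm_quot] c by blast
qed

text \<open>The monomial of shape \<open>(i, j, k)\<close> whose last variable is \<open>x\<^sub>l\<close> is
  \<open>outer l (i, j, k) \<otimes> inner l (i, j, k) \<otimes> (i, j, k)\<close>.\<close>

definition outer :: "nat \<Rightarrow> nat \<times> nat \<times> nat \<Rightarrow> 'k::field \<times> 'k"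
  where "outer l = (\<lambda>(i, j, k). if l = k then e22 else e21)"

definition inner :: "nat \<Rightarrow> nat \<times> nat \<times> nat \<Rightarrow> 'k::field \<times> 'k"
  where "inner l = (\<lambda>(i, j, k). if l = i then e21 else e22)"

text \<open>\<open>e21\<close> is the transposed product, so each \<open>e21\<close> at a vertex
  exchanges the two inputs of that vertex.\<close>

lemma cubic_monom:
  assumes "(i, j, k) \<in> cyclic_triples"
  shows "cubic PG e22 e22 (i, j, k) = (left_monom i j k :: (('k::field \<times> 'k) btree \<Rightarrow>\<^sub>0 'k) set)"
    and "cubic PG e22 e21 (i, j, k) = (left_monom j i k :: (('k::field \<times> 'k) btree \<Rightarrow>\<^sub>0 'k) set)"
    and "cubic PG e21 e22 (i, j, k) = (right_monom k i j :: (('k::field \<times> 'k) btree \<Rightarrow>\<^sub>0 'k) set)"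
    and "cubic PG e21 e21 (i, j, k) = (right_monom k j i :: (('k::field \<times> 'k) btree \<Rightarrow>\<^sub>0 'k) set)"
proof -
  note d = cyclic_triples_perm[OF assms]
  have d': "distinct [j, i, k]" "{j, i, k} = {1..3}" using d by auto
  note inner = tree_class_swap_inner[OF perm_gens_s2_module] and outer = tree_class_swap_outer[OF perm_gens_s2_module]
  show "cubic PG e22 e22 (i, j, k) = (left_monom i j k :: (('k \<times> 'k) btree \<Rightarrow>\<^sub>0 'k) set)"
    by (simp add: cubic_def left_monom_def)
  show "cubic PG e22 e21 (i, j, k) = (left_monom j i k :: (('k \<times> 'k) btree \<Rightarrow>\<^sub>0 'k) set)"
    using inner[of "e22 :: 'k \<times> 'k" "e22 :: 'k \<times> 'k" i j k] d by (simp add: cubic_def left_monom_def)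
  show "cubic PG e21 e22 (i, j, k) = (right_monom k i j :: (('k \<times> 'k) btree \<Rightarrow>\<^sub>0 'k) set)"
    using outer[of "e22 :: 'k \<times> 'k" "e22 :: 'k \<times> 'k" i j k] d by (simp add: cubic_def right_monom_def)
  show "cubic PG e21 e21 (i, j, k) = (right_monom k j i :: (('k \<times> 'k) btree \<Rightarrow>\<^sub>0 'k) set)"
    using outer[of "e22 :: 'k \<times> 'k" "e22 :: 'k \<times> 'k" j i k] inner[of "e21 :: 'k \<times> 'k" "e22 :: 'k \<times> 'k" i j k] d d'
    by (simp add: cubic_def right_monom_def)
qed

lemma cubic_PG_closed: "u \<in> cyclic_triples \<Longrightarrow> cubic PG a b u \<in> carrier (V3 :: ('k::field, _) module)"
  by (rule cubic_closed[OF perm_gens_s2_module]) simp_all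

text \<open>The representative on the right is the left monomial whose index triple is the cyclic
  one ending in \<open>l\<close>. It depends on \<open>l\<close> alone, which makes terms of the
  three shapes \<open>u\<close> comparable.\<close>

lemma perm_cls_cubic:
  assumes u: "u \<in> cyclic_triples" and l: "l \<in> {1..3}"
  shows "perm_cls (cubic PG (outer l u) (inner l u) u) =
    (perm_cls (left_monom (if l = 1 then 2 else if l = 2 then 3 else 1) (if l = 1 then 3 else if l = 2 then 1 else 2) l)
      :: (('k::field \<times> 'k) btree \<Rightarrow>\<^sub>0 'k) set set)"
proof -
  obtain i j k where ijk: "u = (i, j, k)" by (cases u)
  note c = u[unfolded ijk]
  note d = cyclic_triples_perm[OF c]
  have sets: "{k, i, j} = {i, j, k}" "{k, j, i} = {i, j, k}" by auto
  have "distinct [k, i, j]" "distinct [k, j, i]" using d(1) by simp_all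
  then have ij: "distinct [k, i, j]" "{k, i, j} = {1..3}" "distinct [k, j, i]" "{k, j, i} = {1..3}"
    unfolding sets d(2) by simp_all
  have ne: "i \<noteq> j" "i \<noteq> k" "j \<noteq> k" using d(1) by simp_all
  have "l \<in> {i, j, k}" using l d(2) by (simp only:)
  then consider "l = k" | "l = j" | "l = i" by (simp only: insert_iff empty_iff) blast
  \<comment> \<open>Associativity turns the monomial into some left monomial ending in
    \<open>x_l\<close>; the order of the two other variables is settled at the end by the second
    relation.\<close>
  then have "\<exists>p q. distinct [p, q, l] \<and> {p, q, l} = {1..3} \<and>
    perm_cls (cubic PG (outer l u) (inner l u) u) = (perm_cls (left_monom p q l) :: (('k \<times> 'k) btree \<Rightarrow>\<^sub>0 'k) set set)"
  proof cases
    case 1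
    then have "outer l u = (e22 :: 'k \<times> 'k)" "inner l u = (e22 :: 'k \<times> 'k)" using ne by (simp_all add: ijk outer_def inner_def)
    then have "cubic PG (outer l u) (inner l u) u = (left_monom i j l :: (('k \<times> 'k) btree \<Rightarrow>\<^sub>0 'k) set)"
      using cubic_monom(1)[OF c, where 'k = 'k] by (simp only: ijk 1)
    then show ?thesis using d unfolding 1 by (intro exI conjI) (assumption | simp only:)+
  next
    case 2
    then have "outer l u = (e21 :: 'k \<times> 'k)" "inner l u = (e22 :: 'k \<times> 'k)" using ne by (simp_all add: ijk outer_def inner_def)
    then have "perm_cls (cubic PG (outer l u) (inner l u) u) = (perm_cls (left_monom k i l) :: (('k \<times> 'k) btree \<Rightarrow>\<^sub>0 'k) set set)"
      using cubic_monom(3)[OF c, where 'k = 'k] perm_monom_eq(1)[OF ij(1,2), where 'k = 'k] by (simp only: ijk 2)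
    then show ?thesis using ij(1,2) unfolding 2 by (intro exI conjI) (assumption | simp only:)+
  next
    case 3
    then have "outer l u = (e21 :: 'k \<times> 'k)" "inner l u = (e21 :: 'k \<times> 'k)" using ne by (simp_all add: ijk outer_def inner_def)
    then have "perm_cls (cubic PG (outer l u) (inner l u) u) = (perm_cls (left_monom k j l) :: (('k \<times> 'k) btree \<Rightarrow>\<^sub>0 'k) set set)"
      using cubic_monom(4)[OF c, where 'k = 'k] perm_monom_eq(1)[OF ij(3,4), where 'k = 'k] by (simp only: ijk 3)
    then show ?thesis using ij(3,4) unfolding 3 by (intro exI conjI) (assumption | simp only:)+
  qed
  then obtain p q where pq: "distinct [p, q, l]" "{p, q, l} = {1..3}"
    "perm_cls (cubic PG (outer l u) (inner l u) u) = (perm_cls (left_monom p q l) :: (('k \<times> 'k) btree \<Rightarrow>\<^sub>0 'k) set set)"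
    by blast
  have "(p, q, l) \<in> cyclic_triples \<or> (q, p, l) \<in> cyclic_triples" by (rule cyclic_triples_cases[OF pq(1,2)])
  moreover have "(a, b, l) \<in> cyclic_triples \<Longrightarrow>
      a = (if l = 1 then 2 else if l = 2 then 3 else 1) \<and> b = (if l = 1 then 3 else if l = 2 then 1 else 2)" for a b
    unfolding cyclic_triples_def by auto
  ultimately consider
      "p = (if l = 1 then 2 else if l = 2 then 3 else 1)" "q = (if l = 1 then 3 else if l = 2 then 1 else 2)"
    | "q = (if l = 1 then 2 else if l = 2 then 3 else 1)" "p = (if l = 1 then 3 else if l = 2 then 1 else 2)"
    by blast
  then show ?thesis
  proof cases
    case 1
    show ?thesis unfolding pq(3) by (simp only: 1)
  next
    case 2
    show ?thesis unfolding pq(3) perm_monom_eq(2)[OF pq(1,2)] by (simp only: 2)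
  qed
qed

section \<open>The white product with the operad of permutation algebras\<close>

lemma scalar_minus: "(x :: 'k::field) \<ominus>\<^bsub>scalar_module\<^esub> y = x - y"
  using kmodule.minus_as_smult[of "scalar_module :: ('k, 'k) module" x y] scalar_module_module
  by (simp add: kmodule_def)

locale perm_tensor = s2_tensor_modules perm_gens F for F :: "('k::field, 'e) s2module"
begin

abbreviation pt :: "'k \<times> 'k \<Rightarrow> 'e \<Rightarrow> (('k \<times> 'k) \<times> 'e \<Rightarrow>\<^sub>0 'k) set"
  where "pt \<equiv> pure_tensor perm_gens F"

text \<open>At \<open>e22\<close> and \<open>e21\<close> these are the two components of
  \<open>g\<close> in the dual of \<open>E\<close>.\<close>

definition comp :: "'k \<times> 'k \<Rightarrow> ((('k \<times> 'k) \<times> 'e \<Rightarrow>\<^sub>0 'k) set \<Rightarrow> 'k) \<Rightarrow> 'e \<Rightarrow> 'k"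
  where "comp a g = (\<lambda>\<mu>\<in>carrier F. g (pt a \<mu>))"

lemma G_s2: "s2_module G" by (rule s2_tensor_s2_module)
lemmas dual_F = dual_s2_module[OF F]
lemmas dual_G = dual_s2_module[OF G_s2]

lemma pt_closed: "\<mu> \<in> carrier F \<Longrightarrow> pt a \<mu> \<in> carrier G"
  using pure_closed[of a \<mu>] by simp

lemma comp_apply: "\<mu> \<in> carrier F \<Longrightarrow> comp a g \<mu> = g (pt a \<mu>)"
  by (simp add: comp_def)

lemma comp_closed:
  assumes "g \<in> carrier (dual G)"
  shows "comp a g \<in> carrier (dual F)"
proof -
  have g: "g \<in> dual_space G" using assms by (simp add: dual_carrier)
  show ?thesis
    unfolding dual_carrier dual_space_def
  proof (intro IntI CollectI conjI ballI allI)
    fix x y assume "x \<in> carrier F" "y \<in> carrier F"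
    then show "comp a g (x \<oplus>\<^bsub>F\<^esub> y) = comp a g x + comp a g y"
      using dual_spaceD(1)[OF g pt_closed pt_closed, of x y a a] pure_add_right[of a x y] by (simp add: comp_def)
  next
    fix c x assume "x \<in> carrier F"
    then show "comp a g (c \<odot>\<^bsub>F\<^esub> x) = c * comp a g x"
      using dual_spaceD(2)[OF g pt_closed, of x c a] pure_smult_right[of a x c] by (simp add: comp_def)
  qed (simp add: comp_def)
qed

lemma comp_add: "comp a (g \<oplus>\<^bsub>dual G\<^esub> h) = comp a g \<oplus>\<^bsub>dual F\<^esub> comp a h"
  unfolding comp_def dual_simps by (rule restrict_ext) (simp only: pt_closed restrict_apply if_True)

lemma comp_smult: "comp a (c \<odot>\<^bsub>dual G\<^esub> g) = c \<odot>\<^bsub>dual F\<^esub> comp a g"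
  unfolding comp_def dual_simps by (rule restrict_ext) (simp only: pt_closed restrict_apply if_True)

text \<open>The transposition exchanges \<open>e22\<close> and \<open>e21\<close>, hence the two
  components, while the sign of the dual action is the same on both sides.\<close>

lemma comp_swap: "comp (a, b) (swap (dual G) g) = swap (dual F) (comp (b, a) g)"
  unfolding comp_def dual_simps
proof (rule restrict_ext)
  fix \<mu> assume \<mu>: "\<mu> \<in> carrier F"
  then have s: "swap F \<mu> \<in> carrier F" by (rule s2_moduleD[OF F])
  have "swap G (pt (a, b) \<mu>) = pt (b, a) (swap F \<mu>)" using swap_pure[OF _ \<mu>, of "(a, b)"] by simp
  then show "(\<lambda>x\<in>carrier G. - g (swap G x)) (pt (a, b) \<mu>) = - (\<lambda>\<mu>\<in>carrier F. g (pt (b, a) \<mu>)) (swap F \<mu>)"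
    using pt_closed[OF \<mu>] s by (simp only: restrict_apply if_True)
qed

lemma pt_split:
  assumes "\<mu> \<in> carrier F"
  shows "pt (a, b) \<mu> = a \<odot>\<^bsub>G\<^esub> pt e22 \<mu> \<oplus>\<^bsub>G\<^esub> b \<odot>\<^bsub>G\<^esub> pt e21 \<mu>"
proof -
  have "pt (a, b) \<mu> = pt ((a, 0) \<oplus>\<^bsub>PG\<^esub> (0, b)) \<mu>" by simp
  also have "\<dots> = pt (a, 0) \<mu> \<oplus>\<^bsub>G\<^esub> pt (0, b) \<mu>"
    using pure_add_left[OF _ _ assms, of "(a, 0)" "(0, b)"] by (simp only: s2_tensor_simps perm_gens_simps UNIV_I)
  also have "pt (a, 0) \<mu> = a \<odot>\<^bsub>G\<^esub> pt e22 \<mu>"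
    using pure_smult_left[OF _ assms, of "e22" a] by simp
  also have "pt (0, b) \<mu> = b \<odot>\<^bsub>G\<^esub> pt e21 \<mu>"
    using pure_smult_left[OF _ assms, of "e21" b] by simp
  finally show ?thesis .
qed

lemma comp_eqI:
  assumes g: "g \<in> carrier (dual G)" and h: "h \<in> carrier (dual G)"
    and eq: "\<And>\<mu>. \<mu> \<in> carrier F \<Longrightarrow> g (pt e22 \<mu>) = h (pt e22 \<mu>)" "\<And>\<mu>. \<mu> \<in> carrier F \<Longrightarrow> g (pt e21 \<mu>) = h (pt e21 \<mu>)"
  shows "g = h"
proof (rule dual_eqI[OF g h])
  fix x assume "x \<in> carrier G"
  then have x: "x \<in> carrier (tensor PG F)" by simp
  have lin: "linear_between (tensor PG F) scalar_module k" and sp: "k \<in> dual_space G" if "k \<in> carrier (dual G)" for k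
  proof -
    show k: "k \<in> dual_space G" using that by (simp add: dual_carrier)
    show "linear_between (tensor PG F) scalar_module k"
      by (rule linear_betweenI) (use dual_spaceD[OF k] in simp_all)
  qed
  have val: "k (pt (a, b) \<mu>) = a * k (pt e22 \<mu>) + b * k (pt e21 \<mu>)" if "k \<in> carrier (dual G)" "\<mu> \<in> carrier F" for k a b \<mu>
  proof -
    interpret GM: kmodule G using s2_tensor_module by (simp add: kmodule_def)
    note c = pt_closed[OF that(2)]
    show ?thesis
      unfolding pt_split[OF that(2), of a b]
      by (simp only: dual_spaceD[OF sp[OF that(1)]] GM.k_closed c)
  qed
  show "g x = h x"
  proof (rule tensor_linear_eq[OF scalar_module_module lin[OF g] lin[OF h] _ x])
    fix v :: "'k \<times> 'k" and w assume w: "w \<in> carrier F"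
    obtain a b where v: "v = (a, b)" by (cases v)
    have "g (pt v w) = a * g (pt e22 w) + b * g (pt e21 w)" unfolding v by (rule val[OF g w])
    also have "\<dots> = a * h (pt e22 w) + b * h (pt e21 w)" unfolding eq[OF w] ..
    also have "\<dots> = h (pt v w)" unfolding v by (rule val[OF h w, symmetric])
    finally show "g (pt v w) = h (pt v w)" .
  qed
qed

text \<open>\<open>e22\<close> and \<open>e21\<close> form a basis, so a functional on
  \<open>Perm(2) \<otimes> E\<close> amounts to a pair of functionals on \<open>E\<close>. Unique
  existence is what the descriptions \<open>beta_left\<close> and \<open>beta_right\<close> rest
  on.\<close>

lemma comp_glue:
  assumes f1: "f1 \<in> carrier (dual F)" and f2: "f2 \<in> carrier (dual F)"
  shows "\<exists>!g. g \<in> carrier (dual G) \<and> (\<forall>\<mu>\<in>carrier F. g (pt e22 \<mu>) = f1 \<mu> \<and> g (pt e21 \<mu>) = f2 \<mu>)"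
proof -
  have f: "f1 \<in> dual_space F" "f2 \<in> dual_space F" using f1 f2 by (simp_all add: dual_carrier)
  obtain L where L: "linear_between (tensor PG F) (scalar_module :: ('k, 'k) module) L"
    "\<And>v w. v \<in> carrier PG \<Longrightarrow> w \<in> carrier F \<Longrightarrow> L (pt v w) = fst v * f1 w + snd v * f2 w"
  proof (rule tensor_extend[OF scalar_module_module, where b = "\<lambda>v w. fst v * f1 w + snd v * f2 w"])
    fix v v' :: "'k \<times> 'k" and w assume "w \<in> carrier F"
    show "fst (v \<oplus>\<^bsub>PG\<^esub> v') * f1 w + snd (v \<oplus>\<^bsub>PG\<^esub> v') * f2 w =
        fst v * f1 w + snd v * f2 w \<oplus>\<^bsub>scalar_module\<^esub> (fst v' * f1 w + snd v' * f2 w)"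
      by (cases v; cases v') (simp add: algebra_simps)
  next
    fix v :: "'k \<times> 'k" and c w assume "w \<in> carrier F"
    show "fst (c \<odot>\<^bsub>PG\<^esub> v) * f1 w + snd (c \<odot>\<^bsub>PG\<^esub> v) * f2 w = c \<odot>\<^bsub>scalar_module\<^esub> (fst v * f1 w + snd v * f2 w)"
      by (cases v) (simp add: algebra_simps)
  next
    fix v :: "'k \<times> 'k" and w w' assume "w \<in> carrier F" "w' \<in> carrier F"
    then show "fst v * f1 (w \<oplus>\<^bsub>F\<^esub> w') + snd v * f2 (w \<oplus>\<^bsub>F\<^esub> w') =
        fst v * f1 w + snd v * f2 w \<oplus>\<^bsub>scalar_module\<^esub> (fst v * f1 w' + snd v * f2 w')"
      by (simp add: dual_spaceD[OF f(1)] dual_spaceD[OF f(2)] algebra_simps)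
  next
    fix v :: "'k \<times> 'k" and c w assume "w \<in> carrier F"
    then show "fst v * f1 (c \<odot>\<^bsub>F\<^esub> w) + snd v * f2 (c \<odot>\<^bsub>F\<^esub> w) = c \<odot>\<^bsub>scalar_module\<^esub> (fst v * f1 w + snd v * f2 w)"
      by (simp add: dual_spaceD[OF f(1)] dual_spaceD[OF f(2)] algebra_simps)
  qed (simp | rule that; assumption)+
  interpret GM: kmodule G using s2_tensor_module by (simp add: kmodule_def)
  let ?g = "\<lambda>x\<in>carrier G. L x"
  have "?g \<in> carrier (dual G)"
    unfolding dual_carrier dual_space_def
  proof (intro IntI CollectI conjI ballI allI)
    fix x y assume xy: "x \<in> carrier G" "y \<in> carrier G"
    then have "x \<oplus>\<^bsub>G\<^esub> y \<in> carrier G" by (rule GM.M.a_closed)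
    with xy linear_betweenD(2)[OF L(1), of x y] show "?g (x \<oplus>\<^bsub>G\<^esub> y) = ?g x + ?g y"
      by simp
  next
    fix c x assume x: "x \<in> carrier G"
    then have "c \<odot>\<^bsub>G\<^esub> x \<in> carrier G" by (rule GM.k_closed)
    with x linear_betweenD(3)[OF L(1), of x c] show "?g (c \<odot>\<^bsub>G\<^esub> x) = c * ?g x" by simp
  qed simp
  moreover have "?g (pt e22 \<mu>) = f1 \<mu>" "?g (pt e21 \<mu>) = f2 \<mu>" if "\<mu> \<in> carrier F" for \<mu>
    using L(2)[of _ \<mu>] pt_closed[OF that] that by simp_all
  ultimately have ex: "?g \<in> carrier (dual G) \<and> (\<forall>\<mu>\<in>carrier F. ?g (pt e22 \<mu>) = f1 \<mu> \<and> ?g (pt e21 \<mu>) = f2 \<mu>)" by blast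
  show ?thesis
  proof (rule ex1I[of _ ?g])
    show "?g \<in> carrier (dual G) \<and> (\<forall>\<mu>\<in>carrier F. ?g (pt e22 \<mu>) = f1 \<mu> \<and> ?g (pt e21 \<mu>) = f2 \<mu>)" by (rule ex)
    fix h assume h: "h \<in> carrier (dual G) \<and> (\<forall>\<mu>\<in>carrier F. h (pt e22 \<mu>) = f1 \<mu> \<and> h (pt e21 \<mu>) = f2 \<mu>)"
    show "h = ?g"
    proof (rule comp_eqI)
      show "h \<in> carrier (dual G)" using h by (rule conjunct1)
      show "?g \<in> carrier (dual G)" using ex by (rule conjunct1)
      fix \<mu> assume "\<mu> \<in> carrier F"
      note \<mu> = this
      have "h (pt e22 \<mu>) = f1 \<mu> \<and> h (pt e21 \<mu>) = f2 \<mu>" by (rule bspec[OF conjunct2[OF h] \<mu>])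
      moreover have "?g (pt e22 \<mu>) = f1 \<mu> \<and> ?g (pt e21 \<mu>) = f2 \<mu>" by (rule bspec[OF conjunct2[OF ex] \<mu>])
      ultimately show "h (pt e22 \<mu>) = ?g (pt e22 \<mu>)" "h (pt e21 \<mu>) = ?g (pt e21 \<mu>)" by (simp_all only:)
    qed
  qed
qed

lemma dual_zero: "\<zero>\<^bsub>dual F\<^esub> \<in> carrier (dual F)"
proof -
  interpret DM: kmodule "dual F" using s2_moduleD(1)[OF dual_F] by (simp add: kmodule_def)
  show ?thesis by (rule DM.M.zero_closed)
qed

lemma beta:
  assumes f: "f \<in> carrier (dual F)"
  shows beta_left_closed: "beta_left F f \<in> carrier (dual G)"
    and comp_beta_left: "comp e22 (beta_left F f) = f" "comp e21 (beta_left F f) = \<zero>\<^bsub>dual F\<^esub>"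
    and beta_right_closed: "beta_right F f \<in> carrier (dual G)"
    and comp_beta_right: "comp e22 (beta_right F f) = \<zero>\<^bsub>dual F\<^esub>" "comp e21 (beta_right F f) = f"
proof -
  have z: "\<zero>\<^bsub>dual F\<^esub> \<mu> = 0" if "\<mu> \<in> carrier F" for \<mu> using that by (simp add: dual_simps)
  have l: "beta_left F f \<in> carrier (dual G) \<and>
      (\<forall>\<mu>\<in>carrier F. beta_left F f (pt e22 \<mu>) = f \<mu> \<and> beta_left F f (pt e21 \<mu>) = \<zero>\<^bsub>dual F\<^esub> \<mu>)"
    using theI'[OF comp_glue[OF f dual_zero]] unfolding beta_left_def by (simp add: z cong: ball_cong)
  have r: "beta_right F f \<in> carrier (dual G) \<and>
      (\<forall>\<mu>\<in>carrier F. beta_right F f (pt e22 \<mu>) = \<zero>\<^bsub>dual F\<^esub> \<mu> \<and> beta_right F f (pt e21 \<mu>) = f \<mu>)"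
    using theI'[OF comp_glue[OF dual_zero f]] unfolding beta_right_def by (simp add: z conj_commute cong: ball_cong)
  show lc: "beta_left F f \<in> carrier (dual G)" and rc: "beta_right F f \<in> carrier (dual G)" using l r by simp_all
  show "comp e22 (beta_left F f) = f" "comp e21 (beta_left F f) = \<zero>\<^bsub>dual F\<^esub>"
    by (rule dual_eqI[OF comp_closed[OF lc]]; simp add: f dual_zero comp_apply l)+
  show "comp e22 (beta_right F f) = \<zero>\<^bsub>dual F\<^esub>" "comp e21 (beta_right F f) = f"
    by (rule dual_eqI[OF comp_closed[OF rc]]; simp add: f dual_zero comp_apply r)+
qed

section \<open>Elements of the relations of the white product\<close>

abbreviation W3 :: "('k, ('e btree \<Rightarrow>\<^sub>0 'k) set) module"
  where "W3 \<equiv> comps (free_operad F) 3"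

definition span_rels :: "('e btree \<Rightarrow>\<^sub>0 'k) set set \<Rightarrow> ((('k \<times> 'k) btree \<Rightarrow>\<^sub>0 'k) set \<times> ('e btree \<Rightarrow>\<^sub>0 'k) set \<Rightarrow>\<^sub>0 'k) set set"
  where "span_rels R = lin_span (tensor V3 W3)
    ({pure_tensor V3 W3 r y | r y. r \<in> perm_rels \<and> y \<in> carrier W3} \<union>
     {pure_tensor V3 W3 y r | y r. y \<in> carrier V3 \<and> r \<in> R})"

definition white_rels :: "('e btree \<Rightarrow>\<^sub>0 'k) set set \<Rightarrow> ((('k \<times> 'k) \<times> 'e \<Rightarrow>\<^sub>0 'k) set btree \<Rightarrow>\<^sub>0 'k) set set"
  where "white_rels R = {x \<in> carrier (comps (free_operad G) 3). manin_map perm_gens F 3 x \<in> span_rels R}"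

lemma white_product_eq: "white_product Perm (F, R) = (G, white_rels R)"
proof -
  have "gens Perm = (perm_gens :: ('k, 'k \<times> 'k) s2module)" by (simp add: Perm_def Let_def)
  then show ?thesis
    by (simp add: white_product_def Let_def white_rels_def span_rels_def perm_rels_def)
qed

lemma W3_module: "kmodule W3" by (rule free_module_3[OF F])

lemma tensor_VW: "tensor_modules (V3 :: ('k, _) module) W3"
  using kmodule.axioms(1)[OF V3_module] kmodule.axioms(1)[OF W3_module] by (simp add: tensor_modules_def)

lemma manin_linear: "linear_between (comps (free_operad G) 3) (tensor V3 W3) (manin_map perm_gens F 3)"
  using operad_hom_linear[OF manin_hom, of 3] two_operads.hadamard_comps[OF two_operads.intro[OF PG_free lin_operad_free[OF F]]]
  by simp

text \<open>Each term is tensored with the permutation monomial of the same shape whose last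
  variable is \<open>x_l\<close>, so that different terms receive the same class modulo the
  relations of \<open>Perm\<close>.\<close>

definition lift_terms :: "nat \<Rightarrow> ('k \<times> 'e \<times> 'e \<times> nat \<times> nat \<times> nat) list \<Rightarrow> _"
  where "lift_terms l = map (\<lambda>(c, \<mu>, \<nu>, u). (c, pt (outer l u) \<mu>, pt (inner l u) \<nu>, u))"

lemma lift_terms_cubic: "cubic_terms F ts \<Longrightarrow> cubic_terms G (lift_terms l ts)"
  unfolding lift_terms_def by (induction ts) (simp, clarsimp simp only: list.map prod.case cubic_terms_simps pt_closed simp_thms)

context
  fixes R :: "('e btree \<Rightarrow>\<^sub>0 'k) set set"
  assumes R: "R \<subseteq> carrier W3"
begin

lemma perm_rels_closed: "perm_rels \<subseteq> carrier (V3 :: ('k, _) module)"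
  by (rule kquot.N_facts(1)[OF perm_quot])

lemma span_quot: "kquot (tensor V3 W3) (span_rels R)"
proof -
  interpret TM: tensor_modules "V3 :: ('k, _) module" W3 by (rule tensor_VW)
  have "submodule (span_rels R) KK (tensor V3 W3)"
    unfolding span_rels_def
    by (rule TM.VxW.lin_span_submodule) (use R perm_rels_closed in \<open>auto intro!: TM.pure_closed\<close>)
  then show ?thesis using TM.VxW.kmodule_axioms by (simp add: kquot_def kquot_axioms_def)
qed

lemma span_rels_left: "r \<in> perm_rels \<Longrightarrow> y \<in> carrier W3 \<Longrightarrow> pure_tensor V3 W3 r y \<in> span_rels R"
  unfolding span_rels_def by (rule subsetD[OF lin_span_superset], rule UnI1) (intro CollectI exI conjI; (assumption | rule refl))

lemma span_rels_right: "y \<in> carrier V3 \<Longrightarrow> r \<in> R \<Longrightarrow> pure_tensor V3 W3 y r \<in> span_rels R"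
  unfolding span_rels_def by (rule subsetD[OF lin_span_superset], rule UnI2) (intro CollectI exI conjI; (assumption | rule refl))

lemma ht_left_linear: "y \<in> carrier W3 \<Longrightarrow> linear_between V3 (tensor V3 W3) (\<lambda>a. pure_tensor V3 W3 a y)"
  by (rule linear_betweenI; rule tensor_modules.pure_closed[OF tensor_VW] tensor_modules.pure_add_left[OF tensor_VW]
    tensor_modules.pure_smult_left[OF tensor_VW]; assumption)

lemma ht_right_linear: "a \<in> carrier V3 \<Longrightarrow> linear_between W3 (tensor V3 W3) (pure_tensor V3 W3 a)"
  by (rule linear_betweenI; rule tensor_modules.pure_closed[OF tensor_VW] tensor_modules.pure_add_right[OF tensor_VW]
    tensor_modules.pure_smult_right[OF tensor_VW]; assumption)

lemma ht_minus_span: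
  assumes "a \<in> carrier V3" "b \<in> carrier V3" "perm_cls a = perm_cls b" "y \<in> carrier W3"
  shows "pure_tensor V3 W3 a y \<ominus>\<^bsub>tensor V3 W3\<^esub> pure_tensor V3 W3 b y \<in> span_rels R"
proof -
  note m = linear_between_minus[OF kmodule.axioms(1)[OF V3_module] tensor_modules.tensor_module[OF tensor_VW]
    ht_left_linear[OF assms(4)] assms(1,2)]
  have "a \<ominus>\<^bsub>V3\<^esub> b \<in> perm_rels" by (rule iffD1[OF kquot.coset_eq[OF perm_quot assms(1,2)] assms(3)])
  then show ?thesis unfolding m[symmetric] by (rule span_rels_left[OF _ assms(4)])
qed

lemma cubic_G_closed: "\<mu> \<in> carrier F \<Longrightarrow> \<nu> \<in> carrier F \<Longrightarrow> u \<in> cyclic_triples \<Longrightarrow>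
    cubic G (pt a \<mu>) (pt b \<nu>) u \<in> carrier (comps (free_operad G) 3)"
  by (rule cubic_closed[OF G_s2 pt_closed pt_closed])

lemma manin_cubic_pt: "\<mu> \<in> carrier F \<Longrightarrow> \<nu> \<in> carrier F \<Longrightarrow> u \<in> cyclic_triples \<Longrightarrow>
    manin_map perm_gens F 3 (cubic G (pt a \<mu>) (pt b \<nu>) u) = pure_tensor V3 W3 (cubic PG a b u) (cubic F \<mu> \<nu> u)"
  by (rule manin_cubic) simp_all

text \<open>The image under \<open>manin_map\<close> is \<open>(x_i x_j) x_k - (x_j x_i) x_k\<close>
  tensored with a cubic element, and the first factor is a relation of \<open>Perm\<close>.\<close>

lemma white_rels_inner:
  assumes \<mu>: "\<mu> \<in> carrier F" "\<nu> \<in> carrier F" and u: "u \<in> cyclic_triples"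
  shows "cubic G (pt e22 \<mu>) (pt e22 \<nu>) u \<ominus>\<^bsub>comps (free_operad G) 3\<^esub> cubic G (pt e22 \<mu>) (pt e21 \<nu>) u \<in> white_rels R"
proof -
  obtain i j k where ijk: "u = (i, j, k)" by (cases u)
  note c = u[unfolded ijk]
  interpret G3: kmodule "comps (free_operad G) 3" by (rule free_module_3[OF G_s2])
  have "perm_cls (cubic PG e22 e22 u) = (perm_cls (cubic PG e22 e21 u) :: (('k \<times> 'k) btree \<Rightarrow>\<^sub>0 'k) set set)"
    unfolding ijk cubic_monom[OF c] by (rule perm_monom_eq(2)[OF cyclic_triples_perm[OF c]])
  note s = ht_minus_span[OF cubic_PG_closed[OF u] cubic_PG_closed[OF u] this cubic_closed[OF F \<mu> u]]
  note m = linear_between_minus[OF G3.module_axioms tensor_modules.tensor_module[OF tensor_VW] manin_linear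
    cubic_G_closed[OF \<mu> u] cubic_G_closed[OF \<mu> u]]
  show ?thesis
    unfolding white_rels_def
    by (rule CollectI, rule conjI, rule G3.M.minus_closed; (rule cubic_G_closed[OF \<mu> u])?) (simp only: m manin_cubic_pt[OF \<mu> u] s)
qed

text \<open>Modulo \<open>span_rels R\<close> the permutation monomials of all lifted terms may be
  replaced by one and the same \<open>N\<close>. The image of the lift is then \<open>N\<close>
  tensored with the original sum, which lies in \<open>R\<close>.\<close>

lemma white_rels_lift:
  assumes ts: "cubic_terms F ts" and l: "l \<in> {1..3}" and r: "cubic_sum F ts \<in> R"
  shows "cubic_sum G (lift_terms l ts) \<in> white_rels R"
proof -
  interpret Q: kquot "tensor V3 W3" "span_rels R" by (rule span_quot)
  let ?cls = "\<lambda>x. span_rels R +>\<^bsub>tensor V3 W3\<^esub> x"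
  let ?Q = "quot_module (tensor V3 W3) (span_rels R)"
  define N :: "(('k \<times> 'k) btree \<Rightarrow>\<^sub>0 'k) set" where
    "N = left_monom (if l = 1 then 2 else if l = 2 then 3 else 1) (if l = 1 then 3 else if l = 2 then 1 else 2) l"
  have N: "N \<in> carrier V3"
  proof -
    have "l = 1 \<or> l = 2 \<or> l = 3" using l by auto
    then show ?thesis unfolding N_def by (elim disjE; hypsubst) (rule monom_closed(1); auto)+
  qed
  have lin1: "linear_between (comps (free_operad G) 3) ?Q (\<lambda>x. ?cls (manin_map perm_gens F 3 x))"
    by (rule linear_between_comp[OF manin_linear Q.proj_linear])
  have lin2: "linear_between W3 ?Q (\<lambda>y. ?cls (pure_tensor V3 W3 N y))"
    by (rule linear_between_comp[OF ht_right_linear[OF N] Q.proj_linear])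
  have tm_eq: "?cls (manin_map perm_gens F 3 (cubic G (pt (outer l u) \<mu>) (pt (inner l u) \<nu>) u)) = ?cls (pure_tensor V3 W3 N (cubic F \<mu> \<nu> u))"
    if "\<mu> \<in> carrier F" "\<nu> \<in> carrier F" "u \<in> cyclic_triples" for \<mu> \<nu> u
  proof -
    note y = cubic_closed[OF F that]
    note a = cubic_PG_closed[OF that(3), where 'k = 'k]
    have "perm_cls (cubic PG (outer l u) (inner l u) u) = perm_cls N"
      unfolding N_def by (rule perm_cls_cubic[OF that(3) l])
    from ht_minus_span[OF a N this y] show ?thesis
      unfolding manin_cubic_pt[OF that]
      by (subst Q.coset_eq) (rule tensor_modules.pure_closed[OF tensor_VW]; (rule a N y))+
  qed
  have eq: "foldr (\<lambda>(c, e, e', u) x. c \<odot>\<^bsub>?Q\<^esub> ?cls (manin_map perm_gens F 3 (cubic G e e' u)) \<oplus>\<^bsub>?Q\<^esub> x) (lift_terms l ts) \<zero>\<^bsub>?Q\<^esub> =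
    foldr (\<lambda>(c, e, e', u) x. c \<odot>\<^bsub>?Q\<^esub> ?cls (pure_tensor V3 W3 N (cubic F e e' u)) \<oplus>\<^bsub>?Q\<^esub> x) ts \<zero>\<^bsub>?Q\<^esub>"
    using ts unfolding lift_terms_def
  proof (induction ts)
    case (Cons t ts)
    obtain c \<mu> \<nu> u where t: "t = (c, \<mu>, \<nu>, u)" by (cases t)
    have c: "\<mu> \<in> carrier F" "\<nu> \<in> carrier F" "u \<in> cyclic_triples" "cubic_terms F ts"
      using Cons.prems unfolding t cubic_terms_simps by blast+
    show ?case
      unfolding t by (simp only: list.map foldr.simps comp_apply prod.case o_apply Cons.IH[OF c(4)] tm_eq[OF c(1-3)])
  qed simp
  have "?cls (manin_map perm_gens F 3 (cubic_sum G (lift_terms l ts))) = ?cls (pure_tensor V3 W3 N (cubic_sum F ts))"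
    unfolding linear_cubic_sum[OF G_s2 Q.quot_module lin1 lift_terms_cubic[OF ts]] linear_cubic_sum[OF F Q.quot_module lin2 ts] eq ..
  also have "\<dots> = span_rels R"
    by (rule iffD2[OF Q.coset_eq_N]) (use span_rels_right[OF N r] Q.N_facts(1) in blast)+
  finally have "manin_map perm_gens F 3 (cubic_sum G (lift_terms l ts)) \<in> span_rels R"
    using Q.coset_eq_N[OF linear_betweenD(1)[OF manin_linear cubic_sum_closed[OF G_s2 lift_terms_cubic[OF ts]]]] by simp
  then show ?thesis
    unfolding white_rels_def using cubic_sum_closed[OF G_s2 lift_terms_cubic[OF ts]] by (simp only: mem_Collect_eq simp_thms)
qed

end

end

section \<open>Orthogonality\<close>

lemma pairing_cubic_sums:
  assumes E: "s2_module E" and ts: "cubic_terms E ts" and ys: "cubic_terms (dual E) ys"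
  shows "pairing E (cubic_sum E ts) (cubic_sum (dual E) ys) =
    (\<Sum>(c, e, e', u)\<leftarrow>ts. c * (\<Sum>(c', f, f', v)\<leftarrow>ys. c' * (if u = v then f e * f' e' else 0)))"
proof -
  note z = cubic_sum_closed[OF dual_s2_module[OF E] ys]
  have inner: "pairing E (cubic E e e' u) (cubic_sum (dual E) ys) = (\<Sum>(c', f, f', v)\<leftarrow>ys. c' * (if u = v then f e * f' e' else 0))"
    if "e \<in> carrier E" "e' \<in> carrier E" "u \<in> cyclic_triples" for e e' u
    unfolding linear_scalar_cubic_sum[OF dual_s2_module[OF E] pairing_right[OF E cubic_closed[OF E that]] ys]
    using ys by (induction ys) (auto simp: pairing_cubic[OF E] that)
  show ?thesis
    unfolding linear_scalar_cubic_sum[OF E pairing_left[OF E z] ts]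
    using ts by (induction ts) (auto simp: inner)
qed

lemma foldr_module_sum:
  fixes M :: "('k::field, 'x, 'm) module_scheme"
  assumes M: "module KK M" and ts: "\<forall>(a, h)\<in>set ts. h \<in> carrier M"
  shows "foldr (\<lambda>(a, h) x. a \<odot>\<^bsub>M\<^esub> h \<oplus>\<^bsub>M\<^esub> x) ts \<zero>\<^bsub>M\<^esub> \<in> carrier M"
proof -
  interpret kmodule M using M by (simp add: kmodule_def)
  show ?thesis using ts by (induction ts) auto
qed

text \<open>Induction on the number of terms: evaluating at a point where \<open>f\<^sub>0\<close> does not vanish expresses
  \<open>h\<^sub>0\<close> by the other \<open>h\<^sub>t\<close>.\<close>

lemma bilinear_vanish:
  fixes F :: "('k::field, 'e) s2module" and s :: "'k \<Rightarrow> 'a::ab_group_add \<Rightarrow> 'a"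
    and N :: "('e \<Rightarrow> 'k) \<Rightarrow> ('e \<Rightarrow> 'k) \<Rightarrow> 'a"
  assumes F: "s2_module F" and s: "vector_space s"
    and add_left: "\<And>f f' h. f \<in> carrier (dual F) \<Longrightarrow> f' \<in> carrier (dual F) \<Longrightarrow> h \<in> carrier (dual F) \<Longrightarrow> N (f \<oplus>\<^bsub>dual F\<^esub> f') h = N f h + N f' h"
    and add_right: "\<And>f h h'. f \<in> carrier (dual F) \<Longrightarrow> h \<in> carrier (dual F) \<Longrightarrow> h' \<in> carrier (dual F) \<Longrightarrow> N f (h \<oplus>\<^bsub>dual F\<^esub> h') = N f h + N f h'"
    and smult_left: "\<And>c f h. f \<in> carrier (dual F) \<Longrightarrow> h \<in> carrier (dual F) \<Longrightarrow> N (c \<odot>\<^bsub>dual F\<^esub> f) h = s c (N f h)"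
    and smult_right: "\<And>c f h. f \<in> carrier (dual F) \<Longrightarrow> h \<in> carrier (dual F) \<Longrightarrow> N f (c \<odot>\<^bsub>dual F\<^esub> h) = s c (N f h)"
    and ts: "\<forall>(f, h)\<in>set ts. f \<in> carrier (dual F) \<and> h \<in> carrier (dual F)"
    and vanish: "\<And>\<mu> \<nu>. \<mu> \<in> carrier F \<Longrightarrow> \<nu> \<in> carrier F \<Longrightarrow> (\<Sum>(f, h)\<leftarrow>ts. f \<mu> * h \<nu>) = 0"
  shows "(\<Sum>(f, h)\<leftarrow>ts. N f h) = 0"
  using ts vanish
proof (induction "length ts" arbitrary: ts)
  case (Suc n)
  interpret s: vector_space s by (rule s)
  interpret D: kmodule "dual F" using s2_moduleD(1)[OF dual_s2_module[OF F]] by (simp add: kmodule_def)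
  obtain f0 h0 us where ts: "ts = (f0, h0) # us" using Suc.hyps(2) by (cases ts) auto
  have len: "n = length us" using Suc.hyps(2) ts by simp
  have f0: "f0 \<in> carrier (dual F)" and h0: "h0 \<in> carrier (dual F)"
    and us: "\<forall>(f, h)\<in>set us. f \<in> carrier (dual F) \<and> h \<in> carrier (dual F)" using Suc.prems(1) ts by auto
  have van: "f0 \<mu> * h0 \<nu> + (\<Sum>(f, h)\<leftarrow>us. f \<mu> * h \<nu>) = 0" if "\<mu> \<in> carrier F" "\<nu> \<in> carrier F" for \<mu> \<nu>
    using Suc.prems(2)[OF that] ts by simp
  show ?case
  proof (cases "\<exists>\<mu>\<in>carrier F. f0 \<mu> \<noteq> 0")
    case False
    then have "(\<Sum>(f, h)\<leftarrow>us. f \<mu> * h \<nu>) = 0" if "\<mu> \<in> carrier F" "\<nu> \<in> carrier F" for \<mu> \<nu>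
      using van[OF that] that by simp
    then have "(\<Sum>(f, h)\<leftarrow>us. N f h) = 0" by (rule Suc.hyps(1)[OF len us])
    moreover have "f0 = 0 \<odot>\<^bsub>dual F\<^esub> f0"
      by (rule dual_eqI[OF f0 D.k_closed[OF f0]]) (use False in \<open>simp add: dual_simps\<close>)
    then have "N f0 h0 = 0" using smult_left[OF f0 h0, of 0] by simp
    ultimately show ?thesis by (simp add: ts)
  next
    case True
    then obtain \<mu>0 where \<mu>0: "\<mu>0 \<in> carrier F" "f0 \<mu>0 \<noteq> 0" by blast
    define r where "r f = - (f \<mu>0 / f0 \<mu>0)" for f :: "'e \<Rightarrow> 'k"
    \<comment> \<open>At \<open>\<mu>0\<close> the hypothesis says that \<open>h0\<close> is the
      combination of the other \<open>h\<close> with coefficients \<open>r f\<close>. Inserting this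
      absorbs the pair \<open>(f0, h0)\<close> into the remaining ones, and the list becomes shorter
      by one.\<close>
    define us' where "us' = map (\<lambda>(f, h). (f \<oplus>\<^bsub>dual F\<^esub> r f \<odot>\<^bsub>dual F\<^esub> f0, h)) us"
    have us': "\<forall>(f, h)\<in>set us'. f \<in> carrier (dual F) \<and> h \<in> carrier (dual F)"
      using us f0 by (auto simp: us'_def)
    define comb where "comb vs = foldr (\<lambda>(a, h) x. a \<odot>\<^bsub>dual F\<^esub> h \<oplus>\<^bsub>dual F\<^esub> x) vs \<zero>\<^bsub>dual F\<^esub>"
      for vs :: "('k \<times> ('e \<Rightarrow> 'k)) list"
    define vs where "vs = map (\<lambda>(f, h). (r f, h)) us"
    have vs: "\<forall>(a, h)\<in>set vs. h \<in> carrier (dual F)" using us by (auto simp: vs_def)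
    have comb_closed: "comb ws \<in> carrier (dual F)" if "\<forall>(a, h)\<in>set ws. h \<in> carrier (dual F)" for ws
      unfolding comb_def by (rule foldr_module_sum[OF D.module_axioms that])
    have comb_val: "comb ws \<nu> = (\<Sum>(a, h)\<leftarrow>ws. a * h \<nu>)" if "\<nu> \<in> carrier F" for ws \<nu>
      unfolding comb_def using that by (induction ws) (auto simp: dual_simps)
    have N0: "N f0 \<zero>\<^bsub>dual F\<^esub> = 0" using smult_right[OF f0 h0, of 0] h0 by simp
    have comb_N: "N f0 (comb ws) = (\<Sum>(a, h)\<leftarrow>ws. s a (N f0 h))" if "\<forall>(a, h)\<in>set ws. h \<in> carrier (dual F)" for ws
      using that
    proof (induction ws)
      case (Cons w ws)
      obtain a h where w: "w = (a, h)" by (cases w)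
      have c: "h \<in> carrier (dual F)" "comb ws \<in> carrier (dual F)" using Cons.prems w comb_closed by auto
      have "N f0 (comb (w # ws)) = N f0 (a \<odot>\<^bsub>dual F\<^esub> h \<oplus>\<^bsub>dual F\<^esub> comb ws)" by (simp add: comb_def w)
      also have "\<dots> = s a (N f0 h) + N f0 (comb ws)" using c f0 by (simp add: add_right smult_right)
      finally show ?case using Cons by (simp add: w)
    qed (simp add: comb_def N0)
    have "h0 = comb vs"
    proof (rule dual_eqI[OF h0 comb_closed[OF vs]])
      fix \<nu> assume \<nu>: "\<nu> \<in> carrier F"
      have "(\<Sum>(a, h)\<leftarrow>vs. a * h \<nu>) * f0 \<mu>0 = - (\<Sum>(f, h)\<leftarrow>us. f \<mu>0 * h \<nu>)"
        unfolding vs_def using \<mu>0(2) by (induction us) (auto simp: r_def field_simps)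
      also have "\<dots> = h0 \<nu> * f0 \<mu>0"
        by (rule minus_unique) (use van[OF \<mu>0(1) \<nu>] in \<open>simp only: mult.commute[of "h0 \<nu>"] add.commute\<close>)
      finally show "h0 \<nu> = comb vs \<nu>" unfolding comb_val[OF \<nu>] using \<mu>0(2) by simp
    qed
    then have "N f0 h0 = (\<Sum>(a, h)\<leftarrow>vs. s a (N f0 h))" using comb_N[OF vs] by (simp only:)
    also have "\<dots> = (\<Sum>(f, h)\<leftarrow>us. s (r f) (N f0 h))" unfolding vs_def by (induction us) auto
    finally have N_h0: "N f0 h0 = (\<Sum>(f, h)\<leftarrow>us. s (r f) (N f0 h))" .
    have van': "(\<Sum>(f, h)\<leftarrow>us'. f \<mu> * h \<nu>) = 0" if "\<mu> \<in> carrier F" "\<nu> \<in> carrier F" for \<mu> \<nu>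
    proof -
      have "(\<Sum>(f, h)\<leftarrow>us'. f \<mu> * h \<nu>) = (\<Sum>(f, h)\<leftarrow>us. f \<mu> * h \<nu>) + f0 \<mu> * (\<Sum>(a, h)\<leftarrow>vs. a * h \<nu>)"
        unfolding us'_def vs_def using that by (induction us) (auto simp: dual_simps algebra_simps)
      also have "(\<Sum>(a, h)\<leftarrow>vs. a * h \<nu>) = h0 \<nu>" using \<open>h0 = comb vs\<close> comb_val[OF that(2), of vs] by (simp only:)
      finally show ?thesis using van[OF that] by (simp add: add.commute)
    qed
    have "n = length us'" by (simp add: us'_def len)
    then have "(\<Sum>(f, h)\<leftarrow>us'. N f h) = 0"
      by (rule Suc.hyps(1)[OF _ us' van'])
    moreover have "(\<Sum>(f, h)\<leftarrow>us'. N f h) = (\<Sum>(f, h)\<leftarrow>us. N f h) + (\<Sum>(f, h)\<leftarrow>us. s (r f) (N f0 h))"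
      unfolding us'_def using us
    proof (induction us)
      case (Cons w us)
      obtain f h where w: "w = (f, h)" by (cases w)
      have "N (f \<oplus>\<^bsub>dual F\<^esub> r f \<odot>\<^bsub>dual F\<^esub> f0) h = N f h + s (r f) (N f0 h)"
        using Cons.prems f0 w by (simp add: add_left smult_left)
      then show ?case using Cons w by (simp add: algebra_simps)
    qed simp
    ultimately show ?thesis using N_h0 by (simp add: ts add.commute)
  qed
qed simp

context perm_tensor
begin

section \<open>Projections of the orthogonal space of the white product\<close>

definition proj_terms :: "nat \<Rightarrow> ('k \<times> _ \<times> _ \<times> nat \<times> nat \<times> nat) list \<Rightarrow> _"
  where "proj_terms l = map (\<lambda>(c, g, h, u). (c, comp (outer l u) g, comp (inner l u) h, u))"

lemma proj_terms_cubic: "cubic_terms (dual G) ys \<Longrightarrow> cubic_terms (dual F) (proj_terms l ys)"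
  unfolding proj_terms_def by (induction ys) (simp, clarsimp simp only: list.map prod.case cubic_terms_simps comp_closed simp_thms)

text \<open>The value of \<open>comp (outer l u) g\<close> at \<open>\<mu>\<close> is that of
  \<open>g\<close> at \<open>pt (outer l u) \<mu>\<close>, and likewise for the inner labels; so
  \<open>proj_terms l\<close> is adjoint to \<open>lift_terms l\<close>, term by term.\<close>

lemma pairing_proj:
  assumes ts: "cubic_terms F ts" and ys: "cubic_terms (dual G) ys"
  shows "pairing F (cubic_sum F ts) (cubic_sum (dual F) (proj_terms l ys)) =
    pairing G (cubic_sum G (lift_terms l ts)) (cubic_sum (dual G) ys)"
proof -
  have inner: "(\<Sum>(c', f, f', v)\<leftarrow>proj_terms l ys. c' * (if u = v then f \<mu> * f' \<nu> else 0)) =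
      (\<Sum>(c', g, g', v)\<leftarrow>ys. c' * (if u = v then g (pt (outer l u) \<mu>) * g' (pt (inner l u) \<nu>) else 0))"
    if "\<mu> \<in> carrier F" "\<nu> \<in> carrier F" for \<mu> \<nu> u
    unfolding proj_terms_def by (induction ys) (simp, clarsimp simp: comp_apply that)
  show ?thesis
    unfolding pairing_cubic_sums[OF F ts proj_terms_cubic[OF ys]] pairing_cubic_sums[OF G_s2 lift_terms_cubic[OF ts] ys]
    using ts
  proof (induction ts)
    case (Cons t ts)
    obtain c \<mu> \<nu> u where t: "t = (c, \<mu>, \<nu>, u)" by (cases t)
    have c: "\<mu> \<in> carrier F" "\<nu> \<in> carrier F" "cubic_terms F ts"
      using Cons.prems unfolding t cubic_terms_simps by blast+
    show ?case
      unfolding lift_terms_def t list.map prod.case sum_list.Cons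
      by (simp only: inner[OF c(1,2)] Cons.IH[OF c(3), unfolded lift_terms_def])
  qed (simp add: lift_terms_def)
qed

text \<open>By adjointness, pairing the projection with an element of \<open>R\<close> means pairing
  \<open>y\<close> with its lift, a relation of the white product.\<close>

lemma orthogonal_proj:
  assumes R: "R \<subseteq> carrier W3" and ys: "cubic_terms (dual G) ys"
    and y: "cubic_sum (dual G) ys \<in> orthogonal G (white_rels R)" and l: "l \<in> {1..3}"
  shows "cubic_sum (dual F) (proj_terms l ys) \<in> orthogonal F R"
  unfolding orthogonal_def
proof (intro CollectI conjI ballI)
  show "cubic_sum (dual F) (proj_terms l ys) \<in> carrier (comps (free_operad (dual F)) 3)"
    by (rule cubic_sum_closed[OF dual_F proj_terms_cubic[OF ys]])
  fix r assume r: "r \<in> R"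
  obtain ts where ts: "cubic_terms F ts" "r = cubic_sum F ts"
    using cubic_span[OF F subsetD[OF R r]] .
  have "cubic_sum G (lift_terms l ts) \<in> white_rels R"
    by (rule white_rels_lift[OF R ts(1) l]) (use r ts(2) in simp)
  then show "pairing F r (cubic_sum (dual F) (proj_terms l ys)) = 0"
    using y unfolding ts(2) pairing_proj[OF ts(1) ys] orthogonal_def by blast
qed

text \<open>Pairing \<open>y\<close> with the differences of \<open>white_rels_inner\<close> keeps
  only the terms of shape \<open>u\<close>. The outcome says that the tensor formed from the terms
  \<open>c * g_1 \<otimes> (h_1 - h_2)\<close> of that shape vanishes as a bilinear form on
  \<open>E\<close>.\<close>

lemma orthogonal_inner:
  assumes R: "R \<subseteq> carrier W3" and ys: "cubic_terms (dual G) ys"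
    and y: "cubic_sum (dual G) ys \<in> orthogonal G (white_rels R)"
    and \<mu>: "\<mu> \<in> carrier F" "\<nu> \<in> carrier F" and u: "u \<in> cyclic_triples"
  shows "(\<Sum>(c, g, h, v)\<leftarrow>ys. (if v = u then c else 0) * comp e22 g \<mu> * (comp e22 h \<nu> - comp e21 h \<nu>)) = 0"
proof -
  let ?y = "cubic_sum (dual G) ys"
  have yc: "?y \<in> carrier (comps (free_operad (dual G)) 3)" by (rule cubic_sum_closed[OF dual_G ys])
  note cl = cubic_G_closed[OF R \<mu> u]
  have val: "pairing G (cubic G (pt e22 \<mu>) (pt b \<nu>) u) ?y = (\<Sum>(c, g, h, v)\<leftarrow>ys. c * (if u = v then g (pt e22 \<mu>) * h (pt b \<nu>) else 0))" for b
    unfolding linear_scalar_cubic_sum[OF dual_G pairing_right[OF G_s2 cl] ys]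
    using ys by (induction ys) (auto simp: pairing_cubic[OF G_s2 pt_closed[OF \<mu>(1)] pt_closed[OF \<mu>(2)] _ _ u])
  have "pairing G (cubic G (pt e22 \<mu>) (pt e22 \<nu>) u \<ominus>\<^bsub>comps (free_operad G) 3\<^esub> cubic G (pt e22 \<mu>) (pt e21 \<nu>) u) ?y = 0"
    using y white_rels_inner[OF R \<mu> u] unfolding orthogonal_def by blast
  then have "(\<Sum>(c, g, h, v)\<leftarrow>ys. c * (if u = v then g (pt e22 \<mu>) * h (pt e22 \<nu>) else 0)) -
      (\<Sum>(c, g, h, v)\<leftarrow>ys. c * (if u = v then g (pt e22 \<mu>) * h (pt e21 \<nu>) else 0)) = 0"
    unfolding linear_between_minus[OF kmodule.axioms(1)[OF free_module_3[OF G_s2]] scalar_module_module pairing_left[OF G_s2 yc] cl cl]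
      scalar_minus val .
  moreover have "(\<Sum>(c, g, h, v)\<leftarrow>ys. (if v = u then c else 0) * comp e22 g \<mu> * (comp e22 h \<nu> - comp e21 h \<nu>)) =
      (\<Sum>(c, g, h, v)\<leftarrow>ys. c * (if u = v then g (pt e22 \<mu>) * h (pt e22 \<nu>) else 0)) -
      (\<Sum>(c, g, h, v)\<leftarrow>ys. c * (if u = v then g (pt e22 \<mu>) * h (pt e21 \<nu>) else 0))"
    by (induction ys) (simp, clarsimp simp: comp_apply \<mu> algebra_simps)
  ultimately show ?thesis by simp
qed

end

section \<open>The dual-derived products\<close>

locale rota_baxter_tree = perm_tensor F + A: tree_algebra s gr "dual F" d m
  for F :: "('k::field, 'e) s2module" and s :: "'k \<Rightarrow> 'a::ab_group_add \<Rightarrow> 'a" and gr d m +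
  fixes \<beta> :: "'a \<Rightarrow> 'a"
  assumes \<beta>_add: "\<beta> (x + y) = \<beta> x + \<beta> y" and \<beta>_scale: "\<beta> (s r x) = s r (\<beta> x)"
    and \<beta>_gr: "x \<in> gr k \<Longrightarrow> \<beta> x \<in> gr k"
    and rota_baxter: "f \<in> carrier (dual F) \<Longrightarrow> m f (\<beta> x) (\<beta> y) = \<beta> (m f (\<beta> x) y + m f x (\<beta> y))"
begin

definition derived :: "((('k \<times> 'k) \<times> 'e \<Rightarrow>\<^sub>0 'k) set \<Rightarrow> 'k) \<Rightarrow> 'a \<Rightarrow> 'a \<Rightarrow> 'a"
  where "derived g x y = m (comp e22 g) (\<beta> x) y + m (comp e21 g) x (\<beta> y)"

text \<open>For the symmetry, the transposition exchanges the two components of \<open>e\<close>,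
  hence the roles of the two summands; as \<beta> preserves degrees, both acquire the same
  sign.\<close>

lemma derived_tree: "tree_algebra s gr (dual G) d derived"
proof (intro tree_algebra.intro A.graded_axioms tree_algebra_axioms.intro dual_G A.even_d)
  fix e k l a b assume e: "e \<in> carrier (dual G)" and ab: "a \<in> gr k" "b \<in> gr l"
  note c = comp_closed[OF e]
  show "derived e a b \<in> gr (k + l + d)"
    unfolding derived_def
    by (rule A.V.subspace_add[OF A.subspace]) (rule A.m_deg[OF c]; simp add: ab \<beta>_gr)+
  show "derived (swap (dual G) e) a b = s (if odd k \<and> odd l then - 1 else 1) (derived e b a)"
    unfolding derived_def comp_swap A.V.scale_right_distrib
    by (simp only: A.m_swap[OF c \<beta>_gr[OF ab(1)] ab(2)] A.m_swap[OF c ab(1) \<beta>_gr[OF ab(2)]] add.commute)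
qed (simp_all add: derived_def comp_closed comp_add comp_smult \<beta>_add \<beta>_scale A.m_add_left A.m_add_right A.m_scale_left
    A.m_scale_right A.m_add A.m_smult A.V.scale_right_distrib algebra_simps)

definition twist :: "nat \<Rightarrow> (nat \<Rightarrow> 'a) \<Rightarrow> nat \<Rightarrow> 'a"
  where "twist l v i = (if i = l then v i else \<beta> (v i))"

lemma twist_homogeneous: "homogeneous gr n k v \<Longrightarrow> homogeneous gr n k (twist l v)"
  by (simp add: homogeneous_def twist_def \<beta>_gr)

text \<open>The left side has four terms. Write x, y, z for the arguments. The two terms with
  \<open>g_2\<close> outside are the summands \<open>l = q\<close> and \<open>l = p\<close>. The
  summand \<open>l = r\<close> is \<open>g_1(h_1(\<beta> x, \<beta> y), z)\<close>, which the
  Rota-Baxter identity splits into \<open>g_1(\<beta>(h_1(\<beta> x, y)), z)\<close>, a term of the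
  left side, and \<open>g_1(\<beta>(h_1(x, \<beta> y)), z)\<close>. The left side has
  \<open>h_2\<close> in place of this last \<open>h_1\<close>, and the difference is
  subtracted.\<close>

lemma derived_expand:
  assumes g: "g \<in> carrier (dual G)" and h: "h \<in> carrier (dual G)" and u: "(p, q, r) \<in> cyclic_triples"
  shows "derived g (derived h (v p) (v q)) (v r) =
    (\<Sum>l\<in>{1..3}. m (comp (outer l (p, q, r)) g) (m (comp (inner l (p, q, r)) h) (twist l v p) (twist l v q)) (twist l v r)) -
    (m (comp e22 g) (\<beta> (m (comp e22 h) (v p) (\<beta> (v q)))) (v r) - m (comp e22 g) (\<beta> (m (comp e21 h) (v p) (\<beta> (v q)))) (v r))"
proof -
  note d = cyclic_triples_perm[OF u]
  have ne: "p \<noteq> q" "p \<noteq> r" "q \<noteq> r" "q \<noteq> p" "r \<noteq> p" "r \<noteq> q" using d(1) by auto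
  have "(\<Sum>l\<in>{1..3}. T l) = T p + T q + T r" for T :: "nat \<Rightarrow> 'a"
    unfolding d(2)[symmetric] using ne by (simp add: add.assoc)
  note sum = this
  note c = comp_closed[OF g, of "e22"] comp_closed[OF g, of "e21"] comp_closed[OF h, of "e22"] comp_closed[OF h, of "e21"]
  show ?thesis
    unfolding sum derived_def
    by (simp add: outer_def inner_def twist_def ne rota_baxter c \<beta>_add A.m_add_left[OF c(1)] A.m_add_left[OF c(2)])
qed

lemma sum_cyclic: "u \<in> cyclic_triples \<Longrightarrow> (\<Sum>w\<in>cyclic_triples. if u = w then a w else 0) = (a u :: 'a)"
  by (simp add: sum.delta' cyclic_triples_def)

lemma derived_kills:
  assumes R: "R \<subseteq> carrier W3"
    and \<rho>: "operad_hom (free_operad (dual F)) (End_operad s gr d) \<rho>"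
    and \<rho>_m: "\<And>f x y. f \<in> carrier (dual F) \<Longrightarrow> \<rho> 2 (corolla (dual F) f) [x, y] = m f x y"
    and \<rho>_rels: "\<And>z. z \<in> orthogonal F R \<Longrightarrow> \<rho> 3 z = (\<lambda>xs. 0)"
    and \<phi>: "operad_hom (free_operad (dual G)) (End_operad s gr d) \<phi>"
    and \<phi>_m: "\<And>g x y. g \<in> carrier (dual G) \<Longrightarrow> \<phi> 2 (corolla (dual G) g) [x, y] = derived g x y"
    and y: "y \<in> orthogonal G (white_rels R)"
  shows "\<phi> 3 y = (\<lambda>xs. 0)"
proof -
  have yc: "y \<in> carrier (comps (free_operad (dual G)) 3)" using y by (simp add: orthogonal_def)
  obtain ys where ys: "cubic_terms (dual G) ys" "y = cubic_sum (dual G) ys"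
    using cubic_span[OF dual_G yc] .
  note y' = y[unfolded ys(2)]
  note even = A.even_d
  have endo: "\<phi> 3 y \<in> endo_maps s gr d 3"
    using operad_hom_closed[OF \<phi> _ yc] by simp
  have endo0: "(\<lambda>xs. 0) \<in> endo_maps s gr d 3"
    using module.axioms(2)[OF A.End_module[of d 3], THEN abelian_group.axioms(1), THEN abelian_monoid.zero_closed] by simp
  show ?thesis
  proof (rule A.endo_eqI[OF endo endo0])
    fix k v assume h: "homogeneous gr 3 k v"
    \<comment> \<open>The sign depends on the degrees of the arguments, which \<beta> preserves; so
      all terms in the expansion of one monomial share it, and it also is the sign for the twisted
      arguments.\<close>
    define \<epsilon> :: "nat \<times> nat \<times> nat \<Rightarrow> 'k" where "\<epsilon> = (\<lambda>(p, q, r). list_sign (odd_indices 3 k) [p, q, r])"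
    define T where "T l = (\<lambda>(c, g, g', (p, q, r)). s c (s (\<epsilon> (p, q, r))
      (m (comp (outer l (p, q, r)) g) (m (comp (inner l (p, q, r)) g') (twist l v p) (twist l v q)) (twist l v r))))" for l
    \<comment> \<open>The defect as an expression bilinear in the two labels, for one fixed shape
      and fixed arguments; this makes it accessible to \<open>bilinear_vanish\<close>.\<close>
    define N where "N = (\<lambda>(p, q, r) f f'. s (\<epsilon> (p, q, r)) (m f (\<beta> (m f' (v p) (\<beta> (v q)))) (v r)))"
    define D where "D = (\<lambda>(c, g, g', u). s c (N u (comp e22 g) (comp e22 g') - N u (comp e22 g) (comp e21 g')))"
    have val: "op_of 3 (\<phi> 3 y) v = (\<Sum>t\<leftarrow>ys. (\<Sum>l\<in>{1..3}. T l t) - D t)"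
      unfolding ys(2) A.op_of_cubic_sum[OF dual_G \<phi> ys(1)]
    proof (rule arg_cong[of _ _ sum_list], rule map_cong[OF refl])
      fix t assume "t \<in> set ys"
      moreover obtain c g g' p q r where t: "t = (c, g, g', p, q, r)" by (metis prod.exhaust)
      ultimately have e: "g \<in> carrier (dual G)" "g' \<in> carrier (dual G)" and u: "(p, q, r) \<in> cyclic_triples"
        using ys(1) unfolding cubic_terms_def by blast+
      have "op_of 3 (\<phi> 3 (cubic (dual G) g g' (p, q, r))) v = s (\<epsilon> (p, q, r)) (derived g (derived g' (v p) (v q)) (v r))"
        unfolding A.hom_cubic_value[OF dual_G even \<phi> e u h] by (simp only: \<phi>_m[OF e(1)] \<phi>_m[OF e(2)] \<epsilon>_def prod.case)
      then show "(case t of (c, e, e', u) \<Rightarrow> s c (op_of 3 (\<phi> 3 (cubic (dual G) e e' u)) v)) = (\<Sum>l\<in>{1..3}. T l t) - D t"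
        unfolding t T_def D_def N_def prod.case derived_expand[OF e u]
        by (simp only: A.V.scale_right_diff_distrib A.V.scale_sum_right)
    qed
    \<comment> \<open>For fixed \<open>l\<close> the terms are the value of \<open>\<rho>\<close> on
      the projection of \<open>y\<close> at the twisted arguments, and that projection lies in the
      orthogonal space of \<open>R\<close>.\<close>
    have T0: "(\<Sum>t\<leftarrow>ys. T l t) = 0" if l: "l \<in> {1..3}" for l
    proof -
      note tw = twist_homogeneous[OF h, of l]
      note pc = proj_terms_cubic[OF ys(1), of l]
      have tval: "T l t = (case (case t of (c, g, g', u) \<Rightarrow> (c, comp (outer l u) g, comp (inner l u) g', u)) of
          (c, e, e', u) \<Rightarrow> s c (op_of 3 (\<rho> 3 (cubic (dual F) e e' u)) (twist l v)))" if "t \<in> set ys" for t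
      proof -
        obtain c g g' p q r where t: "t = (c, g, g', p, q, r)" by (metis prod.exhaust)
        have e: "g \<in> carrier (dual G)" "g' \<in> carrier (dual G)" and u: "(p, q, r) \<in> cyclic_triples"
          using ys(1) that unfolding t cubic_terms_def by blast+
        note ce = comp_closed[OF e(1)] comp_closed[OF e(2)]
        show ?thesis
          unfolding t T_def prod.case A.hom_cubic_value[OF dual_F even \<rho> ce u tw]
          by (simp only: \<rho>_m[OF ce(1)] \<rho>_m[OF ce(2)] \<epsilon>_def prod.case)
      qed
      have "(\<Sum>t\<leftarrow>ys. T l t) = op_of 3 (\<rho> 3 (cubic_sum (dual F) (proj_terms l ys))) (twist l v)"
        unfolding A.op_of_cubic_sum[OF dual_F \<rho> pc] unfolding proj_terms_def list.map_comp
        by (rule arg_cong[of _ _ sum_list], rule map_cong[OF refl]) (simp only: o_apply tval)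
      also have "\<dots> = 0"
        unfolding \<rho>_rels[OF orthogonal_proj[OF R ys(1) y' l]] op_of_def ..
      finally show ?thesis .
    qed
    have N_lin: "N u (f \<oplus>\<^bsub>dual F\<^esub> f') h = N u f h + N u f' h" "N u h (f \<oplus>\<^bsub>dual F\<^esub> f') = N u h f + N u h f'"
        "N u (c \<odot>\<^bsub>dual F\<^esub> f) h = s c (N u f h)" "N u h (c \<odot>\<^bsub>dual F\<^esub> f) = s c (N u h f)"
      if "f \<in> carrier (dual F)" "f' \<in> carrier (dual F)" "h \<in> carrier (dual F)" for u f f' h c
      using that by (cases u; simp add: N_def A.m_add A.m_smult A.m_add_left A.m_scale_left \<beta>_add \<beta>_scale
        A.V.scale_right_distrib A.V.scale_left_commute)+
    interpret DM: kmodule "dual F" using s2_moduleD(1)[OF dual_F] by (simp add: kmodule_def)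
    \<comment> \<open>The defects cancel within each shape separately, because the pairing
      distinguishes shapes and \<open>orthogonal_inner\<close> gives one condition per
      shape.\<close>
    have Du: "(\<Sum>t\<leftarrow>ys. if (case t of (c, g, g', w) \<Rightarrow> w) = u then D t else 0) = 0" if u: "u \<in> cyclic_triples" for u
    proof -
      \<comment> \<open>Terms of other shapes get the coefficient 0, so that sums over all of
        \<open>ys\<close> can be used; the second component is the difference of the two components
        of the inner label.\<close>
      define K where "K = (\<lambda>(c, g, g', w). ((if w = u then c else 0) \<odot>\<^bsub>dual F\<^esub> comp e22 g,
        comp e22 g' \<oplus>\<^bsub>dual F\<^esub> (- 1) \<odot>\<^bsub>dual F\<^esub> comp e21 g'))"
      have mem: "g \<in> carrier (dual G)" "g' \<in> carrier (dual G)" if "(c, g, g', w) \<in> set ys" for c g g' w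
        using ys(1) that unfolding cubic_terms_def by blast+
      have cl: "\<forall>(f, f')\<in>set (map K ys). f \<in> carrier (dual F) \<and> f' \<in> carrier (dual F)"
        using mem by (auto simp: K_def intro!: DM.k_closed DM.M.a_closed comp_closed)
      have "(\<Sum>(f, f')\<leftarrow>map K ys. N u f f') = 0"
      proof (rule bilinear_vanish[OF F A.V.vector_space_axioms _ _ _ _ cl])
        fix \<mu> \<nu> assume \<mu>: "\<mu> \<in> carrier F" "\<nu> \<in> carrier F"
        have "(\<Sum>(f, f')\<leftarrow>map K ys. f \<mu> * f' \<nu>) =
            (\<Sum>(c, g, h, v)\<leftarrow>ys. (if v = u then c else 0) * comp e22 g \<mu> * (comp e22 h \<nu> - comp e21 h \<nu>))"
          unfolding K_def by (induction ys) (simp, clarsimp simp: dual_simps \<mu>)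
        also have "\<dots> = 0" by (rule orthogonal_inner[OF R ys(1) y' \<mu> u])
        finally show "(\<Sum>(f, f')\<leftarrow>map K ys. f \<mu> * f' \<nu>) = 0" .
      qed (rule N_lin; assumption)+
      moreover have "(\<Sum>(f, f')\<leftarrow>map K ys. N u f f') = (\<Sum>t\<leftarrow>ys. if (case t of (c, g, g', w) \<Rightarrow> w) = u then D t else 0)"
        unfolding list.map_comp
      proof (rule arg_cong[of _ _ sum_list], rule map_cong[OF refl])
        fix t assume t': "t \<in> set ys"
        obtain c g g' w where t: "t = (c, g, g', w)" by (metis prod.exhaust)
        note e = mem[OF t'[unfolded t]]
        note ce = comp_closed[OF e(1), of "e22"] comp_closed[OF e(2), of "e22"] comp_closed[OF e(2), of "e21"]
        have "N u ((if w = u then c else 0) \<odot>\<^bsub>dual F\<^esub> comp e22 g) (comp e22 g' \<oplus>\<^bsub>dual F\<^esub> (- 1) \<odot>\<^bsub>dual F\<^esub> comp e21 g') =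
            s (if w = u then c else 0) (N u (comp e22 g) (comp e22 g') + s (- 1) (N u (comp e22 g) (comp e21 g')))"
          using N_lin(3)[OF ce(1) ce(1) DM.M.a_closed[OF ce(2) DM.k_closed[OF ce(3)]]]
            N_lin(2)[OF ce(2) DM.k_closed[OF ce(3)] ce(1)] N_lin(4)[OF ce(3) ce(3) ce(1)] by (simp only:)
        then show "((\<lambda>(f, f'). N u f f') \<circ> K) t = (if (case t of (c, g, g', w) \<Rightarrow> w) = u then D t else 0)"
          unfolding t K_def D_def o_apply prod.case by simp
      qed
      ultimately show ?thesis by (simp only:)
    qed
    \<comment> \<open>Every term has exactly one cyclic shape, so the total defect is the sum of the
      defects over the three shapes.\<close>
    have "(\<Sum>t\<leftarrow>ys. D t) = (\<Sum>t\<leftarrow>ys. \<Sum>u\<in>cyclic_triples. if (case t of (c, g, g', w) \<Rightarrow> w) = u then D t else 0)"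
    proof (rule arg_cong[of _ _ sum_list], rule map_cong[OF refl])
      fix t assume t': "t \<in> set ys"
      obtain c g g' w where t: "t = (c, g, g', w)" by (metis prod.exhaust)
      have "w \<in> cyclic_triples" using ys(1) t' unfolding t cubic_terms_def by blast
      then show "D t = (\<Sum>u\<in>cyclic_triples. if (case t of (c, g, g', w) \<Rightarrow> w) = u then D t else 0)"
        unfolding t prod.case by (rule sum_cyclic[symmetric])
    qed
    also have "\<dots> = (\<Sum>u\<in>cyclic_triples. \<Sum>t\<leftarrow>ys. if (case t of (c, g, g', w) \<Rightarrow> w) = u then D t else 0)"
      by (induction ys) (simp_all only: list.map sum_list.Nil sum_list.Cons sum.neutral_const sum.distrib)
    also have "\<dots> = 0" by (rule sum.neutral) (intro ballI Du)
    finally have D0: "(\<Sum>t\<leftarrow>ys. D t) = 0" .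
    have "(\<Sum>t\<leftarrow>ys. (\<Sum>l\<in>{1..3}. T l t) - D t) = (\<Sum>l\<in>{1..3}. \<Sum>t\<leftarrow>ys. T l t) - (\<Sum>t\<leftarrow>ys. D t)"
      by (induction ys) (simp_all only: list.map sum_list.Nil sum_list.Cons sum.neutral_const sum.distrib, simp_all)
    also have "\<dots> = 0" using T0 D0 by simp
    finally have "op_of 3 (\<phi> 3 y) v = 0" unfolding val .
    then show "op_of 3 (\<phi> 3 y) v = op_of 3 (\<lambda>xs. 0) v" by (simp only: op_of_def)
  qed
qed

end

theorem theorem4p2:
  fixes P :: "('k::field_char_0, 'e) quad_data"
    and s :: "'k \<Rightarrow> 'a::ab_group_add \<Rightarrow> 'a"
    and gr :: "int \<Rightarrow> 'a set"
    and \<rho> :: "nat \<Rightarrow> (('e \<Rightarrow> 'k) btree \<Rightarrow>\<^sub>0 'k) set set \<Rightarrow> 'a list \<Rightarrow> 'a"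
    and \<beta> :: "'a \<Rightarrow> 'a"
  assumes "binary_quadratic P"
    and "even (hdeg (gens P))"
    and "graded_space s gr"
    and "algebra_over (koszul_dual P) s gr \<rho>"
    and "rota_baxter (koszul_dual P) s gr \<rho> \<beta>"
  shows "\<exists>\<phi>. algebra_over (preLie_black P) s gr \<phi> \<and>
    (\<forall>f\<in>carrier (dual (gens P)). \<forall>x y.
       \<phi> 2 (generator (preLie_black P) (beta_left (gens P) f)) [x, y] =
         \<rho> 2 (generator (koszul_dual P) f) [\<beta> x, y] \<and>
       \<phi> 2 (generator (preLie_black P) (beta_right (gens P) f)) [x, y] =
         \<rho> 2 (generator (koszul_dual P) f) [x, \<beta> y])"
proof -
  define E where "E = gens P"
  define R where "R = rels P"
  \<comment> \<open>Passing to the dual negates the degree, and \<open>Perm(2)\<close> has degree 0;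
    hence the operations of both operads acting on A have this degree.\<close>
  define d where "d = - hdeg E"
  have P: "P = (E, R)" by (simp add: E_def R_def)
  have E: "s2_module E" and sub: "submodule R KK (comps (free_operad E) 3)"
    using assms(1) unfolding binary_quadratic_def E_def R_def by blast+
  have d: "even d" using assms(2) by (simp add: d_def E_def)
  interpret GS: graded s gr using assms(3) by (rule graded.intro)
  interpret PT: perm_tensor E
    by (intro perm_tensor.intro s2_tensor_modules.intro perm_gens_s2_module E)
  have R: "R \<subseteq> carrier PT.W3"
    by (rule conjunct1[OF iffD1[OF kmodule.submodule_iff[OF PT.W3_module] sub]])
  have Q: "koszul_dual P = (dual E, orthogonal E R)" by (simp add: koszul_dual_def P)
  define I where "I = rel_ideal (koszul_dual P)"
  have I: "I = ideal_generated (free_operad (dual E)) 3 (orthogonal E R)"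
    unfolding I_def rel_ideal_def Q by simp
  have orth: "orthogonal E R \<subseteq> carrier (comps (free_operad (dual E)) 3)" unfolding orthogonal_def by blast
  interpret OQ: operad_quotient "free_operad (dual E)" I
    unfolding I by (rule operad_quotient.intro[OF lin_operad_free[OF PT.dual_F]
      operad_ideal_generated[OF lin_operad_free[OF PT.dual_F] orth]])
  have \<rho>: "operad_hom (quot_operad (free_operad (dual E)) I) (End_operad s gr d) \<rho>"
    using assms(4) unfolding algebra_over_def operad_of_def I_def by (simp add: Q dual_simps d_def)
  \<comment> \<open>Pulling \<open>\<rho>\<close> back to the free operad makes the evaluation
    formulas for cubic elements applicable; the relations are remembered by
    \<open>\<rho>'_rels\<close>.\<close>
  define \<rho>' where "\<rho>' n x = \<rho> n (I n +>\<^bsub>comps (free_operad (dual E)) n\<^esub> x)" for n x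
  have \<rho>': "operad_hom (free_operad (dual E)) (End_operad s gr d) \<rho>'"
    using operad_hom_comp[OF OQ.proj_hom \<rho>] unfolding \<rho>'_def .
  have gen: "\<rho>' 2 (corolla (dual E) f) = \<rho> 2 (generator (koszul_dual P) f)" for f
    unfolding \<rho>'_def generator_def I_def Q by simp
  have \<rho>'_lin: "linear_between (comps (free_operad (dual E)) 3) (comps (End_operad s gr d) 3) (\<rho>' 3)"
    by (rule operad_hom_linear[OF \<rho>']) simp
  have \<rho>'_rels: "\<rho>' 3 z = (\<lambda>xs. 0)" if z: "z \<in> orthogonal E R" for z
  proof -
    interpret K: kquot "comps (free_operad (dual E)) 3" "I 3" by (rule OQ.kq)
    have "z \<in> I 3" unfolding I by (rule subsetD[OF ideal_generated_superset z])
    then have "OQ.cls 3 z = I 3" by (rule iffD2[OF K.coset_eq_N[OF subsetD[OF orth z]]])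
    then have "\<rho>' 3 z = \<rho>' 3 \<zero>\<^bsub>comps (free_operad (dual E)) 3\<^esub>"
      unfolding \<rho>'_def by (simp only: K.coset_zero)
    then show ?thesis
      using linear_between_zero[OF K.module_M lin_operad_module[OF GS.lin_operad_End] \<rho>'_lin] by simp
  qed
  define m where "m f x y = \<rho>' 2 (corolla (dual E) f) [x, y]" for f x y
  have m: "tree_algebra s gr (dual E) d m"
    unfolding m_def[abs_def] by (rule GS.hom_tree_algebra[OF PT.dual_F d \<rho>'])
  have lin: "Vector_Spaces.linear s s \<beta>" and \<beta>_gr: "\<And>k. \<beta> ` gr k \<subseteq> gr k"
    and rb: "\<And>f x y. f \<in> carrier (dual E) \<Longrightarrow> m f (\<beta> x) (\<beta> y) = \<beta> (m f (\<beta> x) y + m f x (\<beta> y))"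
    using assms(5) unfolding rota_baxter_def m_def gen Let_def by (simp_all add: Q)
  interpret RB: rota_baxter_tree E s gr d m \<beta>
  proof (intro rota_baxter_tree.intro rota_baxter_tree_axioms.intro PT.perm_tensor_axioms m)
    show "\<beta> (x + y) = \<beta> x + \<beta> y" for x y using lin unfolding Vector_Spaces.linear_iff by blast
    show "\<beta> (s r x) = s r (\<beta> x)" for r x using lin unfolding Vector_Spaces.linear_iff by blast
    show "\<beta> x \<in> gr k" if "x \<in> gr k" for x k using \<beta>_gr[of k] that by blast
  qed (rule rb)
  interpret D: tree_algebra s gr "dual PT.G" d RB.derived by (rule RB.derived_tree)
  obtain \<phi>0 where \<phi>0: "operad_hom (free_operad (dual PT.G)) (End_operad s gr d) \<phi>0"
    "\<And>n t k v. n \<ge> 1 \<Longrightarrow> t \<in> elems (tree_operad (carrier (dual PT.G))) n \<Longrightarrow> homogeneous gr n k v \<Longrightarrow>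
      op_of n (\<phi>0 n (tree_class (dual PT.G) n t)) v = s (list_sign (odd_indices n k) (leaves t)) (tree_eval RB.derived t v)"
    by (rule D.free_operad_to_End) (rule that; assumption)
  have \<phi>0_val: "\<phi>0 2 (corolla (dual PT.G) g) [x, y] = RB.derived g x y" if "g \<in> carrier (dual PT.G)" for g x y
    by (rule D.corolla_value[OF \<phi>0(1) \<phi>0(2) that])
  let ?S = "orthogonal PT.G (PT.white_rels R)"
  have black: "preLie_black P = (dual PT.G, ?S)"
    unfolding preLie_black_def black_product_duals_def P PT.white_product_eq by (simp add: koszul_dual_def)
  have S: "?S \<subseteq> carrier (comps (free_operad (dual PT.G)) 3)" unfolding orthogonal_def by blast
  \<comment> \<open>By the universal property of the generated ideal, vanishing on the generating
    relations in arity 3 is all that is needed to descend to the black product.\<close>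
  have kill: "\<phi>0 3 y = \<zero>\<^bsub>comps (End_operad s gr d) 3\<^esub>" if "y \<in> ?S" for y
    unfolding GS.End_comps by (rule RB.derived_kills[OF R \<rho>' _ \<rho>'_rels \<phi>0(1) \<phi>0_val that]) (simp only: m_def)
  let ?I = "ideal_generated (free_operad (dual PT.G)) 3 ?S"
  obtain \<phi> where \<phi>: "operad_hom (quot_operad (free_operad (dual PT.G)) ?I) (End_operad s gr d) \<phi>"
    "\<And>n x. n \<ge> 1 \<Longrightarrow> x \<in> carrier (comps (free_operad (dual PT.G)) n) \<Longrightarrow>
      \<phi> n (?I n +>\<^bsub>comps (free_operad (dual PT.G)) n\<^esub> x) = \<phi>0 n x"
    by (rule hom_quot_generated[OF lin_operad_free[OF PT.dual_G] S GS.lin_operad_End \<phi>0(1) kill])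
      (assumption | (rule that; assumption))+
  have "algebra_over (preLie_black P) s gr \<phi>"
    using \<phi>(1) unfolding algebra_over_def operad_of_def rel_ideal_def black by (simp add: dual_simps d_def)
  moreover have val: "\<phi> 2 (generator (preLie_black P) g) [x, y] = RB.derived g x y" if g: "g \<in> carrier (dual PT.G)" for g x y
  proof -
    have "\<phi> 2 (generator (preLie_black P) g) = \<phi>0 2 (corolla (dual PT.G) g)"
      unfolding generator_def rel_ideal_def black fst_conv snd_conv
      by (rule \<phi>(2)[OF one_le_numeral corolla_closed[OF PT.dual_G g]])
    then show ?thesis by (simp only: \<phi>0_val[OF g])
  qed
  \<comment> \<open>Each of \<open>beta_left E f\<close> and \<open>beta_right E f\<close> has one
    component equal to \<open>f\<close> and the other zero; the zero functional multiplies to 0, so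
    one of the two summands of the derived product remains.\<close>
  have zero: "m \<zero>\<^bsub>dual E\<^esub> x y = 0" for x y
  proof -
    interpret DM: kmodule "dual E" using s2_moduleD(1)[OF PT.dual_F] by (simp add: kmodule_def)
    show ?thesis using RB.A.m_smult[OF PT.dual_zero, of 0 x y] by simp
  qed
  have "\<phi> 2 (generator (preLie_black P) (beta_left E f)) [x, y] = \<rho> 2 (generator (koszul_dual P) f) [\<beta> x, y] \<and>
      \<phi> 2 (generator (preLie_black P) (beta_right E f)) [x, y] = \<rho> 2 (generator (koszul_dual P) f) [x, \<beta> y]"
    if f: "f \<in> carrier (dual E)" for f x y
    unfolding val[OF PT.beta_left_closed[OF f]] val[OF PT.beta_right_closed[OF f]] RB.derived_def
      PT.comp_beta_left[OF f] PT.comp_beta_right[OF f] zero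
    by (simp add: m_def gen)
  ultimately show ?thesis
    unfolding E_def[symmetric] by (intro exI[of _ \<phi>] conjI ballI allI) simp_all
qed

end
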